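(* Let $0<q<p<\infty$, $\omega\in\mathcal{D}$, $n\in\mathbb{N}\cup\{0\}$, and let $\nu$ be a positive Borel measure on $\mathbb{D}$. Let $\varphi$ be an analytic self-map of $\mathbb{D}$ and let $u\in L^q_\nu$. Let $D^n_{\varphi,u}$ be the operator $D^n_{\varphi,u}f=u\cdot (f^{(n)}\circ\varphi)$. Then the following statements are equivalent: (i) $D^n_{\varphi,u}:A^p_\omega\to L^q_\nu$ is bounded; (ii) $D^n_{\varphi,u}:A^p_\omega\to L^q_\nu$ is compact; (iii) the function $$z\mapsto \frac{\varphi_*(|u|^q,\nu)(\Delta(z,r))}{\omega(S(z))(1-|z|)^{nq}}$$ belongs to $L^{\frac{p}{p-q}}_{\widetilde{\omega}}$ for some (equivalently, for all) $r\in(0,1)$.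
   Context: $\mathbb{D}=\{z\in\mathbb{C}:|z|<1\}$; $\mathcal{H}(\mathbb{D})$ is the space of analytic functions on $\mathbb{D}$; $dA(z)=\frac{dx\,dy}{\pi}$ is normalized area measure. An analytic self-map of $\mathbb{D}$ is an analytic function $\varphi:\mathbb{D}\to\mathbb{D}$. A weight is an integrable function $\omega:\mathbb{D}\to[0,\infty)$; it is radial if $\omega(z)=\omega(|z|)$ for all $z\in\mathbb{D}$. For a radial weight, $\widehat{\omega}(z)=\int_{|z|}^1\omega(s)\,ds$ and $\widetilde{\omega}(z)=\widehat{\omega}(z)/(1-|z|)$ for $z\in\mathbb{D}$; radial weights are taken to be nontrivial (not almost everywhere zero). The class $\mathcal{D}$ of doubling weights consists of the radial weights $\omega$ satisfying both: (1) there is a constant $C=C(\omega)\ge 1$ with $\widehat{\omega}(r)\le C\,\widehat{\omega}\left(\frac{1+r}{2}\right)$ for all $0\le r<1$; (2) there are constants $K=K(\omega)>1$ and $C=C(\omega)>1$ with $\widehat{\omega}(r)\ge C\,\widehat{\omega}\left(1-\frac{1-r}{K}\right)$ for all $0\le r<1$. For $0<p<\infty$ and a weight $\omega$, $L^p_\omega$ is the Lebesgue space of measurable $f$ on $\mathbb{D}$ with $\|f\|^p_{L^p_\omega}=\int_{\mathbb{D}}|f|^p\omega\,dA<\infty$, and the weighted Bergman space is $A^p_\omega=L^p_\omega\cap\mathcal{H}(\mathbb{D})$ with $\|f\|_{A^p_\omega}=\|f\|_{L^p_\omega}$. For a positive Borel measure $\nu$ on $\mathbb{D}$, $L^q_\nu$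 is the space of measurable $f$ with $\|f\|^q_{L^q_\nu}=\int_{\mathbb{D}}|f|^q\,d\nu<\infty$. For measurable $E\subset\mathbb{D}$, $\omega(E)=\int_E\omega\,dA$. The Carleson square is $S(z)=\{\zeta\in\mathbb{D}:|z|<|\zeta|,\ |\arg\zeta-\arg z|<(1-|z|)/2\}$ for $z\in\mathbb{D}\setminus\{0\}$ (arguments compared modulo $2\pi$), and $S(0)=\mathbb{D}$. The pseudohyperbolic disc is $\Delta(a,r)=\{z\in\mathbb{D}:|(a-z)/(1-\overline{a}z)|<r\}$ for $a\in\mathbb{D}$, $0<r<1$. The weighted pushforward measure is $\varphi_*(h,\nu)(M)=\int_{\varphi^{-1}(M)}h\,d\nu$ for measurable $M\subset\mathbb{D}$. *)

theory Defs
  imports "HOL-Complex_Analysis.Complex_Analysis"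
begin

abbreviation unit_disc :: "complex set"
  where "unit_disc \<equiv> ball 0 1"

definition area :: "complex measure"
  where "area = scale_measure (ennreal (1 / pi)) (lebesgue_on unit_disc)"

(* Weights that occur as densities take values in ennreal, because the tail integral of an
   area-integrable radial weight may be infinite at the origin. *)

definition weighted_area :: "(complex \<Rightarrow> ennreal) \<Rightarrow> complex measure"
  where "weighted_area w = density area w"

definition radial_weight :: "(complex \<Rightarrow> real) \<Rightarrow> bool"
  where "radial_weight \<omega> \<longleftrightarrow>
    integrable area \<omega> \<and> (\<forall>z\<in>unit_disc. 0 \<le> \<omega> z) \<and>
    (\<forall>z\<in>unit_disc. \<omega> z = \<omega> (of_real (norm z))) \<and>
    \<not> (AE z in area. \<omega> z = 0)"

definition weight_hat :: "(complex \<Rightarrow> real) \<Rightarrow> complex \<Rightarrow> ennreal"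
  where "weight_hat \<omega> z = (\<integral>\<^sup>+ s \<in> {norm z..<1}. ennreal (\<omega> (of_real s)) \<partial>lebesgue)"

definition weight_tilde :: "(complex \<Rightarrow> real) \<Rightarrow> complex \<Rightarrow> ennreal"
  where "weight_tilde \<omega> z = weight_hat \<omega> z / ennreal (1 - norm z)"

definition doubling_weight :: "(complex \<Rightarrow> real) \<Rightarrow> bool"
  where "doubling_weight \<omega> \<longleftrightarrow> radial_weight \<omega> \<and>
    (\<exists>C::real. C \<ge> 1 \<and> (\<forall>r::real. 0 \<le> r \<and> r < 1 \<longrightarrow>
       weight_hat \<omega> (of_real r) \<le> ennreal C * weight_hat \<omega> (of_real ((1 + r) / 2)))) \<and>
    (\<exists>K C::real. K > 1 \<and> C > 1 \<and> (\<forall>r::real. 0 \<le> r \<and> r < 1 \<longrightarrow>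
       weight_hat \<omega> (of_real r) \<ge> ennreal C * weight_hat \<omega> (of_real (1 - (1 - r) / K))))"

(* Elements are functions, not classes modulo null sets. For p < 1, Lp_norm is only a quasi-norm. *)

definition Lp :: "real \<Rightarrow> 'a measure \<Rightarrow> ('a \<Rightarrow> 'b::{real_normed_vector, second_countable_topology}) set"
  where "Lp p M = {f \<in> borel_measurable M. integrable M (\<lambda>x. norm (f x) powr p)}"

definition Lp_norm :: "real \<Rightarrow> 'a measure \<Rightarrow> ('a \<Rightarrow> 'b::{real_normed_vector, second_countable_topology}) \<Rightarrow> real"
  where "Lp_norm p M f = (\<integral>x. norm (f x) powr p \<partial>M) powr (1 / p)"

definition bergman_space :: "real \<Rightarrow> (complex \<Rightarrow> real) \<Rightarrow> (complex \<Rightarrow> complex) set"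
  where "bergman_space p \<omega> = Lp p (weighted_area (\<lambda>z. ennreal (\<omega> z))) \<inter> {f. f holomorphic_on unit_disc}"

definition bergman_norm :: "real \<Rightarrow> (complex \<Rightarrow> real) \<Rightarrow> (complex \<Rightarrow> complex) \<Rightarrow> real"
  where "bergman_norm p \<omega> = Lp_norm p (weighted_area (\<lambda>z. ennreal (\<omega> z)))"

definition bounded_operator_Lp ::
  "real \<Rightarrow> (complex \<Rightarrow> real) \<Rightarrow> real \<Rightarrow> complex measure \<Rightarrow>
    ((complex \<Rightarrow> complex) \<Rightarrow> complex \<Rightarrow> complex) \<Rightarrow> bool"
  where "bounded_operator_Lp p \<omega> q \<nu> T \<longleftrightarrow>
    T ` bergman_space p \<omega> \<subseteq> Lp q \<nu> \<and>
    (\<exists>C. \<forall>f \<in> bergman_space p \<omega>. Lp_norm q \<nu> (T f) \<le> C * bergman_norm p \<omega> f)"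

definition compact_operator_Lp ::
  "real \<Rightarrow> (complex \<Rightarrow> real) \<Rightarrow> real \<Rightarrow> complex measure \<Rightarrow>
    ((complex \<Rightarrow> complex) \<Rightarrow> complex \<Rightarrow> complex) \<Rightarrow> bool"
  where "compact_operator_Lp p \<omega> q \<nu> T \<longleftrightarrow>
    T ` bergman_space p \<omega> \<subseteq> Lp q \<nu> \<and>
    (\<forall>F :: nat \<Rightarrow> complex \<Rightarrow> complex. \<forall>B.
       (\<forall>k. F k \<in> bergman_space p \<omega> \<and> bergman_norm p \<omega> (F k) \<le> B) \<longrightarrow>
       (\<exists>g \<in> Lp q \<nu>. \<exists>s. strict_mono s \<and>
          (\<lambda>k. Lp_norm q \<nu> (\<lambda>x. T (F (s k)) x - g x)) \<longlonglongrightarrow> 0))"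

definition weighted_diff_comp ::
  "nat \<Rightarrow> (complex \<Rightarrow> complex) \<Rightarrow> (complex \<Rightarrow> complex) \<Rightarrow> (complex \<Rightarrow> complex) \<Rightarrow> complex \<Rightarrow> complex"
  where "weighted_diff_comp n \<phi> u f = (\<lambda>z. u z * (deriv ^^ n) f (\<phi> z))"

definition carleson_square :: "complex \<Rightarrow> complex set"
  where "carleson_square z = (if z = 0 then unit_disc
    else {\<zeta> \<in> unit_disc. norm z < norm \<zeta> \<and>
      (\<exists>k::int. \<bar>Arg \<zeta> - Arg z + 2 * pi * of_int k\<bar> < (1 - norm z) / 2)})"

definition pseudohyperbolic_disc :: "complex \<Rightarrow> real \<Rightarrow> complex set"
  where "pseudohyperbolic_disc a r = {z \<in> unit_disc. norm ((a - z) / (1 - cnj a * z)) < r}"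

definition weighted_pushforward ::
  "(complex \<Rightarrow> complex) \<Rightarrow> (complex \<Rightarrow> real) \<Rightarrow> complex measure \<Rightarrow> complex measure"
  where "weighted_pushforward \<phi> h \<nu> =
    distr (density \<nu> (\<lambda>x. ennreal (h x))) (restrict_space borel unit_disc) \<phi>"

(* The real-valued measure loses nothing here: for u in Lp q \<nu> and integrable \<omega> both
   measures are finite. *)

definition averaging_function ::
  "nat \<Rightarrow> real \<Rightarrow> (complex \<Rightarrow> real) \<Rightarrow> complex measure \<Rightarrow>
    (complex \<Rightarrow> complex) \<Rightarrow> (complex \<Rightarrow> complex) \<Rightarrow> real \<Rightarrow> complex \<Rightarrow> real"
  where "averaging_function n q \<omega> \<nu> \<phi> u r z =
    measure (weighted_pushforward \<phi> (\<lambda>x. norm (u x) powr q) \<nu>) (pseudohyperbolic_disc z r) /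
    (measure (weighted_area (\<lambda>x. ennreal (\<omega> x))) (carleson_square z) * (1 - norm z) powr (real n * q))"

end

theory Submission
  imports Defs
begin

text \<open>Let \<open>W\<close> denote the weight \<open>\<omega>\<close>-tilde and \<open>\<mu>\<close> the pushforward of \<open>\<bar>u\<bar>\<^sup>q \<nu>\<close> under \<open>\<phi>\<close>. Because circle means of \<open>\<bar>f\<bar>\<^sup>p\<close>
  increase with the radius, the doubling conditions make the norms of \<open>f\<close> with respect to \<open>\<omega>\<close> and to \<open>W\<close>
  comparable, and \<open>W\<close> is essentially constant on hyperbolic discs.

  Sufficiency of the averaging condition: \<open>\<bar>f\<^sup>(\<^sup>n\<^sup>)\<bar>\<^sup>q\<close> at a point is bounded by an area mean of \<open>\<bar>f\<bar>\<^sup>q\<close>, so by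
  Fubini's theorem the \<open>q\<close>-integral of \<open>f\<^sup>(\<^sup>n\<^sup>)\<close> against \<open>\<mu>\<close> is at most a constant times the \<open>W\<close>-integral of
  \<open>\<bar>f\<bar>\<^sup>q \<Phi>\<close>, where \<open>\<Phi>\<close> is the averaging function; Young's inequality, Montel's theorem and dominated
  convergence then give compactness.

  Necessity: test the operator on sums of \<open>\<plusminus> c\<^sub>a (1 - \<bar>a\<bar>)\<^sup>N / (1 - cnj a z)\<^sup>N\<close> over a finite hyperbolically
  separated set. Averaging over the signs decouples the summands (for this only
  \<open>max (\<bar>x + y\<bar>) (\<bar>x - y\<bar>) \<ge> \<bar>y\<bar>\<close> is needed, not Khinchine's inequality), and choosing the coefficients
  optimally yields the \<open>p / (p - q)\<close>-summability of the averages with a bound independent of the set.\<close>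

section \<open>Polar coordinates\<close>

text \<open>A doubling weight may vanish on whole annuli, so values of f cannot be estimated by
  integrals over small discs against \<omega>. Hence every estimate is made against
  \<open>W\<close>, and \<omega> returns only through the norm comparison and the mass of Carleson
  squares. Since p and q may be below 1, neither duality nor the triangle inequality is available;
  the arguments use powers of norms, circle means of |f|^p for arbitrary p > 0, and elementary
  pointwise inequalities. The condition q < p acts twice. With s = p / (p - q), Young's inequality
  a^q b <= \<epsilon> a^p + C b^s turns boundedness in L^p plus pointwise convergence into
  convergence of weighted q-integrals. In the other direction, coefficients with c^p = c^q G = G^s
  give S <= K S^(q/p) for the sum S of the G^s, which bounds S because S is a finite sum and q / p <
  1. For n > 0 the n-th derivative of a summand of the test functions vanishes when a = 0, so a
  central disc is treated apart. The radius r is free because necessity produces every r and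
  sufficiency consumes a single one.\<close>

lemma sets_unit_disc [measurable]: "unit_disc \<in> sets borel"
  by simp

lemma nn_integral_lborel_shift:
  fixes f :: "'a::euclidean_space \<Rightarrow> ennreal"
  assumes [measurable]: "f \<in> borel_measurable borel"
  shows "(\<integral>\<^sup>+x. f (a + x) \<partial>lborel) = (\<integral>\<^sup>+x. f x \<partial>lborel)"
proof -
  have "(\<integral>\<^sup>+x. f x \<partial>lborel) = (\<integral>\<^sup>+x. f x \<partial>distr lborel borel ((+) a))"
    by (simp add: lborel_distr_plus)
  also have "\<dots> = (\<integral>\<^sup>+x. f (a + x) \<partial>lborel)"
    by (subst nn_integral_distr) auto
  finally show ?thesis ..
qed

lemma emeasure_lborel_ball_complex:
  fixes a :: complex
  assumes "0 \<le> r"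
  shows "emeasure lborel (ball a r) = ennreal (pi * r\<^sup>2)"
  using assms by (simp add: emeasure_ball unit_ball_vol_2)

text \<open>Any translation-invariant measure is proportional to Lebesgue measure, by evaluating
  a double integral in both orders; the factor is 1 because the unit ball is preserved.\<close>

lemma distr_lborel_rotation:
  fixes c :: complex
  assumes c: "norm c = 1"
  shows "distr lborel borel ((*) c) = lborel"
proof (rule measure_eqI)
  fix A assume "A \<in> sets (distr lborel borel ((*) c))"
  then have A[measurable]: "A \<in> sets borel" by simp
  define B where "B = ball (0::complex) 1"
  have B[measurable]: "B \<in> sets borel" by (simp add: B_def)
  have c0: "c \<noteq> 0" using c by auto
  \<comment> \<open>The rotated measure is translation invariant: adding y to c * x amounts to
    adding y / c to x.\<close>
  have shift: "(\<integral>\<^sup>+x. indicator A (c * x) \<partial>lborel) = (\<integral>\<^sup>+x. (indicator A (c * x + y)::ennreal) \<partial>lborel)" for y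
  proof -
    have "(\<integral>\<^sup>+x. indicator A (c * x) \<partial>lborel) = (\<integral>\<^sup>+x. (indicator A (c * (y / c + x))::ennreal) \<partial>lborel)"
      by (rule nn_integral_lborel_shift[symmetric]) measurable
    also have "\<dots> = (\<integral>\<^sup>+x. indicator A (c * x + y) \<partial>lborel)"
      using c0 by (simp add: distrib_left add.commute)
    finally show ?thesis .
  qed
  have eB: "emeasure lborel B = ennreal pi" unfolding B_def
    by (subst emeasure_lborel_ball_complex) auto
  have "emeasure lborel B * emeasure (distr lborel borel ((*) c)) A
      = (\<integral>\<^sup>+y. indicator B y * (\<integral>\<^sup>+x. indicator A (c * x) \<partial>lborel) \<partial>lborel)"
  proof -
    have "emeasure (distr lborel borel ((*) c)) A = (\<integral>\<^sup>+x. indicator A x \<partial>distr lborel borel ((*) c))"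
      by simp
    also have "\<dots> = (\<integral>\<^sup>+x. indicator A (c * x) \<partial>lborel)"
      by (subst nn_integral_distr) auto
    finally show ?thesis by (subst nn_integral_multc) (auto simp: mult.commute)
  qed
  also have "\<dots> = (\<integral>\<^sup>+y. (\<integral>\<^sup>+x. indicator B y * indicator A (c * x + y) \<partial>lborel) \<partial>lborel)"
    by (intro nn_integral_cong, subst nn_integral_cmult) (auto simp flip: shift)
  also have "\<dots> = (\<integral>\<^sup>+x. (\<integral>\<^sup>+y. indicator B y * indicator A (c * x + y) \<partial>lborel) \<partial>lborel)"
    by (rule lborel_pair.Fubini') measurable
  also have "\<dots> = (\<integral>\<^sup>+x. (\<integral>\<^sup>+y. indicator B (y - c * x) * indicator A y \<partial>lborel) \<partial>lborel)"
  proof (rule nn_integral_cong)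
    fix x
    have "(\<integral>\<^sup>+y. indicator B (y - c * x) * (indicator A y::ennreal) \<partial>lborel)
        = (\<integral>\<^sup>+y. indicator B (c * x + y - c * x) * indicator A (c * x + y) \<partial>lborel)"
      by (rule nn_integral_lborel_shift[symmetric]) measurable
    then show "(\<integral>\<^sup>+y. indicator B y * indicator A (c * x + y) \<partial>lborel)
      = (\<integral>\<^sup>+y. indicator B (y - c * x) * (indicator A y::ennreal) \<partial>lborel)" by simp
  qed
  also have "\<dots> = (\<integral>\<^sup>+y. (\<integral>\<^sup>+x. indicator B (y - c * x) * indicator A y \<partial>lborel) \<partial>lborel)"
    by (rule lborel_pair.Fubini') measurable
  also have "\<dots> = (\<integral>\<^sup>+y. ennreal pi * indicator A y \<partial>lborel)"
  proof (rule nn_integral_cong)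
    fix y
    \<comment> \<open>As a condition on x this describes the unit ball around y / c, because c has
      modulus 1; its area does not depend on y.\<close>
    have "y - c * x \<in> B \<longleftrightarrow> x \<in> ball (y / c) 1" for x
    proof -
      have "y - c * x = c * (y / c - x)" using c0 by (simp add: field_simps)
      then have "norm (y - c * x) = norm (y / c - x)" using c by (metis mult_1 norm_mult)
      then show ?thesis by (simp add: B_def dist_norm norm_minus_commute)
    qed
    then have "(\<integral>\<^sup>+x. indicator B (y - c * x) * indicator A y \<partial>lborel)
      = (\<integral>\<^sup>+x. indicator (ball (y / c) 1) x * (indicator A y::ennreal) \<partial>lborel)"
      by (intro nn_integral_cong) (simp add: indicator_def)
    also have "\<dots> = ennreal pi * indicator A y"
      by (subst nn_integral_multc) (auto simp: emeasure_lborel_ball_complex intro!: borel_measurable_indicator)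
    finally show "(\<integral>\<^sup>+x. indicator B (y - c * x) * indicator A y \<partial>lborel) = ennreal pi * indicator A y" .
  qed
  also have "\<dots> = emeasure lborel B * emeasure lborel A"
    by (simp add: nn_integral_cmult eB)
  finally show "emeasure (distr lborel borel ((*) c)) A = emeasure lborel A"
    by (subst (asm) ennreal_mult_cancel_left) (auto simp: eB)
qed simp

lemma nn_integral_lborel_rotation:
  fixes c :: complex and f :: "complex \<Rightarrow> ennreal"
  assumes c: "norm c = 1" and [measurable]: "f \<in> borel_measurable borel"
  shows "(\<integral>\<^sup>+x. f (c * x) \<partial>lborel) = (\<integral>\<^sup>+x. f x \<partial>lborel)"
proof -
  have "(\<integral>\<^sup>+x. f x \<partial>lborel) = (\<integral>\<^sup>+x. f x \<partial>distr lborel borel ((*) c))"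
    by (simp add: distr_lborel_rotation c)
  also have "\<dots> = (\<integral>\<^sup>+x. f (c * x) \<partial>lborel)"
    by (subst nn_integral_distr) auto
  finally show ?thesis ..
qed

text \<open>Two Borel measures on the line that are finite on half-lines agree once they agree on
  all half-lines \<open>{x<..}\<close>. On the left this is the area of the disc minus a closed
  disc, on the right an elementary integral of 2 pi s.\<close>

lemma distr_norm_unit_disc:
  "distr (density lborel (indicator unit_disc)) borel norm
    = density lborel (\<lambda>s. indicator {0..<1} s * ennreal (2 * pi * s))"
proof (rule measure_eqI_lessThan)
  fix x :: real
  have nx: "(norm :: complex \<Rightarrow> real) -` {x<..} \<in> sets borel"
    by (intro borel_open open_vimage continuous_intros)
  have "emeasure (distr (density lborel (indicator unit_disc)) borel norm) {x<..}
      = emeasure lborel (unit_disc \<inter> norm -` {x<..})"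
  proof -
    have "emeasure (distr (density lborel (indicator unit_disc)) borel norm) {x<..}
        = emeasure (density lborel (indicator unit_disc)) ((norm :: complex \<Rightarrow> real) -` {x<..})"
      by (subst emeasure_distr) auto
    also have "\<dots> = (\<integral>\<^sup>+z. indicator (unit_disc \<inter> norm -` {x<..}) z \<partial>lborel)"
      using nx by (subst emeasure_density) (auto simp flip: indicator_inter_arith)
    also have "\<dots> = emeasure lborel (unit_disc \<inter> norm -` {x<..})"
      using nx by (intro nn_integral_indicator) auto
    finally show ?thesis .
  qed
  also have "unit_disc \<inter> norm -` {x<..} = unit_disc - cball 0 x" by (auto simp: dist_norm)
  also have "emeasure lborel \<dots> = ennreal (if x < 0 then pi else if x < 1 then pi - pi * x\<^sup>2 else 0)"
  proof -
    consider "x < 0" | "0 \<le> x" "x < 1" | "x \<ge> 1" by linarith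
    then show ?thesis
    proof cases
      case 1 then show ?thesis using emeasure_lborel_ball_complex[of 1 0] by simp
    next
      case 2
      have "emeasure lborel (unit_disc - cball 0 x) = emeasure lborel unit_disc - emeasure lborel (cball (0::complex) x)"
        using 2 by (intro emeasure_Diff) (auto simp: emeasure_cball)
      also have "emeasure lborel (cball (0::complex) x) = ennreal (pi * x\<^sup>2)"
        using 2 by (simp add: emeasure_cball unit_ball_vol_2)
      also have "emeasure lborel unit_disc = ennreal (pi * 1\<^sup>2)"
        by (rule emeasure_lborel_ball_complex) simp
      finally show ?thesis using 2 by (simp add: ennreal_minus)
    next
      case 3
      then have E: "unit_disc - cball (0::complex) x = {}" by (auto simp: dist_norm)
      show ?thesis unfolding E using 3 by simp
    qed
  qed
  finally have L: "emeasure (distr (density lborel (indicator unit_disc)) borel norm) {x<..}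
    = ennreal (if x < 0 then pi else if x < 1 then pi - pi * x\<^sup>2 else 0)" .
  then show "emeasure (distr (density lborel (indicator unit_disc)) borel norm) {x<..} < \<infinity>" by simp
  have "emeasure (density lborel (\<lambda>s. indicator {0..<1} s * ennreal (2 * pi * s))) {x<..}
      = (\<integral>\<^sup>+s. indicator {0..<1} s * ennreal (2 * pi * s) * indicator {x<..} s \<partial>lborel)"
    by (subst emeasure_density) auto
  also have "\<dots> = (\<integral>\<^sup>+s. ennreal (2 * pi * s) * indicator {max 0 x..1} s \<partial>lborel)"
  proof (rule nn_integral_cong_AE)
    have "AE s in lborel. s \<noteq> max 0 x \<and> s \<noteq> 1"
      using AE_lborel_singleton[of "max 0 x"] AE_lborel_singleton[of "1::real"] by eventually_elim simp
    then show "AE s in lborel. indicator {0..<1} s * ennreal (2 * pi * s) * indicator {x<..} s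
        = ennreal (2 * pi * s) * indicator {max 0 x..1} s"
      by eventually_elim (auto simp: indicator_def)
  qed
  also have "\<dots> = ennreal (if x < 0 then pi else if x < 1 then pi - pi * x\<^sup>2 else 0)"
  proof (cases "max 0 x \<le> 1")
    case True
    have "(\<integral>\<^sup>+s. ennreal (2 * pi * s) * indicator {max 0 x..1} s \<partial>lborel) = ennreal (pi * 1\<^sup>2 - pi * (max 0 x)\<^sup>2)"
      by (rule nn_integral_FTC_Icc[where F="\<lambda>s. pi * s\<^sup>2"])
        (use True in \<open>auto intro!: derivative_eq_intros\<close>)
    then show ?thesis using True by (auto simp: max_def)
  next
    case False then show ?thesis by auto
  qed
  finally show "emeasure (distr (density lborel (indicator unit_disc)) borel norm) {x<..} =
    emeasure (density lborel (\<lambda>s. indicator {0..<1} s * ennreal (2 * pi * s))) {x<..}"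
    by (simp add: L)
qed simp_all

lemma nn_integral_radial:
  fixes G :: "real \<Rightarrow> ennreal"
  assumes [measurable]: "G \<in> borel_measurable borel"
  shows "(\<integral>\<^sup>+z\<in>unit_disc. G (norm z) \<partial>lborel) = (\<integral>\<^sup>+s\<in>{0..<1}. ennreal (2 * pi * s) * G s \<partial>lborel)"
proof -
  have "(\<integral>\<^sup>+z\<in>unit_disc. G (norm z) \<partial>lborel) = (\<integral>\<^sup>+s. G s \<partial>distr (density lborel (indicator unit_disc)) borel norm)"
    by (subst nn_integral_distr, simp, simp, subst nn_integral_density)
       (auto simp: mult.commute intro!: borel_measurable_indicator)
  also have "\<dots> = (\<integral>\<^sup>+s\<in>{0..<1}. ennreal (2 * pi * s) * G s \<partial>lborel)"
    unfolding distr_norm_unit_disc by (subst nn_integral_density) (auto simp: mult_ac)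
  finally show ?thesis .
qed

text \<open>Whole periods contained in a are removed by periodicity, leaving a shift b in [0, 2 pi);
  the piece of the shifted interval beyond pi is then moved back by one period.\<close>

lemma nn_integral_periodic_shift:
  fixes F :: "real \<Rightarrow> ennreal"
  assumes F[measurable]: "F \<in> borel_measurable borel" and per: "\<And>t. F (t + 2 * pi) = F t"
  shows "(\<integral>\<^sup>+t\<in>{-pi..pi}. F (a + t) \<partial>lborel) = (\<integral>\<^sup>+t\<in>{-pi..pi}. F t \<partial>lborel)"
proof -
  have perN: "F (t + 2 * pi * real k) = F t" for t k
  proof (induction k)
    case (Suc k)
    have "F (t + 2 * pi * real (Suc k)) = F (t + 2 * pi * real k + 2 * pi)" by (simp add: algebra_simps)
    then show ?case using per Suc by simp
  qed simp
  have perZ: "F (t + 2 * pi * of_int k) = F t" for t k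
  proof (cases "k \<ge> 0")
    case True then show ?thesis using perN[of t "nat k"] by simp
  next
    case False then show ?thesis using perN[of "t + 2 * pi * of_int k" "nat (-k)"] by simp
  qed
  define k where "k = \<lfloor>a / (2 * pi)\<rfloor>"
  define b where "b = a - 2 * pi * of_int k"
  have "of_int k \<le> a / (2 * pi)" "a / (2 * pi) < of_int k + 1" unfolding k_def by linarith+
  then have "2 * pi * of_int k \<le> a" "a < 2 * pi * (of_int k + 1)"
    by (simp_all add: field_simps)
  then have b: "0 \<le> b" "b < 2 * pi" by (auto simp: b_def algebra_simps)
  have Fab: "F (a + t) = F (b + t)" for t
  proof -
    have "a + t = (b + t) + 2 * pi * of_int k" by (simp add: b_def)
    then show ?thesis by (metis perZ)
  qed
  have "(\<integral>\<^sup>+t\<in>{-pi..pi}. F (a + t) \<partial>lborel) = (\<integral>\<^sup>+t. F (b + t) * indicator {-pi+b..pi+b} (b + t) \<partial>lborel)"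
    by (intro nn_integral_cong) (auto simp: Fab indicator_def)
  also have "\<dots> = (\<integral>\<^sup>+t. F t * indicator {-pi+b..pi+b} t \<partial>lborel)"
    by (rule nn_integral_lborel_shift) measurable
  also have "\<dots> = (\<integral>\<^sup>+t. F t * indicator {-pi+b..pi} t + F t * indicator {pi<..pi+b} t \<partial>lborel)"
    by (intro nn_integral_cong) (use b in \<open>auto simp: indicator_def\<close>)
  also have "\<dots> = (\<integral>\<^sup>+t. F t * indicator {-pi+b..pi} t \<partial>lborel) + (\<integral>\<^sup>+t. F t * indicator {pi<..pi+b} t \<partial>lborel)"
    by (rule nn_integral_add) measurable
  also have "(\<integral>\<^sup>+t. F t * indicator {pi<..pi+b} t \<partial>lborel) = (\<integral>\<^sup>+t. F (2 * pi + t) * indicator {pi<..pi+b} (2 * pi + t) \<partial>lborel)"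
    by (rule nn_integral_lborel_shift[symmetric]) measurable
  also have "\<dots> = (\<integral>\<^sup>+t. F t * indicator {-pi<..-pi+b} t \<partial>lborel)"
    using per by (intro nn_integral_cong) (auto simp: indicator_def add.commute)
  also have "(\<integral>\<^sup>+t. F t * indicator {-pi+b..pi} t \<partial>lborel) + \<dots>
     = (\<integral>\<^sup>+t. F t * indicator {-pi+b..pi} t + F t * indicator {-pi<..-pi+b} t \<partial>lborel)"
    by (rule nn_integral_add[symmetric]) measurable
  also have "\<dots> = (\<integral>\<^sup>+t\<in>{-pi..pi}. F t \<partial>lborel)"
  proof (rule nn_integral_cong_AE)
    have "AE t in lborel. t \<noteq> -pi + b \<and> t \<noteq> -pi"
      using AE_lborel_singleton[of "-pi+b"] AE_lborel_singleton[of "-pi"] by eventually_elim simp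
    then show "AE t in lborel. F t * indicator {-pi+b..pi} t + F t * indicator {-pi<..-pi+b} t = F t * indicator {-pi..pi} t"
      by eventually_elim (use b in \<open>auto simp: indicator_def\<close>)
  qed
  finally show ?thesis .
qed

lemma measurable_cis[measurable]: "cis \<in> borel_measurable borel"
  by (intro borel_measurable_continuous_onI continuous_intros)

lemma measurable_complex_of_real[measurable]: "complex_of_real \<in> borel_measurable borel"
  by (intro borel_measurable_continuous_onI continuous_intros)

lemma nn_integral_circle_rotate:
  fixes F :: "complex \<Rightarrow> ennreal"
  assumes [measurable]: "F \<in> borel_measurable borel"
  shows "(\<integral>\<^sup>+t\<in>{-pi..pi}. F (z * cis t) \<partial>lborel) = (\<integral>\<^sup>+t\<in>{-pi..pi}. F (of_real (norm z) * cis t) \<partial>lborel)"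
proof -
  have z: "z = of_real (norm z) * cis (Arg z)"
    by (metis rcis_cmod_Arg rcis_def)
  have "(\<integral>\<^sup>+t\<in>{-pi..pi}. F (z * cis t) \<partial>lborel) = (\<integral>\<^sup>+t\<in>{-pi..pi}. F (of_real (norm z) * cis (Arg z + t)) \<partial>lborel)"
    by (subst z) (simp add: cis_mult mult.assoc)
  also have "\<dots> = (\<integral>\<^sup>+t\<in>{-pi..pi}. F (of_real (norm z) * cis t) \<partial>lborel)"
    by (rule nn_integral_periodic_shift[where F="\<lambda>t. F (of_real (norm z) * cis t)"]) (auto simp flip: cis_mult)
  finally show ?thesis .
qed

text \<open>Instead of computing a Jacobian, the integral is averaged over all rotations of the disc
  and the order of integration is exchanged. The inner angular integral is then a function of
  \<open>norm z\<close> alone, to which \<open>nn_integral_radial\<close> applies.\<close>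

lemma nn_integral_polar:
  fixes F :: "complex \<Rightarrow> ennreal"
  assumes F[measurable]: "F \<in> borel_measurable borel"
  shows "(\<integral>\<^sup>+z\<in>unit_disc. F z \<partial>lborel)
    = (\<integral>\<^sup>+s\<in>{0..<1}. ennreal s * (\<integral>\<^sup>+t\<in>{-pi..pi}. F (of_real s * cis t) \<partial>lborel) \<partial>lborel)"
proof -
  define Q where "Q = (\<lambda>s. \<integral>\<^sup>+t\<in>{-pi..pi}. F (of_real s * cis t) \<partial>lborel)"
  have Q[measurable]: "Q \<in> borel_measurable borel" unfolding Q_def by measurable
  have Qz: "(\<integral>\<^sup>+t\<in>{-pi..pi}. F (cis t * z) \<partial>lborel) = Q (norm z)" for z
    using nn_integral_circle_rotate[OF F, of z] by (simp add: Q_def mult.commute)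
  have "ennreal (2 * pi) * (\<integral>\<^sup>+z\<in>unit_disc. F z \<partial>lborel)
      = (\<integral>\<^sup>+t\<in>{-pi..pi}. (\<integral>\<^sup>+z\<in>unit_disc. F z \<partial>lborel) \<partial>lborel)"
    by (subst nn_integral_cmult_indicator) (auto simp: mult.commute)
  also have "\<dots> = (\<integral>\<^sup>+t\<in>{-pi..pi}. (\<integral>\<^sup>+z\<in>unit_disc. F (cis t * z) \<partial>lborel) \<partial>lborel)"
  proof -
    have "(\<integral>\<^sup>+z\<in>unit_disc. F z \<partial>lborel) = (\<integral>\<^sup>+z\<in>unit_disc. F (cis t * z) \<partial>lborel)" for t
      using nn_integral_lborel_rotation[of "cis t" "\<lambda>z. F z * indicator unit_disc z"]
      by (simp add: indicator_def norm_mult)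
    then show ?thesis by simp
  qed
  also have "\<dots> = (\<integral>\<^sup>+t. (\<integral>\<^sup>+z. F (cis t * z) * indicator unit_disc z * indicator {-pi..pi} t \<partial>lborel) \<partial>lborel)"
    by (intro nn_integral_cong nn_integral_multc[symmetric]) measurable
  also have "\<dots> = (\<integral>\<^sup>+z. (\<integral>\<^sup>+t. F (cis t * z) * indicator unit_disc z * indicator {-pi..pi} t \<partial>lborel) \<partial>lborel)"
    by (rule lborel_pair.Fubini') measurable
  also have "\<dots> = (\<integral>\<^sup>+z\<in>unit_disc. Q (norm z) \<partial>lborel)"
  proof (rule nn_integral_cong)
    fix z :: complex
    have "(\<integral>\<^sup>+t. F (cis t * z) * indicator unit_disc z * indicator {-pi..pi} t \<partial>lborel)
      = (\<integral>\<^sup>+t. F (cis t * z) * indicator {-pi..pi} t * indicator unit_disc z \<partial>lborel)"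
      by (simp add: mult_ac)
    then show "(\<integral>\<^sup>+t. F (cis t * z) * indicator unit_disc z * indicator {-pi..pi} t \<partial>lborel) = Q (norm z) * indicator unit_disc z"
      by (simp add: nn_integral_multc Qz)
  qed
  also have "\<dots> = (\<integral>\<^sup>+s\<in>{0..<1}. ennreal (2 * pi * s) * Q s \<partial>lborel)"
    by (rule nn_integral_radial) simp
  also have "\<dots> = (\<integral>\<^sup>+s. ennreal (2 * pi) * (ennreal s * Q s * indicator {0..<1} s) \<partial>lborel)"
    by (intro nn_integral_cong) (auto simp: indicator_def ennreal_mult mult_ac)
  also have "\<dots> = ennreal (2 * pi) * (\<integral>\<^sup>+s\<in>{0..<1}. ennreal s * Q s \<partial>lborel)"
    by (rule nn_integral_cmult) measurable
  finally show ?thesis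
    by (subst (asm) ennreal_mult_cancel_left) (auto simp: Q_def)
qed

section \<open>Circle means and area estimates of holomorphic functions\<close>

lemma nn_integral_Icc_continuous:
  fixes f :: "real \<Rightarrow> real"
  assumes "continuous_on {a..b} f" "\<And>t. 0 \<le> f t"
  shows "(\<integral>\<^sup>+t\<in>{a..b}. ennreal (f t) \<partial>lborel) = ennreal (integral {a..b} f)"
proof -
  have i: "set_integrable lborel {a..b} f" by (rule borel_integrable_atLeastAtMost'[OF assms(1)])
  have "(\<integral>\<^sup>+t\<in>{a..b}. ennreal (f t) \<partial>lborel) = (\<integral>\<^sup>+t. ennreal (indicator {a..b} t *\<^sub>R f t) \<partial>lborel)"
    by (intro nn_integral_cong) (auto simp: indicator_def)
  also have "\<dots> = ennreal (LINT t:{a..b}|lborel. f t)"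
    unfolding set_lebesgue_integral_def using i assms(2)
    by (intro nn_integral_eq_integral) (auto simp: set_integrable_def)
  also have "\<dots> = ennreal (integral {a..b} f)" using set_borel_integral_eq_integral(2)[OF i] by simp
  finally show ?thesis .
qed

section \<open>Monotonicity of the circle means of |f|^p for all p > 0\<close>

lemma ball_0_subset_of_cball_subset:
  fixes U :: "complex set"
  assumes "open U" "cball 0 R \<subseteq> U" "0 < R"
  obtains e where "e > 0" "ball 0 (R + e) \<subseteq> U"
proof -
  obtain e where e: "e > 0" "(\<Union>x\<in>cball 0 R. ball x e) \<subseteq> U"
    using compact_subset_open_imp_ball_epsilon_subset[OF compact_cball assms(1,2)] by blast
  have "ball 0 (R + e) \<subseteq> U"
  proof
    fix z :: complex assume z: "z \<in> ball 0 (R + e)"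
    show "z \<in> U"
    proof (cases "norm z \<le> R")
      case True then show ?thesis using assms(2) by auto
    next
      case False
      define x where "x = of_real (R / norm z) * z"
      have "norm x = R" using False assms(3) by (auto simp: x_def norm_mult norm_divide)
      have "x - z = of_real (R / norm z - 1) * z" by (simp add: x_def algebra_simps)
      then have "norm (x - z) = \<bar>R / norm z - 1\<bar> * norm z" by (metis norm_mult norm_of_real)
      also have "\<dots> = norm z - R" using False assms(3) by (auto simp: abs_if field_simps)
      finally have "z \<in> ball x e" using z by (simp add: dist_norm)
      moreover have "x \<in> cball 0 R" using \<open>norm x = R\<close> by simp
      ultimately show ?thesis using e(2) by blast
    qed
  qed
  then show ?thesis using that e(1) by blast
qed

text \<open>The local factorization at the zero extends to all of S, since off a the quotient of f
  by (z - a)^m is holomorphic anyway and the two descriptions agree near a. The exponent is the full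
  order of the zero, so h does not vanish at a.\<close>

lemma holomorphic_divide_zero:
  assumes f: "f holomorphic_on S" and S: "open S" "connected S" and a: "a \<in> S" "f a = 0"
    and nc: "\<not> f constant_on S"
  obtains h m where "h holomorphic_on S" "h a \<noteq> 0" "\<And>z. z \<in> S \<Longrightarrow> f z = (z - a) ^ m * h z"
proof -
  obtain g r n where g: "0 < n" "0 < r" "ball a r \<subseteq> S" "g holomorphic_on ball a r"
      "\<And>w. w \<in> ball a r \<Longrightarrow> f w = (w - a)^n * g w" "\<And>w. w \<in> ball a r \<Longrightarrow> g w \<noteq> 0"
    using holomorphic_factor_zero_nonconstant[OF f S a nc] by metis
  define h where "h = (\<lambda>z. if z \<in> ball a r then g z else f z / (z - a)^n)"
  have hd: "h z = f z / (z - a)^n" if "z \<noteq> a" for z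
    using that g(5)[of z] by (auto simp: h_def)
  have 1: "h holomorphic_on ball a r"
    by (rule holomorphic_transform[OF g(4)]) (auto simp: h_def)
  have "(\<lambda>z. f z / (z - a)^n) holomorphic_on S - {a}"
    by (intro holomorphic_intros holomorphic_on_subset[OF f]) auto
  then have 2: "h holomorphic_on S - {a}"
    by (rule holomorphic_transform) (auto simp: hd)
  have "h holomorphic_on ball a r \<union> (S - {a})"
    using 1 2 S by (intro holomorphic_on_Un) auto
  moreover have "ball a r \<union> (S - {a}) = S" using g(2,3) a by auto
  moreover have "h a \<noteq> 0" using g(2,6) by (auto simp: h_def)
  moreover have "f z = (z - a)^n * h z" if "z \<in> S" for z
    using that hd[of z] a(2) g(1) by (cases "z = a") auto
  ultimately show ?thesis using that by metis
qed

text \<open>For |z| and |a| at most R both factors on the right are nonnegative, which compares z -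
  a with its Blaschke counterpart. With R = 1 the same identity relates the pseudohyperbolic
  distance to the distances from the unit circle.\<close>

lemma blaschke_factor_identity:
  fixes z a :: complex and R :: real
  shows "(norm (of_real (R\<^sup>2) - cnj a * z))\<^sup>2 - (R * norm (z - a))\<^sup>2
    = (R\<^sup>2 - (norm z)\<^sup>2) * (R\<^sup>2 - (norm a)\<^sup>2)"
  by (simp add: cmod_power2 power_mult_distrib) (simp add: algebra_simps power2_eq_square)

lemma blaschke_factor_le:
  fixes z a :: complex
  assumes "norm z \<le> R" "norm a \<le> R" "0 < R"
  shows "norm (z - a) \<le> norm ((of_real (R\<^sup>2) - cnj a * z) / of_real R)"
proof -
  have "0 \<le> (R\<^sup>2 - (norm z)\<^sup>2) * (R\<^sup>2 - (norm a)\<^sup>2)"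
    using assms by (intro mult_nonneg_nonneg) (auto simp: power_mono)
  then have "(R * norm (z - a))\<^sup>2 \<le> (norm (of_real (R\<^sup>2) - cnj a * z))\<^sup>2"
    using blaschke_factor_identity[of R a z] by linarith
  then have "R * norm (z - a) \<le> norm (of_real (R\<^sup>2) - cnj a * z)"
    by (rule power2_le_imp_le) simp
  then show ?thesis using assms by (simp add: norm_divide field_simps)
qed

lemma blaschke_factor_eq:
  fixes z a :: complex
  assumes "norm z = R" "0 < R"
  shows "norm (z - a) = norm ((of_real (R\<^sup>2) - cnj a * z) / of_real R)"
proof -
  have "(R * norm (z - a))\<^sup>2 = (norm (of_real (R\<^sup>2) - cnj a * z))\<^sup>2"
    using blaschke_factor_identity[of R a z] assms by simp
  then have "R * norm (z - a) = norm (of_real (R\<^sup>2) - cnj a * z)"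
    by (rule power2_eq_imp_eq) (use assms in auto)
  then show ?thesis using assms by (simp add: norm_divide field_simps)
qed

text \<open>Induction on the number of distinct zeros in the closed disc. A zero a, with its full
  multiplicity, is exchanged for powers of the Blaschke factor (R^2 - cnj a z) / R, which has the
  same modulus as z - a on the circle, at least this modulus inside, and no zero in the closed disc
  because a is not on the circle.\<close>

lemma zero_free_majorant:
  assumes "f holomorphic_on ball 0 \<rho>" "0 < R" "R < \<rho>" "\<And>z. norm z = R \<Longrightarrow> f z \<noteq> 0"
  shows "\<exists>g. g holomorphic_on ball 0 \<rho> \<and> (\<forall>z\<in>cball 0 R. g z \<noteq> 0 \<and> norm (f z) \<le> norm (g z)) \<and>
    (\<forall>z. norm z = R \<longrightarrow> norm (f z) = norm (g z))"
  using assms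
proof (induction "card {z \<in> cball 0 R. f z = 0}" arbitrary: f rule: less_induct)
  case less
  show ?case
  proof (cases "\<exists>a\<in>cball 0 R. f a = 0")
    case False
    then show ?thesis using less.prems by (intro exI[of _ f]) auto
  next
    case True
    then obtain a where a: "norm a \<le> R" "f a = 0" by auto
    have nc: "\<not> f constant_on ball 0 \<rho>"
    proof
      assume "f constant_on ball 0 \<rho>"
      then have "f a = f (of_real R)" using a less.prems(2,3)
        unfolding constant_on_def by (metis dist_0_norm le_less_trans mem_ball norm_of_real abs_of_pos)
      then show False using a less.prems(4)[of "of_real R"] less.prems(2) by auto
    qed
    have aS: "a \<in> ball 0 \<rho>" using a less.prems by auto
    obtain h m where h: "h holomorphic_on ball 0 \<rho>" "h a \<noteq> 0"
        "\<And>z. z \<in> ball 0 \<rho> \<Longrightarrow> f z = (z - a) ^ m * h z"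
      using holomorphic_divide_zero[OF less.prems(1) open_ball connected_ball aS a(2) nc] by blast
    define f1 where "f1 = (\<lambda>z. ((of_real (R\<^sup>2) - cnj a * z) / of_real R) ^ m * h z)"
    have R0: "complex_of_real R \<noteq> 0" using less.prems by auto
    have f1: "f1 holomorphic_on ball 0 \<rho>"
      unfolding f1_def using R0 by (intro holomorphic_intros h(1)) auto
    have le: "norm (f z) \<le> norm (f1 z)" if "norm z \<le> R" for z
    proof -
      have "f z = (z - a) ^ m * h z" using that less.prems by (intro h(3)) auto
      then show ?thesis unfolding f1_def using blaschke_factor_le[OF that a(1) less.prems(2)]
        by (auto simp: norm_mult norm_power intro!: mult_right_mono power_mono)
    qed
    have eq: "norm (f z) = norm (f1 z)" if "norm z = R" for z
    proof -
      have "f z = (z - a) ^ m * h z" using that less.prems by (intro h(3)) auto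
      then show ?thesis unfolding f1_def using blaschke_factor_eq[OF that less.prems(2), of a]
        by (simp add: norm_mult norm_power)
    qed
    have a': "norm a < R" using a less.prems(4)[of a] by fastforce
    have nz: "of_real (R\<^sup>2) - cnj a * z \<noteq> 0" if "norm z \<le> R" for z
    proof
      assume "of_real (R\<^sup>2) - cnj a * z = 0"
      then have "of_real (R\<^sup>2) = cnj a * z" by simp
      then have "R\<^sup>2 = norm a * norm z"
        by (metis abs_of_nonneg complex_mod_cnj norm_mult norm_of_real zero_le_power2)
      moreover have "norm a * norm z \<le> norm a * R" using that by (intro mult_left_mono) auto
      moreover have "norm a * R < R * R" using a' less.prems(2) by simp
      ultimately show False by (simp add: power2_eq_square)
    qed
    have fin: "finite {z \<in> cball 0 R. f z = 0}"
      using less.prems nc by (intro holomorphic_compact_finite_zeros[OF less.prems(1)]) auto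
    have f1a: "f1 a \<noteq> 0" using nz[OF a(1)] R0 h(2) by (simp add: f1_def)
    have f1z: "f z = 0" if "norm z \<le> R" "f1 z = 0" for z
      using le[of z] that by simp
    have "{z \<in> cball 0 R. f1 z = 0} \<subset> {z \<in> cball 0 R. f z = 0}"
    proof
      show "{z \<in> cball 0 R. f1 z = 0} \<subseteq> {z \<in> cball 0 R. f z = 0}" using f1z by auto
      show "{z \<in> cball 0 R. f1 z = 0} \<noteq> {z \<in> cball 0 R. f z = 0}" using f1a a by auto
    qed
    then have "card {z \<in> cball 0 R. f1 z = 0} < card {z \<in> cball 0 R. f z = 0}"
      by (rule psubset_card_mono[OF fin])
    moreover have "f1 z \<noteq> 0" if "norm z = R" for z using eq[OF that] less.prems(4)[OF that] by auto
    ultimately obtain g where g: "g holomorphic_on ball 0 \<rho>"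
        "\<forall>z\<in>cball 0 R. g z \<noteq> 0 \<and> norm (f1 z) \<le> norm (g z)" "\<forall>z. norm z = R \<longrightarrow> norm (f1 z) = norm (g z)"
      using less.hyps[of f1, OF _ f1 less.prems(2,3)] by blast
    show ?thesis
      using g le eq by (intro exI[of _ g]) (force intro: order_trans[OF le])
  qed
qed

text \<open>The mean of the modulus over the inner circle is the value at \<open>z\<close> of a holomorphic function,
  to which the maximum principle applies.\<close>

lemma circle_mean_norm_mono:
  assumes G: "G holomorphic_on ball 0 \<rho>" and R: "norm z \<le> R" "R < \<rho>" "0 < R"
    and nz: "\<And>w. w \<in> ball 0 \<rho> \<Longrightarrow> G w \<noteq> 0"
  shows "integral {-pi..pi} (\<lambda>t. norm (G (z * cis t))) \<le> integral {-pi..pi} (\<lambda>t. norm (G (of_real R * cis t)))"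
proof -
  have contG: "continuous_on (ball 0 \<rho>) G" using G by (rule holomorphic_on_imp_continuous_on)
  have inb: "w * cis t \<in> ball 0 \<rho>" if "norm w < \<rho>" for w :: complex and t using that by (simp add: norm_mult)
  have zb: "norm z < \<rho>" using R by simp
  \<comment> \<open>The phase that makes \<open>G (z * cis t)\<close> positive. It is frozen at the
    given z, so the integral \<open>\<Phi>\<close> below depends on its argument only through G and
    is holomorphic.\<close>
  define X where "X = (\<lambda>t. cnj (G (z * cis t)) / of_real (norm (G (z * cis t))))"
  have [measurable]: "(\<lambda>w. indicator (ball 0 \<rho>) w *\<^sub>R G w) \<in> borel_measurable borel"
    by (intro borel_measurable_continuous_on_indicator contG) auto
  have contGw: "continuous_on A (\<lambda>t. G (w * cis t))" if "norm w < \<rho>" for w :: complex and A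
    by (rule continuous_on_compose2[OF contG]) (use that in \<open>auto intro!: continuous_intros simp: image_subset_iff norm_mult\<close>)
  have contX: "continuous_on A X" for A unfolding X_def
    using nz inb[OF zb] by (intro continuous_intros contGw zb) auto
  have normX: "norm (X t) = 1" for t
    using nz[OF inb[OF zb, of t]] by (simp add: X_def norm_divide)
  have GX: "G (z * cis t) * X t = of_real (norm (G (z * cis t)))" for t
    using nz[OF inb[OF zb, of t]] complex_norm_square[of "G (z * cis t)"]
    by (simp add: X_def power2_eq_square field_simps)
  define \<Phi> where "\<Phi> = (\<lambda>w. integral (cbox (-pi) pi) (\<lambda>t. G (w * cis t) * X t))"
  have hol: "\<Phi> holomorphic_on ball 0 \<rho>" unfolding \<Phi>_def
  proof (rule leibniz_rule_holomorphic[where fx="\<lambda>w t. deriv G (w * cis t) * cis t * X t"])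
    fix w :: complex and t :: real assume w: "w \<in> ball 0 \<rho>"
    have "(G has_field_derivative deriv G (w * cis t)) (at (w * cis t))"
      using w by (intro holomorphic_derivI[OF G] inb) auto
    moreover have "((\<lambda>w. w * cis t) has_field_derivative cis t) (at w within ball 0 \<rho>)"
      by (auto intro!: derivative_eq_intros)
    ultimately have "((\<lambda>w. G (w * cis t)) has_field_derivative deriv G (w * cis t) * cis t) (at w within ball 0 \<rho>)"
      by (rule DERIV_chain2)
    then show "((\<lambda>w. G (w * cis t) * X t) has_field_derivative deriv G (w * cis t) * cis t * X t) (at w within ball 0 \<rho>)"
      by (rule DERIV_cmult_right)
  next
    fix w :: complex assume w: "w \<in> ball 0 \<rho>"
    show "(\<lambda>t. G (w * cis t) * X t) integrable_on cbox (-pi) pi"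
      using w by (intro integrable_continuous continuous_intros contGw contX) auto
  next
    have "continuous_on (ball 0 \<rho>) (deriv G)"
      by (intro holomorphic_on_imp_continuous_on holomorphic_deriv G) auto
    then have "continuous_on (ball 0 \<rho> \<times> cbox (-pi) pi) (\<lambda>x. deriv G (fst x * cis (snd x)))"
      by (rule continuous_on_compose2) (auto intro!: continuous_intros simp: image_subset_iff norm_mult)
    moreover have "continuous_on (ball 0 \<rho> \<times> cbox (-pi) pi) (\<lambda>x. X (snd x))"
      by (rule continuous_on_compose2[OF contX[of UNIV]]) (auto intro!: continuous_intros)
    ultimately show "continuous_on (ball 0 \<rho> \<times> cbox (-pi) pi) (\<lambda>(w, t). deriv G (w * cis t) * cis t * X t)"
      unfolding case_prod_unfold by (intro continuous_intros)
  qed simp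
  let ?B = "integral {-pi..pi} (\<lambda>t. norm (G (of_real R * cis t)))"
  \<comment> \<open>On the circle of radius R the mean does not depend on the starting point, so one
    bound serves the whole boundary. The cut-off in \<open>F\<close> makes the integrand Borel on
    the plane.\<close>
  have rot: "integral {-pi..pi} (\<lambda>t. norm (G (w * cis t))) = ?B" if w: "norm w = R" for w
  proof -
    define F where "F = (\<lambda>w. ennreal (norm (indicator (ball 0 \<rho>) w *\<^sub>R G w)))"
    have [measurable]: "F \<in> borel_measurable borel" unfolding F_def by measurable
    have F: "(\<integral>\<^sup>+t\<in>{-pi..pi}. F (v * cis t) \<partial>lborel) = ennreal (integral {-pi..pi} (\<lambda>t. norm (G (v * cis t))))"
      if "norm v = R" for v
    proof -
      have "F (v * cis t) = ennreal (norm (G (v * cis t)))" for t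
        using that R inb[of v t] by (simp add: F_def)
      then show ?thesis using that R
        by (simp only:) (intro nn_integral_Icc_continuous continuous_intros contGw; simp)
    qed
    have "ennreal (integral {-pi..pi} (\<lambda>t. norm (G (w * cis t)))) = ennreal ?B"
      using nn_integral_circle_rotate[of F w] F[OF w] F[of "of_real R"] R w by simp
    then show ?thesis
      by (subst (asm) ennreal_inj) (use R w in \<open>auto intro!: integral_nonneg integrable_continuous_interval continuous_intros contGw\<close>)
  qed
  have "norm (\<Phi> z) \<le> ?B"
  proof (rule maximum_modulus_frontier[of \<Phi> "cball 0 R"])
    show "\<Phi> holomorphic_on interior (cball 0 R)"
      by (rule holomorphic_on_subset[OF hol]) (use R in auto)
    show "continuous_on (closure (cball 0 R)) \<Phi>"
      by (rule holomorphic_on_imp_continuous_on[OF holomorphic_on_subset[OF hol]]) (use R in auto)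
    fix w assume "w \<in> frontier (cball (0::complex) R)"
    then have w: "norm w = R" using R by (simp add: frontier_cball)
    have "norm (\<Phi> w) \<le> integral (cbox (-pi) pi) (\<lambda>t. norm (G (w * cis t)))"
      unfolding \<Phi>_def
      by (rule integral_norm_bound_integral)
        (use w R in \<open>auto intro!: integrable_continuous_interval continuous_intros contGw contX simp: norm_mult normX\<close>)
    then show "norm (\<Phi> w) \<le> ?B" using rot[OF w] by simp
  qed (use R in auto)
  moreover have "\<Phi> z = of_real (integral {-pi..pi} (\<lambda>t. norm (G (z * cis t))))"
  proof -
    have "(\<lambda>t. norm (G (z * cis t))) integrable_on cbox (-pi) pi"
      by (intro integrable_continuous continuous_intros contGw zb)
    from integral_linear[OF this bounded_linear_of_real]
    show ?thesis unfolding \<Phi>_def GX by (simp add: o_def)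
  qed
  ultimately show ?thesis by simp
qed

text \<open>In general |f|^p is not the modulus of a holomorphic function, but |g|^p is when g has
  no zeros: it is the modulus of exp (p L) for a logarithm L of g. Passing to the majorant g changes
  nothing on the circle and can only increase the inner mean.\<close>

lemma circle_mean_powr_mono_zero_free_circle:
  assumes f: "f holomorphic_on ball 0 \<rho>" and R: "norm z \<le> R" "R < \<rho>" "0 < R" and p: "0 < p"
    and nz: "\<And>w. norm w = R \<Longrightarrow> f w \<noteq> 0"
  shows "integral {-pi..pi} (\<lambda>t. norm (f (z * cis t)) powr p)
    \<le> integral {-pi..pi} (\<lambda>t. norm (f (of_real R * cis t)) powr p)"
proof -
  obtain g where g: "g holomorphic_on ball 0 \<rho>" "\<And>z. z \<in> cball 0 R \<Longrightarrow> g z \<noteq> 0"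
      "\<And>z. z \<in> cball 0 R \<Longrightarrow> norm (f z) \<le> norm (g z)"
      "\<And>z. norm z = R \<Longrightarrow> norm (f z) = norm (g z)"
    using zero_free_majorant[OF f R(3,2) nz] by blast
  have cg: "continuous_on (ball 0 \<rho>) g" using g(1) by (rule holomorphic_on_imp_continuous_on)
  \<comment> \<open>The majorant is known to be zero-free on the closed disc only; the logarithm is
    taken on a slightly larger open disc, so that its exponential is holomorphic across the
    circle.\<close>
  define U where "U = {z \<in> ball 0 \<rho>. g z \<noteq> 0}"
  have "open (ball 0 \<rho> \<inter> g -` (- {0}))"
    by (rule continuous_open_preimage[OF cg open_ball]) auto
  moreover have "ball 0 \<rho> \<inter> g -` (- {0}) = U" by (auto simp: U_def)
  ultimately have "open U" by simp
  moreover have "cball 0 R \<subseteq> U" using g(2) R by (auto simp: U_def)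
  ultimately obtain e where e: "e > 0" "ball 0 (R + e) \<subseteq> U"
    using ball_0_subset_of_cball_subset[OF _ _ R(3)] by metis
  have gU: "g holomorphic_on ball 0 (R + e)" "\<And>z. z \<in> ball 0 (R + e) \<Longrightarrow> g z \<noteq> 0"
    using e(2) by (auto simp: U_def intro!: holomorphic_on_subset[OF g(1)])
  obtain L where L: "L holomorphic_on ball 0 (R + e)" "\<And>x. x \<in> ball 0 (R + e) \<Longrightarrow> exp (L x) = g x"
    using holomorphic_logarithm_exists[of "ball 0 (R + e)" g 0] gU R(3) e(1) by auto
  define G where "G = (\<lambda>z. exp (of_real p * L z))"
  have G: "G holomorphic_on ball 0 (R + e)" unfolding G_def by (intro holomorphic_intros L)
  have nG: "norm (G z) = norm (g z) powr p" if "z \<in> ball 0 (R + e)" for z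
  proof -
    have "norm (g z) = exp (Re (L z))" using L(2)[OF that] by (metis norm_exp_eq_Re)
    then show ?thesis by (simp add: G_def powr_def)
  qed
  have cts: "continuous_on A (\<lambda>t. norm (h (w * cis t)) powr p)" if "norm w < \<rho>" "h holomorphic_on ball 0 \<rho>" for w h A
  proof -
    have "continuous_on A (\<lambda>t. h (w * cis t))"
      by (rule continuous_on_compose2[OF holomorphic_on_imp_continuous_on[OF that(2)]])
        (auto intro!: continuous_intros simp: image_subset_iff norm_mult that)
    then show ?thesis using p by (intro continuous_on_powr' continuous_intros) auto
  qed
  have "integral {-pi..pi} (\<lambda>t. norm (f (z * cis t)) powr p) \<le> integral {-pi..pi} (\<lambda>t. norm (g (z * cis t)) powr p)"
    using R p by (intro integral_le integrable_continuous_interval cts powr_mono2 f g)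
      (auto simp: norm_mult)
  also have "\<dots> = integral {-pi..pi} (\<lambda>t. norm (G (z * cis t)))"
    using R e by (intro integral_cong nG[symmetric]) (auto simp: norm_mult)
  also have "\<dots> \<le> integral {-pi..pi} (\<lambda>t. norm (G (of_real R * cis t)))"
    using R e by (intro circle_mean_norm_mono[OF G]) (auto simp: G_def)
  also have "\<dots> = integral {-pi..pi} (\<lambda>t. norm (g (of_real R * cis t)) powr p)"
    using R e by (intro integral_cong nG) (auto simp: norm_mult)
  also have "\<dots> = integral {-pi..pi} (\<lambda>t. norm (f (of_real R * cis t)) powr p)"
    using R by (intro integral_cong arg_cong[where f="\<lambda>x. x powr p"] g(4)[symmetric]) (auto simp: norm_mult)
  finally show ?thesis .
qed

text \<open>The circle of radius R may carry zeros of f. A nonconstant f has finitely many zeros in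
  a closed disc, so there are radii slightly larger than R with a zero-free circle, and the mean is
  continuous in the radius. The perturbation goes outwards because \<open>norm z\<close> may equal
  R.\<close>

lemma circle_mean_powr_mono:
  assumes f: "f holomorphic_on ball 0 \<rho>" and R: "norm z \<le> R" "R < \<rho>" and p: "0 < p"
  shows "integral {-pi..pi} (\<lambda>t. norm (f (z * cis t)) powr p)
    \<le> integral {-pi..pi} (\<lambda>t. norm (f (of_real R * cis t)) powr p)"
proof (cases "R = 0 \<or> f constant_on ball 0 \<rho>")
  case True
  then show ?thesis
  proof
    assume "R = 0" then show ?thesis using R by simp
  next
    assume "f constant_on ball 0 \<rho>"
    then obtain c where c: "\<And>x. x \<in> ball 0 \<rho> \<Longrightarrow> f x = c" unfolding constant_on_def by auto
    have "norm z < \<rho>" "0 \<le> R" using R norm_ge_zero[of z] by linarith+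
    then show ?thesis using R c by (simp add: norm_mult)
  qed
next
  case False
  then have R0: "0 < R" using R norm_ge_zero[of z] by linarith
  have nc: "\<not> f constant_on ball 0 \<rho>" using False by simp
  define M where "M = (\<lambda>r. integral (cbox (-pi) pi) (\<lambda>t. norm (f (of_real r * cis t)) powr p))"
  have "continuous_on ({0..<\<rho>} \<times> cbox (-pi) pi) (\<lambda>x. f (of_real (fst x) * cis (snd x)))"
    by (rule continuous_on_compose2[OF holomorphic_on_imp_continuous_on[OF f]])
      (auto intro!: continuous_intros simp: image_subset_iff norm_mult)
  then have "continuous_on ({0..<\<rho>} \<times> cbox (-pi) pi) (\<lambda>(r, t). norm (f (of_real r * cis t)) powr p)"
    unfolding case_prod_unfold using p by (intro continuous_on_powr' continuous_intros) auto
  then have contM: "continuous_on {0..<\<rho>} M" unfolding M_def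
    by (rule integral_continuous_on_param)
  let ?m = "integral {-pi..pi} (\<lambda>t. norm (f (z * cis t)) powr p)"
  have "?m \<le> M R"
  proof (rule ccontr)
    assume "\<not> ?m \<le> M R"
    then have pos: "0 < ?m - M R" by simp
    have "R \<in> {0..<\<rho>}" using R R0 by auto
    then obtain d where d: "d > 0" "\<And>x. x \<in> {0..<\<rho>} \<Longrightarrow> dist x R < d \<Longrightarrow> dist (M x) (M R) < ?m - M R"
      using contM pos unfolding continuous_on_iff by meson
    define S where "S = min (R + d / 2) ((R + \<rho>) / 2)"
    have S: "R < S" "S < \<rho>" "S \<le> R + d / 2" using d(1) R unfolding S_def by (auto simp: min_def field_simps)
    have "finite {w \<in> cball 0 S. f w = 0}"
      using S nc by (intro holomorphic_compact_finite_zeros[OF f]) auto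
    then have "finite (norm ` {w \<in> cball 0 S. f w = 0})" by simp
    moreover have "infinite {R<..<S}" using S by simp
    ultimately obtain r where r: "r \<in> {R<..<S}" "r \<notin> norm ` {w \<in> cball 0 S. f w = 0}"
      by (meson finite_subset subsetI)
    have "f w \<noteq> 0" if "norm w = r" for w using that r by auto
    then have "?m \<le> M r" unfolding M_def cbox_interval
      using r R R0 S by (intro circle_mean_powr_mono_zero_free_circle[OF f _ _ _ p]) auto
    moreover have "dist (M r) (M R) < ?m - M R"
      using r R0 S by (intro d(2)) (auto simp: dist_real_def)
    ultimately show False by (simp add: dist_real_def)
  qed
  then show ?thesis by (simp add: M_def)
qed

lemma nn_circle_mean_powr_mono:
  assumes f: "f holomorphic_on ball 0 \<rho>" and R: "norm z \<le> R" "R < \<rho>" and p: "0 < p"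
  shows "(\<integral>\<^sup>+t\<in>{-pi..pi}. ennreal (norm (f (z * cis t)) powr p) \<partial>lborel)
    \<le> (\<integral>\<^sup>+t\<in>{-pi..pi}. ennreal (norm (f (of_real R * cis t)) powr p) \<partial>lborel)"
proof -
  have cts: "continuous_on A (\<lambda>t. norm (f (w * cis t)) powr p)" if "norm w < \<rho>" for w A
  proof -
    have "continuous_on A (\<lambda>t. f (w * cis t))"
      by (rule continuous_on_compose2[OF holomorphic_on_imp_continuous_on[OF f]])
        (auto intro!: continuous_intros simp: image_subset_iff norm_mult that)
    then show ?thesis using p by (intro continuous_on_powr' continuous_intros) auto
  qed
  have "0 \<le> R" using R norm_ge_zero[of z] by linarith
  then have "norm z < \<rho>" "norm (complex_of_real R) < \<rho>" using R by auto
  then show ?thesis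
    by (simp add: nn_integral_Icc_continuous cts ennreal_leI circle_mean_powr_mono[OF assms])
qed

section \<open>Area estimates: the submean property and derivatives\<close>

lemma nn_integral_affine_complex:
  fixes F :: "complex \<Rightarrow> ennreal"
  assumes [measurable]: "F \<in> borel_measurable borel" and r: "r > 0"
  shows "(\<integral>\<^sup>+z. F z \<partial>lborel) = ennreal (r\<^sup>2) * (\<integral>\<^sup>+z. F (a + of_real r * z) \<partial>lborel)"
proof -
  have "(\<integral>\<^sup>+z. F z \<partial>lborel) = (\<integral>\<^sup>+z. F z \<partial>density (distr lborel borel (\<lambda>x. a + r *\<^sub>R x)) (\<lambda>_. \<bar>r\<bar> ^ DIM(complex)))"
    using r by (subst lborel_affine[of r a]) auto
  also have "\<dots> = (\<integral>\<^sup>+z. ennreal (r\<^sup>2) * F (a + r *\<^sub>R z) \<partial>lborel)"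
    using r by (subst nn_integral_density, simp, simp, subst nn_integral_distr) auto
  also have "\<dots> = ennreal (r\<^sup>2) * (\<integral>\<^sup>+z. F (a + of_real r * z) \<partial>lborel)"
    by (subst nn_integral_cmult) (auto simp: scaleR_conv_of_real)
  finally show ?thesis .
qed

lemma measurable_norm_powr_indicator:
  fixes f :: "complex \<Rightarrow> complex"
  assumes "continuous_on S f" "open S" "0 < p"
  shows "(\<lambda>z. ennreal (norm (f z) powr p) * indicator S z) \<in> borel_measurable borel"
proof -
  have [measurable]: "(\<lambda>z. indicator S z *\<^sub>R f z) \<in> borel_measurable borel"
    by (intro borel_measurable_continuous_on_indicator assms) (use assms in auto)
  have "(\<lambda>z. ennreal (norm (indicator S z *\<^sub>R f z) powr p)) \<in> borel_measurable borel"
    by measurable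
  moreover have "(\<lambda>z. ennreal (norm (indicator S z *\<^sub>R f z) powr p)) = (\<lambda>z. ennreal (norm (f z) powr p) * indicator S z)"
    using assms(3) by (auto simp: indicator_def)
  ultimately show ?thesis by (simp only:)
qed

text \<open>After rescaling to the unit disc, each circle mean dominates the one of radius 0, which
  is the value at the centre; integrating 2 pi s over [0, 1) then yields the area.\<close>

lemma powr_norm_submean:
  assumes f: "f holomorphic_on ball a r" and r: "0 < r" and p: "0 < p"
  shows "ennreal (norm (f a) powr p) * ennreal (pi * r\<^sup>2) \<le> (\<integral>\<^sup>+z\<in>ball a r. ennreal (norm (f z) powr p) \<partial>lborel)"
proof -
  define g where "g = (\<lambda>z. f (a + of_real r * z))"
  have inb: "a + of_real r * z \<in> ball a r \<longleftrightarrow> z \<in> unit_disc" for z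
  proof -
    have "dist a (a + of_real r * z) = r * norm z" using r by (simp add: dist_norm norm_mult)
    then show ?thesis using r by (simp add: field_simps)
  qed
  then have inb': "z \<in> unit_disc \<Longrightarrow> a + of_real r * z \<in> ball a r" for z by blast
  have g: "g holomorphic_on unit_disc" unfolding g_def
    by (rule holomorphic_on_compose_gen[OF _ f, unfolded o_def]) (auto intro!: holomorphic_intros simp del: mem_ball intro: inb')
  define F where "F = (\<lambda>z. ennreal (norm (g z) powr p) * indicator unit_disc z)"
  have F[measurable]: "F \<in> borel_measurable borel" unfolding F_def
    by (intro measurable_norm_powr_indicator holomorphic_on_imp_continuous_on g p) auto
  have "(\<integral>\<^sup>+z\<in>ball a r. ennreal (norm (f z) powr p) \<partial>lborel)
      = ennreal (r\<^sup>2) * (\<integral>\<^sup>+z. ennreal (norm (f (a + of_real r * z)) powr p) * indicator (ball a r) (a + of_real r * z) \<partial>lborel)"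
    by (rule nn_integral_affine_complex[OF _ r])
      (intro measurable_norm_powr_indicator holomorphic_on_imp_continuous_on f p open_ball)
  also have "(\<integral>\<^sup>+z. ennreal (norm (f (a + of_real r * z)) powr p) * indicator (ball a r) (a + of_real r * z) \<partial>lborel)
      = (\<integral>\<^sup>+z\<in>unit_disc. F z \<partial>lborel)"
    by (intro nn_integral_cong) (auto simp: F_def g_def indicator_def simp del: mem_ball simp: inb)
  also have "\<dots> = (\<integral>\<^sup>+s\<in>{0..<1}. ennreal s * (\<integral>\<^sup>+t\<in>{-pi..pi}. F (of_real s * cis t) \<partial>lborel) \<partial>lborel)"
    by (rule nn_integral_polar[OF F])
  finally have eq: "(\<integral>\<^sup>+z\<in>ball a r. ennreal (norm (f z) powr p) \<partial>lborel) = ennreal (r\<^sup>2) * \<dots>" .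
  have "(\<integral>\<^sup>+s\<in>{0..<1}. ennreal s * (ennreal (2 * pi) * ennreal (norm (g 0) powr p)) \<partial>lborel)
      \<le> (\<integral>\<^sup>+s\<in>{0..<1}. ennreal s * (\<integral>\<^sup>+t\<in>{-pi..pi}. F (of_real s * cis t) \<partial>lborel) \<partial>lborel)"
  proof (rule nn_integral_mono)
    fix s :: real
    show "ennreal s * (ennreal (2 * pi) * ennreal (norm (g 0) powr p)) * indicator {0..<1} s
      \<le> ennreal s * (\<integral>\<^sup>+t\<in>{-pi..pi}. F (of_real s * cis t) \<partial>lborel) * indicator {0..<1} s"
    proof (cases "s \<in> {0..<1}")
      case True
      have "ennreal (2 * pi) * ennreal (norm (g 0) powr p) = (\<integral>\<^sup>+t\<in>{-pi..pi}. ennreal (norm (g (0 * cis t)) powr p) \<partial>lborel)"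
        using nn_integral_cmult_indicator[of "{-pi..pi}" lborel "ennreal (norm (g 0) powr p)"]
        by (simp add: mult.commute)
      also have "\<dots> \<le> (\<integral>\<^sup>+t\<in>{-pi..pi}. ennreal (norm (g (of_real s * cis t)) powr p) \<partial>lborel)"
        using True by (intro nn_circle_mean_powr_mono[OF g _ _ p]) auto
      also have "\<dots> = (\<integral>\<^sup>+t\<in>{-pi..pi}. F (of_real s * cis t) \<partial>lborel)"
        using True by (intro nn_integral_cong) (auto simp: F_def norm_mult)
      finally show ?thesis using True by (auto intro!: mult_left_mono)
    qed simp
  qed
  moreover have "(\<integral>\<^sup>+s\<in>{0..<1}. ennreal s * (ennreal (2 * pi) * ennreal (norm (g 0) powr p)) \<partial>lborel)
      = ennreal pi * ennreal (norm (g 0) powr p)"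
  proof -
    have "(\<integral>\<^sup>+s\<in>{0..<1}. ennreal s * (ennreal (2 * pi) * ennreal (norm (g 0) powr p)) \<partial>lborel)
        = (\<integral>\<^sup>+s. ennreal (norm (g 0) powr p) * (ennreal (2 * pi * s) * indicator {0..<1} s) \<partial>lborel)"
      by (intro nn_integral_cong) (auto simp: indicator_def ennreal_mult mult_ac)
    also have "\<dots> = ennreal (norm (g 0) powr p) * (\<integral>\<^sup>+s\<in>{0..<1}. ennreal (2 * pi * s) * 1 \<partial>lborel)"
      by (subst nn_integral_cmult) auto
    also have "(\<integral>\<^sup>+s\<in>{0..<1}. ennreal (2 * pi * s) * 1 \<partial>lborel) = ennreal pi"
      using nn_integral_radial[of "\<lambda>_. 1"] emeasure_lborel_ball_complex[of 1 0]
      by (simp add: mult.commute)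
    finally show ?thesis by (simp add: mult.commute)
  qed
  ultimately have "ennreal (r\<^sup>2) * (ennreal pi * ennreal (norm (g 0) powr p)) \<le> (\<integral>\<^sup>+z\<in>ball a r. ennreal (norm (f z) powr p) \<partial>lborel)"
    unfolding eq by (intro mult_left_mono) auto
  then show ?thesis by (simp add: g_def ennreal_mult mult_ac)
qed

text \<open>The submean property on discs of radius \<rho> / 2 bounds f on a smaller disc, and
  Cauchy's inequality converts this into a bound of the derivative. The exponent collects n q from
  Cauchy's inequality and 2 from the area of the disc.\<close>

lemma powr_norm_higher_deriv_le:
  assumes q: "0 < q"
  obtains C where "0 < C" "\<And>f z \<rho>. f holomorphic_on ball z \<rho> \<Longrightarrow> 0 < \<rho> \<Longrightarrow>
    ennreal (norm ((deriv ^^ n) f z) powr q)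
      \<le> ennreal (C * \<rho> powr (- (real n * q) - 2)) * (\<integral>\<^sup>+w\<in>ball z \<rho>. ennreal (norm (f w) powr q) \<partial>lborel)"
proof
  define C where "C = (fact n * 2 ^ n) powr q * (4 / pi)"
  show "0 < C" by (simp add: C_def)
  fix f :: "complex \<Rightarrow> complex" and z \<rho>
  assume f: "f holomorphic_on ball z \<rho>" and \<rho>: "0 < \<rho>"
  define I where "I = (\<integral>\<^sup>+w\<in>ball z \<rho>. ennreal (norm (f w) powr q) \<partial>lborel)"
  show "ennreal (norm ((deriv ^^ n) f z) powr q) \<le> ennreal (C * \<rho> powr (- (real n * q) - 2)) * I"
  proof (cases "I = \<infinity>")
    case True
    have "0 < C * \<rho> powr (- (real n * q) - 2)" using \<open>0 < C\<close> \<rho> by simp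
    then have "ennreal (C * \<rho> powr (- (real n * q) - 2)) * I = \<infinity>"
      unfolding True infinity_ennreal_def by (subst ennreal_mult_eq_top_iff) (use \<open>0 < C\<close> \<rho> in simp)
    then show ?thesis by simp
  next
    case False
    then obtain i where i: "I = ennreal i" "0 \<le> i" by (cases I) auto
    \<comment> \<open>The bound for |f| at distance at most \<rho> / 2 from z that follows from the
      area integral over the ball of radius \<rho>; the factor 4 is due to halving the
      radius.\<close>
    define B where "B = (4 * i / (pi * \<rho>\<^sup>2)) powr (1 / q)"
    have fB: "norm (f w) \<le> B" if w: "dist z w \<le> \<rho> / 2" for w
    proof -
      have sub: "ball w (\<rho> / 2) \<subseteq> ball z \<rho>"
      proof
        fix x assume "x \<in> ball w (\<rho> / 2)"
        then show "x \<in> ball z \<rho>" using w dist_triangle[of z x w] by simp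
      qed
      have "ennreal (norm (f w) powr q) * ennreal (pi * (\<rho> / 2)\<^sup>2) \<le> (\<integral>\<^sup>+w\<in>ball w (\<rho> / 2). ennreal (norm (f w) powr q) \<partial>lborel)"
        using \<rho> q by (intro powr_norm_submean holomorphic_on_subset[OF f sub]) auto
      also have "\<dots> \<le> I" unfolding I_def using sub
        by (intro nn_integral_mono mult_left_mono) (auto simp: indicator_def)
      finally have "norm (f w) powr q * (pi * (\<rho> / 2)\<^sup>2) \<le> i"
        using i by (simp flip: ennreal_mult)
      then have "norm (f w) powr q \<le> 4 * i / (pi * \<rho>\<^sup>2)" using \<rho> by (simp add: field_simps)
      then have "(norm (f w) powr q) powr (1 / q) \<le> B" unfolding B_def
        using q by (intro powr_mono2) auto
      then show ?thesis using q by (simp add: powr_powr)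
    qed
    have sub2: "cball z (\<rho> / 2) \<subseteq> ball z \<rho>" using \<rho> by auto
    have "norm ((deriv ^^ n) f z) \<le> fact n * B / (\<rho> / 2) ^ n"
    proof (rule Cauchy_inequality)
      show "f holomorphic_on ball z (\<rho> / 2)"
        using \<rho> by (intro holomorphic_on_subset[OF f]) auto
      show "continuous_on (cball z (\<rho> / 2)) f"
        by (rule holomorphic_on_imp_continuous_on[OF holomorphic_on_subset[OF f sub2]])
    qed (use \<rho> fB in \<open>auto simp: dist_norm\<close>)
    then have "norm ((deriv ^^ n) f z) powr q \<le> (fact n * B / (\<rho> / 2) ^ n) powr q"
      using q by (intro powr_mono2) auto
    also have "\<dots> = (fact n * 2 ^ n) powr q * B powr q * (\<rho> ^ n) powr (- q)"
    proof -
      have "fact n * B / (\<rho> / 2) ^ n = (fact n * 2 ^ n) * B / \<rho> ^ n"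
        using \<rho> by (simp add: power_divide)
      moreover have "0 \<le> B" by (simp add: B_def)
      ultimately show ?thesis using \<rho>
        by (simp add: powr_divide powr_mult powr_minus divide_simps)
    qed
    also have "B powr q = 4 * i / (pi * \<rho>\<^sup>2)" using q i \<rho> by (simp add: B_def powr_powr)
    also have "(\<rho> ^ n) powr (- q) = \<rho> powr (- (real n * q))"
      using \<rho> by (simp add: powr_powr flip: powr_realpow)
    also have "(fact n * 2 ^ n) powr q * (4 * i / (pi * \<rho>\<^sup>2)) * \<rho> powr (- (real n * q))
        = C * \<rho> powr (- (real n * q) - 2) * i"
      using \<rho> by (simp add: C_def powr_diff field_simps)
    finally show ?thesis using i \<open>0 < C\<close> by (simp flip: ennreal_mult)
  qed
qed

section \<open>Radial and doubling weights\<close>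

lemma sets_area [simp]: "sets area = sets (lebesgue_on unit_disc)"
  by (simp add: area_def)

lemma space_area [simp]: "space area = unit_disc"
  using sets_eq_imp_space_eq[OF sets_area] by simp

lemma borel_measurable_area:
  assumes "F \<in> borel_measurable borel" shows "F \<in> borel_measurable area"
proof -
  have "F \<in> borel_measurable (lebesgue_on unit_disc)"
    using assms by (intro measurable_restrict_space1 borel_measurable_if_I measurable_completion) auto
  then show ?thesis by (simp cong: measurable_cong_sets)
qed

lemma nn_integral_area:
  fixes F :: "complex \<Rightarrow> ennreal"
  assumes [measurable]: "F \<in> borel_measurable borel"
  shows "(\<integral>\<^sup>+z. F z \<partial>area) = ennreal (1 / pi) * (\<integral>\<^sup>+z\<in>unit_disc. F z \<partial>lborel)"
proof -
  have "F \<in> borel_measurable (lebesgue_on unit_disc)"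
    using borel_measurable_area[OF assms] by (simp cong: measurable_cong_sets)
  then have "(\<integral>\<^sup>+z. F z \<partial>area) = ennreal (1 / pi) * (\<integral>\<^sup>+z. F z \<partial>lebesgue_on unit_disc)"
    unfolding area_def by (intro nn_integral_scale_measure)
  also have "(\<integral>\<^sup>+z. F z \<partial>lebesgue_on unit_disc) = (\<integral>\<^sup>+z\<in>unit_disc. F z \<partial>lebesgue)"
    by (intro nn_integral_restrict_space) simp
  also have "\<dots> = (\<integral>\<^sup>+z\<in>unit_disc. F z \<partial>lborel)"
    by (intro nn_integral_completion) 
  finally show ?thesis .
qed

lemma AE_area_if_AE_lborel:
  assumes "AE z in lborel. z \<in> unit_disc \<longrightarrow> P z" shows "AE z in area. P z"
proof -
  obtain N where N: "{z \<in> space lborel. \<not> (z \<in> unit_disc \<longrightarrow> P z)} \<subseteq> N" "emeasure lborel N = 0" "N \<in> sets lborel"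
    by (rule AE_E[OF assms])
  have [measurable]: "N \<in> sets borel" using N(3) by simp
  have "emeasure area (N \<inter> unit_disc) = (\<integral>\<^sup>+z. indicator (N \<inter> unit_disc) z \<partial>area)"
  proof (rule nn_integral_indicator[symmetric])
    show "N \<inter> unit_disc \<in> sets area"
      by (simp add: sets_restrict_space_iff)
  qed
  also have "\<dots> = ennreal (1 / pi) * (\<integral>\<^sup>+z\<in>unit_disc. indicator (N \<inter> unit_disc) z \<partial>lborel)"
    by (rule nn_integral_area) measurable
  also have "(\<integral>\<^sup>+z\<in>unit_disc. indicator (N \<inter> unit_disc) z \<partial>lborel) = 0"
  proof -
  have "(\<integral>\<^sup>+z\<in>unit_disc. indicator (N \<inter> unit_disc) z \<partial>lborel) \<le> (\<integral>\<^sup>+z. indicator N z \<partial>lborel)"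
    by (intro nn_integral_mono) (auto simp: indicator_def)
  then show ?thesis using N(2) by simp
  qed
  finally have "emeasure area (N \<inter> unit_disc) = 0" by simp
  then show ?thesis
    using N(1) by (intro AE_I[of _ _ "N \<inter> unit_disc"]) (auto simp: sets_restrict_space_iff)
qed

text \<open>The real axis is a null set, so the values \<open>\<omega> (of_real s)\<close> cannot be
  read off from an almost everywhere statement on the disc. By polar coordinates almost every circle
  meets the exceptional null set in angular measure zero; on such a circle the Borel version has
  mean \<open>\<omega> (of_real s)\<close>, and that mean is a Borel function of the radius.\<close>

lemma radial_borel_version:
  fixes \<omega> :: "complex \<Rightarrow> real"
  assumes meas: "\<omega> \<in> borel_measurable area" and nonneg: "\<And>z. z \<in> unit_disc \<Longrightarrow> 0 \<le> \<omega> z"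
    and rad: "\<And>z. z \<in> unit_disc \<Longrightarrow> \<omega> z = \<omega> (of_real (norm z))"
  obtains g :: "real \<Rightarrow> real" where "g \<in> borel_measurable borel" "\<And>s. 0 \<le> g s"
    "AE s in lborel. 0 < s \<and> s < 1 \<longrightarrow> \<omega> (of_real s) = g s"
    "AE z in area. \<omega> z = g (norm z)"
proof -
  have "\<omega> \<in> borel_measurable (lebesgue_on unit_disc)" using meas by (simp cong: measurable_cong_sets)
  then have "(\<lambda>z. if z \<in> unit_disc then \<omega> z else 0) \<in> borel_measurable lebesgue"
    by (subst borel_measurable_if) auto
  from completion_ex_borel_measurable_real[OF this] obtain w where
    w[measurable]: "w \<in> borel_measurable borel" and w_eq: "AE z in lborel. (if z \<in> unit_disc then \<omega> z else 0) = w z"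
    by auto
  obtain N where N: "{z \<in> space lborel. \<not> ((if z \<in> unit_disc then \<omega> z else 0) = w z)} \<subseteq> N"
      "emeasure lborel N = 0" "N \<in> sets lborel"
    by (rule AE_E[OF w_eq])
  have [measurable]: "N \<in> sets borel" using N(3) by simp
  have wN: "w z = \<omega> z" if "z \<in> unit_disc" "z \<notin> N" for z
    using subsetD[OF N(1), of z] that by (cases "\<omega> z = w z") auto
  \<comment> \<open>The angular measure of the exceptional set on the circle of radius s.\<close>
  define J where "J = (\<lambda>s. \<integral>\<^sup>+t\<in>{-pi..pi}. indicator N (of_real s * cis t) \<partial>lborel)"
  have [measurable]: "J \<in> borel_measurable borel" unfolding J_def by measurable
  have "(\<integral>\<^sup>+s\<in>{0..<1}. ennreal s * J s \<partial>lborel) = (\<integral>\<^sup>+z\<in>unit_disc. indicator N z \<partial>lborel)"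
    unfolding J_def by (rule nn_integral_polar[symmetric]) measurable
  also have "\<dots> \<le> (\<integral>\<^sup>+z. indicator N z \<partial>lborel)"
    by (intro nn_integral_mono) (auto simp: indicator_def)
  finally have "(\<integral>\<^sup>+s\<in>{0..<1}. ennreal s * J s \<partial>lborel) = 0" using N(2) by simp
  then have J0: "AE s in lborel. ennreal s * J s * indicator {0..<1} s = 0"
    by (subst (asm) nn_integral_0_iff_AE) auto
  define g0 where "g0 = (\<lambda>s. ennreal (1 / (2 * pi)) * (\<integral>\<^sup>+t\<in>{-pi..pi}. ennreal (w (of_real s * cis t)) \<partial>lborel))"
  have [measurable]: "g0 \<in> borel_measurable borel" unfolding g0_def by measurable
  define g where "g = (\<lambda>s. enn2real (g0 s))"
  have g[measurable]: "g \<in> borel_measurable borel" unfolding g_def by measurable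
  have eq: "\<omega> (of_real s) = g s" if s: "0 < s" "s < 1" and Js: "J s = 0" for s
  proof -
    have "AE t in lborel. indicator N (of_real s * cis t) * indicator {-pi..pi} t = (0::ennreal)"
      using Js unfolding J_def by (subst (asm) nn_integral_0_iff_AE) auto
    then have "AE t in lborel. ennreal (w (of_real s * cis t)) * indicator {-pi..pi} t = ennreal (\<omega> (of_real s)) * indicator {-pi..pi} t"
    proof eventually_elim
      case (elim t)
      have "of_real s * cis t \<in> unit_disc" using s by (simp add: norm_mult)
      then have "w (of_real s * cis t) = \<omega> (of_real s)" if "of_real s * cis t \<notin> N"
        using wN[OF _ that] rad[of "of_real s * cis t"] s by (simp add: norm_mult)
      then show ?case using elim by (auto simp: indicator_def split: if_splits)
    qed
    then have "(\<integral>\<^sup>+t\<in>{-pi..pi}. ennreal (w (of_real s * cis t)) \<partial>lborel) = (\<integral>\<^sup>+t\<in>{-pi..pi}. ennreal (\<omega> (of_real s)) \<partial>lborel)"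
      by (rule nn_integral_cong_AE)
    also have "\<dots> = ennreal (\<omega> (of_real s)) * ennreal (2 * pi)"
      by (subst nn_integral_cmult_indicator) auto
    finally have "g0 s = ennreal (\<omega> (of_real s))"
      using nonneg[of "of_real s"] s by (simp add: g0_def flip: ennreal_mult)
    then show ?thesis using nonneg[of "of_real s"] s by (simp add: g_def)
  qed
  have ae: "AE s in lborel. 0 < s \<and> s < 1 \<longrightarrow> \<omega> (of_real s) = g s"
    using J0 by eventually_elim (auto intro!: eq simp: indicator_def)
  \<comment> \<open>A null set of radii pulls back to a null set of the disc, again by integration
    in polar form.\<close>
  obtain N1 where N1: "{s \<in> space lborel. \<not> (0 < s \<and> s < 1 \<longrightarrow> \<omega> (of_real s) = g s)} \<subseteq> N1" "emeasure lborel N1 = 0" "N1 \<in> sets lborel"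
    by (rule AE_E[OF ae])
  have [measurable]: "N1 \<in> sets borel" using N1(3) by simp
  have "AE s in lborel. s \<notin> N1" using N1(2,3) by (intro AE_not_in) auto
  then have "(\<integral>\<^sup>+s\<in>{0..<1}. ennreal (2 * pi * s) * indicator N1 s \<partial>lborel) = 0"
    by (subst nn_integral_0_iff_AE) (auto elim!: eventually_mono simp: indicator_def)
  then have "(\<integral>\<^sup>+z\<in>unit_disc. indicator N1 (norm z) \<partial>lborel) = 0"
    by (subst nn_integral_radial) auto
  then have "AE z in lborel. indicator N1 (norm z) * indicator unit_disc z = (0::ennreal)"
    by (subst (asm) nn_integral_0_iff_AE) auto
  moreover have "AE z in lborel. z \<noteq> (0::complex)" by (rule AE_lborel_singleton)
  ultimately have "AE z in lborel. z \<in> unit_disc \<longrightarrow> \<omega> z = g (norm z)"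
  proof eventually_elim
    case (elim z)
    show ?case
    proof
      assume z: "z \<in> unit_disc"
      then have "norm z \<notin> N1" using elim by (auto simp: indicator_def split: if_splits)
      then have "\<omega> (of_real (norm z)) = g (norm z)"
        using subsetD[OF N1(1), of "norm z"] z elim(2) by (cases "\<omega> (of_real (norm z)) = g (norm z)") auto
      then show "\<omega> z = g (norm z)" using rad[OF z] by simp
    qed
  qed
  then have "AE z in area. \<omega> z = g (norm z)" by (rule AE_area_if_AE_lborel)
  with g ae show ?thesis by (intro that[of g]) (auto simp: g_def)
qed

text \<open>\<open>g\<close> is a Borel version of the radial weight as a function of the modulus and \<open>h\<close> its tail integral;
  the last two assumptions are the two doubling conditions in power form.\<close>

locale doubling_profile =
  fixes g h :: "real \<Rightarrow> real" and C b \<alpha> :: real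
  assumes g_meas [measurable]: "g \<in> borel_measurable borel" and g_nonneg: "\<And>s. 0 \<le> g s"
    and tail: "\<And>r. 0 \<le> r \<Longrightarrow> r < 1 \<Longrightarrow> (\<integral>\<^sup>+s\<in>{r..<1}. ennreal (g s) \<partial>lborel) = ennreal (h r)"
    and h_pos: "\<And>r. 0 \<le> r \<Longrightarrow> r < 1 \<Longrightarrow> 0 < h r"
    and C_ge_1: "1 \<le> C" and \<alpha>_le_b: "\<alpha> \<le> b" and \<alpha>_pos: "0 < \<alpha>"
    and upper: "\<And>r s. 0 \<le> r \<Longrightarrow> r \<le> s \<Longrightarrow> s < 1 \<Longrightarrow> h r \<le> C * ((1 - r) / (1 - s)) powr b * h s"
    and lower: "\<And>r s. 0 \<le> r \<Longrightarrow> r \<le> s \<Longrightarrow> s < 1 \<Longrightarrow> h s \<le> C * ((1 - s) / (1 - r)) powr \<alpha> * h r"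

text \<open>The condition is iterated until x / 2^k is at most y. Rounding the number of steps up
  costs one factor D, and D^(log 2 t) = t^(log 2 D). In the application \<open>V x\<close> is the
  tail integral starting at 1 - x.\<close>

lemma doubling_power_upper:
  fixes V :: "real \<Rightarrow> real"
  assumes mono: "\<And>x y. 0 < y \<Longrightarrow> y \<le> x \<Longrightarrow> x \<le> 1 \<Longrightarrow> V y \<le> V x"
    and nn: "\<And>x. 0 < x \<Longrightarrow> x \<le> 1 \<Longrightarrow> 0 \<le> V x"
    and doub: "\<And>x. 0 < x \<Longrightarrow> x \<le> 1 \<Longrightarrow> V x \<le> D * V (x / 2)" and D: "1 \<le> D"
    and xy: "0 < y" "y \<le> x" "x \<le> 1"
  shows "V x \<le> D * (x / y) powr (log 2 D) * V y"
proof -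
  have it: "V x \<le> D ^ k * V (x / 2 ^ k)" for k
  proof (induction k)
    case (Suc k)
    have "x / 2 ^ k \<le> 1" using xy by (simp add: divide_le_eq) (metis mult_left_mono mult.right_neutral one_le_power one_le_numeral order.trans)
    then have "V (x / 2 ^ k) \<le> D * V (x / 2 ^ k / 2)" using xy by (intro doub) auto
    then have "D ^ k * V (x / 2 ^ k) \<le> D ^ k * (D * V (x / 2 ^ k / 2))" using D by (intro mult_left_mono) auto
    then show ?case using Suc by (simp add: mult_ac)
  qed simp
  define k where "k = nat \<lceil>log 2 (x / y)\<rceil>"
  have l0: "0 \<le> log 2 (x / y)" using xy by simp
  have k: "log 2 (x / y) \<le> real k" "real k \<le> log 2 (x / y) + 1"
    using l0 unfolding k_def by linarith+
  have "x / y = 2 powr (log 2 (x / y))" using xy by simp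
  also have "\<dots> \<le> 2 powr real k" using k by (intro powr_mono) auto
  finally have "x / 2 ^ k \<le> y" using xy by (simp add: powr_realpow field_simps)
  then have "V (x / 2 ^ k) \<le> V y" using xy by (intro mono) auto
  then have "V x \<le> D ^ k * V y" using it[of k] D by (smt (verit) mult_left_mono zero_le_power)
  also have "D ^ k = D powr real k" using D by (simp add: powr_realpow)
  also have "\<dots> \<le> D powr (log 2 (x / y) + 1)" using D k by (intro powr_mono) auto
  also have "\<dots> = D * (x / y) powr (log 2 D)"
  proof -
    have "D powr (log 2 (x / y)) = (x / y) powr (log 2 D)"
      using D xy by (simp add: powr_def log_def)
    then show ?thesis using D by (simp add: powr_add)
  qed
  finally show ?thesis using nn[of y] xy by (smt (verit) mult_right_mono)
qed

text \<open>The same iteration with ratio K, except that the number of steps is rounded down so that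
  x / K^k stays at least y; the missing fraction of a step costs the factor D.\<close>

lemma doubling_power_lower:
  fixes V :: "real \<Rightarrow> real"
  assumes mono: "\<And>x y. 0 < y \<Longrightarrow> y \<le> x \<Longrightarrow> x \<le> 1 \<Longrightarrow> V y \<le> V x"
    and nn: "\<And>x. 0 < x \<Longrightarrow> x \<le> 1 \<Longrightarrow> 0 \<le> V x"
    and doub: "\<And>x. 0 < x \<Longrightarrow> x \<le> 1 \<Longrightarrow> D * V (x / K) \<le> V x" and D: "1 < D" and K: "1 < K"
    and xy: "0 < y" "y \<le> x" "x \<le> 1"
  shows "V y \<le> D * (y / x) powr (log K D) * V x"
proof -
  have it: "D ^ k * V (x / K ^ k) \<le> V x" for k
  proof (induction k)
    case (Suc k)
    have "1 \<le> K ^ k" using K by simp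
    then have "x \<le> K ^ k" using xy by linarith
    then have "x / K ^ k \<le> 1" using K by (simp add: divide_le_eq)
    then have "D * V (x / K ^ k / K) \<le> V (x / K ^ k)" using xy K by (intro doub) auto
    then have "D ^ k * (D * V (x / K ^ k / K)) \<le> D ^ k * V (x / K ^ k)" using D by (intro mult_left_mono) auto
    then show ?case using Suc by (simp add: mult_ac)
  qed simp
  define k where "k = nat \<lfloor>log K (x / y)\<rfloor>"
  have l0: "0 \<le> log K (x / y)" using xy K by simp
  have k: "real k \<le> log K (x / y)" "log K (x / y) - 1 \<le> real k"
    using l0 unfolding k_def by linarith+
  have "K powr real k \<le> K powr (log K (x / y))" using k K by (intro powr_mono) auto
  also have "\<dots> = x / y" using xy K by simp
  finally have "y \<le> x / K ^ k" using xy K by (simp add: powr_realpow field_simps)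
  moreover have "x / K ^ k \<le> 1"
  proof -
    have "1 \<le> K ^ k" using K by simp
    then have "x \<le> K ^ k" using xy by linarith
    then show ?thesis using K by (simp add: divide_le_eq)
  qed
  ultimately have "V y \<le> V (x / K ^ k)" using xy by (intro mono) auto
  then have "D ^ k * V y \<le> V x" using it[of k] D by (smt (verit) mult_left_mono zero_le_power)
  moreover have "D powr (log K (x / y) - 1) \<le> D ^ k"
  proof -
    have "D powr (log K (x / y) - 1) \<le> D powr real k" using D k by (intro powr_mono) auto
    then show ?thesis using D by (simp add: powr_realpow)
  qed
  ultimately have "D powr (log K (x / y) - 1) * V y \<le> V x"
    using nn[of y] xy by (smt (verit) mult_right_mono)
  moreover have "D powr (log K (x / y) - 1) = (x / y) powr (log K D) / D"
  proof -
    have "D powr (log K (x / y)) = (x / y) powr (log K D)"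
      using D xy K by (simp add: powr_def log_def)
    then show ?thesis using D by (simp add: powr_diff)
  qed
  ultimately have "(x / y) powr (log K D) * V y \<le> D * V x" using D by (simp add: field_simps)
  moreover have "(y / x) powr (log K D) = 1 / (x / y) powr (log K D)"
    using xy by (simp add: powr_divide)
  moreover have "0 < (x / y) powr (log K D)" using xy by simp
  ultimately show ?thesis by (simp add: pos_le_divide_eq mult_ac)
qed

text \<open>Integrability over the disc controls only the integral of s g(s), so at first the tail
  \<open>H\<close> is finite away from 0; the first doubling condition at r = 0 compares
  \<open>H 0\<close> with \<open>H (1 / 2)\<close> and closes this gap. Positivity of all tails is
  likewise traced back to that of \<open>H 0\<close>.\<close>

lemma doubling_weight_profile:
  fixes \<omega> :: "complex \<Rightarrow> real"
  assumes "doubling_weight \<omega>"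
  obtains g h C b \<alpha> where "doubling_profile g h C b \<alpha>" "AE z in area. \<omega> z = g (norm z)"
    "\<And>z. z \<in> unit_disc \<Longrightarrow> weight_hat \<omega> z = ennreal (h (norm z))"
proof -
  have rw: "radial_weight \<omega>" using assms by (simp add: doubling_weight_def)
  obtain D where D: "D \<ge> 1" "\<And>r. 0 \<le> r \<Longrightarrow> r < 1 \<Longrightarrow>
       weight_hat \<omega> (of_real r) \<le> ennreal D * weight_hat \<omega> (of_real ((1 + r) / 2))"
    using assms unfolding doubling_weight_def by blast
  obtain K E where E: "K > 1" "E > 1" "\<And>r. 0 \<le> r \<Longrightarrow> r < 1 \<Longrightarrow>
       weight_hat \<omega> (of_real r) \<ge> ennreal E * weight_hat \<omega> (of_real (1 - (1 - r) / K))"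
    using assms unfolding doubling_weight_def by blast
  have int: "integrable area \<omega>" and nn\<omega>: "\<And>z. z \<in> unit_disc \<Longrightarrow> 0 \<le> \<omega> z"
    and rad: "\<And>z. z \<in> unit_disc \<Longrightarrow> \<omega> z = \<omega> (of_real (norm z))" and nz: "\<not> (AE z in area. \<omega> z = 0)"
    using rw unfolding radial_weight_def by blast+
  obtain g :: "real \<Rightarrow> real" where g[measurable]: "g \<in> borel_measurable borel" and gnn: "\<And>s. 0 \<le> g s"
    and g1: "AE s in lborel. 0 < s \<and> s < 1 \<longrightarrow> \<omega> (of_real s) = g s"
    and g2: "AE z in area. \<omega> z = g (norm z)"
    by (rule radial_borel_version[of \<omega>], rule borel_measurable_integrable[OF int], erule nn\<omega>, erule rad, rule that)
  define H where "H = (\<lambda>r. \<integral>\<^sup>+s\<in>{r..<1}. ennreal (g s) \<partial>lborel)"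
  have hat: "weight_hat \<omega> z = H (norm z)" for z
  proof -
    have "(\<integral>\<^sup>+s\<in>{norm z..<1}. ennreal (\<omega> (of_real s)) \<partial>lebesgue) = (\<integral>\<^sup>+s\<in>{norm z..<1}. ennreal (g s) \<partial>lebesgue)"
    proof (rule nn_integral_cong_AE, rule AE_completion)
      have "AE s in lborel. s \<noteq> (0::real)" by (rule AE_lborel_singleton)
      with g1 show "AE s in lborel. ennreal (\<omega> (of_real s)) * indicator {norm z..<1} s = ennreal (g s) * indicator {norm z..<1} s"
      proof eventually_elim
        case (elim s)
        show ?case
        proof (cases "s \<in> {norm z..<1}")
          case True
          then have "0 \<le> s" "s < 1" using order_trans[OF norm_ge_zero[of z], of s] by auto
          then have "0 < s" "s < 1" using elim(2) by auto
          then show ?thesis using elim(1) by simp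
        qed simp
      qed
    qed
    then show ?thesis by (simp add: weight_hat_def H_def nn_integral_completion)
  qed
  have Hanti: "H s \<le> H r" if "r \<le> s" for r s
    unfolding H_def using that by (intro nn_integral_mono) (auto simp: indicator_def)
  have "(\<integral>\<^sup>+z. ennreal (\<omega> z) \<partial>area) < \<infinity>"
  proof -
    have "(\<integral>\<^sup>+z. ennreal (\<omega> z) \<partial>area) = (\<integral>\<^sup>+z. ennreal (norm (\<omega> z)) \<partial>area)"
      using nn\<omega> by (intro nn_integral_cong) simp
    then show ?thesis using int by (simp add: integrable_iff_bounded)
  qed
  moreover have "(\<integral>\<^sup>+z. ennreal (\<omega> z) \<partial>area) = (\<integral>\<^sup>+z. ennreal (g (norm z)) \<partial>area)"
    using g2 by (intro nn_integral_cong_AE) auto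
  ultimately have "ennreal (1 / pi) * (\<integral>\<^sup>+z\<in>unit_disc. ennreal (g (norm z)) \<partial>lborel) < \<infinity>"
    using nn_integral_area[of "\<lambda>z. ennreal (g (norm z))"] by simp
  then have "(\<integral>\<^sup>+z\<in>unit_disc. ennreal (g (norm z)) \<partial>lborel) < \<infinity>"
    by (auto simp: ennreal_mult_less_top)
  then have fin: "(\<integral>\<^sup>+s\<in>{0..<1}. ennreal (2 * pi * s) * ennreal (g s) \<partial>lborel) < \<infinity>"
    by (subst (asm) nn_integral_radial) auto
  \<comment> \<open>For s >= 1 / 2 the polar factor 2 pi s is at least 1.\<close>
  have Hhalf: "H (1 / 2) < \<infinity>"
  proof -
    have "H (1 / 2) \<le> (\<integral>\<^sup>+s\<in>{0..<1}. ennreal (2 * pi * s) * ennreal (g s) \<partial>lborel)"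
      unfolding H_def
    proof (rule nn_integral_mono)
      fix s :: real
      have "1 * g s \<le> 2 * pi * s * g s" if "1 / 2 \<le> s"
      proof (rule mult_right_mono)
        show "1 \<le> 2 * pi * s" using that pi_gt3 mult_mono[of 1 "2*pi" "1/2" s] mult_mono[of 6 "2*pi" "1/2" s] by simp
      qed (rule gnn)
      then show "ennreal (g s) * indicator {1 / 2..<1} s \<le> ennreal (2 * pi * s) * ennreal (g s) * indicator {0..<1} s"
        using gnn[of s] by (auto simp: indicator_def simp flip: ennreal_mult intro!: ennreal_leI)
    qed
    then show ?thesis using fin by (rule le_less_trans)
  qed
  have D': "H r \<le> ennreal D * H ((1 + r) / 2)" if "0 \<le> r" "r < 1" for r
    using D(2)[OF that] that unfolding hat norm_of_real by simp
  have E': "ennreal E * H (1 - (1 - r) / K) \<le> H r" if "0 \<le> r" "r < 1" for r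
  proof -
    have "(1 - r) / K \<le> 1" using E that by (simp add: divide_le_eq)
    then have "norm (complex_of_real (1 - (1 - r) / K)) = 1 - (1 - r) / K"
      by (subst norm_of_real) simp
    then show ?thesis using E(3)[OF that] that unfolding hat by simp
  qed
  have H0: "H 0 < \<infinity>"
    using D'[of 0] Hhalf by (auto intro: le_less_trans simp: ennreal_mult_less_top)
  have Hfin: "H r < \<infinity>" if "0 \<le> r" for r using Hanti[OF that] H0 by (rule le_less_trans)
  have H0pos: "H 0 \<noteq> 0"
  proof
    assume "H 0 = 0"
    then have "AE s in lborel. ennreal (g s) * indicator {0..<1} s = 0"
      unfolding H_def by (subst (asm) nn_integral_0_iff_AE) auto
    then have "(\<integral>\<^sup>+s\<in>{0..<1}. ennreal (2 * pi * s) * ennreal (g s) \<partial>lborel) = 0"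
      by (subst nn_integral_0_iff_AE) (auto elim!: eventually_mono simp: indicator_def split: if_splits)
    then have "(\<integral>\<^sup>+z\<in>unit_disc. ennreal (g (norm z)) \<partial>lborel) = 0"
      by (subst nn_integral_radial) auto
    then have "AE z in lborel. ennreal (g (norm z)) * indicator unit_disc z = 0"
      by (subst (asm) nn_integral_0_iff_AE) auto
    then have "AE z in lborel. z \<in> unit_disc \<longrightarrow> g (norm z) = 0"
      by eventually_elim (use gnn in \<open>auto simp: indicator_def ennreal_eq_0_iff antisym split: if_splits\<close>)
    then have "AE z in area. g (norm z) = 0" by (rule AE_area_if_AE_lborel)
    with g2 have "AE z in area. \<omega> z = 0" by eventually_elim simp
    with nz show False by simp
  qed
  define h where "h = (\<lambda>r. enn2real (H r))"
  have Hh: "H r = ennreal (h r)" if "0 \<le> r" for r using Hfin[OF that] by (simp add: h_def less_top)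
  have hnn: "0 \<le> h r" for r by (simp add: h_def)
  have hanti: "h s \<le> h r" if "0 \<le> r" "r \<le> s" for r s
    using Hanti[OF that(2)] that hnn by (simp add: Hh)
  have hD: "h r \<le> D * h ((1 + r) / 2)" if "0 \<le> r" "r < 1" for r
    using D'[OF that] that D(1) hnn by (simp add: Hh flip: ennreal_mult)
  have hE: "E * h (1 - (1 - r) / K) \<le> h r" if "0 \<le> r" "r < 1" for r
  proof -
    have "(1 - r) / K \<le> 1" using E that by (simp add: divide_le_eq)
    then show ?thesis using E'[OF that] that E hnn by (simp add: Hh flip: ennreal_mult)
  qed
  \<comment> \<open>In terms of the distance x = 1 - r to the boundary the doubling conditions
    compare x with x / 2 and x / K.\<close>
  define V where "V = (\<lambda>x. h (1 - x))"
  have Vm: "V y \<le> V x" if "0 < y" "y \<le> x" "x \<le> 1" for x y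
    unfolding V_def using that by (intro hanti) auto
  have Vn: "0 \<le> V x" for x by (simp add: V_def hnn)
  have VD: "V x \<le> max 2 D * V (x / 2)" if "0 < x" "x \<le> 1" for x
  proof -
    have "V x \<le> D * V (x / 2)" using hD[of "1 - x"] that by (simp add: V_def field_simps)
    also have "\<dots> \<le> max 2 D * V (x / 2)" using Vn by (intro mult_right_mono) auto
    finally show ?thesis .
  qed
  have VE: "E * V (x / K) \<le> V x" if "0 < x" "x \<le> 1" for x
    using hE[of "1 - x"] that by (simp add: V_def)
  have up: "h r \<le> max 2 D * ((1 - r) / (1 - s)) powr log 2 (max 2 D) * h s" if "0 \<le> r" "r \<le> s" "s < 1" for r s
    using doubling_power_upper[of V "max 2 D" "1 - s" "1 - r", OF Vm Vn VD] that by (simp add: V_def)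
  have lo: "h s \<le> E * ((1 - s) / (1 - r)) powr log K E * h r" if "0 \<le> r" "r \<le> s" "s < 1" for r s
    using doubling_power_lower[of V E K "1 - s" "1 - r", OF Vm Vn VE E(2,1)] that by (simp add: V_def)
  \<comment> \<open>By the power estimate a vanishing tail at r would force \<open>h 0\<close> to
    vanish, which means that \<omega> is zero almost everywhere.\<close>
  have hpos: "0 < h r" if "0 \<le> r" "r < 1" for r
  proof (rule ccontr)
    assume "\<not> 0 < h r"
    then have "h 0 \<le> 0" using up[of 0 r] hnn[of r] that by simp
    then have "h 0 = 0" using hnn[of 0] by simp
    then show False using H0pos Hh[of 0] by simp
  qed
  define C where "C = max (max 2 D) E"
  \<comment> \<open>The maximum secures \<alpha> <= b, on which the exponents of the kernel
    estimates rely.\<close>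
  define b where "b = max (log 2 (max 2 D)) (log K E)"
  have "doubling_profile g h C b (log K E)"
  proof
    fix r s :: real assume rs: "0 \<le> r" "r \<le> s" "s < 1"
    have "h r \<le> max 2 D * (((1 - r) / (1 - s)) powr log 2 (max 2 D) * h s)" using up[OF rs] by (simp add: mult.assoc)
    also have "\<dots> \<le> C * (((1 - r) / (1 - s)) powr log 2 (max 2 D) * h s)"
      using hnn by (intro mult_right_mono) (auto simp: C_def)
    also have "\<dots> \<le> C * (((1 - r) / (1 - s)) powr b * h s)"
      using hnn rs by (intro mult_left_mono mult_right_mono powr_mono) (auto simp: C_def b_def)
    finally show "h r \<le> C * ((1 - r) / (1 - s)) powr b * h s" by (simp add: mult.assoc)
    have "h s \<le> E * (((1 - s) / (1 - r)) powr log K E * h r)" using lo[OF rs] by (simp add: mult.assoc)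
    also have "\<dots> \<le> C * (((1 - s) / (1 - r)) powr log K E * h r)"
      using hnn by (intro mult_right_mono) (auto simp: C_def)
    finally show "h s \<le> C * ((1 - s) / (1 - r)) powr log K E * h r" by (simp add: mult.assoc)
  next
    fix r :: real assume "0 \<le> r" "r < 1"
    then show "(\<integral>\<^sup>+s\<in>{r..<1}. ennreal (g s) \<partial>lborel) = ennreal (h r)" using Hh by (simp add: H_def)
  qed (use gnn hpos E in \<open>auto simp: C_def b_def\<close>)
  moreover have "weight_hat \<omega> z = ennreal (h (norm z))" if "z \<in> unit_disc" for z
    by (simp add: hat Hh)
  ultimately show ?thesis using g2 that by blast
qed

section \<open>Forelli--Rudin estimates\<close>

text \<open>The function (1 + w z) / (1 - w z) equals 1 at the origin, and its real part on the unit
  circle is the Poisson kernel (1 - |w|^2) / |1 - w z|^2; so the integral is an instance of Cauchy's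
  formula.\<close>

lemma circle_integral_inverse_square:
  fixes w :: complex
  assumes w: "norm w < 1"
  shows "(\<integral>\<^sup>+t\<in>{-pi..pi}. ennreal (1 / (norm (1 - w * cis t))\<^sup>2) \<partial>lborel) = ennreal (2 * pi / (1 - (norm w)\<^sup>2))"
proof -
  define F where "F = (\<lambda>z. (1 + w * z) / (1 - w * z))"
  have nz: "1 - w * z \<noteq> 0" if "norm z \<le> 1" for z
  proof
    assume "1 - w * z = 0"
    then have "w * z = 1" by simp
    then have "norm w * norm z = 1" by (metis norm_mult norm_one)
    moreover have "norm w * norm z \<le> norm w * 1" using that by (intro mult_left_mono) auto
    ultimately show False using w by simp
  qed
  have "F holomorphic_on cball 0 1" unfolding F_def using nz by (intro holomorphic_intros) auto
  then have "((\<lambda>u. F u / (u - 0)) has_contour_integral 2 * of_real pi * \<i> * F 0) (circlepath 0 1)"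
    by (rule Cauchy_integral_circlepath_simple) auto
  then have "((\<lambda>t. F (cis t) / cis t * \<i> * cis t) has_integral 2 * of_real pi * \<i>) {0..2*pi}"
    unfolding circlepath_def by (subst (asm) has_contour_integral_part_circlepath_iff) (auto simp: F_def)
  then have "((\<lambda>t. - \<i> * (F (cis t) / cis t * \<i> * cis t)) has_integral - \<i> * (2 * of_real pi * \<i>)) {0..2*pi}"
    by (rule has_integral_mult_right)
  then have "((\<lambda>t. F (cis t)) has_integral of_real (2 * pi)) {0..2*pi}"
    by (simp add: field_simps)
  then have 1: "((\<lambda>t. Re (F (cis t))) has_integral Re (of_real (2 * pi))) {0..2*pi}"
    by (rule has_integral_linear[OF _ bounded_linear_Re, unfolded o_def])
  have ReF: "Re (F (cis t)) = (1 - (norm w)\<^sup>2) / (norm (1 - w * cis t))\<^sup>2" for t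
  proof -
    have c: "(norm (w * cis t))\<^sup>2 = (norm w)\<^sup>2" by (simp add: norm_mult)
    have "Re (F (cis t)) = (Re (1 + w * cis t) * Re (1 - w * cis t) + Im (1 + w * cis t) * Im (1 - w * cis t)) / (norm (1 - w * cis t))\<^sup>2"
      by (simp add: F_def Re_divide cmod_power2)
    also have "Re (1 + w * cis t) * Re (1 - w * cis t) + Im (1 + w * cis t) * Im (1 - w * cis t) = 1 - (norm (w * cis t))\<^sup>2"
      unfolding cmod_power2 by (simp add: algebra_simps power2_eq_square)
    finally show ?thesis using c by simp
  qed
  have pos: "0 < 1 - (norm w)\<^sup>2" using w by (simp add: power_less_one_iff abs_square_less_1)
  have "((\<lambda>t. (1 / (1 - (norm w)\<^sup>2)) * Re (F (cis t))) has_integral (1 / (1 - (norm w)\<^sup>2)) * (2 * pi)) {0..2*pi}"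
    using has_integral_mult_right[OF 1, of "1 / (1 - (norm w)\<^sup>2)"] by simp
  then have 2: "integral {0..2*pi} (\<lambda>t. 1 / (norm (1 - w * cis t))\<^sup>2) = 2 * pi / (1 - (norm w)\<^sup>2)"
    using pos unfolding ReF by (intro integral_unique) simp
  have meas: "(\<lambda>t. ennreal (1 / (norm (1 - w * cis t))\<^sup>2)) \<in> borel_measurable borel" by measurable
  have "(\<integral>\<^sup>+t\<in>{-pi..pi}. ennreal (1 / (norm (1 - w * cis t))\<^sup>2) \<partial>lborel)
      = (\<integral>\<^sup>+t\<in>{-pi..pi}. ennreal (1 / (norm (1 - w * cis (pi + t)))\<^sup>2) \<partial>lborel)"
    by (rule nn_integral_periodic_shift[symmetric, OF meas]) (simp flip: cis_mult)
  also have "\<dots> = (\<integral>\<^sup>+t. ennreal (1 / (norm (1 - w * cis (pi + t)))\<^sup>2) * indicator {0..2*pi} (pi + t) \<partial>lborel)"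
    by (intro nn_integral_cong) (auto simp: indicator_def)
  also have "\<dots> = (\<integral>\<^sup>+t\<in>{0..2*pi}. ennreal (1 / (norm (1 - w * cis t))\<^sup>2) \<partial>lborel)"
    by (rule nn_integral_lborel_shift) measurable
  also have "\<dots> = ennreal (integral {0..2*pi} (\<lambda>t. 1 / (norm (1 - w * cis t))\<^sup>2))"
    using nz[of "cis _"] by (intro nn_integral_Icc_continuous continuous_intros) auto
  finally show ?thesis by (simp add: 2)
qed

text \<open>The integral is split at y. Below y the maximum is y, and c > -1 gives convergence at 0;
  above y the integrand is a pure power with exponent c + 1 - \<gamma> < -1, integrable up to
  infinity.\<close>

lemma nn_integral_powr_max:
  assumes c: "-1 < c" and \<gamma>: "c + 2 < \<gamma>" "1 \<le> \<gamma>" and y: "0 < y"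
  shows "(\<integral>\<^sup>+x\<in>{0<..1}. ennreal (x powr c * (max x y) powr (1 - \<gamma>)) \<partial>lborel)
    \<le> ennreal ((1 / (c + 1) + 1 / (\<gamma> - c - 2)) * y powr (c + 2 - \<gamma>))"
proof -
  have "(\<integral>\<^sup>+x\<in>{0<..1}. ennreal (x powr c * (max x y) powr (1 - \<gamma>)) \<partial>lborel)
     \<le> (\<integral>\<^sup>+x. ennreal (y powr (1 - \<gamma>)) * ennreal (indicator {0..y} x * x powr c) + ennreal (indicator {y..} x * x powr (c + 1 - \<gamma>)) \<partial>lborel)"
  proof (rule nn_integral_mono)
    fix x :: real
    consider "x \<le> 0" | "0 < x" "x \<le> y" | "y < x" by linarith
    then show "ennreal (x powr c * (max x y) powr (1 - \<gamma>)) * indicator {0<..1} x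
      \<le> ennreal (y powr (1 - \<gamma>)) * ennreal (indicator {0..y} x * x powr c) + ennreal (indicator {y..} x * x powr (c + 1 - \<gamma>))"
    proof cases
      case 2
      then have "ennreal (x powr c * (max x y) powr (1 - \<gamma>)) = ennreal (y powr (1 - \<gamma>)) * ennreal (indicator {0..y} x * x powr c)"
        by (simp add: max_def mult.commute flip: ennreal_mult)
      then show ?thesis by (auto simp: indicator_def add_increasing2)
    next
      case 3
      then have "x powr c * (max x y) powr (1 - \<gamma>) = x powr (c + 1 - \<gamma>)"
        using y by (simp add: max_def add_diff_eq flip: powr_add)
      then show ?thesis using 3 by (auto simp: indicator_def)
    qed simp
  qed
  also have "\<dots> = ennreal (y powr (1 - \<gamma>)) * (\<integral>\<^sup>+x. ennreal (indicator {0..y} x * x powr c) \<partial>lborel)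
     + (\<integral>\<^sup>+x. ennreal (indicator {y..} x * x powr (c + 1 - \<gamma>)) \<partial>lborel)"
    by (subst nn_integral_add) (auto simp: nn_integral_cmult)
  also have "(\<integral>\<^sup>+x. ennreal (indicator {0..y} x * x powr c) \<partial>lborel) = ennreal (y powr (c + 1) / (c + 1))"
  proof (rule nn_integral_has_integral_lborel)
    have "((\<lambda>x. if x \<in> {0..y} then x powr c else 0) has_integral y powr (c + 1) / (c + 1)) UNIV"
      using has_integral_powr_from_0[of c y] c y by (subst has_integral_restrict_UNIV) auto
    then show "((\<lambda>x. indicator {0..y} x * x powr c) has_integral y powr (c + 1) / (c + 1)) UNIV"
      by (rule has_integral_eq[rotated]) (auto simp: indicator_def)
  qed auto
  also have "(\<integral>\<^sup>+x. ennreal (indicator {y..} x * x powr (c + 1 - \<gamma>)) \<partial>lborel) = ennreal (- (y powr (c + 1 - \<gamma> + 1)) / (c + 1 - \<gamma> + 1))"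
  proof (rule nn_integral_has_integral_lborel)
    have "((\<lambda>x. if x \<in> {y..} then x powr (c + 1 - \<gamma>) else 0) has_integral - (y powr (c + 1 - \<gamma> + 1)) / (c + 1 - \<gamma> + 1)) UNIV"
      using has_integral_powr_to_inf[of "c + 1 - \<gamma>" y] \<gamma> y by (subst has_integral_restrict_UNIV) auto
    then show "((\<lambda>x. indicator {y..} x * x powr (c + 1 - \<gamma>)) has_integral - (y powr (c + 1 - \<gamma> + 1)) / (c + 1 - \<gamma> + 1)) UNIV"
      by (rule has_integral_eq[rotated]) (auto simp: indicator_def)
  qed auto
  also have "ennreal (y powr (1 - \<gamma>)) * ennreal (y powr (c + 1) / (c + 1)) + ennreal (- (y powr (c + 1 - \<gamma> + 1)) / (c + 1 - \<gamma> + 1))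
     = ennreal ((1 / (c + 1) + 1 / (\<gamma> - c - 2)) * y powr (c + 2 - \<gamma>))"
  proof -
    have "y powr (1 - \<gamma>) * (y powr (c + 1) / (c + 1)) = y powr (c + 2 - \<gamma>) / (c + 1)"
      by (simp flip: powr_add) (simp add: algebra_simps)
    moreover have "- (y powr (c + 1 - \<gamma> + 1)) / (c + 1 - \<gamma> + 1) = y powr (c + 2 - \<gamma>) / (\<gamma> - c - 2)"
    proof -
      have "c + 1 - \<gamma> + 1 = - (\<gamma> - c - 2)" "c + 1 - \<gamma> + 1 = c + 2 - \<gamma>" by simp_all
      then show ?thesis by (metis minus_divide_divide minus_minus)
    qed
    ultimately show ?thesis using c \<gamma>
      by (simp add: distrib_right flip: ennreal_mult ennreal_plus)
  qed
  finally show ?thesis .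
qed

text \<open>With w = cnj a s, two of the \<gamma> powers are integrated over the circle by means of
  the Poisson kernel, and the remaining \<gamma> - 2 >= 0 are estimated by |1 - w e^(it)| >= 1 -
  |w|. What is left is a radial integral, where 1 - |w| is at least 1 - s and at least 1 -
  |a|.\<close>

lemma forelli_rudin:
  assumes c: "-1 < c" and \<gamma>: "c + 2 < \<gamma>" "2 \<le> \<gamma>"
  obtains D where "0 < D" "\<And>a. a \<in> unit_disc \<Longrightarrow>
    (\<integral>\<^sup>+z\<in>unit_disc. ennreal ((1 - norm z) powr c * norm (1 - cnj a * z) powr (- \<gamma>)) \<partial>lborel)
      \<le> ennreal (D * (1 - norm a) powr (c + 2 - \<gamma>))"
proof
  define D where "D = 2 * pi * (1 / (c + 1) + 1 / (\<gamma> - c - 2))"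
  show "0 < D" using c \<gamma> by (auto simp: D_def intro!: mult_pos_pos add_pos_pos)
  fix a :: complex assume a: "a \<in> unit_disc"
  define y where "y = 1 - norm a"
  have y: "0 < y" "y \<le> 1" using a by (auto simp: y_def)
  define F where "F = (\<lambda>z. ennreal ((1 - norm z) powr c * norm (1 - cnj a * z) powr (- \<gamma>)))"
  have F[measurable]: "F \<in> borel_measurable borel" unfolding F_def by measurable
  have inner: "ennreal s * (\<integral>\<^sup>+t\<in>{-pi..pi}. F (of_real s * cis t) \<partial>lborel) \<le> ennreal (2 * pi) * ennreal ((1 - s) powr c * (max (1 - s) y) powr (1 - \<gamma>))"
    if s: "0 \<le> s" "s < 1" for s
  proof -
    define w where "w = cnj a * of_real s"
    have nw: "norm w = norm a * s" using s by (simp add: w_def norm_mult)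
    have as: "norm a * s \<le> s" "norm a * s \<le> norm a" using s a by (auto simp: mult_left_le_one_le mult_right_le_one_le)
    then have w1: "norm w < 1" using nw s by simp
    have low: "1 - norm w \<le> norm (1 - w * cis t)" for t
      using norm_triangle_ineq2[of 1 "w * cis t"] by (simp add: norm_mult)
    have pt: "F (of_real s * cis t) \<le> ennreal ((1 - s) powr c * (1 - norm w) powr (2 - \<gamma>)) * ennreal (1 / (norm (1 - w * cis t))\<^sup>2)" for t
    proof -
      have p: "0 < norm (1 - w * cis t)" using low[of t] w1 by linarith
      have "norm (1 - w * cis t) powr (- \<gamma>) = norm (1 - w * cis t) powr (2 - \<gamma>) * (1 / (norm (1 - w * cis t))\<^sup>2)"
        using p by (simp add: powr_diff powr_minus field_simps)
      also have "\<dots> \<le> (1 - norm w) powr (2 - \<gamma>) * (1 / (norm (1 - w * cis t))\<^sup>2)"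
        using low[of t] w1 \<gamma> by (intro mult_right_mono powr_mono2') auto
      finally have "(1 - s) powr c * norm (1 - w * cis t) powr (- \<gamma>) \<le> (1 - s) powr c * ((1 - norm w) powr (2 - \<gamma>) * (1 / (norm (1 - w * cis t))\<^sup>2))"
        by (rule mult_left_mono) simp
      then show ?thesis using s
        by (simp add: F_def w_def norm_mult mult_ac flip: ennreal_mult)
    qed
    have "(\<integral>\<^sup>+t\<in>{-pi..pi}. F (of_real s * cis t) \<partial>lborel)
       \<le> (\<integral>\<^sup>+t. ennreal ((1 - s) powr c * (1 - norm w) powr (2 - \<gamma>)) * (ennreal (1 / (norm (1 - w * cis t))\<^sup>2) * indicator {-pi..pi} t) \<partial>lborel)"
      by (intro nn_integral_mono) (use pt in \<open>auto simp: indicator_def\<close>)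
    also have "\<dots> = ennreal ((1 - s) powr c * (1 - norm w) powr (2 - \<gamma>)) * ennreal (2 * pi / (1 - (norm w)\<^sup>2))"
      by (subst nn_integral_cmult) (auto simp: circle_integral_inverse_square[OF w1])
    also have "\<dots> \<le> ennreal ((1 - s) powr c * (1 - norm w) powr (2 - \<gamma>)) * ennreal (2 * pi * (1 - norm w) powr (-1))"
    proof (intro mult_left_mono ennreal_leI)
      have "1 - norm w \<le> 1 - (norm w)\<^sup>2" using w1 by (simp add: power2_eq_square mult_left_le_one_le)
      then show "2 * pi / (1 - (norm w)\<^sup>2) \<le> 2 * pi * (1 - norm w) powr (-1)"
        using w1 by (simp add: powr_minus field_simps frac_le)
    qed simp
    also have "\<dots> = ennreal (2 * pi) * ennreal ((1 - s) powr c * (1 - norm w) powr (1 - \<gamma>))"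
    proof -
      have "(1 - norm w) powr (2 - \<gamma>) * (1 - norm w) powr (-1) = (1 - norm w) powr (1 - \<gamma>)"
        unfolding powr_add[symmetric] by (rule arg_cong[where f="\<lambda>x. _ powr x"]) simp
      moreover have "ennreal (A * P) * ennreal (2 * pi * Q) = ennreal (2 * pi) * ennreal (A * (P * Q))"
        if "0 \<le> A" "0 \<le> P" "0 \<le> Q" for A P Q
        using that by (simp add: mult_ac flip: ennreal_mult)
      ultimately show ?thesis by (metis powr_ge_zero)
    qed
    also have "\<dots> \<le> ennreal (2 * pi) * ennreal ((1 - s) powr c * (max (1 - s) y) powr (1 - \<gamma>))"
    proof -
      have "max (1 - s) y \<le> 1 - norm w" using as nw by (auto simp: y_def)
      then show ?thesis using y \<gamma> by (intro mult_left_mono ennreal_leI powr_mono2') auto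
    qed
    finally have *: "(\<integral>\<^sup>+t\<in>{-pi..pi}. F (of_real s * cis t) \<partial>lborel) \<le> \<dots>" .
    \<comment> \<open>The polar factor s is at most 1.\<close>
    have "ennreal s * (\<integral>\<^sup>+t\<in>{-pi..pi}. F (of_real s * cis t) \<partial>lborel) \<le> 1 * (\<integral>\<^sup>+t\<in>{-pi..pi}. F (of_real s * cis t) \<partial>lborel)"
      using s by (intro mult_right_mono) (auto simp: ennreal_le_1)
    then show ?thesis using * by simp
  qed
  have "(\<integral>\<^sup>+z\<in>unit_disc. F z \<partial>lborel) = (\<integral>\<^sup>+s\<in>{0..<1}. ennreal s * (\<integral>\<^sup>+t\<in>{-pi..pi}. F (of_real s * cis t) \<partial>lborel) \<partial>lborel)"
    by (rule nn_integral_polar) measurable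
  also have "\<dots> \<le> (\<integral>\<^sup>+s. ennreal (2 * pi) * (ennreal ((1 - s) powr c * (max (1 - s) y) powr (1 - \<gamma>)) * indicator {0..<1} s) \<partial>lborel)"
    by (intro nn_integral_mono) (use inner in \<open>auto simp: indicator_def\<close>)
  also have "\<dots> = ennreal (2 * pi) * (\<integral>\<^sup>+s\<in>{0..<1}. ennreal ((1 - s) powr c * (max (1 - s) y) powr (1 - \<gamma>)) \<partial>lborel)"
    by (subst nn_integral_cmult) auto
  also have "(\<integral>\<^sup>+s\<in>{0..<1}. ennreal ((1 - s) powr c * (max (1 - s) y) powr (1 - \<gamma>)) \<partial>lborel)
     = (\<integral>\<^sup>+x\<in>{0<..1}. ennreal (x powr c * (max x y) powr (1 - \<gamma>)) \<partial>lborel)"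
    by (subst nn_integral_real_affine[where c="-1" and t=1])
       (auto intro!: nn_integral_cong simp: indicator_def)
  also have "\<dots> \<le> ennreal ((1 / (c + 1) + 1 / (\<gamma> - c - 2)) * y powr (c + 2 - \<gamma>))"
    using \<gamma> by (intro nn_integral_powr_max c y) auto
  finally show "(\<integral>\<^sup>+z\<in>unit_disc. ennreal ((1 - norm z) powr c * norm (1 - cnj a * z) powr (- \<gamma>)) \<partial>lborel)
      \<le> ennreal (D * (1 - norm a) powr (c + 2 - \<gamma>))"
    using c \<gamma> by (simp add: F_def D_def y_def mult.assoc mult_left_mono add_nonneg_nonneg flip: ennreal_mult)
qed

section \<open>Geometric partitions of the interval and sums over separated points\<close>

lemma nn_integral_unit_interval_split:
  fixes X :: "real \<Rightarrow> ennreal"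
  assumes [measurable]: "X \<in> borel_measurable borel" and L: "0 < L" "L < (1::real)"
  shows "(\<integral>\<^sup>+s\<in>{0..<1}. X s \<partial>lborel) = (\<Sum>j. \<integral>\<^sup>+s\<in>{1 - L ^ j..<1 - L ^ Suc j}. X s \<partial>lborel)"
proof -
  define B where "B = (\<lambda>j. {1 - L ^ j..<1 - L ^ Suc j})"
  have disj: "disjoint_family B"
  proof -
    have "B i \<inter> B j = {}" if "i < j" for i j
    proof -
      have "L ^ j \<le> L ^ Suc i" using that L by (intro power_decreasing) auto
      then show ?thesis by (auto simp: B_def)
    qed
    then show ?thesis unfolding disjoint_family_on_def by (metis Int_commute nat_neq_iff)
  qed
  have "(\<Union>j. B j) = {0..<1}"
  proof (intro equalityI subsetI)
    fix s assume "s \<in> (\<Union>j. B j)"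
    then obtain j where j: "1 - L ^ j \<le> s" "s < 1 - L ^ Suc j" by (auto simp: B_def)
    have "L ^ j \<le> 1" "0 < L ^ Suc j" using L by (auto intro!: power_le_one)
    then show "s \<in> {0..<1}" using j by auto
  next
    fix s :: real assume s: "s \<in> {0..<1}"
    have "\<exists>j. L ^ j < 1 - s" using s L by (intro real_arch_pow_inv) auto
    then have ex: "\<exists>j. s < 1 - L ^ j" by (auto simp: algebra_simps)
    define k where "k = (LEAST j. s < 1 - L ^ j)"
    have k: "s < 1 - L ^ k" unfolding k_def using ex by (rule LeastI_ex)
    have "k \<noteq> 0" using k s by (cases k) auto
    then obtain j where j: "k = Suc j" by (cases k) auto
    have "\<not> s < 1 - L ^ j" using not_less_Least[of j "\<lambda>j. s < 1 - L ^ j"] j by (simp add: k_def)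
    then show "s \<in> (\<Union>j. B j)" using k j by (auto simp: B_def intro!: exI[of _ j])
  qed
  then have "(\<integral>\<^sup>+s\<in>{0..<1}. X s \<partial>lborel) = (\<integral>\<^sup>+s\<in>(\<Union>j. B j). X s \<partial>lborel)" by simp
  also have "\<dots> = (\<Sum>j. \<integral>\<^sup>+s\<in>B j. X s \<partial>lborel)"
    by (rule nn_integral_disjoint_family[OF _ _ disj]) (auto simp: B_def)
  finally show ?thesis by (simp add: B_def)
qed

text \<open>Monotonicity of \<open>M\<close> moves mass outwards by one dyadic interval.\<close>

lemma nn_integral_monotone_compare:
  fixes X Y M :: "real \<Rightarrow> ennreal"
  assumes [measurable]: "X \<in> borel_measurable borel" "Y \<in> borel_measurable borel" "M \<in> borel_measurable borel"
    and L: "0 < L" "L < (1::real)"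
    and M: "\<And>r s. 0 \<le> r \<Longrightarrow> r \<le> s \<Longrightarrow> s < 1 \<Longrightarrow> M r \<le> M s"
    and XY: "\<And>j. (\<integral>\<^sup>+s\<in>{1 - L ^ j..<1 - L ^ Suc j}. X s \<partial>lborel)
      \<le> c * (\<integral>\<^sup>+s\<in>{1 - L ^ Suc j..<1 - L ^ Suc (Suc j)}. Y s \<partial>lborel)"
  shows "(\<integral>\<^sup>+s\<in>{0..<1}. X s * M s \<partial>lborel) \<le> c * (\<integral>\<^sup>+s\<in>{0..<1}. Y s * M s \<partial>lborel)"
proof -
  let ?I = "\<lambda>j. {1 - L ^ j..<1 - L ^ Suc j}"
  \<comment> \<open>The value of \<open>M\<close> at the common endpoint of two consecutive
    intervals bounds \<open>M\<close> from above on the inner interval and from below on the outer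
    one.\<close>
  let ?M = "\<lambda>j. M (1 - L ^ Suc j)"
  have Lj: "0 < L ^ j" "L ^ j \<le> 1" for j using L by (auto intro: power_le_one)
  have step: "(\<integral>\<^sup>+s\<in>?I j. X s * M s \<partial>lborel) \<le> c * (\<integral>\<^sup>+s\<in>?I (Suc j). Y s * M s \<partial>lborel)" for j
  proof -
    have le: "M s \<le> ?M j" if "s \<in> ?I j" for s
      using that Lj[of j] Lj[of "Suc j"] by (intro M) auto
    have ge: "?M j \<le> M s" if "s \<in> ?I (Suc j)" for s
      using that Lj[of "Suc j"] Lj[of "Suc (Suc j)"] by (intro M) auto
    have "(\<integral>\<^sup>+s\<in>?I j. X s * M s \<partial>lborel) \<le> (\<integral>\<^sup>+s. (X s * indicator (?I j) s) * ?M j \<partial>lborel)"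
      by (intro nn_integral_mono) (use le in \<open>auto simp: indicator_def intro!: mult_left_mono\<close>)
    also have "\<dots> = ?M j * (\<integral>\<^sup>+s\<in>?I j. X s \<partial>lborel)" by (subst nn_integral_multc) (auto simp: mult.commute)
    also have "\<dots> \<le> ?M j * (c * (\<integral>\<^sup>+s\<in>?I (Suc j). Y s \<partial>lborel))" by (intro mult_left_mono XY) simp
    also have "\<dots> = c * (\<integral>\<^sup>+s. (Y s * indicator (?I (Suc j)) s) * ?M j \<partial>lborel)"
      by (subst nn_integral_multc) (auto simp: mult_ac)
    also have "\<dots> \<le> c * (\<integral>\<^sup>+s\<in>?I (Suc j). Y s * M s \<partial>lborel)"
      by (intro mult_left_mono nn_integral_mono) (use ge in \<open>auto simp: indicator_def intro!: mult_left_mono\<close>)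
    finally show ?thesis .
  qed
  have "(\<integral>\<^sup>+s\<in>{0..<1}. X s * M s \<partial>lborel) = (\<Sum>j. \<integral>\<^sup>+s\<in>?I j. X s * M s \<partial>lborel)"
    by (intro nn_integral_unit_interval_split L) measurable
  also have "\<dots> \<le> (\<Sum>j. c * (\<integral>\<^sup>+s\<in>?I (Suc j). Y s * M s \<partial>lborel))"
    by (intro suminf_le step) auto
  also have "\<dots> = c * (\<Sum>j. \<integral>\<^sup>+s\<in>?I (Suc j). Y s * M s \<partial>lborel)" by (rule ennreal_suminf_cmult)
  also have "(\<Sum>j. \<integral>\<^sup>+s\<in>?I (Suc j). Y s * M s \<partial>lborel) \<le> (\<Sum>j. \<integral>\<^sup>+s\<in>?I j. Y s * M s \<partial>lborel)"
    using suminf_offset[of "\<lambda>j. \<integral>\<^sup>+s\<in>?I j. Y s * M s \<partial>lborel" 1] by simp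
  also have "\<dots> = (\<integral>\<^sup>+s\<in>{0..<1}. Y s * M s \<partial>lborel)"
    by (intro nn_integral_unit_interval_split[symmetric] L) measurable
  finally show ?thesis by (simp add: mult_left_mono)
qed

text \<open>Each summand is at most a constant times the integral of its continuous analogue over
  the ball attached to a, whose area is comparable to (1 - |a|)^2; the balls are disjoint, so the
  sum is bounded by a single integral over the disc. In the Forelli-Rudin estimate z then plays the
  role of the fixed point.\<close>

lemma separated_sum_le:
  assumes s: "1 < s" "s < \<gamma>" and \<gamma>: "2 \<le> \<gamma>" and \<delta>: "0 < \<delta>" "\<delta> \<le> 1 / 2"
  obtains D where "0 < D" "\<And>A z. finite A \<Longrightarrow> A \<subseteq> unit_disc \<Longrightarrow>
    disjoint_family_on (\<lambda>a. ball a (\<delta> * (1 - norm a))) A \<Longrightarrow> z \<in> unit_disc \<Longrightarrow>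
    (\<Sum>a\<in>A. (1 - norm a) powr s * norm (1 - cnj a * z) powr (- \<gamma>)) \<le> D * (1 - norm z) powr (s - \<gamma>)"
proof -
  obtain D0 where D0: "0 < D0" "\<And>a. a \<in> unit_disc \<Longrightarrow>
    (\<integral>\<^sup>+z\<in>unit_disc. ennreal ((1 - norm z) powr (s - 2) * norm (1 - cnj a * z) powr (- \<gamma>)) \<partial>lborel)
      \<le> ennreal (D0 * (1 - norm a) powr (s - 2 + 2 - \<gamma>))"
    by (rule forelli_rudin[of "s - 2" \<gamma>]) (use s \<gamma> in auto)
  \<comment> \<open>Contributions of one ball with y = 1 - |a|: its area gives pi \<delta>^2, the
    variation of 1 - |w| between y / 2 and 2 y gives the factor with |s - 2| (either sign of s - 2
    may occur), and |1 - cnj z w| <= 3/2 |1 - cnj a z| gives the last one.\<close>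
  define c where "c = pi * \<delta>\<^sup>2 * 2 powr (- \<bar>s - 2\<bar>) * (3 / 2) powr (- \<gamma>)"
  have c: "0 < c" using \<delta> by (simp add: c_def)
  show ?thesis
  proof (rule that[of "D0 / c"])
    show "0 < D0 / c" using c D0 by simp
    fix A :: "complex set" and z :: complex
    assume A: "finite A" "A \<subseteq> unit_disc" and disj: "disjoint_family_on (\<lambda>a. ball a (\<delta> * (1 - norm a))) A"
      and z: "z \<in> unit_disc"
    let ?B = "\<lambda>a. ball a (\<delta> * (1 - norm a))"
    define F where "F = (\<lambda>w. ennreal ((1 - norm w) powr (s - 2) * norm (1 - cnj z * w) powr (- \<gamma>)))"
    have [measurable]: "F \<in> borel_measurable borel" unfolding F_def by measurable
    have tm: "ennreal (c * ((1 - norm a) powr s * norm (1 - cnj a * z) powr (- \<gamma>))) \<le> (\<integral>\<^sup>+w\<in>?B a. F w \<partial>lborel)"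
      if "a \<in> A" for a
    proof -
      define y where "y = 1 - norm a"
      have y: "0 < y" using that A by (auto simp: y_def)
      define N where "N = norm (1 - cnj a * z)"
      have Ny: "y \<le> N"
      proof -
        have "norm (cnj a * z) \<le> norm a" using z by (simp add: norm_mult mult_right_le_one_le)
        then show ?thesis using norm_triangle_ineq2[of 1 "cnj a * z"] by (simp add: N_def y_def)
      qed
      define m where "m = 2 powr (- \<bar>s - 2\<bar>) * (3 / 2) powr (- \<gamma>) * (y powr (s - 2) * N powr (- \<gamma>))"
      have "ennreal (c * (y powr s * N powr (- \<gamma>))) = ennreal m * emeasure lborel (?B a)"
      proof -
        have "y powr s = y powr (s - 2) * y\<^sup>2" using y by (simp add: powr_diff)
        then show ?thesis using y \<delta>
          by (simp add: emeasure_lborel_ball_complex m_def c_def power_mult_distrib mult_ac flip: y_def ennreal_mult)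
      qed
      also have "\<dots> = (\<integral>\<^sup>+w\<in>?B a. ennreal m \<partial>lborel)" by (subst nn_integral_cmult_indicator) auto
      also have "\<dots> \<le> (\<integral>\<^sup>+w\<in>?B a. F w \<partial>lborel)"
      proof (rule nn_integral_mono)
        fix w
        have "m \<le> (1 - norm w) powr (s - 2) * norm (1 - cnj z * w) powr (- \<gamma>)" if w: "w \<in> ?B a"
        proof -
          have d: "norm (w - a) < y / 2"
          proof -
            have "norm (w - a) < \<delta> * y" using w by (simp add: dist_norm norm_minus_commute y_def)
            also have "\<dots> \<le> 1 / 2 * y" using \<delta> y by (intro mult_right_mono) auto
            finally show ?thesis by simp
          qed
          have "norm w \<le> norm a + norm (w - a)" "norm a \<le> norm w + norm (w - a)"
            using norm_triangle_ineq[of a "w - a"] norm_triangle_ineq[of w "a - w"] by (auto simp: norm_minus_commute)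
          then have yw: "y / 2 \<le> 1 - norm w" "1 - norm w \<le> 2 * y" using d by (auto simp: y_def)
          have 1: "2 powr (- \<bar>s - 2\<bar>) * y powr (s - 2) \<le> (1 - norm w) powr (s - 2)"
          proof (cases "2 \<le> s")
            case True
            have "(y / 2) powr (s - 2) \<le> (1 - norm w) powr (s - 2)"
              using yw y True by (intro powr_mono2) auto
            moreover have "(y / 2) powr (s - 2) = 2 powr (- (s - 2)) * y powr (s - 2)"
              using y by (simp add: powr_divide powr_minus_divide del: minus_diff_eq)
            ultimately show ?thesis using True by simp
          next
            case False
            have "(2 * y) powr (s - 2) \<le> (1 - norm w) powr (s - 2)"
              using yw y False by (intro powr_mono2') auto
            then show ?thesis using False y by (simp add: powr_mult)
          qed
          have "norm (1 - cnj z * w) \<le> 3 / 2 * N"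
          proof -
            have "1 - cnj z * w = cnj (1 - cnj a * z) - cnj z * (w - a)" by (simp add: algebra_simps)
            then have "norm (1 - cnj z * w) \<le> norm (cnj (1 - cnj a * z)) + norm (cnj z * (w - a))"
              by (metis norm_triangle_ineq4)
            also have "norm (cnj (1 - cnj a * z)) = N" unfolding complex_mod_cnj N_def ..
            also have "norm (cnj z * (w - a)) \<le> norm (w - a)" using z by (simp add: norm_mult mult_left_le_one_le)
            finally show ?thesis using d Ny by linarith
          qed
          moreover have "0 < norm (1 - cnj z * w)"
          proof -
            have "norm w < 1" using yw y by linarith
            then have "norm (cnj z * w) < 1" using z by (simp add: norm_mult) (metis mult_strict_mono norm_ge_zero mult.right_neutral less_eq_real_def norm_not_less_zero not_less zero_less_one mult_zero_left mult_zero_right)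
            then show ?thesis by (auto simp: dest: )
          qed
          ultimately have 2: "(3 / 2 * N) powr (- \<gamma>) \<le> norm (1 - cnj z * w) powr (- \<gamma>)"
            using \<gamma> by (intro powr_mono2') auto
          have "m = (2 powr (- \<bar>s - 2\<bar>) * y powr (s - 2)) * (3 / 2 * N) powr (- \<gamma>)"
            using powr_mult[of "3 / 2" N "- \<gamma>"] Ny y by (simp only: m_def) simp
          also have "\<dots> \<le> (1 - norm w) powr (s - 2) * norm (1 - cnj z * w) powr (- \<gamma>)"
            using 1 2 by (intro mult_mono) auto
          finally show ?thesis .
        qed
        then show "ennreal m * indicator (?B a) w \<le> F w * indicator (?B a) w"
          by (auto simp: indicator_def F_def intro!: ennreal_leI)
      qed
      finally show ?thesis by (simp add: y_def N_def)
    qed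
    have "ennreal (c * (\<Sum>a\<in>A. (1 - norm a) powr s * norm (1 - cnj a * z) powr (- \<gamma>)))
        = (\<Sum>a\<in>A. ennreal (c * ((1 - norm a) powr s * norm (1 - cnj a * z) powr (- \<gamma>))))"
      using c by (simp add: sum_distrib_left)
    also have "\<dots> \<le> (\<Sum>a\<in>A. \<integral>\<^sup>+w\<in>?B a. F w \<partial>lborel)" by (intro sum_mono tm)
    also have "\<dots> = (\<integral>\<^sup>+w. (\<Sum>a\<in>A. F w * indicator (?B a) w) \<partial>lborel)"
      by (intro nn_integral_sum[symmetric]) (auto intro!: borel_measurable_times_ennreal borel_measurable_indicator)
    also have "\<dots> \<le> (\<integral>\<^sup>+w\<in>unit_disc. F w \<partial>lborel)"
    proof (rule nn_integral_mono)
      fix w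
      have sub: "?B a \<subseteq> unit_disc" if "a \<in> A" for a
      proof
        fix w assume "w \<in> ?B a"
        then have "norm (w - a) < \<delta> * (1 - norm a)" by (simp add: dist_norm norm_minus_commute)
        also have "\<dots> \<le> 1 * (1 - norm a)" using \<delta> that A by (intro mult_right_mono) auto
        finally show "w \<in> unit_disc" using norm_triangle_ineq[of a "w - a"] by simp
      qed
      have "(\<Sum>a\<in>A. indicator (?B a) w) = (indicator (\<Union>a\<in>A. ?B a) w :: ennreal)"
        by (rule indicator_UN_disjoint[OF A(1) disj, symmetric])
      also have "\<dots> \<le> indicator unit_disc w"
        using UN_least[of A ?B unit_disc, OF sub] by (intro indicator_leI) blast
      finally show "(\<Sum>a\<in>A. F w * indicator (?B a) w) \<le> F w * indicator unit_disc w"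
        unfolding sum_distrib_left[symmetric] by (rule mult_left_mono) simp
    qed
    also have "\<dots> \<le> ennreal (D0 * (1 - norm z) powr (s - \<gamma>))" using D0(2)[OF z] by (simp add: F_def)
    finally have "c * (\<Sum>a\<in>A. (1 - norm a) powr s * norm (1 - cnj a * z) powr (- \<gamma>)) \<le> D0 * (1 - norm z) powr (s - \<gamma>)"
      using D0(1) by (subst (asm) ennreal_le_iff) auto
    then show "(\<Sum>a\<in>A. (1 - norm a) powr s * norm (1 - cnj a * z) powr (- \<gamma>)) \<le> D0 / c * (1 - norm z) powr (s - \<gamma>)"
      using c by (simp add: field_simps)
  qed
qed

section \<open>Equivalence of the norms induced by a doubling weight and its smoothing\<close>

lemma powr_le_of_ratio_bounds:
  fixes t \<kappa> e :: real
  assumes "1 \<le> \<kappa>" "1 / \<kappa> \<le> t" "t \<le> \<kappa>"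
  shows "t powr e \<le> \<kappa> powr \<bar>e\<bar>"
proof (cases "0 \<le> e")
  case True
  have "0 < t" using assms by (meson divide_pos_pos less_le_trans zero_less_one)
  then show ?thesis using True assms by (simp add: powr_mono2)
next
  case False
  have "0 < 1 / \<kappa>" using assms by simp
  then have "t powr e \<le> (1 / \<kappa>) powr e" using False assms by (intro powr_mono2') auto
  also have "\<dots> = \<kappa> powr \<bar>e\<bar>" using False assms by (simp add: powr_divide powr_minus_divide)
  finally show ?thesis .
qed

context doubling_profile
begin

text \<open>\<open>W (norm z)\<close> is \<open>weight_tilde \<omega> z\<close>, extended by 0 to make it Borel on the whole line.\<close>

definition W :: "real \<Rightarrow> real"
  where "W s = (if 0 \<le> s \<and> s < 1 then h s / (1 - s) else 0)"

lemma h_anti: "0 \<le> r \<Longrightarrow> r \<le> s \<Longrightarrow> s < 1 \<Longrightarrow> h s \<le> h r"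
proof -
  assume rs: "0 \<le> r" "r \<le> s" "s < 1"
  have "(\<integral>\<^sup>+x\<in>{s..<1}. ennreal (g x) \<partial>lborel) \<le> (\<integral>\<^sup>+x\<in>{r..<1}. ennreal (g x) \<partial>lborel)"
    using rs by (intro nn_integral_mono) (auto simp: indicator_def)
  then show ?thesis using rs h_pos[of r] by (simp add: tail)
qed

lemma W_measurable [measurable]: "W \<in> borel_measurable borel"
proof -
  \<comment> \<open>\<open>h\<close> is known to be monotone on [0, 1) only; \<open>k\<close>
    extends its negative to a monotone function on the whole line, which is therefore Borel.\<close>
  define k where "k = (\<lambda>s. - (if s < 0 then h 0 else if s < 1 then h s else 0))"
  have "mono k"
  proof
    fix r s :: real assume "r \<le> s"
    then show "k r \<le> k s"
      using h_anti[of r s] h_anti[of 0 s] h_pos[of r] h_pos[of 0] by (auto simp: k_def)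
  qed
  then have [measurable]: "k \<in> borel_measurable borel" by (rule borel_measurable_mono)
  have "W = (\<lambda>s. indicator {0..<1} s * (- k s) / (1 - s))"
    by (auto simp: W_def k_def indicator_def)
  then show ?thesis by simp
qed

lemma W_pos: "0 \<le> s \<Longrightarrow> s < 1 \<Longrightarrow> 0 < W s"
  using h_pos by (simp add: W_def)

lemma W_nonneg: "0 \<le> W s"
  using h_pos[of s] by (auto simp: W_def intro!: divide_nonneg_pos less_imp_le)

text \<open>The sum of two powers covers both orders of r and s: for r <= s the lower condition
  gives the exponent \<alpha>, otherwise the upper one gives b, and the division by 1 - s lowers
  either by 1.\<close>

lemma W_le:
  assumes s: "0 \<le> s" "s < 1" and r: "0 \<le> r" "r < 1"
  shows "W s \<le> C * W r * (((1 - s) / (1 - r)) powr (\<alpha> - 1) + ((1 - s) / (1 - r)) powr (b - 1))"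
proof -
  let ?t = "(1 - s) / (1 - r)"
  have t: "0 < ?t" using s r by simp
  have eq: "?t powr e * h r / (1 - s) = ?t powr (e - 1) * W r" for e
  proof -
    have "?t powr e = ?t powr (e - 1) * ?t"
      using powr_add[of ?t "e - 1" 1] s r by simp
    moreover have "u * ?t * h r / (1 - s) = u * W r" for u
      using s r by (simp add: W_def)
    ultimately show ?thesis by simp
  qed
  have "W s \<le> C * (?t powr (e - 1) * W r)" if "h s \<le> C * ?t powr e * h r" for e
  proof -
    have "W s \<le> C * ?t powr e * h r / (1 - s)" using that s by (simp add: W_def divide_right_mono)
    also have "\<dots> = C * (?t powr e * h r / (1 - s))" by simp
    finally show ?thesis unfolding eq .
  qed
  then have "W s \<le> C * (?t powr (\<alpha> - 1) * W r) \<or> W s \<le> C * (?t powr (b - 1) * W r)"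
    using lower[of r s] upper[of s r] s r by (cases "r \<le> s") auto
  moreover have "0 \<le> C * (?t powr (\<alpha> - 1) * W r)" "0 \<le> C * (?t powr (b - 1) * W r)"
    using C_ge_1 W_nonneg by auto
  ultimately have "W s \<le> C * (?t powr (\<alpha> - 1) * W r) + C * (?t powr (b - 1) * W r)" by linarith
  then show ?thesis by (simp add: algebra_simps)
qed

text \<open>The precise form in which \<open>W\<close> is nearly constant on hyperbolic discs: only
  the ratio of the distances to the unit circle matters.\<close>

lemma W_comparable:
  assumes "1 \<le> \<kappa>"
  obtains D where "0 < D" "\<And>s r. 0 \<le> s \<Longrightarrow> s < 1 \<Longrightarrow> 0 \<le> r \<Longrightarrow> r < 1 \<Longrightarrow>
    1 - s \<le> \<kappa> * (1 - r) \<Longrightarrow> 1 - r \<le> \<kappa> * (1 - s) \<Longrightarrow> W s \<le> D * W r"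
proof
  define D where "D = C * (\<kappa> powr \<bar>\<alpha> - 1\<bar> + \<kappa> powr \<bar>b - 1\<bar>)"
  show "0 < D" using assms C_ge_1 by (auto simp: D_def intro!: mult_pos_pos add_pos_pos)
  fix s r :: real
  assume s: "0 \<le> s" "s < 1" and r: "0 \<le> r" "r < 1" and c: "1 - s \<le> \<kappa> * (1 - r)" "1 - r \<le> \<kappa> * (1 - s)"
  let ?t = "(1 - s) / (1 - r)"
  have t: "1 / \<kappa> \<le> ?t" "?t \<le> \<kappa>" using c s r assms by (auto simp: field_simps)
  have "W s \<le> C * W r * (?t powr (\<alpha> - 1) + ?t powr (b - 1))" by (rule W_le[OF s r])
  also have "\<dots> \<le> C * W r * (\<kappa> powr \<bar>\<alpha> - 1\<bar> + \<kappa> powr \<bar>b - 1\<bar>)"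
    using C_ge_1 W_nonneg by (intro mult_left_mono add_mono powr_le_of_ratio_bounds assms t) auto
  also have "\<dots> = D * W r" by (simp add: D_def)
  finally show "W s \<le> D * W r" .
qed

lemma exists_dyadic_ratio:
  obtains L where "0 < L" "L < 1" "\<And>x. 0 < x \<Longrightarrow> x \<le> 1 \<Longrightarrow> h (1 - L * x) \<le> h (1 - x) / 2"
    "\<And>x. 0 < x \<Longrightarrow> x \<le> 1 \<Longrightarrow> h (1 - x) \<le> C * L powr (- b) * h (1 - L * x)"
proof
  \<comment> \<open>Chosen so that C * L powr \<alpha> = 1 / 2; the lower condition then halves the
    tail when the distance to the boundary shrinks by the factor L.\<close>
  define L where "L = (1 / (2 * C)) powr (1 / \<alpha>)"
  have C2: "0 < 1 / (2 * C)" "1 / (2 * C) < 1" using C_ge_1 by auto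
  show L: "0 < L" using C2 by (simp add: L_def)
  show L1: "L < 1" unfolding L_def using C2 \<alpha>_pos powr_less_mono2[of "1 / \<alpha>" "1 / (2 * C)" 1] by simp
  fix x :: real assume x: "0 < x" "x \<le> 1"
  have Lx: "L * x \<le> x" "0 < L * x" using x L L1 by (auto simp: mult_left_le_one_le)
  have La: "L powr \<alpha> = 1 / (2 * C)" using \<alpha>_pos C2 by (simp add: L_def powr_powr)
  have "h (1 - L * x) \<le> C * (L * x / x) powr \<alpha> * h (1 - x)"
    using lower[of "1 - x" "1 - L * x"] x Lx by simp
  also have "\<dots> = h (1 - x) / 2" using x La C_ge_1 by simp
  finally show "h (1 - L * x) \<le> h (1 - x) / 2" .
  have "h (1 - x) \<le> C * (x / (L * x)) powr b * h (1 - L * x)"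
    using upper[of "1 - x" "1 - L * x"] x Lx by simp
  also have "x / (L * x) = 1 / L" using x by simp
  also have "(1 / L) powr b = L powr (- b)" using L by (simp add: powr_divide powr_minus_divide)
  finally show "h (1 - x) \<le> C * L powr (- b) * h (1 - L * x)" .
qed

lemma g_interval:
  assumes "0 \<le> r" "r \<le> s" "s < 1"
  shows "(\<integral>\<^sup>+x\<in>{r..<s}. ennreal (g x) \<partial>lborel) = ennreal (h r - h s)"
proof -
  have "(\<integral>\<^sup>+x\<in>{r..<1}. ennreal (g x) \<partial>lborel)
      = (\<integral>\<^sup>+x. ennreal (g x) * indicator {r..<s} x + ennreal (g x) * indicator {s..<1} x \<partial>lborel)"
    using assms by (intro nn_integral_cong) (auto simp: indicator_def)
  also have "\<dots> = (\<integral>\<^sup>+x\<in>{r..<s}. ennreal (g x) \<partial>lborel) + (\<integral>\<^sup>+x\<in>{s..<1}. ennreal (g x) \<partial>lborel)"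
    by (rule nn_integral_add) measurable
  finally have "ennreal (h r) = (\<integral>\<^sup>+x\<in>{r..<s}. ennreal (g x) \<partial>lborel) + ennreal (h s)"
    using assms by (simp add: tail)
  then have "ennreal (h r) - ennreal (h s) = (\<integral>\<^sup>+x\<in>{r..<s}. ennreal (g x) \<partial>lborel)"
    by simp
  then show ?thesis using h_pos[of s] assms by (simp add: ennreal_minus)
qed

text \<open>Up to the factor s, both densities have mass comparable to the tail \<open>h\<close> at
  the left end of an interval: \<open>g\<close> because the tail is at least halved across it,
  \<open>W\<close> because it is about \<open>h\<close> divided by L^j on a length of order L^j. The
  factor s is bounded below on every interval but the first, which the shift by one on the right
  avoids.\<close>

lemma densities_compare:
  obtains L c where "0 < L" "L < 1" "0 < c"
    "\<And>j. (\<integral>\<^sup>+s\<in>{1 - L ^ j..<1 - L ^ Suc j}. ennreal s * ennreal (W s) \<partial>lborel)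
      \<le> ennreal c * (\<integral>\<^sup>+s\<in>{1 - L ^ Suc j..<1 - L ^ Suc (Suc j)}. ennreal s * ennreal (g s) \<partial>lborel)"
    "\<And>j. (\<integral>\<^sup>+s\<in>{1 - L ^ j..<1 - L ^ Suc j}. ennreal s * ennreal (g s) \<partial>lborel)
      \<le> ennreal c * (\<integral>\<^sup>+s\<in>{1 - L ^ Suc j..<1 - L ^ Suc (Suc j)}. ennreal s * ennreal (W s) \<partial>lborel)"
proof -
  obtain L where L: "0 < L" "L < 1" and half: "\<And>x. 0 < x \<Longrightarrow> x \<le> 1 \<Longrightarrow> h (1 - L * x) \<le> h (1 - x) / 2"
    and up: "\<And>x. 0 < x \<Longrightarrow> x \<le> 1 \<Longrightarrow> h (1 - x) \<le> C * L powr (- b) * h (1 - L * x)"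
    by (rule exists_dyadic_ratio) (rule that)
  define B where "B = C * L powr (- b)"
  have B: "0 < B" using C_ge_1 L by (simp add: B_def)
  define r where "r = (\<lambda>j. 1 - L ^ j)"
  have Lj: "0 < L ^ j" "L ^ j \<le> 1" for j using L by (auto intro: power_le_one)
  have r: "0 \<le> r j" "r j < 1" for j using Lj[of j] by (auto simp: r_def)
  have rmono: "r j \<le> r (Suc j)" for j using L Lj[of j] by (simp add: r_def mult_left_le_one_le)
  have r1: "1 - L \<le> r (Suc j)" for j
    using L Lj[of j] by (simp add: r_def mult_right_le_one_le)
  have halfr: "h (r (Suc j)) \<le> h (r j) / 2" for j using half[of "L ^ j"] Lj by (simp add: r_def)
  have upr: "h (r j) \<le> B * h (r (Suc j))" for j using up[of "L ^ j"] Lj by (simp add: r_def B_def)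
  \<comment> \<open>\<open>c1\<close> collects B / L from the size of \<open>W\<close>, 2 from the
    halving and 1 / (1 - L) from s >= 1 - L; \<open>c2\<close> collects B twice for two steps
    outwards, one 1 / (1 - L) from the length of the interval and one from the bound for s.\<close>
  define c1 where "c1 = 2 * B / (L * (1 - L))"
  define c2 where "c2 = B * B / ((1 - L) * (1 - L))"
  have c: "0 < c1" "0 < c2" using B L by (auto simp: c1_def c2_def)
  have len: "r (Suc j) - r j = L ^ j * (1 - L)" for j by (simp add: r_def algebra_simps)
  have const: "(\<integral>\<^sup>+s\<in>{r j..<r (Suc j)}. ennreal x \<partial>lborel) = ennreal (x * (L ^ j * (1 - L)))" if "0 \<le> x" for x j
    using that L rmono[of j] by (subst nn_integral_cmult_indicator) (auto simp: len simp flip: ennreal_mult)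
  have 1: "(\<integral>\<^sup>+s\<in>{r j..<r (Suc j)}. ennreal s * ennreal (W s) \<partial>lborel)
      \<le> ennreal c1 * (\<integral>\<^sup>+s\<in>{r (Suc j)..<r (Suc (Suc j))}. ennreal s * ennreal (g s) \<partial>lborel)" for j
  proof -
    have hp: "0 < h (r i)" for i using r h_pos by simp
    have "(\<integral>\<^sup>+s\<in>{r j..<r (Suc j)}. ennreal s * ennreal (W s) \<partial>lborel) \<le> (\<integral>\<^sup>+s\<in>{r j..<r (Suc j)}. ennreal (h (r j) / L ^ Suc j) \<partial>lborel)"
    proof (intro nn_integral_mono)
      fix s
      have "s * W s \<le> h (r j) / L ^ Suc j" if s: "r j \<le> s" "s < r (Suc j)"
      proof -
        have s': "0 \<le> s" "s < 1" using s r[of j] r[of "Suc j"] by linarith+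
        have "s * W s \<le> 1 * W s" using s' W_nonneg by (intro mult_right_mono) auto
        also have "\<dots> = h s / (1 - s)" using s' by (simp add: W_def)
        also have "h s / (1 - s) \<le> h (r j) / L ^ Suc j"
          using s s' Lj[of "Suc j"] h_anti[of "r j" s] r[of j] hp[of j] by (intro frac_le) (auto simp: r_def)
        finally show ?thesis by simp
      qed
      moreover have "0 \<le> s" if "r j \<le> s" using that r[of j] by linarith
      ultimately show "ennreal s * ennreal (W s) * indicator {r j..<r (Suc j)} s \<le> ennreal (h (r j) / L ^ Suc j) * indicator {r j..<r (Suc j)} s"
        using W_nonneg by (auto simp: indicator_def ennreal_leI simp flip: ennreal_mult)
    qed
    also have "\<dots> = ennreal (h (r j) / L ^ Suc j * (L ^ j * (1 - L)))"
      using hp[of j] L by (intro const) auto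
    also have "\<dots> \<le> ennreal (c1 * ((1 - L) * (h (r (Suc j)) / 2)))"
    proof (rule ennreal_leI)
      have "h (r j) / L ^ Suc j * (L ^ j * (1 - L)) = h (r j) * (1 - L) / L" using L by simp
      also have "\<dots> \<le> h (r j) * 1 / L" using L hp[of j] by (intro divide_right_mono mult_left_mono) auto
      also have "\<dots> \<le> B * h (r (Suc j)) / L" using upr L by (intro divide_right_mono) auto
      also have "\<dots> = c1 * ((1 - L) * (h (r (Suc j)) / 2))" using L by (simp add: c1_def)
      finally show "h (r j) / L ^ Suc j * (L ^ j * (1 - L)) \<le> c1 * ((1 - L) * (h (r (Suc j)) / 2))" .
    qed
    also have "\<dots> = ennreal c1 * (ennreal (1 - L) * ennreal (h (r (Suc j)) / 2))"
      using L c hp[of "Suc j"] by (simp del: times_divide_eq_right times_divide_eq_left flip: ennreal_mult)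
    also have "\<dots> \<le> ennreal c1 * (ennreal (1 - L) * (\<integral>\<^sup>+s\<in>{r (Suc j)..<r (Suc (Suc j))}. ennreal (g s) \<partial>lborel))"
    proof (intro mult_left_mono)
      have "h (r (Suc j)) / 2 \<le> h (r (Suc j)) - h (r (Suc (Suc j)))" using halfr[of "Suc j"] by simp
      then show "ennreal (h (r (Suc j)) / 2) \<le> (\<integral>\<^sup>+s\<in>{r (Suc j)..<r (Suc (Suc j))}. ennreal (g s) \<partial>lborel)"
        using r rmono by (subst g_interval) (auto intro!: ennreal_leI)
    qed auto
    also have "ennreal (1 - L) * (\<integral>\<^sup>+s\<in>{r (Suc j)..<r (Suc (Suc j))}. ennreal (g s) \<partial>lborel)
       = (\<integral>\<^sup>+s. ennreal (1 - L) * (ennreal (g s) * indicator {r (Suc j)..<r (Suc (Suc j))} s) \<partial>lborel)"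
      by (intro nn_integral_cmult[symmetric]) measurable
    also have "\<dots> \<le> (\<integral>\<^sup>+s\<in>{r (Suc j)..<r (Suc (Suc j))}. ennreal s * ennreal (g s) \<partial>lborel)"
    proof (rule nn_integral_mono)
      fix s
      have "1 - L \<le> s" if "r (Suc j) \<le> s" using r1[of j] that by linarith
      then show "ennreal (1 - L) * (ennreal (g s) * indicator {r (Suc j)..<r (Suc (Suc j))} s)
          \<le> ennreal s * ennreal (g s) * indicator {r (Suc j)..<r (Suc (Suc j))} s"
        by (auto simp: indicator_def intro!: mult_right_mono ennreal_leI)
    qed
    finally show ?thesis by (simp add: mult_left_mono)
  qed
  have 2: "(\<integral>\<^sup>+s\<in>{r j..<r (Suc j)}. ennreal s * ennreal (g s) \<partial>lborel)
      \<le> ennreal c2 * (\<integral>\<^sup>+s\<in>{r (Suc j)..<r (Suc (Suc j))}. ennreal s * ennreal (W s) \<partial>lborel)" for j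
  proof -
    have hp: "0 < h (r i)" for i using r h_pos by simp
    define x where "x = (1 - L) * (h (r (Suc (Suc j))) / L ^ Suc j)"
    have x: "0 \<le> x" using L hp[of "Suc (Suc j)"] by (simp add: x_def)
    have "(\<integral>\<^sup>+s\<in>{r j..<r (Suc j)}. ennreal s * ennreal (g s) \<partial>lborel) \<le> (\<integral>\<^sup>+s\<in>{r j..<1}. ennreal (g s) \<partial>lborel)"
    proof (intro nn_integral_mono)
      fix s
      have "s \<le> 1" if "s < r (Suc j)" using that r[of "Suc j"] by linarith
      then show "ennreal s * ennreal (g s) * indicator {r j..<r (Suc j)} s \<le> ennreal (g s) * indicator {r j..<1} s"
        using r[of "Suc j"] mult_right_mono[of "ennreal s" 1 "ennreal (g s)"] by (auto simp: indicator_def)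
    qed
    also have "\<dots> = ennreal (h (r j))" using r by (simp add: tail)
    also have "\<dots> \<le> ennreal (c2 * (x * (L ^ Suc j * (1 - L))))"
    proof (rule ennreal_leI)
      have "h (r j) \<le> B * h (r (Suc j))" by (rule upr)
      also have "\<dots> \<le> B * (B * h (r (Suc (Suc j))))" using upr B by (intro mult_left_mono) auto
      also have "\<dots> = c2 * (x * (L ^ Suc j * (1 - L)))" using L by (simp add: c2_def x_def)
      finally show "h (r j) \<le> c2 * (x * (L ^ Suc j * (1 - L)))" .
    qed
    also have "\<dots> = ennreal c2 * (\<integral>\<^sup>+s\<in>{r (Suc j)..<r (Suc (Suc j))}. ennreal x \<partial>lborel)"
      using c x L by (subst const) (auto simp: ennreal_mult)
    also have "\<dots> \<le> ennreal c2 * (\<integral>\<^sup>+s\<in>{r (Suc j)..<r (Suc (Suc j))}. ennreal s * ennreal (W s) \<partial>lborel)"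
    proof (intro mult_left_mono nn_integral_mono)
      fix s
      have "x \<le> s * W s" if s: "r (Suc j) \<le> s" "s < r (Suc (Suc j))"
      proof -
        have s': "0 \<le> s" "s < 1" using s r[of "Suc j"] r[of "Suc (Suc j)"] by linarith+
        have "h (r (Suc (Suc j))) / L ^ Suc j \<le> h s / (1 - s)"
          using s s' Lj[of "Suc j"] h_anti[of s "r (Suc (Suc j))"] r[of "Suc (Suc j)"] h_pos[of s]
          by (intro frac_le) (auto simp: r_def)
        moreover have "1 - L \<le> s" using r1[of j] s by linarith
        ultimately show ?thesis unfolding x_def using s' L hp[of "Suc (Suc j)"]
          by (intro mult_mono) (auto simp: W_def)
      qed
      moreover have "0 \<le> s" if "r (Suc j) \<le> s" using that r[of "Suc j"] by linarith
      ultimately show "ennreal x * indicator {r (Suc j)..<r (Suc (Suc j))} s \<le> ennreal s * ennreal (W s) * indicator {r (Suc j)..<r (Suc (Suc j))} s"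
        using W_nonneg by (auto simp: indicator_def ennreal_leI simp flip: ennreal_mult)
    qed auto
    finally show ?thesis .
  qed
  show ?thesis
  proof (rule that[of L "max c1 c2"])
    fix j
    show "(\<integral>\<^sup>+s\<in>{1 - L ^ j..<1 - L ^ Suc j}. ennreal s * ennreal (W s) \<partial>lborel)
      \<le> ennreal (max c1 c2) * (\<integral>\<^sup>+s\<in>{1 - L ^ Suc j..<1 - L ^ Suc (Suc j)}. ennreal s * ennreal (g s) \<partial>lborel)"
      using order_trans[OF 1[of j] mult_right_mono[OF ennreal_leI[of c1 "max c1 c2"]]] by (simp add: r_def)
    show "(\<integral>\<^sup>+s\<in>{1 - L ^ j..<1 - L ^ Suc j}. ennreal s * ennreal (g s) \<partial>lborel)
      \<le> ennreal (max c1 c2) * (\<integral>\<^sup>+s\<in>{1 - L ^ Suc j..<1 - L ^ Suc (Suc j)}. ennreal s * ennreal (W s) \<partial>lborel)"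
      using order_trans[OF 2[of j] mult_right_mono[OF ennreal_leI[of c2 "max c1 c2"]]] by (simp add: r_def)
  qed (use L c in auto)
qed

text \<open>In polar coordinates both sides integrate the same nondecreasing circle mean against two
  radial densities. Only this monotonicity enters, so one constant serves all f and p.\<close>

lemma norm_equivalence:
  obtains c where "0 < c"
    "\<And>f p. f holomorphic_on unit_disc \<Longrightarrow> 0 < p \<Longrightarrow>
      (\<integral>\<^sup>+z\<in>unit_disc. ennreal (norm (f z) powr p) * ennreal (W (norm z)) \<partial>lborel)
        \<le> ennreal c * (\<integral>\<^sup>+z\<in>unit_disc. ennreal (norm (f z) powr p) * ennreal (g (norm z)) \<partial>lborel)"
    "\<And>f p. f holomorphic_on unit_disc \<Longrightarrow> 0 < p \<Longrightarrow>
      (\<integral>\<^sup>+z\<in>unit_disc. ennreal (norm (f z) powr p) * ennreal (g (norm z)) \<partial>lborel)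
        \<le> ennreal c * (\<integral>\<^sup>+z\<in>unit_disc. ennreal (norm (f z) powr p) * ennreal (W (norm z)) \<partial>lborel)"
proof -
  obtain L c where L: "0 < L" "L < 1" and c: "0 < c" and
    cmp: "\<And>j. (\<integral>\<^sup>+s\<in>{1 - L ^ j..<1 - L ^ Suc j}. ennreal s * ennreal (W s) \<partial>lborel)
      \<le> ennreal c * (\<integral>\<^sup>+s\<in>{1 - L ^ Suc j..<1 - L ^ Suc (Suc j)}. ennreal s * ennreal (g s) \<partial>lborel)"
    "\<And>j. (\<integral>\<^sup>+s\<in>{1 - L ^ j..<1 - L ^ Suc j}. ennreal s * ennreal (g s) \<partial>lborel)
      \<le> ennreal c * (\<integral>\<^sup>+s\<in>{1 - L ^ Suc j..<1 - L ^ Suc (Suc j)}. ennreal s * ennreal (W s) \<partial>lborel)"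
    by (rule densities_compare) (rule that)
  define F where "F = (\<lambda>(f::complex\<Rightarrow>complex) p z. ennreal (norm (f z) powr p) * indicator unit_disc z)"
  define M where "M = (\<lambda>f p s. \<integral>\<^sup>+t\<in>{-pi..pi}. F f p (of_real s * cis t) \<partial>lborel)"
  have Fm: "F f p \<in> borel_measurable borel" if "f holomorphic_on unit_disc" "0 < p" for f p
    unfolding F_def using that by (intro measurable_norm_powr_indicator holomorphic_on_imp_continuous_on) auto
  have Mm: "M f p \<in> borel_measurable borel" if "f holomorphic_on unit_disc" "0 < p" for f p
  proof -
    note [measurable] = Fm[OF that]
    show ?thesis unfolding M_def by measurable
  qed
  have Mmono: "M f p r \<le> M f p s" if f: "f holomorphic_on unit_disc" "0 < p" and rs: "0 \<le> r" "r \<le> s" "s < 1" for f p r s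
  proof -
    have "M f p x = (\<integral>\<^sup>+t\<in>{-pi..pi}. ennreal (norm (f (of_real x * cis t)) powr p) \<partial>lborel)" if "0 \<le> x" "x < 1" for x
      unfolding M_def F_def using that by (intro nn_integral_cong) (auto simp: norm_mult)
    then show ?thesis using nn_circle_mean_powr_mono[OF f(1), of "of_real r" s p] f rs by simp
  qed
  have polar: "(\<integral>\<^sup>+z\<in>unit_disc. ennreal (norm (f z) powr p) * ennreal (u (norm z)) \<partial>lborel)
      = (\<integral>\<^sup>+s\<in>{0..<1}. (ennreal s * ennreal (u s)) * M f p s \<partial>lborel)"
    if f: "f holomorphic_on unit_disc" "0 < p" and [measurable]: "u \<in> borel_measurable borel" for f p and u :: "real \<Rightarrow> real"
  proof -
    note [measurable] = Fm[OF f]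
    have "(\<integral>\<^sup>+z\<in>unit_disc. ennreal (norm (f z) powr p) * ennreal (u (norm z)) \<partial>lborel)
      = (\<integral>\<^sup>+z\<in>unit_disc. F f p z * ennreal (u (norm z)) \<partial>lborel)"
      by (intro nn_integral_cong) (auto simp: F_def indicator_def)
    also have "\<dots> = (\<integral>\<^sup>+s\<in>{0..<1}. ennreal s * (\<integral>\<^sup>+t\<in>{-pi..pi}. F f p (of_real s * cis t) * ennreal (u (norm (of_real s * cis t))) \<partial>lborel) \<partial>lborel)"
      by (rule nn_integral_polar) measurable
    also have "\<dots> = (\<integral>\<^sup>+s\<in>{0..<1}. (ennreal s * ennreal (u s)) * M f p s \<partial>lborel)"
    proof (rule nn_integral_cong)
      fix s :: real
      have "(\<integral>\<^sup>+t\<in>{-pi..pi}. F f p (of_real s * cis t) * ennreal (u (norm (of_real s * cis t))) \<partial>lborel) = M f p s * ennreal (u s)" if "0 \<le> s"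
      proof -
        have "(\<integral>\<^sup>+t\<in>{-pi..pi}. F f p (of_real s * cis t) * ennreal (u (norm (of_real s * cis t))) \<partial>lborel)
          = (\<integral>\<^sup>+t. (F f p (of_real s * cis t) * indicator {-pi..pi} t) * ennreal (u s) \<partial>lborel)"
          using that by (intro nn_integral_cong) (auto simp: norm_mult indicator_def)
        also have "\<dots> = M f p s * ennreal (u s)" unfolding M_def by (intro nn_integral_multc) measurable
        finally show ?thesis .
      qed
      then show "ennreal s * (\<integral>\<^sup>+t\<in>{-pi..pi}. F f p (of_real s * cis t) * ennreal (u (norm (of_real s * cis t))) \<partial>lborel) * indicator {0..<1} s
         = (ennreal s * ennreal (u s)) * M f p s * indicator {0..<1} s"
        by (auto simp: indicator_def mult_ac)
    qed
    finally show ?thesis .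
  qed
  show ?thesis
  proof (rule that[OF c])
    fix f p assume f: "f holomorphic_on unit_disc" "(0::real) < p"
    note [measurable] = Mm[OF f]
    show "(\<integral>\<^sup>+z\<in>unit_disc. ennreal (norm (f z) powr p) * ennreal (W (norm z)) \<partial>lborel)
        \<le> ennreal c * (\<integral>\<^sup>+z\<in>unit_disc. ennreal (norm (f z) powr p) * ennreal (g (norm z)) \<partial>lborel)"
      unfolding polar[OF f W_measurable] polar[OF f g_meas]
      by (rule nn_integral_monotone_compare[OF _ _ _ L Mmono[OF f] cmp(1)]) measurable
    show "(\<integral>\<^sup>+z\<in>unit_disc. ennreal (norm (f z) powr p) * ennreal (g (norm z)) \<partial>lborel)
        \<le> ennreal c * (\<integral>\<^sup>+z\<in>unit_disc. ennreal (norm (f z) powr p) * ennreal (W (norm z)) \<partial>lborel)"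
      unfolding polar[OF f W_measurable] polar[OF f g_meas]
      by (rule nn_integral_monotone_compare[OF _ _ _ L Mmono[OF f] cmp(2)]) measurable
  qed
qed

text \<open>\<open>W_le\<close> majorizes \<open>W\<close> by two powers of 1 - |z| with
  \<open>W (norm a)\<close> in front, and the unweighted estimate applies to each: \<beta> <
  \<alpha> keeps the exponents above -1, and \<gamma> >= b + 2 keeps them below \<gamma> - 2. The
  admissible loss of a power \<beta> is exploited for test functions with p > 1.\<close>

lemma weighted_forelli_rudin:
  assumes \<beta>: "0 \<le> \<beta>" "\<beta> < \<alpha>" and \<gamma>: "b + 2 \<le> \<gamma>"
  obtains D where "0 < D" "\<And>a. a \<in> unit_disc \<Longrightarrow>
    (\<integral>\<^sup>+z\<in>unit_disc. ennreal (W (norm z) * (1 - norm z) powr (- \<beta>) * norm (1 - cnj a * z) powr (- \<gamma>)) \<partial>lborel)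
      \<le> ennreal (D * (W (norm a) * (1 - norm a) powr (2 - \<beta> - \<gamma>)))"
proof -
  have b: "\<alpha> \<le> b" "0 < \<alpha>" using \<alpha>_le_b \<alpha>_pos by auto
  obtain D1 where D1: "0 < D1" "\<And>a. a \<in> unit_disc \<Longrightarrow>
    (\<integral>\<^sup>+z\<in>unit_disc. ennreal ((1 - norm z) powr (\<alpha> - 1 - \<beta>) * norm (1 - cnj a * z) powr (- \<gamma>)) \<partial>lborel)
      \<le> ennreal (D1 * (1 - norm a) powr (\<alpha> - 1 - \<beta> + 2 - \<gamma>))"
    by (rule forelli_rudin[of "\<alpha> - 1 - \<beta>" \<gamma>]) (use \<beta> \<gamma> b in auto)
  obtain D2 where D2: "0 < D2" "\<And>a. a \<in> unit_disc \<Longrightarrow>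
    (\<integral>\<^sup>+z\<in>unit_disc. ennreal ((1 - norm z) powr (b - 1 - \<beta>) * norm (1 - cnj a * z) powr (- \<gamma>)) \<partial>lborel)
      \<le> ennreal (D2 * (1 - norm a) powr (b - 1 - \<beta> + 2 - \<gamma>))"
    by (rule forelli_rudin[of "b - 1 - \<beta>" \<gamma>]) (use \<beta> \<gamma> b in auto)
  show ?thesis
  proof (rule that[of "C * (D1 + D2)"])
    show "0 < C * (D1 + D2)" using C_ge_1 D1(1) D2(1) by simp
    fix a :: complex assume a: "a \<in> unit_disc"
    define y where "y = 1 - norm a"
    have y: "0 < y" using a by (simp add: y_def)
    define w where "w = C * W (norm a)"
    have w: "0 \<le> w" using C_ge_1 W_nonneg by (simp add: w_def)
    define k where "k = (\<lambda>e z. ennreal ((1 - norm z) powr (e - 1 - \<beta>) * norm (1 - cnj a * z) powr (- \<gamma>)))"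
    have [measurable]: "k e \<in> borel_measurable borel" for e unfolding k_def by measurable
    have "(\<integral>\<^sup>+z\<in>unit_disc. ennreal (W (norm z) * (1 - norm z) powr (- \<beta>) * norm (1 - cnj a * z) powr (- \<gamma>)) \<partial>lborel)
      \<le> (\<integral>\<^sup>+z. ennreal (w * y powr (1 - \<alpha>)) * (k \<alpha> z * indicator unit_disc z) + ennreal (w * y powr (1 - b)) * (k b z * indicator unit_disc z) \<partial>lborel)"
    proof (rule nn_integral_mono)
      fix z :: complex
      show "ennreal (W (norm z) * (1 - norm z) powr (- \<beta>) * norm (1 - cnj a * z) powr (- \<gamma>)) * indicator unit_disc z
        \<le> ennreal (w * y powr (1 - \<alpha>)) * (k \<alpha> z * indicator unit_disc z) + ennreal (w * y powr (1 - b)) * (k b z * indicator unit_disc z)"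
      proof (cases "z \<in> unit_disc")
        case True
        define x where "x = 1 - norm z"
        have x: "0 < x" using True by (simp add: x_def)
        define n where "n = norm (1 - cnj a * z) powr (- \<gamma>)"
        have n: "0 \<le> n" by (simp add: n_def)
        have e: "(x / y) powr (e - 1) * x powr (- \<beta>) = y powr (1 - e) * x powr (e - 1 - \<beta>)" for e
        proof -
          have "(x / y) powr (e - 1) = x powr (e - 1) * y powr (1 - e)"
            using x y powr_minus_divide[of y "e - 1"] by (simp add: powr_divide)
          moreover have "x powr (e - 1) * x powr (- \<beta>) = x powr (e - 1 - \<beta>)" by (simp flip: powr_add)
          ultimately show ?thesis by (simp add: mult_ac)
        qed
        have "W (norm z) \<le> w * ((x / y) powr (\<alpha> - 1) + (x / y) powr (b - 1))"
          using W_le[of "norm z" "norm a"] True a by (simp add: w_def x_def y_def)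
        then have "W (norm z) * (x powr (- \<beta>) * n) \<le> w * ((x / y) powr (\<alpha> - 1) + (x / y) powr (b - 1)) * (x powr (- \<beta>) * n)"
          using n by (intro mult_right_mono) auto
        also have "\<dots> = w * n * ((x / y) powr (\<alpha> - 1) * x powr (- \<beta>)) + w * n * ((x / y) powr (b - 1) * x powr (- \<beta>))"
          by (simp add: algebra_simps)
        also have "\<dots> = w * y powr (1 - \<alpha>) * (x powr (\<alpha> - 1 - \<beta>) * n) + w * y powr (1 - b) * (x powr (b - 1 - \<beta>) * n)"
          unfolding e by (simp add: mult_ac)
        finally have "W (norm z) * x powr (- \<beta>) * n \<le> w * y powr (1 - \<alpha>) * (x powr (\<alpha> - 1 - \<beta>) * n) + w * y powr (1 - b) * (x powr (b - 1 - \<beta>) * n)"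
          by (simp add: mult_ac)
        then have "ennreal (W (norm z) * x powr (- \<beta>) * n) \<le> ennreal (w * y powr (1 - \<alpha>)) * ennreal (x powr (\<alpha> - 1 - \<beta>) * n) + ennreal (w * y powr (1 - b)) * ennreal (x powr (b - 1 - \<beta>) * n)"
          using w n by (simp add: ennreal_leI flip: ennreal_mult ennreal_plus)
        then show ?thesis using True by (simp add: k_def x_def n_def)
      qed simp
    qed
    also have "\<dots> = ennreal (w * y powr (1 - \<alpha>)) * (\<integral>\<^sup>+z\<in>unit_disc. k \<alpha> z \<partial>lborel) + ennreal (w * y powr (1 - b)) * (\<integral>\<^sup>+z\<in>unit_disc. k b z \<partial>lborel)"
      by (subst nn_integral_add) (auto simp: nn_integral_cmult)
    also have "\<dots> \<le> ennreal (w * y powr (1 - \<alpha>)) * ennreal (D1 * y powr (\<alpha> - 1 - \<beta> + 2 - \<gamma>)) + ennreal (w * y powr (1 - b)) * ennreal (D2 * y powr (b - 1 - \<beta> + 2 - \<gamma>))"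
      unfolding k_def y_def by (intro add_mono mult_left_mono D1 D2 a) auto
    also have "\<dots> = ennreal (w * D1 * (y powr (1 - \<alpha>) * y powr (\<alpha> - 1 - \<beta> + 2 - \<gamma>)) + w * D2 * (y powr (1 - b) * y powr (b - 1 - \<beta> + 2 - \<gamma>)))"
      using w D1(1) D2(1) by (simp add: mult_ac flip: ennreal_mult ennreal_plus)
    also have "w * D1 * (y powr (1 - \<alpha>) * y powr (\<alpha> - 1 - \<beta> + 2 - \<gamma>)) + w * D2 * (y powr (1 - b) * y powr (b - 1 - \<beta> + 2 - \<gamma>))
      = C * (D1 + D2) * (W (norm a) * y powr (2 - \<beta> - \<gamma>))"
      unfolding powr_add[symmetric] by (simp add: w_def algebra_simps)
    finally show "(\<integral>\<^sup>+z\<in>unit_disc. ennreal (W (norm z) * (1 - norm z) powr (- \<beta>) * norm (1 - cnj a * z) powr (- \<gamma>)) \<partial>lborel)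
      \<le> ennreal (C * (D1 + D2) * (W (norm a) * (1 - norm a) powr (2 - \<beta> - \<gamma>)))"
      by (simp add: y_def)
  qed
qed

end

section \<open>Separated sets and test functions\<close>

lemma powr_add_le_add_powr:
  fixes x y p :: real
  assumes "0 \<le> x" "0 \<le> y" "0 < p" "p \<le> 1"
  shows "(x + y) powr p \<le> x powr p + y powr p"
proof (cases "x + y = 0")
  case True
  then show ?thesis using assms by simp
next
  case False
  then have S: "0 < x + y" using assms by simp
  have le: "t \<le> t powr p" if "0 \<le> t" "t \<le> 1" for t :: real
    using powr_mono'[of p 1 t] that assms by (cases "t = 0") auto
  have "1 = x / (x + y) + y / (x + y)" using S by (simp flip: add_divide_distrib)
  also have "\<dots> \<le> (x / (x + y)) powr p + (y / (x + y)) powr p"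
    using S assms by (intro add_mono le) auto
  also have "\<dots> = (x powr p + y powr p) / (x + y) powr p"
    using S assms by (simp add: powr_divide add_divide_distrib)
  finally show ?thesis using S by (simp add: field_simps)
qed

lemma powr_sum_le_sum_powr:
  fixes x :: "'i \<Rightarrow> real"
  assumes "finite A" "\<And>i. i \<in> A \<Longrightarrow> 0 \<le> x i" "0 < p" "p \<le> 1"
  shows "(\<Sum>i\<in>A. x i) powr p \<le> (\<Sum>i\<in>A. x i powr p)"
  using assms(1,2)
proof (induction A rule: finite_induct)
  case (insert i A)
  have "(x i + (\<Sum>i\<in>A. x i)) powr p \<le> x i powr p + (\<Sum>i\<in>A. x i) powr p"
    using insert assms by (intro powr_add_le_add_powr sum_nonneg) auto
  then show ?case using insert by (simp add: order_trans)
qed (use assms in simp)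

text \<open>Jensen's inequality for the weights divided by their sum. Terms with a zero weight or a
  zero argument are removed first, so that convexity is applied at positive arguments with a
  positive total weight.\<close>

lemma powr_weighted_sum_le:
  fixes x w :: "'i \<Rightarrow> real"
  assumes A: "finite A" and nn: "\<And>i. i \<in> A \<Longrightarrow> 0 \<le> x i" "\<And>i. i \<in> A \<Longrightarrow> 0 \<le> w i" and p: "1 \<le> p"
  shows "(\<Sum>i\<in>A. w i * x i) powr p \<le> (\<Sum>i\<in>A. w i) powr (p - 1) * (\<Sum>i\<in>A. w i * x i powr p)"
proof -
  define B where "B = {i \<in> A. 0 < x i \<and> 0 < w i}"
  have B: "finite B" "B \<subseteq> A" using A by (auto simp: B_def)
  have z: "w i * x i = 0 \<and> w i * x i powr p = 0" if "i \<in> A - B" for i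
    using that nn[of i] by (auto simp: B_def not_less)
  have e1: "(\<Sum>i\<in>A. w i * x i) = (\<Sum>i\<in>B. w i * x i)"
    using z by (intro sum.mono_neutral_right A B) blast
  have e2: "(\<Sum>i\<in>A. w i * x i powr p) = (\<Sum>i\<in>B. w i * x i powr p)"
    using z by (intro sum.mono_neutral_right A B) blast
  show ?thesis
  proof (cases "B = {}")
    case True
    then show ?thesis using p by (simp add: e1 e2)
  next
    case False
    define S where "S = (\<Sum>i\<in>B. w i)"
    have S: "0 < S" unfolding S_def using B False by (intro sum_pos) (auto simp: B_def)
    have "(\<Sum>i\<in>B. (w i / S) *\<^sub>R x i) powr p \<le> (\<Sum>i\<in>B. (w i / S) * x i powr p)"
    proof (rule convex_on_sum[OF B(1) False powr_convex[OF p]])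
      show "(\<Sum>i\<in>B. w i / S) = 1" using S by (simp add: S_def flip: sum_divide_distrib)
    qed (use S in \<open>auto simp: B_def\<close>)
    then have "((\<Sum>i\<in>B. w i * x i) / S) powr p \<le> (\<Sum>i\<in>B. w i * x i powr p) / S"
      by (simp add: sum_divide_distrib)
    moreover have "((\<Sum>i\<in>B. w i * x i) / S) powr p = (\<Sum>i\<in>B. w i * x i) powr p / S powr p"
      by (rule powr_divide)
    ultimately have "(\<Sum>i\<in>B. w i * x i) powr p \<le> S powr p / S * (\<Sum>i\<in>B. w i * x i powr p)"
      using S by (simp add: field_simps)
    also have "S powr p / S = S powr (p - 1)" using S by (simp add: powr_diff)
    also have "\<dots> * (\<Sum>i\<in>B. w i * x i powr p) \<le> (\<Sum>i\<in>A. w i) powr (p - 1) * (\<Sum>i\<in>B. w i * x i powr p)"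
    proof (intro mult_right_mono powr_mono2)
      show "S \<le> (\<Sum>i\<in>A. w i)" unfolding S_def using nn B A by (intro sum_mono2) auto
    qed (use p S in \<open>auto intro!: sum_nonneg simp: B_def\<close>)
    finally show ?thesis by (simp add: e1 e2)
  qed
qed

text \<open>Area limits the number of disjoint balls because K stays at distance 1 - R from the unit
  circle; so a family of largest cardinality exists. A point violating the covering property could
  be added to it.\<close>

lemma exists_maximal_disjoint_balls:
  fixes K :: "complex set"
  assumes K: "K \<subseteq> cball 0 R" and R: "R < 1" and \<delta>: "0 < \<delta>" "\<delta> \<le> 1"
  obtains A where "finite A" "A \<subseteq> K" "disjoint_family_on (\<lambda>a. ball a (\<delta> * (1 - norm a))) A"
    "\<And>z. z \<in> K \<Longrightarrow> \<exists>a\<in>A. norm (z - a) \<le> \<delta> * (1 - norm a) + \<delta> * (1 - norm z)"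
proof -
  let ?B = "\<lambda>a. ball a (\<delta> * (1 - norm a))"
  define P where "P = (\<lambda>A. finite A \<and> A \<subseteq> K \<and> disjoint_family_on ?B A)"
  have bound: "card A < Suc (nat \<lceil>1 / (\<delta> * (1 - R))\<^sup>2\<rceil>)" if "P A" for A
  proof -
    have A: "finite A" "A \<subseteq> K" "disjoint_family_on ?B A" using that by (auto simp: P_def)
    have rad: "\<delta> * (1 - R) \<le> \<delta> * (1 - norm a)" "0 \<le> \<delta> * (1 - norm a)" "a \<in> unit_disc" if "a \<in> A" for a
      using that A(2) K R \<delta> by (force intro!: mult_left_mono mult_nonneg_nonneg)+
    have "ennreal (real (card A) * (pi * (\<delta> * (1 - R))\<^sup>2)) = (\<Sum>a\<in>A. ennreal (pi * (\<delta> * (1 - R))\<^sup>2))"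
      by (simp add: ennreal_mult ennreal_of_nat_eq_real_of_nat)
    also have "\<dots> \<le> (\<Sum>a\<in>A. emeasure lborel (?B a))"
    proof (rule sum_mono)
      fix a assume a: "a \<in> A"
      have "(\<delta> * (1 - R))\<^sup>2 \<le> (\<delta> * (1 - norm a))\<^sup>2"
        using rad[OF a] \<delta> R by (intro power_mono) auto
      then show "ennreal (pi * (\<delta> * (1 - R))\<^sup>2) \<le> emeasure lborel (?B a)"
        using rad[OF a] by (simp add: emeasure_lborel_ball_complex ennreal_leI)
    qed
    also have "\<dots> = emeasure lborel (\<Union>a\<in>A. ?B a)"
      using A by (intro sum_emeasure) auto
    also have "\<dots> \<le> emeasure lborel unit_disc"
    proof (rule emeasure_mono)
      show "(\<Union>a\<in>A. ?B a) \<subseteq> unit_disc"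
      proof (rule UN_least, rule subsetI)
        fix a w assume a: "a \<in> A" and w: "w \<in> ?B a"
        have "norm (w - a) < \<delta> * (1 - norm a)" using w by (simp add: dist_norm norm_minus_commute)
        also have "\<dots> \<le> 1 * (1 - norm a)" using \<delta> rad(3)[OF a] by (intro mult_right_mono) auto
        finally show "w \<in> unit_disc" using norm_triangle_ineq[of a "w - a"] by simp
      qed
    qed simp
    also have "\<dots> = ennreal pi" using emeasure_lborel_ball_complex[of 1 0] by simp
    finally have "real (card A) * (pi * (\<delta> * (1 - R))\<^sup>2) \<le> pi" by simp
    moreover have "0 < (\<delta> * (1 - R))\<^sup>2" using \<delta> R by simp
    ultimately have "real (card A) \<le> 1 / (\<delta> * (1 - R))\<^sup>2"
      by (simp add: field_simps)
    then show ?thesis by linarith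
  qed
  have "P {}" by (simp add: P_def disjoint_family_on_def)
  then obtain A where A: "P A" "\<And>A'. P A' \<Longrightarrow> card A' \<le> card A"
    using ex_has_greatest_nat[of P "{}" card] bound by blast
  show ?thesis
  proof (rule that[of A])
    fix z assume z: "z \<in> K"
    show "\<exists>a\<in>A. norm (z - a) \<le> \<delta> * (1 - norm a) + \<delta> * (1 - norm z)"
    proof (rule ccontr)
      assume "\<not> ?thesis"
      then have far: "\<delta> * (1 - norm a) + \<delta> * (1 - norm z) < norm (z - a)" if "a \<in> A" for a
        using that by (auto simp: not_le)
      have nz: "norm z < 1" using z K R by force
      have "z \<notin> A"
      proof
        assume "z \<in> A"
        from far[OF this] have "\<delta> * (1 - norm z) + \<delta> * (1 - norm z) < 0" by simp
        moreover have "0 \<le> \<delta> * (1 - norm z)" using \<delta> nz by simp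
        ultimately show False by linarith
      qed
      have disj: "?B a \<inter> ?B z = {}" if "a \<in> A" for a
      proof -
        have "\<not> (dist a w < \<delta> * (1 - norm a) \<and> dist z w < \<delta> * (1 - norm z))" for w
          using far[OF that] dist_triangle[of z a w] by (auto simp: dist_norm norm_minus_commute)
        then show ?thesis by auto
      qed
      have "P (insert z A)"
        using A(1) z disj unfolding P_def disjoint_family_on_def by (auto simp: Int_commute)
      then have "card (insert z A) \<le> card A" by (rule A(2))
      then show False using A(1) \<open>z \<notin> A\<close> by (simp add: P_def)
    qed
  qed (use A in \<open>auto simp: P_def\<close>)
qed

lemma one_minus_cnj_mult_bounds:
  fixes a z :: complex
  assumes "a \<in> unit_disc" "z \<in> unit_disc"
  shows "1 - norm a \<le> norm (1 - cnj a * z)" "1 - norm z \<le> norm (1 - cnj a * z)" "0 < norm (1 - cnj a * z)"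
    "1 - cnj a * z \<noteq> 0"
proof -
  have n: "norm (cnj a * z) \<le> norm a" "norm (cnj a * z) \<le> norm z"
    using assms by (auto simp: norm_mult mult_left_le_one_le mult_right_le_one_le)
  then show 1: "1 - norm a \<le> norm (1 - cnj a * z)" and "1 - norm z \<le> norm (1 - cnj a * z)"
    using norm_triangle_ineq2[of 1 "cnj a * z"] by auto
  show 2: "0 < norm (1 - cnj a * z)" using 1 assms by auto
  then show "1 - cnj a * z \<noteq> 0" by auto
qed

section \<open>Test functions and their norms\<close>

context doubling_profile
begin

text \<open>The powers of \<open>W\<close> and \<open>1 - norm a\<close> normalize the summands to have norm comparable to \<open>\<bar>c a\<bar>\<close>.\<close>

definition test_function :: "real \<Rightarrow> nat \<Rightarrow> (complex \<Rightarrow> real) \<Rightarrow> complex set \<Rightarrow> complex \<Rightarrow> complex"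
  where "test_function p N c A z = (\<Sum>a\<in>A. of_real (c a * (W (norm a) * (1 - norm a)\<^sup>2) powr (- 1 / p) * (1 - norm a) ^ N)
    / (1 - cnj a * z) ^ N)"

lemma norm_test_function_le:
  assumes A: "finite A" "A \<subseteq> unit_disc" and z: "z \<in> unit_disc"
  shows "norm (test_function p N c A z) \<le> (\<Sum>a\<in>A. \<bar>c a\<bar> * (W (norm a) * (1 - norm a)\<^sup>2) powr (- 1 / p) *
    ((1 - norm a) powr real N * norm (1 - cnj a * z) powr (- real N)))"
  unfolding test_function_def
proof (rule order_trans[OF norm_sum], rule sum_mono)
  fix a assume "a \<in> A"
  then have a: "a \<in> unit_disc" using A by auto
  have p: "0 < norm (1 - cnj a * z)" "0 < 1 - norm a" using one_minus_cnj_mult_bounds[OF a z] a by auto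
  show "norm (of_real (c a * (W (norm a) * (1 - norm a)\<^sup>2) powr (- 1 / p) * (1 - norm a) ^ N) / (1 - cnj a * z) ^ N)
    \<le> \<bar>c a\<bar> * (W (norm a) * (1 - norm a)\<^sup>2) powr (- 1 / p) * ((1 - norm a) powr real N * norm (1 - cnj a * z) powr (- real N))"
  proof -
    have "norm (of_real x / (1 - cnj a * z) ^ N) = \<bar>x\<bar> / norm (1 - cnj a * z) ^ N" for x :: real
      by (simp only: norm_divide norm_power norm_of_real)
    then show ?thesis using p by (simp only:) (simp add: abs_mult powr_realpow powr_minus_divide)
  qed
qed

lemma test_function_holomorphic:
  assumes A: "finite A" "A \<subseteq> unit_disc"
  shows "test_function p N c A holomorphic_on unit_disc"
  unfolding test_function_def
  using A one_minus_cnj_mult_bounds(4) by (intro holomorphic_intros) (auto simp del: mem_ball)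

text \<open>For p <= 1 the power is subadditive and the summands are integrated one by one. For p >
  1 Jensen's inequality takes over; by separation the total weight is bounded by a negative power of
  1 - |z|, and the weighted Forelli-Rudin estimate absorbs that power. In both cases the
  normalization of the summands cancels \<open>W (norm a)\<close>.\<close>

lemma test_function_integral_le:
  assumes p: "0 < p" and \<delta>: "0 < \<delta>" "\<delta> \<le> 1 / 2"
  obtains N D where "0 < N" "0 < D" "\<And>A c. finite A \<Longrightarrow> A \<subseteq> unit_disc \<Longrightarrow>
    disjoint_family_on (\<lambda>a. ball a (\<delta> * (1 - norm a))) A \<Longrightarrow>
    (\<integral>\<^sup>+z\<in>unit_disc. ennreal (norm (test_function p N c A z) powr p) * ennreal (W (norm z)) \<partial>lborel)
      \<le> ennreal (D * (\<Sum>a\<in>A. \<bar>c a\<bar> powr p))"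
proof -
  have Hp: "((W (norm a) * (1 - norm a)\<^sup>2) powr (- 1 / p)) powr p * W (norm a) * (1 - norm a)\<^sup>2 = 1" if "a \<in> unit_disc" for a
  proof -
    have X: "0 < W (norm a) * (1 - norm a)\<^sup>2" using that W_pos[of "norm a"] by simp
    then have "((W (norm a) * (1 - norm a)\<^sup>2) powr (- 1 / p)) powr p = 1 / (W (norm a) * (1 - norm a)\<^sup>2)"
      unfolding powr_powr using p by (simp add: powr_minus_divide)
    then show ?thesis using W_pos[of "norm a"] that by simp
  qed
  \<comment> \<open>The common end of both cases: a pointwise bound by a sum of kernels is
    integrated term by term. \<beta> is the power of 1 - |z| lost on the way, which is 0 for p <=
    1.\<close>
  have key: "(\<integral>\<^sup>+z\<in>unit_disc. ennreal (norm (test_function p N c A z) powr p) * ennreal (W (norm z)) \<partial>lborel)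
      \<le> ennreal (B * D * (\<Sum>a\<in>A. \<bar>c a\<bar> powr p))"
    if A: "finite A" "A \<subseteq> unit_disc" and \<gamma>: "0 \<le> B" "0 < D"
      and pt: "\<And>z. z \<in> unit_disc \<Longrightarrow> norm (test_function p N c A z) powr p \<le>
        B * (1 - norm z) powr (- \<beta>) * (\<Sum>a\<in>A. \<bar>c a\<bar> powr p * ((W (norm a) * (1 - norm a)\<^sup>2) powr (- 1 / p)) powr p *
          ((1 - norm a) powr (\<gamma> + \<beta>) * norm (1 - cnj a * z) powr (- \<gamma>)))"
      and D: "\<And>a. a \<in> unit_disc \<Longrightarrow>
        (\<integral>\<^sup>+z\<in>unit_disc. ennreal (W (norm z) * (1 - norm z) powr (- \<beta>) * norm (1 - cnj a * z) powr (- \<gamma>)) \<partial>lborel)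
          \<le> ennreal (D * (W (norm a) * (1 - norm a) powr (2 - \<beta> - \<gamma>)))"
    for A c N B D \<beta> \<gamma>
  proof -
    define e where "e = (\<lambda>a. B * (\<bar>c a\<bar> powr p * ((W (norm a) * (1 - norm a)\<^sup>2) powr (- 1 / p)) powr p) * (1 - norm a) powr (\<gamma> + \<beta>))"
    have e: "0 \<le> e a" for a using \<gamma> by (simp add: e_def)
    define k where "k = (\<lambda>a z. ennreal (W (norm z) * (1 - norm z) powr (- \<beta>) * norm (1 - cnj a * z) powr (- \<gamma>)))"
    have [measurable]: "k a \<in> borel_measurable borel" for a unfolding k_def by measurable
    have "(\<integral>\<^sup>+z\<in>unit_disc. ennreal (norm (test_function p N c A z) powr p) * ennreal (W (norm z)) \<partial>lborel)
      \<le> (\<integral>\<^sup>+z. (\<Sum>a\<in>A. ennreal (e a) * (k a z * indicator unit_disc z)) \<partial>lborel)"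
    proof (rule nn_integral_mono)
      fix z :: complex
      show "ennreal (norm (test_function p N c A z) powr p) * ennreal (W (norm z)) * indicator unit_disc z
        \<le> (\<Sum>a\<in>A. ennreal (e a) * (k a z * indicator unit_disc z))"
      proof (cases "z \<in> unit_disc")
        case True
        have "norm (test_function p N c A z) powr p * W (norm z) \<le>
          B * (1 - norm z) powr (- \<beta>) * (\<Sum>a\<in>A. \<bar>c a\<bar> powr p * ((W (norm a) * (1 - norm a)\<^sup>2) powr (- 1 / p)) powr p *
          ((1 - norm a) powr (\<gamma> + \<beta>) * norm (1 - cnj a * z) powr (- \<gamma>))) * W (norm z)"
          using pt[OF True] W_nonneg by (rule mult_right_mono)
        also have "\<dots> = (\<Sum>a\<in>A. e a * (W (norm z) * (1 - norm z) powr (- \<beta>) * norm (1 - cnj a * z) powr (- \<gamma>)))"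
          unfolding sum_distrib_left sum_distrib_right by (intro sum.cong) (auto simp: e_def)
        finally have "ennreal (norm (test_function p N c A z) powr p * W (norm z)) \<le> ennreal \<dots>" by (rule ennreal_leI)
        also have "\<dots> = (\<Sum>a\<in>A. ennreal (e a) * k a z)"
          using e W_nonneg by (subst sum_ennreal[symmetric]) (auto simp: k_def simp flip: ennreal_mult)
        finally show ?thesis using True W_nonneg by (simp add: ennreal_mult)
      qed simp
    qed
    also have "\<dots> = (\<Sum>a\<in>A. ennreal (e a) * (\<integral>\<^sup>+z\<in>unit_disc. k a z \<partial>lborel))"
      by (subst nn_integral_sum) (auto simp: nn_integral_cmult)
    also have "\<dots> \<le> (\<Sum>a\<in>A. ennreal (e a) * ennreal (D * (W (norm a) * (1 - norm a) powr (2 - \<beta> - \<gamma>))))"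
      unfolding k_def using A by (intro sum_mono mult_left_mono D) auto
    also have "\<dots> = (\<Sum>a\<in>A. ennreal (B * D * \<bar>c a\<bar> powr p))"
    proof (rule sum.cong)
      fix a assume "a \<in> A"
      then have a: "a \<in> unit_disc" using A by auto
      have pw: "(1 - norm a) powr (\<gamma> + \<beta>) * (1 - norm a) powr (2 - \<beta> - \<gamma>) = (1 - norm a)\<^sup>2"
        using a by (simp flip: powr_add)
      have "e a * (D * (W (norm a) * (1 - norm a) powr (2 - \<beta> - \<gamma>))) =
        B * D * \<bar>c a\<bar> powr p * (((W (norm a) * (1 - norm a)\<^sup>2) powr (- 1 / p)) powr p * W (norm a) * ((1 - norm a) powr (\<gamma> + \<beta>) * (1 - norm a) powr (2 - \<beta> - \<gamma>)))"
        by (simp add: e_def mult_ac)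
      also have "\<dots> = B * D * \<bar>c a\<bar> powr p" unfolding pw Hp[OF a] by simp
      finally show "ennreal (e a) * ennreal (D * (W (norm a) * (1 - norm a) powr (2 - \<beta> - \<gamma>))) = ennreal (B * D * \<bar>c a\<bar> powr p)"
        using e[of a] \<gamma> W_nonneg by (simp flip: ennreal_mult)
    qed simp
    also have "\<dots> = ennreal (B * D * (\<Sum>a\<in>A. \<bar>c a\<bar> powr p))"
      using \<gamma> by (simp add: sum_distrib_left)
    finally show ?thesis .
  qed
  show ?thesis
  proof (cases "p \<le> 1")
    case True
    \<comment> \<open>Large enough for the kernel exponent N p to reach b + 2.\<close>
    define N where "N = nat \<lceil>(b + 2) / p\<rceil>"
    have N: "(b + 2) / p \<le> real N" unfolding N_def using \<alpha>_le_b \<alpha>_pos p by (simp add: real_nat_ceiling_ge)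
    then have N': "b + 2 \<le> real N * p" using p by (simp add: field_simps)
    then have "0 < real N * p" using \<alpha>_le_b \<alpha>_pos by linarith
    then have N0: "0 < N" using p by (simp add: zero_less_mult_iff)
    obtain D where D: "0 < D" "\<And>a. a \<in> unit_disc \<Longrightarrow>
        (\<integral>\<^sup>+z\<in>unit_disc. ennreal (W (norm z) * (1 - norm z) powr (- 0) * norm (1 - cnj a * z) powr (- (real N * p))) \<partial>lborel)
          \<le> ennreal (D * (W (norm a) * (1 - norm a) powr (2 - 0 - (real N * p))))"
      using weighted_forelli_rudin[of 0 "real N * p"] N' \<alpha>_pos by blast
    show ?thesis
    proof (rule that[OF N0, of D])
      fix A c assume A: "finite A" "A \<subseteq> unit_disc"
      have "norm (test_function p N c A z) powr p \<le>
        1 * (1 - norm z) powr (- 0) * (\<Sum>a\<in>A. \<bar>c a\<bar> powr p * ((W (norm a) * (1 - norm a)\<^sup>2) powr (- 1 / p)) powr p *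
          ((1 - norm a) powr (real N * p + 0) * norm (1 - cnj a * z) powr (- (real N * p))))" if z: "z \<in> unit_disc" for z
      proof -
        have "norm (test_function p N c A z) powr p \<le> (\<Sum>a\<in>A. \<bar>c a\<bar> * (W (norm a) * (1 - norm a)\<^sup>2) powr (- 1 / p) *
          ((1 - norm a) powr real N * norm (1 - cnj a * z) powr (- real N))) powr p"
          using norm_test_function_le[OF A z] p by (intro powr_mono2) auto
        also have "\<dots> \<le> (\<Sum>a\<in>A. (\<bar>c a\<bar> * (W (norm a) * (1 - norm a)\<^sup>2) powr (- 1 / p) *
          ((1 - norm a) powr real N * norm (1 - cnj a * z) powr (- real N))) powr p)"
          using A p True by (intro powr_sum_le_sum_powr) auto
        also have "\<dots> = (\<Sum>a\<in>A. \<bar>c a\<bar> powr p * ((W (norm a) * (1 - norm a)\<^sup>2) powr (- 1 / p)) powr p *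
          ((1 - norm a) powr (real N * p) * norm (1 - cnj a * z) powr (- (real N * p))))"
          by (intro sum.cong refl) (simp add: powr_mult powr_powr)
        finally show ?thesis using z by simp
      qed
      from key[OF A _ D(1) this D(2)]
      show "(\<integral>\<^sup>+z\<in>unit_disc. ennreal (norm (test_function p N c A z) powr p) * ennreal (W (norm z)) \<partial>lborel)
        \<le> ennreal (D * (\<Sum>a\<in>A. \<bar>c a\<bar> powr p))" by simp
    qed (rule D)
  next
    case False
    then have p1: "1 < p" by simp
    \<comment> \<open>Any exponent strictly between 0 and \<alpha> would serve. \<eta> is fixed so
      that (1 - |z|)^(-\<eta>) raised to the power p - 1 is (1 - |z|)^(-\<beta>).\<close>
    define \<beta> where "\<beta> = \<alpha> / 2"
    have \<beta>: "0 \<le> \<beta>" "\<beta> < \<alpha>" "0 < \<beta>" using \<alpha>_pos by (auto simp: \<beta>_def)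
    define \<eta> where "\<eta> = \<beta> / (p - 1)"
    have \<eta>: "0 < \<eta>" using \<beta> p1 by (simp add: \<eta>_def)
    have \<eta>p: "\<eta> * (p - 1) = \<beta>" using p1 by (simp add: \<eta>_def)
    \<comment> \<open>b + 2 serves the weighted kernel estimate; 2 + \<eta> makes the exponent N -
      \<eta> of the separated sum exceed 1.\<close>
    define N where "N = nat \<lceil>max (b + 2) (2 + \<eta>)\<rceil>"
    have "max (b + 2) (2 + \<eta>) \<le> real N" unfolding N_def by (rule real_nat_ceiling_ge)
    then have N: "b + 2 \<le> real N" "2 + \<eta> \<le> real N" by auto
    then have N0: "0 < N" using \<eta> by (cases N) auto
    obtain D1 where D1: "0 < D1" "\<And>A z. finite A \<Longrightarrow> A \<subseteq> unit_disc \<Longrightarrow>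
      disjoint_family_on (\<lambda>a. ball a (\<delta> * (1 - norm a))) A \<Longrightarrow> z \<in> unit_disc \<Longrightarrow>
      (\<Sum>a\<in>A. (1 - norm a) powr (real N - \<eta>) * norm (1 - cnj a * z) powr (- real N)) \<le> D1 * (1 - norm z) powr (real N - \<eta> - real N)"
      by (rule separated_sum_le[of "real N - \<eta>" "real N" \<delta>]) (use N \<eta> \<delta> in auto)
    obtain D where D: "0 < D" "\<And>a. a \<in> unit_disc \<Longrightarrow>
        (\<integral>\<^sup>+z\<in>unit_disc. ennreal (W (norm z) * (1 - norm z) powr (- \<beta>) * norm (1 - cnj a * z) powr (- real N)) \<partial>lborel)
          \<le> ennreal (D * (W (norm a) * (1 - norm a) powr (2 - \<beta> - real N)))"
      using weighted_forelli_rudin[OF \<beta>(1,2) N(1)] by blast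
    show ?thesis
    proof (rule that[OF N0, of "D1 powr (p - 1) * D"])
      show "0 < D1 powr (p - 1) * D" using D D1 by simp
      fix A c assume A: "finite A" "A \<subseteq> unit_disc" and disj: "disjoint_family_on (\<lambda>a. ball a (\<delta> * (1 - norm a))) A"
      have "norm (test_function p N c A z) powr p \<le>
        D1 powr (p - 1) * (1 - norm z) powr (- \<beta>) * (\<Sum>a\<in>A. \<bar>c a\<bar> powr p * ((W (norm a) * (1 - norm a)\<^sup>2) powr (- 1 / p)) powr p *
          ((1 - norm a) powr (real N + \<beta>) * norm (1 - cnj a * z) powr (- real N)))" if z: "z \<in> unit_disc" for z
      proof -
        \<comment> \<open>The factor (1 - |a|)^\<eta> is moved from the weights to the arguments:
          left in the weights, it would put the separated sum at the critical exponent.\<close>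
        define w where "w = (\<lambda>a. (1 - norm a) powr (real N - \<eta>) * norm (1 - cnj a * z) powr (- real N))"
        define x where "x = (\<lambda>a. \<bar>c a\<bar> * (W (norm a) * (1 - norm a)\<^sup>2) powr (- 1 / p) * (1 - norm a) powr \<eta>)"
        have "norm (test_function p N c A z) \<le> (\<Sum>a\<in>A. w a * x a)"
        proof -
          have "w a * x a = \<bar>c a\<bar> * (W (norm a) * (1 - norm a)\<^sup>2) powr (- 1 / p) *
              ((1 - norm a) powr real N * norm (1 - cnj a * z) powr (- real N))" for a
          proof -
            have "(1 - norm a) powr (real N - \<eta>) * (1 - norm a) powr \<eta> = (1 - norm a) powr real N"
              by (simp flip: powr_add)
            then show ?thesis by (simp add: w_def x_def mult_ac flip: mult.assoc[of "(1 - norm a) powr \<eta>"])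
          qed
          then show ?thesis using norm_test_function_le[OF A z, of p N c] by simp
        qed
        then have "norm (test_function p N c A z) powr p \<le> (\<Sum>a\<in>A. w a * x a) powr p"
          using p by (intro powr_mono2) auto
        also have "\<dots> \<le> (\<Sum>a\<in>A. w a) powr (p - 1) * (\<Sum>a\<in>A. w a * x a powr p)"
          using A p1 by (intro powr_weighted_sum_le) (auto simp: w_def x_def)
        also have "\<dots> \<le> (D1 powr (p - 1) * (1 - norm z) powr (- \<beta>)) * (\<Sum>a\<in>A. w a * x a powr p)"
        proof (rule mult_right_mono)
          have "(\<Sum>a\<in>A. w a) powr (p - 1) \<le> (D1 * (1 - norm z) powr (- \<eta>)) powr (p - 1)"
            using D1(2)[OF A disj z] p1 by (intro powr_mono2) (auto simp: w_def intro!: sum_nonneg)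
          also have "\<dots> = D1 powr (p - 1) * (1 - norm z) powr (- \<eta> * (p - 1))"
            using D1(1) by (simp add: powr_mult powr_powr)
          also have "- \<eta> * (p - 1) = - \<beta>" using \<eta>p by simp
          finally show "(\<Sum>a\<in>A. w a) powr (p - 1) \<le> D1 powr (p - 1) * (1 - norm z) powr (- \<beta>)" .
        qed (auto intro!: sum_nonneg simp: w_def)
        also have "(\<Sum>a\<in>A. w a * x a powr p) = (\<Sum>a\<in>A. \<bar>c a\<bar> powr p * ((W (norm a) * (1 - norm a)\<^sup>2) powr (- 1 / p)) powr p *
          ((1 - norm a) powr (real N + \<beta>) * norm (1 - cnj a * z) powr (- real N)))"
        proof (rule sum.cong[OF refl])
          fix a :: complex
          have "(1 - norm a) powr (real N + \<beta>) = (1 - norm a) powr (real N - \<eta>) * (1 - norm a) powr (\<eta> * p)"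
            unfolding powr_add[symmetric] using \<eta>p by (simp add: algebra_simps)
          moreover have "x a powr p = \<bar>c a\<bar> powr p * ((W (norm a) * (1 - norm a)\<^sup>2) powr (- 1 / p)) powr p * (1 - norm a) powr (\<eta> * p)"
            unfolding x_def by (simp only: powr_mult powr_powr abs_ge_zero powr_ge_zero mult_nonneg_nonneg)
          ultimately show "w a * x a powr p = \<bar>c a\<bar> powr p * ((W (norm a) * (1 - norm a)\<^sup>2) powr (- 1 / p)) powr p *
            ((1 - norm a) powr (real N + \<beta>) * norm (1 - cnj a * z) powr (- real N))"
            unfolding w_def by (simp only: mult_ac)
        qed
        finally show ?thesis .
      qed
      from key[OF A _ D(1) this D(2)]
      show "(\<integral>\<^sup>+z\<in>unit_disc. ennreal (norm (test_function p N c A z) powr p) * ennreal (W (norm z)) \<partial>lborel)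
        \<le> ennreal (D1 powr (p - 1) * D * (\<Sum>a\<in>A. \<bar>c a\<bar> powr p))" by simp
    qed
  qed
qed

end

section \<open>Carleson squares and pseudohyperbolic discs\<close>

lemma measurable_cnj [measurable]: "cnj \<in> borel_measurable borel"
  by (intro borel_measurable_continuous_onI continuous_intros)

lemma measurable_Arg [measurable]: "Arg \<in> borel_measurable borel"
proof -
  have "Arg = (\<lambda>z. if z = 0 then 0 else Im (Ln z))"
    by (auto simp: Arg_eq_Im_Ln Arg_zero)
  moreover have "(\<lambda>z. if z = 0 then 0 else Im (Ln z)) \<in> borel_measurable borel" by measurable
  ultimately show ?thesis by (simp only:)
qed

lemma sets_carleson_square [measurable]: "carleson_square z \<in> sets borel"
proof (cases "z = 0")
  case False
  have "{\<zeta>. \<zeta> \<in> unit_disc \<and> norm z < norm \<zeta> \<and> (\<exists>k::int. \<bar>Arg \<zeta> - Arg z + 2 * pi * of_int k\<bar> < (1 - norm z) / 2)} \<in> sets borel"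
    by measurable
  then show ?thesis using False by (simp add: carleson_square_def)
qed (simp add: carleson_square_def)

lemma carleson_square_subset: "carleson_square z \<subseteq> unit_disc"
  by (auto simp: carleson_square_def)

text \<open>The square has opening 1 - |z| < 2 pi, so only one multiple of 2 pi is relevant once
  angles are centred at \<open>Arg z\<close>. The excluded radius |z| belongs to the half-open
  interval but not to the square.\<close>

lemma angular_measure_carleson_square:
  assumes z: "z \<in> unit_disc" "z \<noteq> 0" and s: "0 < s" "s < 1" "s \<noteq> norm z"
  shows "(\<integral>\<^sup>+t\<in>{-pi..pi}. indicator (carleson_square z) (of_real s * cis t) \<partial>lborel)
    = ennreal (1 - norm z) * indicator {norm z..<1} s"
proof (cases "norm z < s")
  case False
  then show ?thesis using s z by (auto simp: carleson_square_def norm_mult indicator_def)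
next
  case True
  define \<delta> where "\<delta> = (1 - norm z) / 2"
  have \<delta>: "0 < \<delta>" "\<delta> < pi" using z pi_gt3 by (auto simp: \<delta>_def intro: less_le_trans[of _ 1])
  define P where "P = (\<lambda>t::real. \<exists>k::int. \<bar>t - Arg z + 2 * pi * of_int k\<bar> < \<delta>)"
  define F :: "real \<Rightarrow> ennreal" where "F = (\<lambda>t. indicator (Collect P) t)"
  have [measurable]: "F \<in> borel_measurable borel" unfolding F_def P_def by measurable
  have per: "F (t + 2 * pi) = F t" for t
  proof -
    have "P (t + 2 * pi) \<longleftrightarrow> P t"
    proof
      assume "P (t + 2 * pi)"
      then obtain k :: int where "\<bar>t + 2 * pi - Arg z + 2 * pi * of_int k\<bar> < \<delta>" by (auto simp: P_def)
      then show "P t" unfolding P_def by (intro exI[of _ "k + 1"]) (simp add: algebra_simps)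
    next
      assume "P t"
      then obtain k :: int where "\<bar>t - Arg z + 2 * pi * of_int k\<bar> < \<delta>" by (auto simp: P_def)
      then show "P (t + 2 * pi)" unfolding P_def by (intro exI[of _ "k - 1"]) (simp add: algebra_simps)
    qed
    then show ?thesis by (simp add: F_def indicator_def)
  qed
  have "(\<integral>\<^sup>+t\<in>{-pi..pi}. indicator (carleson_square z) (of_real s * cis t) \<partial>lborel) = (\<integral>\<^sup>+t\<in>{-pi..pi}. F t \<partial>lborel)"
  proof (rule nn_integral_cong_AE)
    \<comment> \<open>\<open>Arg\<close> takes its values in the half-open interval without
      -pi.\<close>
    have "AE t in lborel. t \<noteq> -pi" by (rule AE_lborel_singleton)
    then show "AE t in lborel. indicator (carleson_square z) (of_real s * cis t) * indicator {-pi..pi} t = F t * indicator {-pi..pi} t"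
    proof eventually_elim
      case (elim t)
      show ?case
      proof (cases "t \<in> {-pi..pi}")
        case t: True
        have "Arg (of_real s * cis t) = t" using Arg_rcis[of t s] t elim s by (simp add: rcis_def)
        then have "of_real s * cis t \<in> carleson_square z \<longleftrightarrow> P t"
          using True s z by (simp add: carleson_square_def P_def \<delta>_def norm_mult)
        then show ?thesis by (simp add: F_def indicator_def)
      qed simp
    qed
  qed
  also have "\<dots> = (\<integral>\<^sup>+t\<in>{-pi..pi}. F (Arg z + t) \<partial>lborel)"
    by (rule nn_integral_periodic_shift[symmetric]) (auto simp: per)
  also have "\<dots> = (\<integral>\<^sup>+t. indicator {-\<delta><..<\<delta>} t \<partial>lborel)"
  proof (rule nn_integral_cong)
    fix t :: real
    have "P (Arg z + t) \<longleftrightarrow> t \<in> {-\<delta><..<\<delta>}" if t: "t \<in> {-pi..pi}"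
    proof
      assume "P (Arg z + t)"
      then obtain k :: int where k: "\<bar>t + 2 * pi * of_int k\<bar> < \<delta>" by (auto simp: P_def)
      have "k = 0"
      proof (rule ccontr)
        assume "k \<noteq> 0"
        then have "1 \<le> \<bar>of_int k :: real\<bar>" by linarith
        then have "2 * pi * 1 \<le> 2 * pi * \<bar>of_int k :: real\<bar>" by (intro mult_left_mono) auto
        also have "\<dots> = \<bar>2 * pi * of_int k\<bar>" by (simp add: abs_mult)
        finally have "2 * pi \<le> \<bar>2 * pi * of_int k\<bar>" by simp
        moreover have "\<bar>2 * pi * of_int k\<bar> \<le> \<bar>t + 2 * pi * of_int k\<bar> + \<bar>t\<bar>" by linarith
        moreover have "\<bar>t\<bar> \<le> pi" using t by auto
        ultimately show False using k \<delta> by linarith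
      qed
      then show "t \<in> {-\<delta><..<\<delta>}" using k by auto
    next
      assume "t \<in> {-\<delta><..<\<delta>}"
      then show "P (Arg z + t)" unfolding P_def by (intro exI[of _ 0]) auto
    qed
    moreover have "t \<in> {-pi..pi}" if "t \<in> {-\<delta><..<\<delta>}" using that \<delta> by auto
    ultimately show "F (Arg z + t) * indicator {-pi..pi} t = indicator {-\<delta><..<\<delta>} t"
      by (cases "t \<in> {-pi..pi}") (auto simp: F_def indicator_def)
  qed
  also have "\<dots> = emeasure lborel {-\<delta><..<\<delta>}" by simp
  also have "\<dots> = ennreal (1 - norm z)" using \<delta> by (subst emeasure_lborel_Ioo) (auto simp: \<delta>_def field_simps)
  finally show ?thesis using True s by simp
qed

lemma pseudohyperbolic_disc_subset: "pseudohyperbolic_disc a r \<subseteq> unit_disc"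
  by (auto simp: pseudohyperbolic_disc_def)

lemma sets_pseudohyperbolic_relation [measurable]:
  "{x. fst x \<in> unit_disc \<and> snd x \<in> pseudohyperbolic_disc (fst x) r} \<in> sets (borel \<Otimes>\<^sub>M (borel :: complex measure))"
proof -
  have "{x \<in> space (borel \<Otimes>\<^sub>M (borel :: complex measure)). fst x \<in> unit_disc \<and> snd x \<in> unit_disc \<and>
      norm ((fst x - snd x) / (1 - cnj (fst x) * snd x)) < r} \<in> sets (borel \<Otimes>\<^sub>M (borel :: complex measure))"
    by measurable
  then show ?thesis by (simp add: pseudohyperbolic_disc_def space_pair_measure)
qed

lemma sets_pseudohyperbolic_disc [measurable]: "pseudohyperbolic_disc a r \<in> sets borel"
proof -
  have "{z. z \<in> unit_disc \<and> norm ((a - z) / (1 - cnj a * z)) < r} \<in> sets borel" by measurable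
  then show ?thesis by (simp add: pseudohyperbolic_disc_def)
qed

text \<open>With N = |1 - cnj z w|, the Blaschke identity for R = 1 gives N^2 (1 - r^2) <= 4 (1 -
  |w|) (1 - |z|). Since N is at least 1 - |w| and at least 1 - |z|, one factor can be cancelled in
  either way.\<close>

lemma pseudohyperbolic_disc_bounds:
  assumes r: "0 < r" "r < 1" and z: "z \<in> unit_disc" and w: "w \<in> pseudohyperbolic_disc z r"
  shows "norm (1 - cnj z * w) \<le> 4 / (1 - r\<^sup>2) * (1 - norm z)" "1 - norm z \<le> 4 / (1 - r\<^sup>2) * (1 - norm w)"
proof -
  have w1: "w \<in> unit_disc" and d: "norm ((z - w) / (1 - cnj z * w)) < r"
    using w by (auto simp: pseudohyperbolic_disc_def)
  define N where "N = norm (1 - cnj z * w)"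
  have N: "1 - norm z \<le> N" "1 - norm w \<le> N" "0 < N"
    using one_minus_cnj_mult_bounds z w1 unfolding N_def
    by (auto simp: norm_mult)
  have r2: "0 < 1 - r\<^sup>2" using r by (simp add: power_less_one_iff)
  have "norm (w - z) < r * N" using d N(3) by (simp add: norm_divide N_def norm_minus_commute field_simps)
  then have "(norm (w - z))\<^sup>2 \<le> (r * N)\<^sup>2" by (intro power_mono) auto
  then have "N\<^sup>2 - (r * N)\<^sup>2 \<le> (1 - (norm w)\<^sup>2) * (1 - (norm z)\<^sup>2)"
    using blaschke_factor_identity[of 1 z w] by (simp add: N_def)
  also have "\<dots> \<le> (2 * (1 - norm w)) * (2 * (1 - norm z))"
  proof (rule mult_mono)
    have "1 - t\<^sup>2 \<le> 2 * (1 - t)" for t :: real using zero_le_power2[of "1 - t"] by (simp add: power2_eq_square algebra_simps)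
    then show "1 - (norm w)\<^sup>2 \<le> 2 * (1 - norm w)" "1 - (norm z)\<^sup>2 \<le> 2 * (1 - norm z)" by auto
  qed (use z w1 in \<open>auto simp: power_le_one\<close>)
  finally have main: "N * N * (1 - r\<^sup>2) \<le> 4 * ((1 - norm w) * (1 - norm z))"
    by (simp add: power_mult_distrib power2_eq_square algebra_simps)
  have "N * (N * (1 - r\<^sup>2)) \<le> N * (4 * (1 - norm z))"
  proof -
    have "(1 - norm w) * (4 * (1 - norm z)) \<le> N * (4 * (1 - norm z))"
      using z by (intro mult_right_mono N(2)) auto
    then show ?thesis using main by linarith
  qed
  then have "N * (1 - r\<^sup>2) \<le> 4 * (1 - norm z)" using N(3) by simp
  then show "norm (1 - cnj z * w) \<le> 4 / (1 - r\<^sup>2) * (1 - norm z)" using r2 by (simp add: N_def field_simps)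
  have "(1 - norm z) * (1 - norm z) * (1 - r\<^sup>2) \<le> N * N * (1 - r\<^sup>2)"
    using N z r2 by (intro mult_right_mono mult_mono) auto
  also note main
  finally have "(1 - norm z) * ((1 - norm z) * (1 - r\<^sup>2)) \<le> (1 - norm z) * (4 * (1 - norm w))"
    by (simp only: mult_ac)
  then have "(1 - norm z) * (1 - r\<^sup>2) \<le> 4 * (1 - norm w)" using z by simp
  then show "1 - norm z \<le> 4 / (1 - r\<^sup>2) * (1 - norm w)" using r2 by (simp add: field_simps)
qed

text \<open>A Euclidean ball around z becomes a condition on the pseudohyperbolic disc around w:
  this is the exchange of centre and point that goes with Fubini's theorem.\<close>

lemma mem_pseudohyperbolic_disc_if_near:
  assumes "z \<in> unit_disc" "w \<in> unit_disc" and d: "norm (w - z) < r * (1 - norm z)"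
  shows "z \<in> pseudohyperbolic_disc w r"
proof -
  have N: "1 - norm z \<le> norm (1 - cnj w * z)" "0 < norm (1 - cnj w * z)"
    using one_minus_cnj_mult_bounds assms by auto
  have "0 \<le> norm (w - z)" by simp
  then have "0 < r * (1 - norm z)" using d by linarith
  then have "0 < r" using assms by (simp add: zero_less_mult_iff)
  then have "norm (w - z) < r * norm (1 - cnj w * z)"
    using d N(1) by (meson less_le_trans mult_left_mono less_imp_le)
  then show ?thesis using assms N(2) by (simp add: pseudohyperbolic_disc_def norm_divide field_simps)
qed

context doubling_profile
begin

text \<open>At the origin the square is the whole disc, with opening 2 pi instead of 1 - |z|, which
  accounts for the two constants; the division by pi is the normalization of the area.\<close>

lemma carleson_square_emeasure:
  assumes \<omega>: "AE z in area. \<omega> z = g (norm z)" "\<omega> \<in> borel_measurable area" and z: "z \<in> unit_disc"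
  shows "emeasure (weighted_area (\<lambda>x. ennreal (\<omega> x))) (carleson_square z)
    = ennreal (if z = 0 then 2 else (1 - norm z) / pi) * (\<integral>\<^sup>+s\<in>{norm z..<1}. ennreal s * ennreal (g s) \<partial>lborel)"
proof -
  let ?S = "carleson_square z"
  have SA: "?S \<in> sets area" using carleson_square_subset[of z] by (auto simp: sets_restrict_space_iff)
  define F :: "complex \<Rightarrow> ennreal" where "F = (\<lambda>\<zeta>. ennreal (g (norm \<zeta>)) * indicator ?S \<zeta>)"
  have [measurable]: "F \<in> borel_measurable borel" unfolding F_def by measurable
  have "emeasure (weighted_area (\<lambda>x. ennreal (\<omega> x))) ?S = (\<integral>\<^sup>+\<zeta>. ennreal (\<omega> \<zeta>) * indicator ?S \<zeta> \<partial>area)"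
    unfolding weighted_area_def using \<omega>(2) SA by (intro emeasure_density) auto
  also have "\<dots> = (\<integral>\<^sup>+\<zeta>. F \<zeta> \<partial>area)"
    using \<omega>(1) by (intro nn_integral_cong_AE) (auto simp: F_def)
  also have "\<dots> = ennreal (1 / pi) * (\<integral>\<^sup>+\<zeta>\<in>unit_disc. F \<zeta> \<partial>lborel)" by (rule nn_integral_area) measurable
  also have "(\<integral>\<^sup>+\<zeta>\<in>unit_disc. F \<zeta> \<partial>lborel) = (\<integral>\<^sup>+s\<in>{0..<1}. ennreal s * (\<integral>\<^sup>+t\<in>{-pi..pi}. F (of_real s * cis t) \<partial>lborel) \<partial>lborel)"
    by (rule nn_integral_polar) measurable
  also have "\<dots> = (\<integral>\<^sup>+s. ennreal (if z = 0 then 2 * pi else 1 - norm z) * (ennreal s * ennreal (g s) * indicator {norm z..<1} s) \<partial>lborel)"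
  proof (rule nn_integral_cong_AE)
    have "AE s in lborel. s \<noteq> (0::real) \<and> s \<noteq> norm z"
      using AE_lborel_singleton[of "0::real"] AE_lborel_singleton[of "norm z"] by eventually_elim simp
    then show "AE s in lborel. ennreal s * (\<integral>\<^sup>+t\<in>{-pi..pi}. F (of_real s * cis t) \<partial>lborel) * indicator {0..<1} s
      = ennreal (if z = 0 then 2 * pi else 1 - norm z) * (ennreal s * ennreal (g s) * indicator {norm z..<1} s)"
    proof eventually_elim
      case (elim s)
      show ?case
      proof (cases "s \<in> {0..<1}")
        case False
        then have "s \<notin> {norm z..<1}" using order_trans[OF norm_ge_zero[of z], of s] by auto
        then show ?thesis using False by simp
      next
        case True
        then have s: "0 < s" "s < 1" using elim by auto
        have "(\<integral>\<^sup>+t\<in>{-pi..pi}. F (of_real s * cis t) \<partial>lborel)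
          = (\<integral>\<^sup>+t. ennreal (g s) * (indicator ?S (of_real s * cis t) * indicator {-pi..pi} t) \<partial>lborel)"
          using s by (intro nn_integral_cong) (auto simp: F_def norm_mult mult_ac)
        also have "\<dots> = ennreal (g s) * (\<integral>\<^sup>+t\<in>{-pi..pi}. indicator ?S (of_real s * cis t) \<partial>lborel)"
          by (intro nn_integral_cmult) measurable
        also have "(\<integral>\<^sup>+t\<in>{-pi..pi}. indicator ?S (of_real s * cis t) \<partial>lborel) =
          ennreal (if z = 0 then 2 * pi else 1 - norm z) * indicator {norm z..<1} s"
        proof (cases "z = 0")
          case zz: True
          have "(\<integral>\<^sup>+t\<in>{-pi..pi}. indicator ?S (of_real s * cis t) \<partial>lborel) = (\<integral>\<^sup>+t. indicator {-pi..pi} t \<partial>lborel)"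
            using s zz by (intro nn_integral_cong) (auto simp: carleson_square_def norm_mult indicator_def)
          then show ?thesis using zz s by simp
        next
          case False
          then show ?thesis using angular_measure_carleson_square[OF z False s] elim by simp
        qed
        finally show ?thesis using True by (simp add: mult_ac)
      qed
    qed
  qed
  also have "\<dots> = ennreal (if z = 0 then 2 * pi else 1 - norm z) * (\<integral>\<^sup>+s\<in>{norm z..<1}. ennreal s * ennreal (g s) \<partial>lborel)"
    by (intro nn_integral_cmult) measurable
  also have "ennreal (1 / pi) * (ennreal (if z = 0 then 2 * pi else 1 - norm z) * (\<integral>\<^sup>+s\<in>{norm z..<1}. ennreal s * ennreal (g s) \<partial>lborel))
     = ennreal (if z = 0 then 2 else (1 - norm z) / pi) * (\<integral>\<^sup>+s\<in>{norm z..<1}. ennreal s * ennreal (g s) \<partial>lborel)"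
    using z by (simp add: mult.assoc[symmetric] flip: ennreal_mult)
  finally show ?thesis .
qed

text \<open>Up to a constant, the mass of a square is 1 - |z| times the integral of s g(s) beyond
  |z|, while (1 - |z|)^2 \<open>W (norm z)\<close> is 1 - |z| times the tail \<open>h\<close>. The
  factor s is at most 1, and near the origin doubling replaces the tail by the one beyond 1 / 2,
  where s is bounded below.\<close>

lemma carleson_square_measure_bounds:
  assumes \<omega>: "AE z in area. \<omega> z = g (norm z)" "\<omega> \<in> borel_measurable area"
  obtains c where "0 < c" "\<And>z. z \<in> unit_disc \<Longrightarrow>
    c * ((1 - norm z)\<^sup>2 * W (norm z)) \<le> measure (weighted_area (\<lambda>x. ennreal (\<omega> x))) (carleson_square z)"
    "\<And>z. z \<in> unit_disc \<Longrightarrow>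
    measure (weighted_area (\<lambda>x. ennreal (\<omega> x))) (carleson_square z) \<le> 2 * ((1 - norm z)\<^sup>2 * W (norm z))"
proof -
  \<comment> \<open>The cost of moving the tail from r <= 1 / 2 to 1 / 2.\<close>
  define B where "B = C * 2 powr b"
  have B: "0 < B" "1 \<le> B" using C_ge_1 \<alpha>_pos \<alpha>_le_b ge_one_powr_ge_zero[of 2 b] mult_mono[of 1 C 1 "2 powr b"] by (auto simp: B_def)
  have hB: "h r \<le> B * h (max r (1 / 2))" if "0 \<le> r" "r < 1" for r
  proof (cases "r \<le> 1 / 2")
    case True
    have "h r \<le> C * ((1 - r) / (1 - 1 / 2)) powr b * h (1 / 2)" using upper[of r "1 / 2"] True that by simp
    also have "\<dots> \<le> C * 2 powr b * h (1 / 2)"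
      using that True C_ge_1 \<alpha>_pos \<alpha>_le_b h_pos[of "1 / 2"] by (intro mult_right_mono mult_left_mono powr_mono2) auto
    finally show ?thesis using True by (simp add: B_def max_def)
  next
    case False
    then show ?thesis using mult_right_mono[OF B(2), of "h r"] h_pos[of r] that by (simp add: max_def)
  qed
  define T where "T = (\<lambda>r. \<integral>\<^sup>+s\<in>{r..<1}. ennreal s * ennreal (g s) \<partial>lborel)"
  have Tup: "T r \<le> ennreal (h r)" if "0 \<le> r" "r < 1" for r
  proof -
    have "T r \<le> (\<integral>\<^sup>+s\<in>{r..<1}. ennreal (g s) \<partial>lborel)" unfolding T_def
    proof (rule nn_integral_mono)
      fix s :: real
      show "ennreal s * ennreal (g s) * indicator {r..<1} s \<le> ennreal (g s) * indicator {r..<1} s"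
        using mult_right_mono[of "ennreal s" 1 "ennreal (g s)"] by (auto simp: indicator_def)
    qed
    then show ?thesis using that by (simp add: tail)
  qed
  have Tlo: "ennreal (h r / (2 * B)) \<le> T r" if "0 \<le> r" "r < 1" for r
  proof -
    let ?m = "max r (1 / 2)"
    have "h r / (2 * B) \<le> 1 / 2 * h ?m" using hB[OF that] B by (simp add: field_simps)
    then have "ennreal (h r / (2 * B)) \<le> ennreal (1 / 2 * h ?m)" by (rule ennreal_leI)
    also have "\<dots> = ennreal (1 / 2) * ennreal (h ?m)" using that h_pos[of ?m] by (intro ennreal_mult) (auto simp: less_imp_le)
    also have "\<dots> = ennreal (1 / 2) * (\<integral>\<^sup>+s\<in>{?m..<1}. ennreal (g s) \<partial>lborel)"
      using that by (subst tail) auto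
    also have "\<dots> = (\<integral>\<^sup>+s. ennreal (1 / 2) * (ennreal (g s) * indicator {?m..<1} s) \<partial>lborel)"
      by (intro nn_integral_cmult[symmetric]) measurable
    also have "\<dots> \<le> T r" unfolding T_def
    proof (rule nn_integral_mono)
      fix s :: real
      show "ennreal (1 / 2) * (ennreal (g s) * indicator {?m..<1} s) \<le> ennreal s * ennreal (g s) * indicator {r..<1} s"
      proof (cases "s \<in> {?m..<1}")
        case True
        then have s: "s \<in> {r..<1}" "1 / 2 \<le> s" by auto
        have "ennreal (1 / 2) * ennreal (g s) \<le> ennreal s * ennreal (g s)"
          by (intro mult_right_mono ennreal_leI s) auto
        then show ?thesis using True s(1) by (simp only: indicator_simps mult_1_right)
      qed simp
    qed
    finally show ?thesis .
  qed
  have main: "1 / (2 * B * pi) * ((1 - norm z)\<^sup>2 * W (norm z)) \<le> measure (weighted_area (\<lambda>x. ennreal (\<omega> x))) (carleson_square z) \<and>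
    measure (weighted_area (\<lambda>x. ennreal (\<omega> x))) (carleson_square z) \<le> 2 * ((1 - norm z)\<^sup>2 * W (norm z))" if z: "z \<in> unit_disc" for z
  proof -
    define k where "k = (if z = 0 then 2 else (1 - norm z) / pi)"
    have k: "0 < k" "(1 - norm z) / pi \<le> k" "k \<le> 2 * (1 - norm z)"
    proof -
      have "(1 - norm z) / pi \<le> (1 - norm z) / 1"
        using z pi_gt3 by (intro divide_left_mono) auto
      moreover have "1 / pi \<le> 2" using pi_gt3 by (simp add: divide_le_eq)
      ultimately show "(1 - norm z) / pi \<le> k" "k \<le> 2 * (1 - norm z)" "0 < k"
        using z pi_gt3 by (auto simp: k_def)
    qed
    have hz: "0 < h (norm z)" using z h_pos[of "norm z"] by simp
    have Wz: "(1 - norm z)\<^sup>2 * W (norm z) = (1 - norm z) * h (norm z)"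
      using z by (simp add: W_def power2_eq_square)
    obtain t where t: "T (norm z) = ennreal t" "0 \<le> t"
      using Tup[of "norm z"] z by (cases "T (norm z)") (auto simp: top_unique)
    have t2: "h (norm z) / (2 * B) \<le> t" "t \<le> h (norm z)"
      using Tlo[of "norm z"] Tup[of "norm z"] z t hz by (auto simp: ennreal_le_iff less_imp_le)
    have "emeasure (weighted_area (\<lambda>x. ennreal (\<omega> x))) (carleson_square z) = ennreal (k * t)"
      using carleson_square_emeasure[OF \<omega> z] t k by (simp add: k_def T_def flip: ennreal_mult)
    then have m: "measure (weighted_area (\<lambda>x. ennreal (\<omega> x))) (carleson_square z) = k * t"
      using k t by (simp add: measure_def)
    have "1 / (2 * B * pi) * ((1 - norm z) * h (norm z)) = (1 - norm z) / pi * (h (norm z) / (2 * B))" by simp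
    also have "\<dots> \<le> k * t" using k t2 hz B by (intro mult_mono) auto
    finally have 1: "1 / (2 * B * pi) * ((1 - norm z) * h (norm z)) \<le> k * t" .
    have "k * t \<le> 2 * (1 - norm z) * h (norm z)" using k t2 t z by (intro mult_mono) auto
    then show ?thesis using 1 unfolding m Wz mult.assoc by blast
  qed
  show ?thesis using that[of "1 / (2 * B * pi)"] main B by auto
qed

end

section \<open>Derivatives integrated against a measure\<close>

lemma measurable_measure_pseudohyperbolic_disc:
  fixes m :: "complex measure"
  assumes "finite_measure m" and sets: "sets m = sets borel"
  shows "(\<lambda>z. indicator unit_disc z * measure m (pseudohyperbolic_disc z r)) \<in> borel_measurable borel"
proof -
  interpret finite_measure m by fact
  define Q where "Q = {x. fst x \<in> unit_disc \<and> snd x \<in> pseudohyperbolic_disc (fst x) r}"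
  have Q: "Q \<in> sets (borel \<Otimes>\<^sub>M m)"
    using sets_pseudohyperbolic_relation[of r] by (simp add: Q_def sets cong: sets_pair_measure_cong)
  have "(\<lambda>z. emeasure m (Pair z -` Q)) \<in> borel_measurable borel" by (rule measurable_emeasure_Pair[OF Q])
  then have "(\<lambda>z. enn2real (emeasure m (Pair z -` Q))) \<in> borel_measurable borel" by measurable
  moreover have "enn2real (emeasure m (Pair z -` Q)) = indicator unit_disc z * measure m (pseudohyperbolic_disc z r)" for z
    by (cases "z \<in> unit_disc") (auto simp: Q_def vimage_def measure_def)
  ultimately show ?thesis by simp
qed

text \<open>Each value of \<open>(deriv ^^ n) f\<close> is controlled by an area integral over a small disc; interchanging the
  integrals turns these discs into pseudohyperbolic discs around the area variable.\<close>

lemma higher_deriv_integral_le: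
  fixes m :: "complex measure"
  assumes fin: "finite_measure m" and sets: "sets m = sets borel" and disc: "AE z in m. z \<in> unit_disc"
    and q: "0 < q" and r: "0 < r" "r < 1"
  obtains K where "0 < K" "\<And>f. f holomorphic_on unit_disc \<Longrightarrow>
    (\<integral>\<^sup>+z. ennreal (norm ((deriv ^^ n) f z) powr q) \<partial>m)
      \<le> ennreal K * (\<integral>\<^sup>+w\<in>unit_disc. ennreal (norm (f w) powr q) *
          ennreal (measure m (pseudohyperbolic_disc w r) * (1 - norm w) powr (- (real n * q) - 2)) \<partial>lborel)"
proof -
  interpret m: finite_measure m by (rule fin)
  interpret pair: pair_sigma_finite m lborel ..
  obtain K1 where K1: "0 < K1" "\<And>f z \<rho>. f holomorphic_on ball z \<rho> \<Longrightarrow> 0 < \<rho> \<Longrightarrow>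
    ennreal (norm ((deriv ^^ n) f z) powr q)
      \<le> ennreal (K1 * \<rho> powr (- (real n * q) - 2)) * (\<integral>\<^sup>+w\<in>ball z \<rho>. ennreal (norm (f w) powr q) \<partial>lborel)"
    using powr_norm_higher_deriv_le[OF q, of n] by blast
  define e where "e = - (real n * q) - 2"
  have e: "e < 0" using mult_nonneg_nonneg[of "real n" q] q unfolding e_def by linarith
  \<comment> \<open>For |w - z| < r (1 - |z|) one has 1 - |w| <= 2 (1 - |z|), so the radius r (1 -
    |z|) is at least r / 2 times 1 - |w|. As e is negative, the distance of w to the boundary may
    replace that of z at the price of (r / 2) powr e.\<close>
  define K where "K = K1 * (r / 2) powr e"
  have K: "0 < K" using K1 r by (simp add: K_def)
  show ?thesis
  proof (rule that[OF K])
    fix f assume f: "f holomorphic_on unit_disc"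
    define F where "F = (\<lambda>w. ennreal (norm (f w) powr q) * indicator unit_disc w)"
    have F[measurable]: "F \<in> borel_measurable borel" unfolding F_def
      by (intro measurable_norm_powr_indicator holomorphic_on_imp_continuous_on f q) auto
    \<comment> \<open>Fubini's theorem asks for joint measurability in w and z, hence the relation
      as one Borel set of the product.\<close>
    define Q where "Q = {x. fst x \<in> unit_disc \<and> snd x \<in> pseudohyperbolic_disc (fst x) r}"
    have Q[measurable]: "Q \<in> sets (borel \<Otimes>\<^sub>M borel)" unfolding Q_def by (rule sets_pseudohyperbolic_relation)
    define G :: "complex \<Rightarrow> complex \<Rightarrow> ennreal" where "G = (\<lambda>z w. ennreal (K * (1 - norm w) powr e) * F w * indicator Q (w, z))"
    have G[measurable]: "(\<lambda>(z, w). G z w) \<in> borel_measurable (borel \<Otimes>\<^sub>M borel)" unfolding G_def by measurable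
    have pt: "ennreal (norm ((deriv ^^ n) f z) powr q) \<le> (\<integral>\<^sup>+w. G z w \<partial>lborel)" if z: "z \<in> unit_disc" for z
    proof -
      define \<rho> where "\<rho> = r * (1 - norm z)"
      have \<rho>: "0 < \<rho>" "\<rho> \<le> 1 - norm z" using r z by (auto simp: \<rho>_def mult_left_le_one_le)
      have sub: "ball z \<rho> \<subseteq> unit_disc"
      proof
        fix w assume "w \<in> ball z \<rho>"
        then have "norm (w - z) < \<rho>" by (simp add: dist_norm norm_minus_commute)
        then show "w \<in> unit_disc" using \<rho> norm_triangle_ineq[of z "w - z"] by simp
      qed
      have "ennreal (norm ((deriv ^^ n) f z) powr q) \<le> ennreal (K1 * \<rho> powr e) * (\<integral>\<^sup>+w\<in>ball z \<rho>. ennreal (norm (f w) powr q) \<partial>lborel)"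
        unfolding e_def by (rule K1(2)[OF holomorphic_on_subset[OF f sub] \<rho>(1)])
      also have "(\<integral>\<^sup>+w\<in>ball z \<rho>. ennreal (norm (f w) powr q) \<partial>lborel) = (\<integral>\<^sup>+w. F w * indicator (ball z \<rho>) w \<partial>lborel)"
        using sub by (intro nn_integral_cong) (auto simp: F_def indicator_def)
      also have "ennreal (K1 * \<rho> powr e) * \<dots> = (\<integral>\<^sup>+w. ennreal (K1 * \<rho> powr e) * (F w * indicator (ball z \<rho>) w) \<partial>lborel)"
        by (intro nn_integral_cmult[symmetric] borel_measurable_times_ennreal borel_measurable_indicator) auto
      also have "\<dots> \<le> (\<integral>\<^sup>+w. G z w \<partial>lborel)"
      proof (rule nn_integral_mono)
        fix w
        show "ennreal (K1 * \<rho> powr e) * (F w * indicator (ball z \<rho>) w) \<le> G z w"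
        proof (cases "w \<in> ball z \<rho>")
          case True
          then have w1: "w \<in> unit_disc" using sub by blast
          have d: "norm (w - z) < r * (1 - norm z)" using True by (simp add: dist_norm norm_minus_commute \<rho>_def)
          then have "(w, z) \<in> Q"
            using mem_pseudohyperbolic_disc_if_near[OF z w1 d] w1 by (simp add: Q_def)
          moreover have "K1 * \<rho> powr e \<le> K * (1 - norm w) powr e"
          proof -
            have "norm (w - z) \<le> 1 - norm z" using True \<rho> by (simp add: dist_norm norm_minus_commute)
            then have "1 - norm w \<le> 2 * (1 - norm z)"
              using norm_triangle_ineq2[of z "z - w"] norm_triangle_ineq[of w "z - w"] by (simp add: norm_minus_commute)
            then have "r / 2 * (1 - norm w) \<le> \<rho>" using r by (simp add: \<rho>_def)
            then have "\<rho> powr e \<le> (r / 2 * (1 - norm w)) powr e"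
              using e r w1 by (intro powr_mono2') auto
            also have "\<dots> = (r / 2) powr e * (1 - norm w) powr e" by (rule powr_mult)
            finally show ?thesis using K1(1) by (simp add: K_def mult.assoc)
          qed
          ultimately show ?thesis using True by (simp add: G_def ennreal_leI mult_right_mono)
        qed simp
      qed
      finally show ?thesis .
    qed
    have "(\<integral>\<^sup>+z. ennreal (norm ((deriv ^^ n) f z) powr q) \<partial>m) \<le> (\<integral>\<^sup>+z. (\<integral>\<^sup>+w. G z w \<partial>lborel) \<partial>m)"
      using disc by (intro nn_integral_mono_AE) (auto elim!: eventually_mono intro: pt)
    also have "\<dots> = (\<integral>\<^sup>+w. (\<integral>\<^sup>+z. G z w \<partial>m) \<partial>lborel)"
    proof (rule pair.Fubini'[symmetric])
      have "sets (m \<Otimes>\<^sub>M (lborel::complex measure)) = sets (borel \<Otimes>\<^sub>M borel)"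
        by (intro sets_pair_measure_cong) (auto simp: sets)
      then show "(\<lambda>(z, w). G z w) \<in> borel_measurable (m \<Otimes>\<^sub>M lborel)"
        using G by (simp cong: measurable_cong_sets)
    qed
    also have "\<dots> = (\<integral>\<^sup>+w. ennreal K * (ennreal (norm (f w) powr q) *
          ennreal (measure m (pseudohyperbolic_disc w r) * (1 - norm w) powr (- (real n * q) - 2)) * indicator unit_disc w) \<partial>lborel)"
    proof (rule nn_integral_cong)
      fix w
      show "(\<integral>\<^sup>+z. G z w \<partial>m) = ennreal K * (ennreal (norm (f w) powr q) *
          ennreal (measure m (pseudohyperbolic_disc w r) * (1 - norm w) powr (- (real n * q) - 2)) * indicator unit_disc w)"
      proof (cases "w \<in> unit_disc")
        case True
        have "(\<integral>\<^sup>+z. G z w \<partial>m) = (\<integral>\<^sup>+z. (ennreal (K * (1 - norm w) powr e) * F w) * indicator (pseudohyperbolic_disc w r) z \<partial>m)"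
          using True by (intro nn_integral_cong) (auto simp: G_def Q_def indicator_def)
        also have "\<dots> = (ennreal (K * (1 - norm w) powr e) * F w) * emeasure m (pseudohyperbolic_disc w r)"
          by (intro nn_integral_cmult_indicator) (simp add: sets)
        also have "\<dots> = ennreal K * (ennreal (norm (f w) powr q) * ennreal (measure m (pseudohyperbolic_disc w r) * (1 - norm w) powr e))"
          using True K by (simp add: F_def m.emeasure_eq_measure ennreal_mult mult_ac)
        finally show ?thesis using True by (simp add: e_def)
      qed (simp add: G_def F_def)
    qed
    also have "\<dots> = ennreal K * (\<integral>\<^sup>+w\<in>unit_disc. ennreal (norm (f w) powr q) *
          ennreal (measure m (pseudohyperbolic_disc w r) * (1 - norm w) powr (- (real n * q) - 2)) \<partial>lborel)"
    proof (rule nn_integral_cmult)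
      have [measurable]: "(\<lambda>w. indicator unit_disc w * measure m (pseudohyperbolic_disc w r)) \<in> borel_measurable borel"
        by (rule measurable_measure_pseudohyperbolic_disc[OF fin sets])
      have "(\<lambda>w. F w * ennreal (indicator unit_disc w * measure m (pseudohyperbolic_disc w r) * (1 - norm w) powr (- (real n * q) - 2))) \<in> borel_measurable borel"
        by measurable
      moreover have "F w * ennreal (indicator unit_disc w * measure m (pseudohyperbolic_disc w r) * (1 - norm w) powr (- (real n * q) - 2))
        = ennreal (norm (f w) powr q) * ennreal (measure m (pseudohyperbolic_disc w r) * (1 - norm w) powr (- (real n * q) - 2)) * indicator unit_disc w" for w
        by (auto simp: F_def indicator_def)
      ultimately show "(\<lambda>w. ennreal (norm (f w) powr q) * ennreal (measure m (pseudohyperbolic_disc w r) * (1 - norm w) powr (- (real n * q) - 2)) * indicator unit_disc w) \<in> borel_measurable lborel"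
        by simp
    qed
    finally show "(\<integral>\<^sup>+z. ennreal (norm ((deriv ^^ n) f z) powr q) \<partial>m)
      \<le> ennreal K * (\<integral>\<^sup>+w\<in>unit_disc. ennreal (norm (f w) powr q) *
          ennreal (measure m (pseudohyperbolic_disc w r) * (1 - norm w) powr (- (real n * q) - 2)) \<partial>lborel)" .
  qed
qed

section \<open>Random signs\<close>

text \<open>\<open>\<sigma>\<close> is the set of indices with a positive sign. The sign patterns
  are paired by flipping the sign at j; the two sums of a pair differ by 2 v j up to sign, so one of
  them has modulus at least |v j|. Bounding by both powers of a pair and summing over all patterns
  counts each pattern twice, whence the factor 2.\<close>

lemma sum_signs_powr_ge:
  fixes v :: "'i \<Rightarrow> complex"
  assumes A: "finite A" "j \<in> A" and q: "0 < q"
  shows "2 ^ card A * norm (v j) powr q \<le> 2 * (\<Sum>\<sigma>\<in>Pow A. norm (\<Sum>a\<in>A. if a \<in> \<sigma> then v a else - v a) powr q)"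
proof -
  define S where "S = (\<lambda>\<sigma>. \<Sum>a\<in>A. if a \<in> \<sigma> then v a else - v a)"
  define \<tau> where "\<tau> = (\<lambda>\<sigma>. if j \<in> \<sigma> then \<sigma> - {j} else insert j \<sigma>)"
  have bij: "bij_betw \<tau> (Pow A) (Pow A)"
    by (rule bij_betw_byWitness[where f'=\<tau>]) (use A in \<open>auto simp: \<tau>_def\<close>)
  have pair: "norm (v j) powr q \<le> norm (S \<sigma>) powr q + norm (S (\<tau> \<sigma>)) powr q" for \<sigma>
  proof -
    define X where "X = (\<Sum>a\<in>A - {j}. if a \<in> \<sigma> then v a else - v a)"
    have 1: "S \<sigma> = (if j \<in> \<sigma> then v j else - v j) + X"
      unfolding S_def X_def by (rule sum.remove[OF A])
    have "S (\<tau> \<sigma>) = (if j \<in> \<tau> \<sigma> then v j else - v j) + (\<Sum>a\<in>A - {j}. if a \<in> \<tau> \<sigma> then v a else - v a)"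
      unfolding S_def by (rule sum.remove[OF A])
    also have "(\<Sum>a\<in>A - {j}. if a \<in> \<tau> \<sigma> then v a else - v a) = X"
      unfolding X_def by (intro sum.cong) (auto simp: \<tau>_def)
    finally have 2: "S (\<tau> \<sigma>) = (if j \<in> \<sigma> then - v j else v j) + X" by (auto simp: \<tau>_def)
    have "S \<sigma> - S (\<tau> \<sigma>) = (if j \<in> \<sigma> then 2 * v j else - (2 * v j))" unfolding 1 2 by auto
    then have "norm (S \<sigma> - S (\<tau> \<sigma>)) = 2 * norm (v j)" by (auto simp: norm_mult)
    then have "2 * norm (v j) \<le> norm (S \<sigma>) + norm (S (\<tau> \<sigma>))"
      using norm_triangle_ineq4[of "S \<sigma>" "S (\<tau> \<sigma>)"] by simp
    then consider "norm (v j) \<le> norm (S \<sigma>)" | "norm (v j) \<le> norm (S (\<tau> \<sigma>))" by linarith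
    then show ?thesis
    proof cases
      case 1
      then have "norm (v j) powr q \<le> norm (S \<sigma>) powr q" using q by (intro powr_mono2) auto
      then show ?thesis by (simp add: add_increasing2)
    next
      case 2
      then have "norm (v j) powr q \<le> norm (S (\<tau> \<sigma>)) powr q" using q by (intro powr_mono2) auto
      then show ?thesis by (simp add: add_increasing)
    qed
  qed
  have "2 ^ card A * norm (v j) powr q = (\<Sum>\<sigma>\<in>Pow A. norm (v j) powr q)" using A by (simp add: card_Pow)
  also have "\<dots> \<le> (\<Sum>\<sigma>\<in>Pow A. norm (S \<sigma>) powr q + norm (S (\<tau> \<sigma>)) powr q)" by (intro sum_mono pair)
  also have "\<dots> = (\<Sum>\<sigma>\<in>Pow A. norm (S \<sigma>) powr q) + (\<Sum>\<sigma>\<in>Pow A. norm (S (\<tau> \<sigma>)) powr q)" by (rule sum.distrib)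
  also have "(\<Sum>\<sigma>\<in>Pow A. norm (S (\<tau> \<sigma>)) powr q) = (\<Sum>\<sigma>\<in>Pow A. norm (S \<sigma>) powr q)"
    by (rule sum.reindex_bij_betw[OF bij])
  finally show ?thesis by (simp add: S_def)
qed

text \<open>Contains \<open>pseudohyperbolic_disc z r\<close> for all \<open>z\<close> close to \<open>a\<close>, if \<open>\<kappa>\<close> is large in terms of \<open>r\<close>.\<close>

definition enlarged_disc :: "real \<Rightarrow> complex \<Rightarrow> complex set"
  where "enlarged_disc \<kappa> a = {w \<in> unit_disc. norm (1 - cnj a * w) \<le> \<kappa> * (1 - norm a) \<and> 1 - norm a \<le> \<kappa> * (1 - norm w)}"

lemma sets_enlarged_disc [measurable]: "enlarged_disc \<kappa> a \<in> sets borel"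
proof -
  have "{w. w \<in> unit_disc \<and> norm (1 - cnj a * w) \<le> \<kappa> * (1 - norm a) \<and> 1 - norm a \<le> \<kappa> * (1 - norm w)} \<in> sets borel"
    by measurable
  then show ?thesis by (simp add: enlarged_disc_def)
qed

text \<open>Every a that is counted contributes at least 1 / (\<kappa>^4 (1 - |w|)) to the separated
  sum with exponents 2 and 3, and that sum is at most D / (1 - |w|).\<close>

lemma enlarged_disc_overlap:
  assumes \<delta>: "0 < \<delta>" "\<delta> \<le> 1 / 2" and \<kappa>: "1 \<le> \<kappa>"
  obtains M where "0 < M" "\<And>A w. finite A \<Longrightarrow> A \<subseteq> unit_disc \<Longrightarrow>
    disjoint_family_on (\<lambda>a. ball a (\<delta> * (1 - norm a))) A \<Longrightarrow> w \<in> unit_disc \<Longrightarrow>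
    real (card {a \<in> A. w \<in> enlarged_disc \<kappa> a}) \<le> M"
proof -
  obtain D where D: "0 < D" "\<And>A z. finite A \<Longrightarrow> A \<subseteq> unit_disc \<Longrightarrow>
    disjoint_family_on (\<lambda>a. ball a (\<delta> * (1 - norm a))) A \<Longrightarrow> z \<in> unit_disc \<Longrightarrow>
    (\<Sum>a\<in>A. (1 - norm a) powr 2 * norm (1 - cnj a * z) powr (- 3)) \<le> D * (1 - norm z) powr (2 - 3)"
    by (rule separated_sum_le[of 2 3 \<delta>]) (use \<delta> in auto)
  show ?thesis
  proof (rule that[of "D * \<kappa> ^ 4"])
    show "0 < D * \<kappa> ^ 4" using D \<kappa> by simp
    fix A w assume A: "finite A" "A \<subseteq> unit_disc" "disjoint_family_on (\<lambda>a. ball a (\<delta> * (1 - norm a))) A" and w: "w \<in> unit_disc"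
    let ?B = "{a \<in> A. w \<in> enlarged_disc \<kappa> a}"
    define x where "x = 1 - norm w"
    have x: "0 < x" using w by (simp add: x_def)
    have "real (card ?B) * (1 / (\<kappa> ^ 4 * x)) = (\<Sum>a\<in>?B. 1 / (\<kappa> ^ 4 * x))" by simp
    also have "\<dots> \<le> (\<Sum>a\<in>?B. (1 - norm a) powr 2 * norm (1 - cnj a * w) powr (- 3))"
    proof (rule sum_mono)
      fix a assume a: "a \<in> ?B"
      then have a1: "a \<in> unit_disc" using A by auto
      define y where "y = 1 - norm a"
      have y: "0 < y" "y \<le> \<kappa> * x" using a a1 by (auto simp: y_def x_def enlarged_disc_def)
      define n where "n = norm (1 - cnj a * w)"
      have n: "0 < n" "n \<le> \<kappa> * y" using a one_minus_cnj_mult_bounds(3)[OF a1 w] by (auto simp: n_def y_def enlarged_disc_def)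
      have "n ^ 3 \<le> (\<kappa> * y) ^ 3" using n by (intro power_mono) auto
      also have "\<dots> = \<kappa> ^ 3 * y\<^sup>2 * y" by (simp add: power_mult_distrib power3_eq_cube power2_eq_square)
      also have "\<dots> \<le> \<kappa> ^ 3 * y\<^sup>2 * (\<kappa> * x)" using y \<kappa> by (intro mult_left_mono) auto
      finally have "n ^ 3 \<le> y\<^sup>2 * (\<kappa> ^ 4 * x)" by (simp add: power4_eq_xxxx power3_eq_cube mult_ac)
      then have "1 / (\<kappa> ^ 4 * x) \<le> y\<^sup>2 / n ^ 3" using n x \<kappa> by (simp add: field_simps)
      also have "\<dots> = y powr 2 * n powr (- 3)" using y n by (simp add: powr_minus_divide)
      finally show "1 / (\<kappa> ^ 4 * x) \<le> (1 - norm a) powr 2 * norm (1 - cnj a * w) powr (- 3)" by (simp add: y_def n_def)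
    qed
    also have "\<dots> \<le> (\<Sum>a\<in>A. (1 - norm a) powr 2 * norm (1 - cnj a * w) powr (- 3))"
      using A by (intro sum_mono2) auto
    also have "\<dots> \<le> D * x powr (2 - 3)" unfolding x_def by (rule D(2)[OF A w])
    also have "\<dots> = D * (1 / x)" using x by (simp add: powr_minus_divide)
    finally show "real (card ?B) \<le> D * \<kappa> ^ 4" using x \<kappa> by (simp add: field_simps)
  qed
qed

section \<open>Derivatives of the test functions and the discrete averages\<close>

context doubling_profile
begin

lemma has_field_derivative_inverse_power:
  fixes c z :: complex
  assumes "1 - c * z \<noteq> 0"
  shows "((\<lambda>z. 1 / (1 - c * z) ^ k) has_field_derivative of_nat k * c / (1 - c * z) ^ Suc k) (at z)"
proof (induction k)
  case (Suc k)
  have "((\<lambda>z. 1 / (1 - c * z)) has_field_derivative c / (1 - c * z)\<^sup>2) (at z)"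
    using assms by (auto intro!: derivative_eq_intros simp: power2_eq_square)
  from DERIV_mult[OF Suc this]
  have "((\<lambda>z. 1 / (1 - c * z) ^ k * (1 / (1 - c * z))) has_field_derivative
    of_nat k * c / (1 - c * z) ^ Suc k * (1 / (1 - c * z)) + c / (1 - c * z)\<^sup>2 * (1 / (1 - c * z) ^ k)) (at z)" .
  moreover have "of_nat k * c / (1 - c * z) ^ Suc k * (1 / (1 - c * z)) + c / (1 - c * z)\<^sup>2 * (1 / (1 - c * z) ^ k)
    = of_nat (Suc k) * c / (1 - c * z) ^ Suc (Suc k)"
    using assms by (simp add: power2_eq_square add_divide_distrib distrib_right distrib_left mult_ac)
  ultimately show ?case by (simp add: mult.commute)
qed simp

text \<open>The n-th derivative of one summand of \<open>test_function\<close> with coefficient 1;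
  each differentiation contributes one factor of the Pochhammer symbol and one
  \<open>cnj a\<close>.\<close>

definition test_deriv :: "real \<Rightarrow> nat \<Rightarrow> nat \<Rightarrow> complex \<Rightarrow> complex \<Rightarrow> complex"
  where "test_deriv p N n a z = of_real ((W (norm a) * (1 - norm a)\<^sup>2) powr (- 1 / p) * (1 - norm a) ^ N * pochhammer (real N) n)
    * cnj a ^ n / (1 - cnj a * z) ^ (N + n)"

lemma test_deriv_Suc:
  assumes "a \<in> unit_disc" "z \<in> unit_disc"
  shows "(test_deriv p N n a has_field_derivative test_deriv p N (Suc n) a z) (at z)"
proof -
  note nz = one_minus_cnj_mult_bounds(4)[OF assms]
  define K where "K = (W (norm a) * (1 - norm a)\<^sup>2) powr (- 1 / p) * (1 - norm a) ^ N"
  have "((\<lambda>z. of_real (K * pochhammer (real N) n) * cnj a ^ n * (1 / (1 - cnj a * z) ^ (N + n))) has_field_derivative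
    of_real (K * pochhammer (real N) n) * cnj a ^ n * (of_nat (N + n) * cnj a / (1 - cnj a * z) ^ Suc (N + n))) (at z)"
    by (intro DERIV_cmult has_field_derivative_inverse_power nz)
  moreover have "of_real (K * pochhammer (real N) n) * cnj a ^ n * (of_nat (N + n) * cnj a / (1 - cnj a * z) ^ Suc (N + n))
    = of_real (K * pochhammer (real N) (Suc n)) * cnj a ^ Suc n / (1 - cnj a * z) ^ (N + Suc n)"
    by (simp add: pochhammer_Suc mult_ac)
  moreover have "test_deriv p N n a = (\<lambda>z. of_real (K * pochhammer (real N) n) * cnj a ^ n * (1 / (1 - cnj a * z) ^ (N + n)))"
    by (simp add: fun_eq_iff test_deriv_def K_def)
  ultimately show ?thesis by (simp only:) (simp only: test_deriv_def K_def)
qed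

lemma higher_deriv_test_function:
  assumes A: "finite A" "A \<subseteq> unit_disc" and z: "z \<in> unit_disc"
  shows "(deriv ^^ n) (test_function p N c A) z = (\<Sum>a\<in>A. of_real (c a) * test_deriv p N n a z)"
  using z
proof (induction n arbitrary: z)
  case 0
  then show ?case by (simp add: test_function_def test_deriv_def mult.assoc)
next
  case (Suc n)
  have "(deriv ^^ Suc n) (test_function p N c A) z = deriv ((deriv ^^ n) (test_function p N c A)) z" by simp
  also have "\<dots> = deriv (\<lambda>z. \<Sum>a\<in>A. of_real (c a) * test_deriv p N n a z) z"
  proof (rule deriv_cong_ev)
    have "eventually (\<lambda>w. w \<in> unit_disc) (nhds z)" using Suc.prems by (intro eventually_nhds_in_open) auto
    then show "\<forall>\<^sub>F w in nhds z. (deriv ^^ n) (test_function p N c A) w = (\<Sum>a\<in>A. of_real (c a) * test_deriv p N n a w)"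
      by eventually_elim (rule Suc.IH)
  qed simp
  also have "\<dots> = (\<Sum>a\<in>A. of_real (c a) * test_deriv p N (Suc n) a z)"
    using A Suc.prems by (intro DERIV_imp_deriv DERIV_sum DERIV_cmult test_deriv_Suc) auto
  finally show ?case .
qed

text \<open>On the enlarged disc |1 - cnj a w| is at most \<kappa> (1 - |a|), so of the N + n powers
  of 1 - |a| in the denominator N cancel against the numerator and n remain. The factor |a|^n is
  kept away from 0 by |a| >= 1 / 2.\<close>

lemma norm_test_deriv_ge:
  assumes p: "0 < p" and q: "0 < q" and N: "0 < N" and \<kappa>: "1 \<le> \<kappa>"
    and a: "a \<in> unit_disc" "1 / 2 \<le> norm a" and w: "w \<in> enlarged_disc \<kappa> a"
  shows "((1 / 2) ^ n / \<kappa> ^ (N + n)) powr q * ((W (norm a) * (1 - norm a)\<^sup>2) powr (- q / p) * (1 - norm a) powr (- (real n * q)))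
    \<le> norm (test_deriv p N n a w) powr q"
proof -
  define y where "y = 1 - norm a"
  have y: "0 < y" using a by (simp add: y_def)
  define H where "H = (W (norm a) * y\<^sup>2) powr (- 1 / p)"
  have w1: "w \<in> unit_disc" and w2: "norm (1 - cnj a * w) \<le> \<kappa> * y" using w by (auto simp: enlarged_disc_def y_def)
  have pos: "0 < norm (1 - cnj a * w)" using one_minus_cnj_mult_bounds(3)[OF a(1) w1] .
  have poch: "1 \<le> pochhammer (real N) n"
  proof (induction n)
    case (Suc n)
    have "1 * 1 \<le> pochhammer (real N) n * (real N + real n)"
      using Suc N by (intro mult_mono) auto
    then show ?case by (simp add: pochhammer_Suc)
  qed simp
  have "(1 / 2) ^ n / \<kappa> ^ (N + n) * (H * (1 / y ^ n)) = H * y ^ N * 1 * (1 / 2) ^ n / (\<kappa> * y) ^ (N + n)"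
    using y \<kappa> by (simp add: power_mult_distrib power_add mult_ac)
  also have "\<dots> \<le> H * y ^ N * pochhammer (real N) n * norm a ^ n / norm (1 - cnj a * w) ^ (N + n)"
    using y poch a w2 pos by (intro frac_le mult_mono power_mono) (auto simp: H_def)
  also have "\<dots> = norm (test_deriv p N n a w)"
  proof -
    have "norm (of_real x * cnj a ^ n / (1 - cnj a * w) ^ (N + n)) = \<bar>x\<bar> * norm a ^ n / norm (1 - cnj a * w) ^ (N + n)" for x :: real
      by (simp only: norm_divide norm_mult norm_power norm_of_real complex_mod_cnj)
    then show ?thesis using y poch unfolding test_deriv_def H_def y_def[symmetric] by (simp only:) (simp add: abs_mult)
  qed
  finally have "((1 / 2) ^ n / \<kappa> ^ (N + n) * (H * (1 / y ^ n))) powr q \<le> norm (test_deriv p N n a w) powr q"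
    using q y \<kappa> by (intro powr_mono2) (auto simp: H_def)
  moreover have "((1 / 2) ^ n / \<kappa> ^ (N + n) * (H * (1 / y ^ n))) powr q = ((1 / 2) ^ n / \<kappa> ^ (N + n)) powr q * (H powr q * (1 / y ^ n) powr q)"
    by (simp only: powr_mult)
  moreover have "H powr q = (W (norm a) * y\<^sup>2) powr (- q / p)" by (simp add: H_def powr_powr)
  moreover have "(1 / y ^ n) powr q = y powr (- (real n * q))"
    using y by (simp add: powr_divide powr_minus_divide powr_powr flip: powr_realpow)
  ultimately show ?thesis by (simp add: y_def)
qed

text \<open>\<open>bound\<close> is the boundedness of n-fold differentiation into L^q of m,
  homogeneous in the p-integral t. It is applied to a test function with every choice of signs;
  averaging bounds the q-integrals from below on all enlarged discs at once, up to the overlap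
  constant. For the sum on the left this is a self-improving inequality whose constant does not
  depend on A.\<close>

lemma discrete_averages_summable:
  fixes m :: "complex measure"
  assumes fin: "finite_measure m" and sets: "sets m = sets borel" and disc: "AE z in m. z \<in> unit_disc"
    and q: "0 < q" "q < p" and \<kappa>: "1 \<le> \<kappa>" and \<delta>: "0 < \<delta>" "\<delta> \<le> 1 / 2" and C0: "0 \<le> C0"
    and bound: "\<And>f t. f holomorphic_on unit_disc \<Longrightarrow> 0 \<le> t \<Longrightarrow>
      (\<integral>\<^sup>+z\<in>unit_disc. ennreal (norm (f z) powr p) * ennreal (W (norm z)) \<partial>lborel) \<le> ennreal t \<Longrightarrow>
      (\<integral>\<^sup>+z. ennreal (norm ((deriv ^^ n) f z) powr q) \<partial>m) \<le> ennreal (C0 * t powr (q / p))"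
  obtains B where "0 \<le> B" "\<And>A. finite A \<Longrightarrow> A \<subseteq> unit_disc \<Longrightarrow>
    disjoint_family_on (\<lambda>a. ball a (\<delta> * (1 - norm a))) A \<Longrightarrow> (\<forall>a\<in>A. 1 / 2 \<le> norm a) \<Longrightarrow>
    (\<Sum>a\<in>A. ((W (norm a) * (1 - norm a)\<^sup>2) powr (- q / p) * (1 - norm a) powr (- (real n * q)) * measure m (enlarged_disc \<kappa> a)) powr (p / (p - q))) \<le> B"
proof -
  interpret m: finite_measure m by (rule fin)
  note [measurable_cong] = sets
  have p: "0 < p" using q by simp
  obtain N D where N: "0 < N" and D: "0 < D" "\<And>A c. finite A \<Longrightarrow> A \<subseteq> unit_disc \<Longrightarrow>
    disjoint_family_on (\<lambda>a. ball a (\<delta> * (1 - norm a))) A \<Longrightarrow>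
    (\<integral>\<^sup>+z\<in>unit_disc. ennreal (norm (test_function p N c A z) powr p) * ennreal (W (norm z)) \<partial>lborel)
      \<le> ennreal (D * (\<Sum>a\<in>A. \<bar>c a\<bar> powr p))"
    using test_function_integral_le[OF p \<delta>] by blast
  obtain M where M: "0 < M" "\<And>A w. finite A \<Longrightarrow> A \<subseteq> unit_disc \<Longrightarrow>
    disjoint_family_on (\<lambda>a. ball a (\<delta> * (1 - norm a))) A \<Longrightarrow> w \<in> unit_disc \<Longrightarrow>
    real (card {a \<in> A. w \<in> enlarged_disc \<kappa> a}) \<le> M"
    using enlarged_disc_overlap[OF \<delta> \<kappa>] by blast
  define e where "e = ((1 / 2) ^ n / \<kappa> ^ (N + n)) powr q"
  have e: "0 < e" using \<kappa> by (simp add: e_def)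
  define s where "s = p / (p - q)"
  have s: "0 < s" "1 \<le> s" using q by (auto simp: s_def)
  \<comment> \<open>2 comes from the pairing of signs, M from the overlap of the discs, 1 / e from
    the lower bound of the derivatives, and C0 * D powr (q / p) from the boundedness applied to the
    test function.\<close>
  define K where "K = 2 * M * C0 * D powr (q / p) / e"
  have K: "0 \<le> K" using M C0 e by (simp add: K_def)
  show ?thesis
  proof (rule that[of "K powr s"])
    fix A assume A: "finite A" "A \<subseteq> unit_disc" and disj: "disjoint_family_on (\<lambda>a. ball a (\<delta> * (1 - norm a))) A"
      and half: "\<forall>a\<in>A. 1 / 2 \<le> norm a"
    define X where "X = (\<lambda>a::complex. (W (norm a) * (1 - norm a)\<^sup>2) powr (- q / p) * (1 - norm a) powr (- (real n * q)))"
    have X: "0 \<le> X a" for a by (simp add: X_def)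
    define G where "G = (\<lambda>a. X a * measure m (enlarged_disc \<kappa> a))"
    have G: "0 \<le> G a" for a using X by (simp add: G_def)
    \<comment> \<open>The extremal coefficients for Hoelder's inequality with exponents p / q and s:
      they make c^p and c^q G both equal to G^s.\<close>
    define c where "c = (\<lambda>a. G a powr (1 / (p - q)))"
    have c: "0 \<le> c a" for a by (simp add: c_def)
    have cp: "c a powr p = G a powr s" for a by (simp add: c_def s_def powr_powr)
    have cq: "c a powr q * G a = G a powr s" for a
    proof (cases "G a = 0")
      case False
      have "c a powr q * G a = G a powr (q / (p - q)) * G a powr 1"
        using G[of a] by (simp add: c_def powr_powr)
      also have "\<dots> = G a powr (q / (p - q) + 1)" by (simp add: powr_add)
      also have "q / (p - q) + 1 = s" using q by (simp add: s_def field_simps)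
      finally show ?thesis .
    qed (use s in simp)
    define S where "S = (\<Sum>a\<in>A. G a powr s)"
    have S: "0 \<le> S" by (simp add: S_def sum_nonneg)
    define T where "T = (\<lambda>\<sigma>. test_function p N (\<lambda>a. if a \<in> \<sigma> then c a else - c a) A)"
    define F where "F = (\<lambda>\<sigma> w. ennreal (norm ((deriv ^^ n) (T \<sigma>) w) powr q) * indicator unit_disc w)"
    have Thol: "T \<sigma> holomorphic_on unit_disc" for \<sigma> unfolding T_def by (rule test_function_holomorphic[OF A])
    have [measurable]: "F \<sigma> \<in> borel_measurable borel" for \<sigma> unfolding F_def
      by (intro measurable_norm_powr_indicator holomorphic_on_imp_continuous_on holomorphic_higher_deriv Thol q) auto
    have Fint: "(\<integral>\<^sup>+w. F \<sigma> w \<partial>m) \<le> ennreal (C0 * (D * S) powr (q / p))" for \<sigma>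
    proof -
      have "(\<integral>\<^sup>+z\<in>unit_disc. ennreal (norm (T \<sigma> z) powr p) * ennreal (W (norm z)) \<partial>lborel)
        \<le> ennreal (D * (\<Sum>a\<in>A. \<bar>if a \<in> \<sigma> then c a else - c a\<bar> powr p))"
        unfolding T_def by (rule D(2)[OF A disj])
      also have "(\<Sum>a\<in>A. \<bar>if a \<in> \<sigma> then c a else - c a\<bar> powr p) = S"
        unfolding S_def using c by (intro sum.cong) (auto simp: cp[symmetric])
      finally have "(\<integral>\<^sup>+z. ennreal (norm ((deriv ^^ n) (T \<sigma>) z) powr q) \<partial>m) \<le> ennreal (C0 * (D * S) powr (q / p))"
        using D(1) S by (intro bound Thol) auto
      moreover have "(\<integral>\<^sup>+w. F \<sigma> w \<partial>m) \<le> (\<integral>\<^sup>+z. ennreal (norm ((deriv ^^ n) (T \<sigma>) z) powr q) \<partial>m)"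
        by (intro nn_integral_mono) (auto simp: F_def indicator_def)
      ultimately show ?thesis by (rule order_trans[rotated])
    qed
    \<comment> \<open>At a fixed w at most M discs contribute, and each of their terms is at most
      twice the average over all signs.\<close>
    have pt: "(\<Sum>a\<in>A. ennreal (e * c a powr q * X a) * indicator (enlarged_disc \<kappa> a) w)
      \<le> ennreal (2 * M / 2 ^ card A) * (\<Sum>\<sigma>\<in>Pow A. F \<sigma> w)" if w: "w \<in> unit_disc" for w
    proof -
      define v where "v = (\<lambda>a. of_real (c a) * test_deriv p N n a w)"
      define Y where "Y = (\<Sum>\<sigma>\<in>Pow A. norm (\<Sum>a\<in>A. if a \<in> \<sigma> then v a else - v a) powr q)"
      have Y: "0 \<le> Y" by (simp add: Y_def sum_nonneg)
      have FY: "(\<Sum>\<sigma>\<in>Pow A. F \<sigma> w) = ennreal Y"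
      proof -
        have "F \<sigma> w = ennreal (norm (\<Sum>a\<in>A. if a \<in> \<sigma> then v a else - v a) powr q)" for \<sigma>
        proof -
          have "(deriv ^^ n) (T \<sigma>) w = (\<Sum>a\<in>A. if a \<in> \<sigma> then v a else - v a)"
            unfolding T_def higher_deriv_test_function[OF A w] v_def by (intro sum.cong) auto
          then show ?thesis using w by (simp add: F_def)
        qed
        then show ?thesis by (simp add: Y_def)
      qed
      let ?B = "{a \<in> A. w \<in> enlarged_disc \<kappa> a}"
      have each: "e * c a powr q * X a \<le> 2 / 2 ^ card A * Y" if a: "a \<in> ?B" for a
      proof -
        have a1: "a \<in> A" "a \<in> unit_disc" "1 / 2 \<le> norm a" "w \<in> enlarged_disc \<kappa> a" using a A half by auto
        have "e * X a \<le> norm (test_deriv p N n a w) powr q"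
          unfolding e_def X_def using norm_test_deriv_ge[OF p q(1) N \<kappa> a1(2-4)] by simp
        then have "c a powr q * (e * X a) \<le> c a powr q * norm (test_deriv p N n a w) powr q"
          by (intro mult_left_mono) auto
        also have "\<dots> = norm (v a) powr q" using c[of a] by (simp add: v_def norm_mult powr_mult)
        also have "\<dots> \<le> 2 / 2 ^ card A * Y"
          using sum_signs_powr_ge[OF A(1) a1(1) q(1), of v] by (simp add: Y_def field_simps)
        finally show ?thesis by (simp add: mult_ac)
      qed
      have "(\<Sum>a\<in>A. ennreal (e * c a powr q * X a) * indicator (enlarged_disc \<kappa> a) w) = (\<Sum>a\<in>?B. ennreal (e * c a powr q * X a))"
        using A(1) by (auto simp: indicator_def sum.If_cases Int_def intro!: sum.mono_neutral_cong_right)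
      also have "\<dots> = ennreal (\<Sum>a\<in>?B. e * c a powr q * X a)" using e X by (intro sum_ennreal) auto
      also have "\<dots> \<le> ennreal (M * (2 / 2 ^ card A * Y))"
      proof (rule ennreal_leI)
        have "(\<Sum>a\<in>?B. e * c a powr q * X a) \<le> real (card ?B) * (2 / 2 ^ card A * Y)"
          by (rule sum_bounded_above) (rule each)
        also have "\<dots> \<le> M * (2 / 2 ^ card A * Y)" using M(2)[OF A disj w] Y by (intro mult_right_mono) auto
        finally show "(\<Sum>a\<in>?B. e * c a powr q * X a) \<le> M * (2 / 2 ^ card A * Y)" .
      qed
      also have "\<dots> = ennreal (2 * M / 2 ^ card A) * ennreal Y" using M Y by (simp flip: ennreal_mult)
      finally show ?thesis by (simp add: FY)
    qed
    have "ennreal (e * S) = (\<Sum>a\<in>A. ennreal (e * c a powr q * X a) * emeasure m (enlarged_disc \<kappa> a))"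
    proof -
      have "(\<Sum>a\<in>A. ennreal (e * c a powr q * X a) * emeasure m (enlarged_disc \<kappa> a)) = (\<Sum>a\<in>A. ennreal (e * (c a powr q * G a)))"
        using e X by (intro sum.cong) (auto simp: m.emeasure_eq_measure G_def mult_ac simp flip: ennreal_mult)
      also have "\<dots> = ennreal (e * S)" unfolding cq S_def using e by (simp add: sum_distrib_left)
      finally show ?thesis ..
    qed
    also have "\<dots> = (\<Sum>a\<in>A. \<integral>\<^sup>+w. ennreal (e * c a powr q * X a) * indicator (enlarged_disc \<kappa> a) w \<partial>m)"
      by (intro sum.cong refl nn_integral_cmult_indicator[symmetric]) (simp add: sets)
    also have "\<dots> = (\<integral>\<^sup>+w. (\<Sum>a\<in>A. ennreal (e * c a powr q * X a) * indicator (enlarged_disc \<kappa> a) w) \<partial>m)"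
      by (intro nn_integral_sum[symmetric]) measurable
    also have "\<dots> \<le> (\<integral>\<^sup>+w. ennreal (2 * M / 2 ^ card A) * (\<Sum>\<sigma>\<in>Pow A. F \<sigma> w) \<partial>m)"
      using disc by (intro nn_integral_mono_AE) (auto elim!: eventually_mono intro: pt)
    also have "\<dots> = ennreal (2 * M / 2 ^ card A) * (\<Sum>\<sigma>\<in>Pow A. \<integral>\<^sup>+w. F \<sigma> w \<partial>m)"
      by (subst nn_integral_cmult, measurable, subst nn_integral_sum) measurable
    also have "\<dots> \<le> ennreal (2 * M / 2 ^ card A) * (\<Sum>\<sigma>\<in>Pow A. ennreal (C0 * (D * S) powr (q / p)))"
      by (intro mult_left_mono sum_mono Fint) auto
    also have "\<dots> = ennreal (2 * M / 2 ^ card A * (2 ^ card A * (C0 * (D * S) powr (q / p))))"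
    proof -
      have "(\<Sum>\<sigma>\<in>Pow A. ennreal (C0 * (D * S) powr (q / p))) = ennreal (\<Sum>\<sigma>\<in>Pow A. C0 * (D * S) powr (q / p))"
        using C0 by (intro sum_ennreal) auto
      also have "\<dots> = ennreal (2 ^ card A * (C0 * (D * S) powr (q / p)))" using A by (simp add: card_Pow)
      finally show ?thesis using M(1) C0 by (simp only:) (intro ennreal_mult[symmetric], auto)
    qed
    also have "2 * M / 2 ^ card A * (2 ^ card A * (C0 * (D * S) powr (q / p))) = 2 * M * C0 * (D * S) powr (q / p)" by simp
    finally have "e * S \<le> 2 * M * C0 * (D * S) powr (q / p)"
      using M C0 by (subst (asm) ennreal_le_iff) auto
    then have main: "S \<le> K * S powr (q / p)" using e D(1) S by (simp add: K_def powr_mult field_simps)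
    \<comment> \<open>S is a real number, so S^(q/p) may be divided out; then (1 - q / p) s =
      1.\<close>
    have "S \<le> K powr s"
    proof (cases "S = 0")
      case False
      then have S0: "0 < S" using S by simp
      have "S powr (1 - q / p) = S / S powr (q / p)" using S0 by (simp add: powr_diff)
      also have "\<dots> \<le> K" using main S0 by (simp add: field_simps)
      finally have "(S powr (1 - q / p)) powr s \<le> K powr s" using s by (intro powr_mono2) auto
      moreover have "(1 - q / p) * s = 1" using q by (simp add: s_def field_simps)
      ultimately show ?thesis using S0 by (simp add: powr_powr)
    qed simp
    then show "(\<Sum>a\<in>A. ((W (norm a) * (1 - norm a)\<^sup>2) powr (- q / p) * (1 - norm a) powr (- (real n * q)) * measure m (enlarged_disc \<kappa> a)) powr (p / (p - q))) \<le> K powr s"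
      by (simp add: S_def G_def X_def s_def)
  qed simp
qed

end

section \<open>Necessity and convergence\<close>

context doubling_profile
begin

text \<open>Passage from sums to the integral. On a compact annulus a maximal disjoint family of
  balls with \<delta> = 1 / 8 puts every z hyperbolically close to some a of the family, so the
  average at z is controlled by the mass of the enlarged disc at a. The resulting step function
  integrates to the discrete sum, with a bound independent of the annulus. For |z| < 1 / 2 the
  comparison is with a = 0 and the total mass of m.\<close>

lemma averages_integrable:
  fixes m :: "complex measure"
  assumes fin: "finite_measure m" and sets: "sets m = sets borel" and disc: "AE z in m. z \<in> unit_disc"
    and q: "0 < q" "q < p" and C0: "0 \<le> C0"
    and bound: "\<And>f t. f holomorphic_on unit_disc \<Longrightarrow> 0 \<le> t \<Longrightarrow>
      (\<integral>\<^sup>+z\<in>unit_disc. ennreal (norm (f z) powr p) * ennreal (W (norm z)) \<partial>lborel) \<le> ennreal t \<Longrightarrow>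
      (\<integral>\<^sup>+z. ennreal (norm ((deriv ^^ n) f z) powr q) \<partial>m) \<le> ennreal (C0 * t powr (q / p))"
    and r: "0 < r" "r < 1"
  shows "(\<integral>\<^sup>+z\<in>unit_disc. ennreal ((measure m (pseudohyperbolic_disc z r) /
    ((1 - norm z)\<^sup>2 * W (norm z) * (1 - norm z) powr (real n * q))) powr (p / (p - q)) * W (norm z)) \<partial>lborel) < \<infinity>"
proof -
  interpret m: finite_measure m by (rule fin)
  define s where "s = p / (p - q)"
  have s: "0 < s" "1 \<le> s" "q / p * s = s - 1" using q by (auto simp: s_def field_simps)
  have r2: "0 < 1 - r\<^sup>2" "1 - r\<^sup>2 \<le> 1" using r by (auto simp: power_less_one_iff)
  \<comment> \<open>The constant of \<open>pseudohyperbolic_disc_bounds\<close>; doubling it leaves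
    room for replacing the centre z by a nearby a.\<close>
  define k where "k = 4 / (1 - r\<^sup>2)"
  have k: "4 \<le> k" using r2 by (simp add: k_def field_simps)
  define \<kappa> where "\<kappa> = 2 * k"
  have \<kappa>: "1 \<le> \<kappa>" using k by (simp add: \<kappa>_def)
  obtain B where B: "0 \<le> B" "\<And>A. finite A \<Longrightarrow> A \<subseteq> unit_disc \<Longrightarrow>
    disjoint_family_on (\<lambda>a. ball a (1 / 8 * (1 - norm a))) A \<Longrightarrow> (\<forall>a\<in>A. 1 / 2 \<le> norm a) \<Longrightarrow>
    (\<Sum>a\<in>A. ((W (norm a) * (1 - norm a)\<^sup>2) powr (- q / p) * (1 - norm a) powr (- (real n * q)) * measure m (enlarged_disc \<kappa> a)) powr (p / (p - q))) \<le> B"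
    by (rule discrete_averages_summable[OF fin sets disc q \<kappa> _ _ C0 bound, where \<delta>="1 / 8"]) (simp, simp, assumption, assumption, assumption, rule that)
  obtain D where D: "0 < D" "\<And>s r. 0 \<le> s \<Longrightarrow> s < 1 \<Longrightarrow> 0 \<le> r \<Longrightarrow> r < 1 \<Longrightarrow>
    1 - s \<le> 2 * (1 - r) \<Longrightarrow> 1 - r \<le> 2 * (1 - s) \<Longrightarrow> W s \<le> D * W r"
    by (rule W_comparable[of 2], simp) (rule that)
  define \<Phi> where "\<Phi> = (\<lambda>z. measure m (pseudohyperbolic_disc z r) / ((1 - norm z)\<^sup>2 * W (norm z) * (1 - norm z) powr (real n * q)))"
  \<comment> \<open>The average with a free numerator, since the mass compared at a is that of an
    enlarged disc, or of the whole plane when a = 0.\<close>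
  define \<Theta> where "\<Theta> = (\<lambda>M (a::complex). M / ((1 - norm a)\<^sup>2 * W (norm a) * (1 - norm a) powr (real n * q)))"
  \<comment> \<open>4, D and the power of 2 bound the change of the three factors of the denominator
    between z and a; the last D bounds the change of the outer \<open>W\<close>.\<close>
  define c where "c = (4 * D * 2 powr (real n * q)) powr s * D"
  have c: "0 < c" using D by (simp add: c_def)
  have pt: "\<Phi> z powr s * W (norm z) \<le> c * (\<Theta> M a powr s * W (norm a))"
    if z: "z \<in> unit_disc" and a: "a \<in> unit_disc" and xy: "1 - norm z \<le> 2 * (1 - norm a)" "1 - norm a \<le> 2 * (1 - norm z)"
      and M: "measure m (pseudohyperbolic_disc z r) \<le> M" for z a :: complex and M
  proof -
    define x where "x = 1 - norm z"
    define y where "y = 1 - norm a"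
    have pos: "0 < x" "0 < y" using z a by (auto simp: x_def y_def)
    have Wpos: "0 < W (norm z)" "0 < W (norm a)" using z a by (auto intro!: W_pos)
    have W1: "W (norm z) \<le> D * W (norm a)" using z a xy by (intro D(2)) auto
    have W2: "W (norm a) \<le> D * W (norm z)" using z a xy by (intro D(2)) auto
    have nq: "0 \<le> real n * q" using q by simp
    have M0: "0 \<le> M" using M measure_nonneg[of m] by (rule order_trans[rotated])
    have "y\<^sup>2 * W (norm a) * y powr (real n * q) \<le> (2 * x)\<^sup>2 * (D * W (norm z)) * (2 * x) powr (real n * q)"
      using xy W2 pos Wpos nq D(1) by (intro mult_mono power_mono powr_mono2) (auto simp: x_def y_def)
    also have "\<dots> = (4 * D * 2 powr (real n * q)) * (x\<^sup>2 * W (norm z) * x powr (real n * q))"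
      using pos by (simp add: powr_mult power_mult_distrib)
    finally have den: "y\<^sup>2 * W (norm a) * y powr (real n * q) \<le> (4 * D * 2 powr (real n * q)) * (x\<^sup>2 * W (norm z) * x powr (real n * q))" .
    have dpos: "0 < y\<^sup>2 * W (norm a) * y powr (real n * q)" "0 < x\<^sup>2 * W (norm z) * x powr (real n * q)"
      using pos Wpos by auto
    have "\<Phi> z \<le> M / (x\<^sup>2 * W (norm z) * x powr (real n * q))"
      unfolding \<Phi>_def x_def[symmetric] using M dpos by (intro divide_right_mono) auto
    also have "\<dots> \<le> (4 * D * 2 powr (real n * q)) * \<Theta> M a"
    proof -
      have "M * (y\<^sup>2 * W (norm a) * y powr (real n * q)) \<le> M * ((4 * D * 2 powr (real n * q)) * (x\<^sup>2 * W (norm z) * x powr (real n * q)))"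
        using den M0 by (rule mult_left_mono)
      then have "M / (x\<^sup>2 * W (norm z) * x powr (real n * q)) \<le> (4 * D * 2 powr (real n * q)) * (M / (y\<^sup>2 * W (norm a) * y powr (real n * q)))"
        using dpos by (simp add: divide_le_eq pos_le_divide_eq mult_ac)
      then show ?thesis by (simp add: \<Theta>_def y_def)
    qed
    finally have 1: "\<Phi> z \<le> (4 * D * 2 powr (real n * q)) * \<Theta> M a" .
    have \<Phi>0: "0 \<le> \<Phi> z" using dpos by (simp add: \<Phi>_def x_def W_nonneg)
    have "\<Phi> z powr s \<le> ((4 * D * 2 powr (real n * q)) * \<Theta> M a) powr s"
      using 1 \<Phi>0 s by (intro powr_mono2) auto
    also have "\<dots> = (4 * D * 2 powr (real n * q)) powr s * \<Theta> M a powr s" by (rule powr_mult)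
    finally have "\<Phi> z powr s * W (norm z) \<le> (4 * D * 2 powr (real n * q)) powr s * \<Theta> M a powr s * (D * W (norm a))"
      using W1 Wpos by (intro mult_mono) auto
    then show ?thesis by (simp add: c_def mult_ac)
  qed
  have [measurable]: "(\<lambda>z. indicator unit_disc z * measure m (pseudohyperbolic_disc z r)) \<in> borel_measurable borel"
    by (rule measurable_measure_pseudohyperbolic_disc[OF fin sets])
  define F where "F = (\<lambda>z. ennreal (\<Phi> z powr s * W (norm z)) * indicator unit_disc z)"
  have F[measurable]: "F \<in> borel_measurable borel"
  proof -
    have "(\<lambda>z. ennreal ((indicator unit_disc z * measure m (pseudohyperbolic_disc z r) / ((1 - norm z)\<^sup>2 * W (norm z) * (1 - norm z) powr (real n * q))) powr s * W (norm z)) * indicator unit_disc z) \<in> borel_measurable borel"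
      by measurable
    moreover have "F z = ennreal ((indicator unit_disc z * measure m (pseudohyperbolic_disc z r) / ((1 - norm z)\<^sup>2 * W (norm z) * (1 - norm z) powr (real n * q))) powr s * W (norm z)) * indicator unit_disc z" for z
      by (auto simp: F_def \<Phi>_def indicator_def)
    ultimately show ?thesis by (subst measurable_cong) auto
  qed
  \<comment> \<open>Closed annuli that exhaust 1 / 2 <= |z| < 1.\<close>
  define K where "K = (\<lambda>j::nat. {z::complex. 1 / 2 \<le> norm z \<and> norm z \<le> 1 - 1 / (real j + 2)})"
  have Kb: "(\<integral>\<^sup>+z. F z * indicator (K j) z \<partial>lborel) \<le> ennreal (c * pi * B)" for j
  proof -
    have Kin: "K j \<subseteq> cball 0 (1 - 1 / (real j + 2))" by (auto simp: K_def)
    obtain A where A: "finite A" "A \<subseteq> K j" and disj: "disjoint_family_on (\<lambda>a. ball a (1 / 8 * (1 - norm a))) A"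
      and cov: "\<And>z. z \<in> K j \<Longrightarrow> \<exists>a\<in>A. norm (z - a) \<le> 1 / 8 * (1 - norm a) + 1 / 8 * (1 - norm z)"
      using exists_maximal_disjoint_balls[OF Kin, of "1 / 8"] by auto
    have Kdisc: "K j \<subseteq> unit_disc"
    proof
      fix z assume "z \<in> K j"
      moreover have "0 < 1 / (real j + 2)" by simp
      ultimately have "norm z < 1" unfolding K_def mem_Collect_eq by linarith
      then show "z \<in> unit_disc" by simp
    qed
    have Ad: "A \<subseteq> unit_disc" "\<forall>a\<in>A. 1 / 2 \<le> norm a" using A(2) Kdisc by (auto simp: K_def)
    define M where "M = (\<lambda>a. measure m (enlarged_disc \<kappa> a))"
    define e where "e = (\<lambda>a. c * (\<Theta> (M a) a powr s * W (norm a)))"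
    have e: "0 \<le> e a" for a using c W_nonneg by (simp add: e_def)
    have "(\<integral>\<^sup>+z. F z * indicator (K j) z \<partial>lborel) \<le> (\<integral>\<^sup>+z. (\<Sum>a\<in>A. ennreal (e a) * indicator (ball a (1 - norm a)) z) \<partial>lborel)"
    proof (rule nn_integral_mono)
      fix z
      show "F z * indicator (K j) z \<le> (\<Sum>a\<in>A. ennreal (e a) * indicator (ball a (1 - norm a)) z)"
      proof (cases "z \<in> K j")
        case True
        then have z: "z \<in> unit_disc" using Kdisc by blast
        obtain a where a: "a \<in> A" and d: "norm (z - a) \<le> 1 / 8 * (1 - norm a) + 1 / 8 * (1 - norm z)"
          using cov[OF True] by blast
        then have a1: "a \<in> unit_disc" using Ad by blast
        define x where "x = 1 - norm z"
        define y where "y = 1 - norm a"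
        have pos: "0 < x" "0 < y" using z a1 by (auto simp: x_def y_def)
        have d': "norm (z - a) \<le> x / 8 + y / 8" using d by (simp add: x_def y_def)
        have "x - y \<le> norm (z - a)" "y - x \<le> norm (z - a)"
          using norm_triangle_ineq2[of a z] norm_triangle_ineq2[of z a] by (auto simp: x_def y_def norm_minus_commute)
        \<comment> \<open>With \<delta> = 1 / 8 the distances of z and a to the unit circle differ
          by a factor of at most 9 / 7, within the 2 that \<open>pt\<close> allows.\<close>
        then have xy: "7 * x \<le> 9 * y" "7 * y \<le> 9 * x" using d' by linarith+
        have sub: "pseudohyperbolic_disc z r \<subseteq> enlarged_disc \<kappa> a"
        proof
          fix w assume w: "w \<in> pseudohyperbolic_disc z r"
          then have w1: "w \<in> unit_disc" using pseudohyperbolic_disc_subset by blast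
          have b: "norm (1 - cnj z * w) \<le> k * x" "x \<le> k * (1 - norm w)"
            using pseudohyperbolic_disc_bounds[OF r z w] by (auto simp: k_def x_def)
          have "1 - cnj a * w = (1 - cnj z * w) + cnj (z - a) * w" by (simp add: algebra_simps)
          then have "norm (1 - cnj a * w) \<le> norm (1 - cnj z * w) + norm (cnj (z - a) * w)"
            by (metis norm_triangle_ineq)
          also have "norm (cnj (z - a) * w) \<le> norm (z - a)"
            unfolding norm_mult complex_mod_cnj using w1 by (simp add: mult_right_le_one_le)
          finally have "norm (1 - cnj a * w) \<le> k * x + (x / 8 + y / 8)" using b d' by linarith
          moreover have "7 * (k * x) \<le> 9 * (k * y)" using mult_left_mono[OF xy(1), of k] k by (simp add: mult_ac)
          moreover have "4 * y \<le> k * y" using k pos by (intro mult_right_mono) auto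
          ultimately have 1: "norm (1 - cnj a * w) \<le> \<kappa> * y" using xy pos unfolding \<kappa>_def mult.assoc by linarith
          have "0 \<le> k * (1 - norm w)" using k w1 by simp
          then have "y \<le> \<kappa> * (1 - norm w)" using b xy pos by (simp add: \<kappa>_def)
          then show "w \<in> enlarged_disc \<kappa> a" using 1 w1 by (simp add: enlarged_disc_def y_def)
        qed
        have "measure m (pseudohyperbolic_disc z r) \<le> M a"
          unfolding M_def by (intro m.finite_measure_mono sub) (simp add: sets)
        then have "\<Phi> z powr s * W (norm z) \<le> e a"
          unfolding e_def using xy pos by (intro pt z a1) (auto simp: x_def y_def)
        then have "F z \<le> ennreal (e a)" using z by (simp add: F_def ennreal_leI)
        also have "\<dots> = ennreal (e a) * indicator (ball a (1 - norm a)) z"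
        proof -
          have "norm (z - a) < y" using d' xy pos by linarith
          then have "z \<in> ball a (1 - norm a)" by (simp add: dist_norm norm_minus_commute y_def)
          then show ?thesis by simp
        qed
        also have "\<dots> \<le> (\<Sum>a\<in>A. ennreal (e a) * indicator (ball a (1 - norm a)) z)"
          using A(1) a by (intro member_le_sum) auto
        finally show ?thesis using True by simp
      qed simp
    qed
    also have "\<dots> = (\<Sum>a\<in>A. ennreal (e a) * emeasure lborel (ball a (1 - norm a)))"
      by (subst nn_integral_sum) (auto simp: nn_integral_cmult_indicator intro!: borel_measurable_times_ennreal borel_measurable_indicator)
    also have "\<dots> = (\<Sum>a\<in>A. ennreal (c * pi * (((W (norm a) * (1 - norm a)\<^sup>2) powr (- q / p) * (1 - norm a) powr (- (real n * q)) * M a) powr s)))"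
    proof (rule sum.cong[OF refl])
      fix a assume "a \<in> A"
      then have a: "a \<in> unit_disc" using Ad by blast
      define y where "y = 1 - norm a"
      have y: "0 < y" using a by (simp add: y_def)
      have w: "0 < W (norm a) * y\<^sup>2" using y W_pos[of "norm a"] a by simp
      \<comment> \<open>Because (q / p) s = s - 1, the normalization of the test functions supplies
        one factor \<open>W (norm a) * y\<^sup>2\<close>, weight times area up to pi, besides the
        denominator raised to the power s.\<close>
      have "((W (norm a) * y\<^sup>2) powr (- q / p)) powr s = (W (norm a) * y\<^sup>2) powr (1 - s)"
      proof -
        have "- q / p * s = 1 - s" using s(3) by simp
        then show ?thesis by (simp only: powr_powr)
      qed
      also have "\<dots> = (W (norm a) * y\<^sup>2) / (W (norm a) * y\<^sup>2) powr s" using w by (simp add: powr_diff)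
      finally have e1: "((W (norm a) * y\<^sup>2) powr (- q / p)) powr s = (W (norm a) * y\<^sup>2) / (W (norm a) * y\<^sup>2) powr s" .
      have e2: "y powr (- (real n * q)) = 1 / y powr (real n * q)" by (simp add: powr_minus_divide)
      have "((W (norm a) * y\<^sup>2) powr (- q / p) * y powr (- (real n * q)) * M a) powr s
          = ((W (norm a) * y\<^sup>2) powr (- q / p)) powr s * (1 / (y powr (real n * q)) powr s) * M a powr s"
        unfolding e2 powr_mult by (simp add: powr_divide)
      also have "\<dots> = \<Theta> (M a) a powr s * W (norm a) * y\<^sup>2"
        unfolding e1 \<Theta>_def y_def[symmetric] by (simp add: powr_mult powr_divide mult_ac)
      finally have "c * pi * (((W (norm a) * y\<^sup>2) powr (- q / p) * y powr (- (real n * q)) * M a) powr s) = e a * (pi * y\<^sup>2)"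
        by (simp add: e_def mult_ac)
      moreover have "emeasure lborel (ball a y) = ennreal (pi * y\<^sup>2)" using y by (intro emeasure_lborel_ball_complex) auto
      ultimately show "ennreal (e a) * emeasure lborel (ball a (1 - norm a)) =
        ennreal (c * pi * (((W (norm a) * (1 - norm a)\<^sup>2) powr (- q / p) * (1 - norm a) powr (- (real n * q)) * M a) powr s))"
        using e[of a] unfolding y_def by (simp only:) (simp add: ennreal_mult)
    qed
    also have "\<dots> = ennreal (c * pi * (\<Sum>a\<in>A. ((W (norm a) * (1 - norm a)\<^sup>2) powr (- q / p) * (1 - norm a) powr (- (real n * q)) * M a) powr s))"
      using c by (simp add: sum_distrib_left)
    also have "\<dots> \<le> ennreal (c * pi * B)"
      using B(2)[OF A(1) Ad(1) disj Ad(2)] c unfolding M_def s_def by (intro ennreal_leI mult_left_mono) auto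
    finally show ?thesis .
  qed
  have Kincr: "K i \<subseteq> K j" if "i \<le> j" for i j
  proof
    fix z assume "z \<in> K i"
    moreover have "1 / (real j + 2) \<le> 1 / (real i + 2)" using that by (intro divide_left_mono) auto
    ultimately show "z \<in> K j" by (auto simp: K_def)
  qed
  have Ksets: "K j \<in> sets borel" for j
  proof -
    have "{z::complex. 1 / 2 \<le> norm z \<and> norm z \<le> 1 - 1 / (real j + 2)} \<in> sets borel" by measurable
    then show ?thesis by (simp add: K_def)
  qed
  define c0 where "c0 = c * (\<Theta> (measure m (space m)) 0 powr s * W (norm (0::complex)))"
  have "(\<integral>\<^sup>+z. F z \<partial>lborel) \<le> (\<integral>\<^sup>+z. ennreal c0 * indicator unit_disc z + (SUP j. F z * indicator (K j) z) \<partial>lborel)"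
  proof (rule nn_integral_mono)
    fix z :: complex
    consider "z \<notin> unit_disc" | "z \<in> unit_disc" "norm z < 1 / 2" | "z \<in> unit_disc" "1 / 2 \<le> norm z" by linarith
    then show "F z \<le> ennreal c0 * indicator unit_disc z + (SUP j. F z * indicator (K j) z)"
    proof cases
      case 1 then show ?thesis by (simp add: F_def)
    next
      case 2
      have "\<Phi> z powr s * W (norm z) \<le> c0"
      proof -
        have "-1 \<le> norm z" by (rule order_trans[OF _ norm_ge_zero]) simp
        then show ?thesis unfolding c0_def using 2 by (intro pt m.bounded_measure) auto
      qed
      then have "F z \<le> ennreal c0 * indicator unit_disc z" using 2 by (simp add: F_def ennreal_leI)
      then show ?thesis by (rule add_increasing2[rotated]) simp
    next
      case 3
      then have "0 < 1 - norm z" by simp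
      then obtain j where j: "1 / real (Suc j) < 1 - norm z" using nat_approx_posE by blast
      have "1 / (real j + 2) \<le> 1 / real (Suc j)" by (intro divide_left_mono) auto
      then have "z \<in> K j" using j 3 unfolding K_def by auto
      then have "F z \<le> F z * indicator (K j) z" by simp
      also have "\<dots> \<le> (SUP j. F z * indicator (K j) z)" by (rule SUP_upper) simp
      finally show ?thesis by (rule add_increasing[rotated]) simp
    qed
  qed
  also have "\<dots> = (\<integral>\<^sup>+z. ennreal c0 * indicator unit_disc z \<partial>lborel) + (\<integral>\<^sup>+z. (SUP j. F z * indicator (K j) z) \<partial>lborel)"
    using Ksets by (intro nn_integral_add) (auto intro!: borel_measurable_SUP borel_measurable_times_ennreal borel_measurable_indicator)
  also have "(\<integral>\<^sup>+z. (SUP j. F z * indicator (K j) z) \<partial>lborel) = (SUP j. \<integral>\<^sup>+z. F z * indicator (K j) z \<partial>lborel)"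
  proof (rule nn_integral_monotone_convergence_SUP)
    show "incseq (\<lambda>j z. F z * indicator (K j) z)"
      using Kincr by (auto simp: incseq_def le_fun_def indicator_def)
    show "(\<lambda>z. F z * indicator (K j) z) \<in> borel_measurable lborel" for j
      using Ksets by (auto intro!: borel_measurable_times_ennreal borel_measurable_indicator)
  qed
  also have "\<dots> \<le> ennreal (c * pi * B)" by (rule SUP_least) (rule Kb)
  also have "(\<integral>\<^sup>+z. ennreal c0 * indicator unit_disc z \<partial>lborel) = ennreal c0 * ennreal pi"
    using emeasure_lborel_ball_complex[of 1 0] by (subst nn_integral_cmult_indicator) auto
  finally have "(\<integral>\<^sup>+z. F z \<partial>lborel) \<le> ennreal c0 * ennreal pi + ennreal (c * pi * B)" by (simp add: add_left_mono)
  also have "\<dots> < \<infinity>" by (simp add: ennreal_mult_less_top)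
  finally show ?thesis by (simp add: F_def \<Phi>_def s_def)
qed

text \<open>The submean property on a ball of radius (1 - R) / 2, on which \<open>W\<close> is at
  least \<open>h (R + \<rho>)\<close>. It provides the local boundedness for Montel's theorem; with
  t = 0 it shows that a function of norm zero vanishes.\<close>

lemma pointwise_bound:
  assumes R: "0 \<le> R" "R < 1" and p: "0 < p"
  obtains K where "0 < K" "\<And>f z t. f holomorphic_on unit_disc \<Longrightarrow> 0 \<le> t \<Longrightarrow>
      (\<integral>\<^sup>+z\<in>unit_disc. ennreal (norm (f z) powr p) * ennreal (W (norm z)) \<partial>lborel) \<le> ennreal t \<Longrightarrow>
      norm z \<le> R \<Longrightarrow> norm (f z) powr p \<le> K * t"
proof
  define \<rho> where "\<rho> = (1 - R) / 2"
  have \<rho>: "0 < \<rho>" "R + \<rho> < 1" using R by (auto simp: \<rho>_def field_simps)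
  define w where "w = h (R + \<rho>)"
  have w: "0 < w" unfolding w_def using R \<rho> by (intro h_pos) auto
  define K where "K = 1 / (w * (pi * \<rho>\<^sup>2))"
  show "0 < K" using w \<rho> by (simp add: K_def)
  fix f :: "complex \<Rightarrow> complex" and z :: complex and t :: real
  assume f: "f holomorphic_on unit_disc" and t: "0 \<le> t" and z: "norm z \<le> R"
    and le: "(\<integral>\<^sup>+z\<in>unit_disc. ennreal (norm (f z) powr p) * ennreal (W (norm z)) \<partial>lborel) \<le> ennreal t"
  have sub: "norm v \<le> R + \<rho>" if "v \<in> ball z \<rho>" for v
    using that z norm_triangle_ineq[of z "v - z"] by (simp add: dist_norm norm_minus_commute)
  have sub': "ball z \<rho> \<subseteq> unit_disc" using sub \<rho> by fastforce
  have m: "(\<lambda>v. ennreal (norm (f v) powr p) * indicator (ball z \<rho>) v) \<in> borel_measurable borel"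
    by (intro measurable_norm_powr_indicator p holomorphic_on_imp_continuous_on holomorphic_on_subset[OF f sub']) auto
  have "ennreal w * (ennreal (norm (f z) powr p) * ennreal (pi * \<rho>\<^sup>2)) \<le> ennreal w * (\<integral>\<^sup>+v\<in>ball z \<rho>. ennreal (norm (f v) powr p) \<partial>lborel)"
    using \<rho> p by (intro mult_left_mono powr_norm_submean holomorphic_on_subset[OF f sub']) auto
  also have "\<dots> = (\<integral>\<^sup>+v. ennreal w * (ennreal (norm (f v) powr p) * indicator (ball z \<rho>) v) \<partial>lborel)"
    using m by (intro nn_integral_cmult[symmetric]) simp
  also have "\<dots> \<le> (\<integral>\<^sup>+v\<in>unit_disc. ennreal (norm (f v) powr p) * ennreal (W (norm v)) \<partial>lborel)"
  proof (rule nn_integral_mono)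
    fix v
    show "ennreal w * (ennreal (norm (f v) powr p) * indicator (ball z \<rho>) v) \<le> ennreal (norm (f v) powr p) * ennreal (W (norm v)) * indicator unit_disc v"
    proof (cases "v \<in> ball z \<rho>")
      case True
      have v1: "norm v \<le> R + \<rho>" "norm v < 1" using sub[OF True] \<rho> by auto
      have "w \<le> h (norm v)" unfolding w_def using v1 \<rho> by (intro h_anti) auto
      also have "\<dots> \<le> W (norm v)" using v1 h_pos[of "norm v"] by (simp add: W_def pos_le_divide_eq mult_left_le)
      finally have "ennreal w \<le> ennreal (W (norm v))" by (rule ennreal_leI)
      then have "ennreal w * ennreal (norm (f v) powr p) \<le> ennreal (W (norm v)) * ennreal (norm (f v) powr p)" by (rule mult_right_mono) simp
      moreover have "v \<in> unit_disc" using v1 by simp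
      ultimately show ?thesis using True by (simp add: mult.commute)
    qed simp
  qed
  also note le
  finally have "w * (norm (f z) powr p * (pi * \<rho>\<^sup>2)) \<le> t"
    using w t by (simp flip: ennreal_mult)
  then show "norm (f z) powr p \<le> K * t" using w \<rho> by (simp add: K_def field_simps)
qed

end

text \<open>Young's inequality with the small constant on one side. The two terms dominate in turn:
  either b is at most \<epsilon> a^(p - q), or a is bounded by a power of b / \<epsilon>.\<close>

lemma powr_mult_le_eps:
  fixes a b \<epsilon> p q :: real
  assumes "0 \<le> a" "0 \<le> b" "0 < \<epsilon>" "0 < q" "q < p"
  shows "a powr q * b \<le> \<epsilon> * a powr p + \<epsilon> powr (- (q / (p - q))) * b powr (p / (p - q))"
proof (cases "b \<le> \<epsilon> * a powr (p - q)")
  case True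
  then have "a powr q * b \<le> a powr q * (\<epsilon> * a powr (p - q))" by (intro mult_left_mono) auto
  also have "\<dots> = \<epsilon> * a powr p" by (simp add: mult.left_commute flip: powr_add)
  finally show ?thesis by (simp add: add_increasing2)
next
  case False
  then have b: "0 < b" using assms by (smt (verit) powr_ge_zero mult_nonneg_nonneg)
  have "a powr (p - q) \<le> b / \<epsilon>" using False assms by (simp add: field_simps)
  then have "(a powr (p - q)) powr (q / (p - q)) \<le> (b / \<epsilon>) powr (q / (p - q))"
    using assms by (intro powr_mono2) auto
  then have "a powr q \<le> (b / \<epsilon>) powr (q / (p - q))" using assms by (simp add: powr_powr)
  then have "a powr q * b \<le> (b / \<epsilon>) powr (q / (p - q)) * b" using b by (intro mult_right_mono) auto
  also have "\<dots> = \<epsilon> powr (- (q / (p - q))) * (b powr (q / (p - q)) * b powr 1)"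
    using b by (simp add: powr_divide powr_minus_divide)
  also have "b powr (q / (p - q)) * b powr 1 = b powr (p / (p - q))"
    unfolding powr_add[symmetric] using assms by (intro arg_cong[where f="\<lambda>x. b powr x"]) (simp add: field_simps)
  finally show ?thesis using assms by (simp add: add_increasing)
qed

text \<open>Stands in for the triangle inequality, which fails for the quasi-norms with p <
  1.\<close>

lemma powr_norm_diff_le:
  fixes x y :: complex
  assumes "0 < p"
  shows "norm (x - y) powr p \<le> 2 powr p * (norm x powr p + norm y powr p)"
proof -
  have "norm (x - y) \<le> 2 * max (norm x) (norm y)" using norm_triangle_ineq4[of x y] by simp
  then have "norm (x - y) powr p \<le> (2 * max (norm x) (norm y)) powr p" using assms by (intro powr_mono2) auto
  also have "\<dots> = 2 powr p * max (norm x) (norm y) powr p" by (rule powr_mult)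
  also have "\<dots> \<le> 2 powr p * (norm x powr p + norm y powr p)" by (intro mult_left_mono) (auto simp: max_def)
  finally show ?thesis .
qed

text \<open>The functions |f k|^q \<Phi> need not have a common integrable majorant, as f k is only
  bounded in L^p. Young's inequality splits off a part whose integral is small uniformly in k; the
  rest is dominated by a multiple of \<Phi> powr (p / (p - q)) and tends to 0 pointwise.\<close>

lemma nn_integral_powr_tendsto_zero:
  fixes f :: "nat \<Rightarrow> 'a \<Rightarrow> complex" and \<Phi> :: "'a \<Rightarrow> real"
  assumes f[measurable]: "\<And>k. f k \<in> borel_measurable M" and \<Phi>[measurable]: "\<Phi> \<in> borel_measurable M" and nn: "\<And>x. 0 \<le> \<Phi> x"
    and q: "0 < q" "q < p" and lim: "AE x in M. (\<lambda>k. f k x) \<longlonglongrightarrow> 0"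
    and B: "\<And>k. (\<integral>\<^sup>+x. ennreal (norm (f k x) powr p) \<partial>M) \<le> ennreal B"
    and fin: "(\<integral>\<^sup>+x. ennreal (\<Phi> x powr (p / (p - q))) \<partial>M) < \<infinity>"
  shows "(\<lambda>k. \<integral>\<^sup>+x. ennreal (norm (f k x) powr q * \<Phi> x) \<partial>M) \<longlonglongrightarrow> 0"
proof (rule order_tendstoI)
  fix a :: ennreal assume a: "0 < a"
  obtain r where r: "0 < r" "ennreal r < a"
  proof (cases a)
    case (real a')
    then show ?thesis using that[of "a' / 2"] a by (auto simp: ennreal_less_iff)
  next
    case top
    then show ?thesis using that[of 1] by simp
  qed
  define B' where "B' = max B 1"
  have B': "0 < B'" "\<And>k. (\<integral>\<^sup>+x. ennreal (norm (f k x) powr p) \<partial>M) \<le> ennreal B'"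
    using order_trans[OF B ennreal_leI[of B "max B 1"]] by (auto simp: B'_def)
  define \<epsilon> where "\<epsilon> = r / (2 * B')"
  have \<epsilon>: "0 < \<epsilon>" using r B' by (simp add: \<epsilon>_def)
  define E where "E = \<epsilon> powr (- (q / (p - q)))"
  define d where "d = (\<lambda>x. E * \<Phi> x powr (p / (p - q)))"
  have E: "0 \<le> E" by (simp add: E_def)
  have [measurable]: "d \<in> borel_measurable M" unfolding d_def by measurable
  \<comment> \<open>The minimum gives the remainder both properties at once: it is at most d, and it
    still tends to 0 with |f k|^q \<Phi>.\<close>
  have split: "ennreal (norm (f k x) powr q * \<Phi> x) \<le> ennreal \<epsilon> * ennreal (norm (f k x) powr p) + ennreal (min (norm (f k x) powr q * \<Phi> x) (d x))" for k x
  proof -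
    have "norm (f k x) powr q * \<Phi> x \<le> \<epsilon> * norm (f k x) powr p + d x"
      unfolding d_def E_def using nn \<epsilon> q by (intro powr_mult_le_eps) auto
    moreover have "0 \<le> \<epsilon> * norm (f k x) powr p" using \<epsilon> by simp
    ultimately have "norm (f k x) powr q * \<Phi> x \<le> \<epsilon> * norm (f k x) powr p + min (norm (f k x) powr q * \<Phi> x) (d x)"
      by (auto simp: min_def)
    then have "ennreal (norm (f k x) powr q * \<Phi> x) \<le> ennreal (\<epsilon> * norm (f k x) powr p + min (norm (f k x) powr q * \<Phi> x) (d x))"
      by (rule ennreal_leI)
    also have "\<dots> = ennreal \<epsilon> * ennreal (norm (f k x) powr p) + ennreal (min (norm (f k x) powr q * \<Phi> x) (d x))"
      using \<epsilon> nn E by (simp add: ennreal_plus ennreal_mult d_def)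
    finally show ?thesis .
  qed
  have "(\<lambda>k. \<integral>\<^sup>+x. ennreal (min (norm (f k x) powr q * \<Phi> x) (d x)) \<partial>M) \<longlonglongrightarrow> (\<integral>\<^sup>+x. 0 \<partial>M)"
  proof (rule nn_integral_dominated_convergence[where w="\<lambda>x. ennreal (d x)"])
    have "(\<integral>\<^sup>+x. ennreal (d x) \<partial>M) = ennreal E * (\<integral>\<^sup>+x. ennreal (\<Phi> x powr (p / (p - q))) \<partial>M)"
      using E by (simp add: d_def ennreal_mult nn_integral_cmult)
    then show "(\<integral>\<^sup>+x. ennreal (d x) \<partial>M) < \<infinity>" using fin by (simp add: ennreal_mult_less_top)
    show "AE x in M. (\<lambda>k. ennreal (min (norm (f k x) powr q * \<Phi> x) (d x))) \<longlonglongrightarrow> 0"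
      using lim
    proof eventually_elim
      case (elim x)
      have "(\<lambda>k. norm (f k x) powr q) \<longlonglongrightarrow> 0"
        using tendsto_powr'[OF tendsto_norm_zero[OF elim] tendsto_const[of q]] q by simp
      then have "(\<lambda>k. norm (f k x) powr q * \<Phi> x) \<longlonglongrightarrow> 0 * \<Phi> x" by (intro tendsto_intros)
      then have "(\<lambda>k. min (norm (f k x) powr q * \<Phi> x) (d x)) \<longlonglongrightarrow> min 0 (d x)" by (intro tendsto_min) auto
      moreover have "min 0 (d x) = 0" using E by (simp add: d_def)
      ultimately show ?case using tendsto_ennrealI by fastforce
    qed
  qed (auto intro!: AE_I2 ennreal_leI)
  then have "\<forall>\<^sub>F k in sequentially. (\<integral>\<^sup>+x. ennreal (min (norm (f k x) powr q * \<Phi> x) (d x)) \<partial>M) < ennreal (r / 2)"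
    using r by (intro order_tendstoD) auto
  then show "\<forall>\<^sub>F k in sequentially. (\<integral>\<^sup>+x. ennreal (norm (f k x) powr q * \<Phi> x) \<partial>M) < a"
  proof eventually_elim
    case (elim k)
    have "(\<integral>\<^sup>+x. ennreal (norm (f k x) powr q * \<Phi> x) \<partial>M)
      \<le> (\<integral>\<^sup>+x. ennreal \<epsilon> * ennreal (norm (f k x) powr p) + ennreal (min (norm (f k x) powr q * \<Phi> x) (d x)) \<partial>M)"
      by (intro nn_integral_mono split)
    also have "\<dots> = ennreal \<epsilon> * (\<integral>\<^sup>+x. ennreal (norm (f k x) powr p) \<partial>M) + (\<integral>\<^sup>+x. ennreal (min (norm (f k x) powr q * \<Phi> x) (d x)) \<partial>M)"
      by (subst nn_integral_add) (auto simp: nn_integral_cmult)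
    also have "\<dots> \<le> ennreal \<epsilon> * ennreal B' + ennreal (r / 2)"
      using elim by (intro add_mono mult_left_mono B') auto
    also have "\<dots> = ennreal (\<epsilon> * B' + r / 2)" using \<epsilon> B' r by (simp add: ennreal_mult ennreal_plus)
    also have "\<epsilon> * B' + r / 2 = r" using B' by (simp add: \<epsilon>_def)
    finally show ?case using r by simp
  qed
qed simp

section \<open>Weighted differentiation composition operators\<close>

lemma mem_Lp_iff:
  "f \<in> Lp p M \<longleftrightarrow> f \<in> borel_measurable M \<and> (\<integral>\<^sup>+x. ennreal (norm (f x) powr p) \<partial>M) < \<infinity>"
proof -
  have "integrable M (\<lambda>x. norm (f x) powr p) \<longleftrightarrow> (\<integral>\<^sup>+x. ennreal (norm (f x) powr p) \<partial>M) < \<infinity>"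
    if [measurable]: "f \<in> borel_measurable M"
  proof -
    have "(\<lambda>x. norm (f x) powr p) \<in> borel_measurable M" by measurable
    then show ?thesis by (simp add: integrable_iff_bounded)
  qed
  then show ?thesis by (auto simp: Lp_def)
qed

lemma Lp_norm_eq:
  assumes [measurable]: "f \<in> borel_measurable M"
  shows "Lp_norm p M f = enn2real (\<integral>\<^sup>+x. ennreal (norm (f x) powr p) \<partial>M) powr (1 / p)"
  unfolding Lp_norm_def by (subst integral_eq_nn_integral) auto

lemma Lp_norm_powr:
  assumes "f \<in> borel_measurable M" "0 < p"
  shows "Lp_norm p M f powr p = enn2real (\<integral>\<^sup>+x. ennreal (norm (f x) powr p) \<partial>M)"
  using assms by (simp add: Lp_norm_eq powr_powr)

lemma Lp_norm_nonneg: "0 \<le> Lp_norm p M f"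
  by (simp add: Lp_norm_def)

lemma Lp_norm_cmult:
  fixes f :: "'a \<Rightarrow> complex"
  assumes "0 < p"
  shows "Lp_norm p M (\<lambda>x. c * f x) = norm c * Lp_norm p M f"
  using assms by (simp add: Lp_norm_def norm_mult powr_mult powr_powr)

text \<open>Both the weight \<omega> and its radial version \<open>g\<close> are kept: the
  conclusions speak of \<omega>, the estimates of \<open>g\<close>, \<open>h\<close> and
  \<open>W\<close>.\<close>

locale weighted_bergman_setup = doubling_profile g h C b \<alpha>
  for g h C b \<alpha> +
  fixes \<omega> :: "complex \<Rightarrow> real" and p q :: real and n :: nat and \<nu> :: "complex measure"
    and \<phi> u :: "complex \<Rightarrow> complex"
  assumes q_pos: "0 < q" and q_less_p: "q < p"
    and \<omega>_measurable: "\<omega> \<in> borel_measurable area" and \<omega>_eq: "AE z in area. \<omega> z = g (norm z)"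
    and hat_eq: "\<And>z. z \<in> unit_disc \<Longrightarrow> weight_hat \<omega> z = ennreal (h (norm z))"
    and sets_\<nu>: "sets \<nu> = sets (restrict_space borel unit_disc)"
    and \<phi>_holomorphic: "\<phi> holomorphic_on unit_disc" and \<phi>_disc: "\<phi> ` unit_disc \<subseteq> unit_disc"
    and u_Lp: "u \<in> Lp q \<nu>"
begin

text \<open>The pushforward taken as a measure on the Borel sets of the plane, so that it can be
  paired with \<open>lborel\<close>; on Borel subsets of the disc it agrees with
  \<open>weighted_pushforward\<close>.\<close>

definition m :: "complex measure"
  where "m = distr (density \<nu> (\<lambda>x. ennreal (norm (u x) powr q))) borel \<phi>"

abbreviation T :: "(complex \<Rightarrow> complex) \<Rightarrow> complex \<Rightarrow> complex"
  where "T \<equiv> weighted_diff_comp n \<phi> u"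

definition J :: "(complex \<Rightarrow> complex) \<Rightarrow> ennreal"
  where "J f = (\<integral>\<^sup>+z\<in>unit_disc. ennreal (norm (f z) powr p) * ennreal (g (norm z)) \<partial>lborel)"

definition JW :: "(complex \<Rightarrow> complex) \<Rightarrow> ennreal"
  where "JW f = (\<integral>\<^sup>+z\<in>unit_disc. ennreal (norm (f z) powr p) * ennreal (W (norm z)) \<partial>lborel)"

text \<open>The averaging function with the mass of the Carleson square replaced by the comparable
  quantity (1 - |z|)^2 \<open>W (norm z)\<close>.\<close>

definition \<Phi> :: "real \<Rightarrow> complex \<Rightarrow> real"
  where "\<Phi> r z = measure m (pseudohyperbolic_disc z r) / ((1 - norm z)\<^sup>2 * W (norm z) * (1 - norm z) powr (real n * q))"

lemma p_pos: "0 < p" using q_pos q_less_p by simp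

lemma space_\<nu> [simp]: "space \<nu> = unit_disc"
  using sets_eq_imp_space_eq[OF sets_\<nu>] by (simp add: space_restrict_space)

lemma borel_measurable_\<nu>:
  assumes "continuous_on unit_disc f"
  shows "f \<in> borel_measurable \<nu>"
  using borel_measurable_continuous_on_restrict[OF assms] by (simp cong: measurable_cong_sets add: sets_\<nu>)

lemma \<phi>_measurable [measurable]: "\<phi> \<in> borel_measurable \<nu>"
  by (intro borel_measurable_\<nu> holomorphic_on_imp_continuous_on \<phi>_holomorphic)

lemma u_measurable [measurable]: "u \<in> borel_measurable \<nu>"
  using u_Lp by (simp add: mem_Lp_iff)

lemma \<phi>_in_disc: "x \<in> unit_disc \<Longrightarrow> \<phi> x \<in> unit_disc"
  using \<phi>_disc by blast

lemma sets_m [measurable_cong]: "sets m = sets borel"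
  by (simp add: m_def)

lemma nn_integral_m:
  assumes [measurable]: "F \<in> borel_measurable borel"
  shows "(\<integral>\<^sup>+z. F z \<partial>m) = (\<integral>\<^sup>+x. ennreal (norm (u x) powr q) * F (\<phi> x) \<partial>\<nu>)"
  unfolding m_def by (subst nn_integral_distr, simp, simp, subst nn_integral_density) auto

lemma finite_measure_m: "finite_measure m"
proof
  have "emeasure m (space m) = (\<integral>\<^sup>+z. 1 \<partial>m)" by simp
  also have "\<dots> = (\<integral>\<^sup>+x. ennreal (norm (u x) powr q) \<partial>\<nu>)" by (subst nn_integral_m) auto
  also have "\<dots> < \<infinity>" using u_Lp by (simp add: mem_Lp_iff)
  finally show "emeasure m (space m) \<noteq> \<infinity>" by simp
qed

lemma AE_m_disc: "AE z in m. z \<in> unit_disc"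
proof -
  have "(\<integral>\<^sup>+z. indicator (- unit_disc) z \<partial>m) = (\<integral>\<^sup>+x. ennreal (norm (u x) powr q) * indicator (- unit_disc) (\<phi> x) \<partial>\<nu>)"
    by (rule nn_integral_m) measurable
  also have "\<dots> = (\<integral>\<^sup>+x. 0 \<partial>\<nu>)"
    using \<phi>_in_disc by (intro nn_integral_cong) auto
  finally have "(\<integral>\<^sup>+z. indicator (- unit_disc) z \<partial>m) = 0" by simp
  then have "AE z in m. indicator (- unit_disc) z = (0::ennreal)"
    by (subst (asm) nn_integral_0_iff_AE) measurable
  then show ?thesis by eventually_elim (auto simp: indicator_def split: if_splits)
qed

lemma weighted_pushforward_measure:
  assumes "E \<in> sets borel" "E \<subseteq> unit_disc"
  shows "measure (weighted_pushforward \<phi> (\<lambda>x. norm (u x) powr q) \<nu>) E = measure m E"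
proof -
  have "\<phi> \<in> \<nu> \<rightarrow>\<^sub>M restrict_space borel unit_disc"
    using \<phi>_in_disc by (intro measurable_restrict_space2) auto
  moreover have "E \<in> sets (restrict_space borel unit_disc)" using assms by (auto simp: sets_restrict_space_iff)
  ultimately show ?thesis unfolding weighted_pushforward_def m_def measure_def
    using assms by (subst (1 2) emeasure_distr) auto
qed

lemma T_measurable:
  assumes f: "f holomorphic_on unit_disc"
  shows "T f \<in> borel_measurable \<nu>"
proof -
  have "continuous_on unit_disc (\<lambda>x. (deriv ^^ n) f (\<phi> x))"
    by (rule continuous_on_compose2[OF holomorphic_on_imp_continuous_on[OF holomorphic_higher_deriv[OF f]]
        holomorphic_on_imp_continuous_on[OF \<phi>_holomorphic] \<phi>_disc]) simp
  from borel_measurable_\<nu>[OF this] show ?thesis unfolding weighted_diff_comp_def by measurable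
qed

lemma T_integral:
  assumes f: "f holomorphic_on unit_disc"
  shows "(\<integral>\<^sup>+x. ennreal (norm (T f x) powr q) \<partial>\<nu>) = (\<integral>\<^sup>+z. ennreal (norm ((deriv ^^ n) f z) powr q) \<partial>m)"
proof -
  define F where "F = (\<lambda>z. ennreal (norm ((deriv ^^ n) f z) powr q) * indicator unit_disc z)"
  have F: "F \<in> borel_measurable borel" unfolding F_def
    by (intro measurable_norm_powr_indicator holomorphic_on_imp_continuous_on holomorphic_higher_deriv f q_pos) auto
  have "(\<integral>\<^sup>+z. ennreal (norm ((deriv ^^ n) f z) powr q) \<partial>m) = (\<integral>\<^sup>+z. F z \<partial>m)"
    using AE_m_disc by (intro nn_integral_cong_AE) (auto elim!: eventually_mono simp: F_def)
  also have "\<dots> = (\<integral>\<^sup>+x. ennreal (norm (u x) powr q) * F (\<phi> x) \<partial>\<nu>)" by (rule nn_integral_m[OF F])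
  also have "\<dots> = (\<integral>\<^sup>+x. ennreal (norm (T f x) powr q) \<partial>\<nu>)"
  proof (rule nn_integral_cong)
    fix x assume "x \<in> space \<nu>"
    then have "\<phi> x \<in> unit_disc" using \<phi>_in_disc by simp
    then show "ennreal (norm (u x) powr q) * F (\<phi> x) = ennreal (norm (T f x) powr q)"
      by (simp add: F_def weighted_diff_comp_def norm_mult powr_mult ennreal_mult)
  qed
  finally show ?thesis ..
qed

lemma bergman_integral:
  assumes f: "f holomorphic_on unit_disc"
  shows "f \<in> borel_measurable (weighted_area (\<lambda>z. ennreal (\<omega> z)))"
    "(\<integral>\<^sup>+z. ennreal (norm (f z) powr p) \<partial>weighted_area (\<lambda>z. ennreal (\<omega> z))) = ennreal (1 / pi) * J f"
proof -
  have [measurable]: "(\<lambda>z. indicator unit_disc z *\<^sub>R f z) \<in> borel_measurable borel"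
    by (intro borel_measurable_continuous_on_indicator holomorphic_on_imp_continuous_on f) auto
  have "(\<lambda>z. indicator unit_disc z *\<^sub>R f z) \<in> borel_measurable area"
  proof -
    have "(\<lambda>z. indicator unit_disc z *\<^sub>R f z) \<in> borel_measurable (lebesgue_on unit_disc)"
      by (intro measurable_restrict_space1 measurable_completion) simp
    then show ?thesis by (simp cong: measurable_cong_sets)
  qed
  then have fa[measurable]: "f \<in> borel_measurable area"
    by (subst measurable_cong[where g="\<lambda>z. indicator unit_disc z *\<^sub>R f z"]) (auto simp: space_area)
  then show "f \<in> borel_measurable (weighted_area (\<lambda>z. ennreal (\<omega> z)))"
    by (simp add: weighted_area_def)
  note \<omega>_measurable[measurable]
  have "(\<integral>\<^sup>+z. ennreal (norm (f z) powr p) \<partial>weighted_area (\<lambda>z. ennreal (\<omega> z)))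
      = (\<integral>\<^sup>+z. ennreal (\<omega> z) * ennreal (norm (f z) powr p) \<partial>area)"
    unfolding weighted_area_def by (intro nn_integral_density) measurable
  also have "\<dots> = (\<integral>\<^sup>+z. ennreal (norm (f z) powr p) * indicator unit_disc z * ennreal (g (norm z)) \<partial>area)"
  proof (rule nn_integral_cong_AE)
    show "AE z in area. ennreal (\<omega> z) * ennreal (norm (f z) powr p) = ennreal (norm (f z) powr p) * indicator unit_disc z * ennreal (g (norm z))"
      using \<omega>_eq AE_space[of area] by eventually_elim (simp add: mult.commute)
  qed
  also have "\<dots> = ennreal (1 / pi) * (\<integral>\<^sup>+z\<in>unit_disc. ennreal (norm (f z) powr p) * indicator unit_disc z * ennreal (g (norm z)) \<partial>lborel)"
    by (intro nn_integral_area borel_measurable_times_ennreal measurable_norm_powr_indicator p_pos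
        holomorphic_on_imp_continuous_on f) auto
  also have "(\<integral>\<^sup>+z\<in>unit_disc. ennreal (norm (f z) powr p) * indicator unit_disc z * ennreal (g (norm z)) \<partial>lborel) = J f"
    unfolding J_def by (intro nn_integral_cong) (auto simp: indicator_def)
  finally show "(\<integral>\<^sup>+z. ennreal (norm (f z) powr p) \<partial>weighted_area (\<lambda>z. ennreal (\<omega> z))) = ennreal (1 / pi) * J f" .
qed

lemma mem_bergman_space_iff: "f \<in> bergman_space p \<omega> \<longleftrightarrow> f holomorphic_on unit_disc \<and> J f < \<infinity>"
proof -
  have "ennreal (1 / pi) * J f < \<infinity> \<longleftrightarrow> J f < \<infinity>" by (auto simp: ennreal_mult_less_top)
  then show ?thesis using bergman_integral[of f] by (auto simp: bergman_space_def mem_Lp_iff)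
qed

lemma bergman_norm_powr:
  assumes "f holomorphic_on unit_disc"
  shows "bergman_norm p \<omega> f powr p = enn2real (ennreal (1 / pi) * J f)"
  unfolding bergman_norm_def using bergman_integral[OF assms] p_pos by (simp add: Lp_norm_powr)

lemma bergman_norm_nonneg: "0 \<le> bergman_norm p \<omega> f"
  by (simp add: bergman_norm_def Lp_norm_nonneg)

lemma J_eq_bergman_norm:
  assumes "f \<in> bergman_space p \<omega>"
  shows "J f = ennreal (pi * bergman_norm p \<omega> f powr p)"
proof -
  have f: "f holomorphic_on unit_disc" "J f < \<infinity>" using assms by (auto simp: mem_bergman_space_iff)
  then obtain t where t: "J f = ennreal t" "0 \<le> t" by (cases "J f") auto
  have "bergman_norm p \<omega> f powr p = t / pi"
    using bergman_norm_powr[OF f(1)] t by (simp flip: ennreal_mult)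
  then show ?thesis using t by simp
qed

lemma T_Lp_norm_powr:
  assumes "f holomorphic_on unit_disc"
  shows "Lp_norm q \<nu> (T f) powr q = enn2real (\<integral>\<^sup>+z. ennreal (norm ((deriv ^^ n) f z) powr q) \<partial>m)"
  using T_measurable[OF assms] q_pos by (simp add: Lp_norm_powr T_integral[OF assms])

lemma T_mem_Lp_iff:
  assumes "f holomorphic_on unit_disc"
  shows "T f \<in> Lp q \<nu> \<longleftrightarrow> (\<integral>\<^sup>+z. ennreal (norm ((deriv ^^ n) f z) powr q) \<partial>m) < \<infinity>"
  using T_measurable[OF assms] by (simp add: mem_Lp_iff T_integral[OF assms])

lemma J_JW_comparable:
  obtains c where "0 < c" "\<And>f. f holomorphic_on unit_disc \<Longrightarrow> J f \<le> ennreal c * JW f"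
    "\<And>f. f holomorphic_on unit_disc \<Longrightarrow> JW f \<le> ennreal c * J f"
proof -
  obtain c where c: "0 < c"
    "\<And>f p. f holomorphic_on unit_disc \<Longrightarrow> 0 < p \<Longrightarrow>
      (\<integral>\<^sup>+z\<in>unit_disc. ennreal (norm (f z) powr p) * ennreal (W (norm z)) \<partial>lborel)
        \<le> ennreal c * (\<integral>\<^sup>+z\<in>unit_disc. ennreal (norm (f z) powr p) * ennreal (g (norm z)) \<partial>lborel)"
    "\<And>f p. f holomorphic_on unit_disc \<Longrightarrow> 0 < p \<Longrightarrow>
      (\<integral>\<^sup>+z\<in>unit_disc. ennreal (norm (f z) powr p) * ennreal (g (norm z)) \<partial>lborel)
        \<le> ennreal c * (\<integral>\<^sup>+z\<in>unit_disc. ennreal (norm (f z) powr p) * ennreal (W (norm z)) \<partial>lborel)"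
    by (rule norm_equivalence) (rule that)
  show ?thesis using that[OF c(1)] c(2,3)[OF _ p_pos] by (auto simp: J_def JW_def)
qed

lemma \<Phi>_measurable: "(\<lambda>z. indicator unit_disc z * \<Phi> r z) \<in> borel_measurable borel"
proof -
  have [measurable]: "(\<lambda>z. indicator unit_disc z * measure m (pseudohyperbolic_disc z r)) \<in> borel_measurable borel"
    by (rule measurable_measure_pseudohyperbolic_disc[OF finite_measure_m sets_m])
  have "(\<lambda>z. (indicator unit_disc z * measure m (pseudohyperbolic_disc z r)) / ((1 - norm z)\<^sup>2 * W (norm z) * (1 - norm z) powr (real n * q))) \<in> borel_measurable borel"
    by measurable
  then show ?thesis by (simp add: \<Phi>_def)
qed

lemma \<Phi>_nonneg: "z \<in> unit_disc \<Longrightarrow> 0 \<le> \<Phi> r z"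
  using W_nonneg by (simp add: \<Phi>_def)

lemma weight_tilde_eq: "z \<in> unit_disc \<Longrightarrow> weight_tilde \<omega> z = ennreal (W (norm z))"
  using h_pos[of "norm z"] by (simp add: weight_tilde_def hat_eq W_def divide_ennreal less_imp_le)

section \<open>The averaging function and its comparable form \<open>\<Phi>\<close>\<close>

lemma averaging_function_bounds:
  obtains c where "0 < c" "\<And>z r. z \<in> unit_disc \<Longrightarrow> averaging_function n q \<omega> \<nu> \<phi> u r z \<le> c * \<Phi> r z"
    "\<And>z r. z \<in> unit_disc \<Longrightarrow> \<Phi> r z \<le> c * averaging_function n q \<omega> \<nu> \<phi> u r z"
proof -
  obtain c where c: "0 < c" "\<And>z. z \<in> unit_disc \<Longrightarrow>
    c * ((1 - norm z)\<^sup>2 * W (norm z)) \<le> measure (weighted_area (\<lambda>x. ennreal (\<omega> x))) (carleson_square z)"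
    "\<And>z. z \<in> unit_disc \<Longrightarrow>
    measure (weighted_area (\<lambda>x. ennreal (\<omega> x))) (carleson_square z) \<le> 2 * ((1 - norm z)\<^sup>2 * W (norm z))"
    by (rule carleson_square_measure_bounds[OF \<omega>_eq \<omega>_measurable]) (rule that)
  have main: "averaging_function n q \<omega> \<nu> \<phi> u r z \<le> 1 / c * \<Phi> r z \<and> \<Phi> r z \<le> 2 * averaging_function n q \<omega> \<nu> \<phi> u r z"
    if z: "z \<in> unit_disc" for z r
  proof -
    define x where "x = (1 - norm z)\<^sup>2 * W (norm z)"
    define y where "y = (1 - norm z) powr (real n * q)"
    define S where "S = measure (weighted_area (\<lambda>x. ennreal (\<omega> x))) (carleson_square z)"
    define M where "M = measure m (pseudohyperbolic_disc z r)"
    have pos: "0 < x" "0 < y" using z W_pos[of "norm z"] by (auto simp: x_def y_def)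
    have S: "c * x \<le> S" "S \<le> 2 * x" using c(2,3)[OF z] by (auto simp: S_def x_def)
    then have S0: "0 < S" using pos c(1) by (meson less_le_trans mult_pos_pos)
    have M0: "0 \<le> M" by (simp add: M_def)
    have avg: "averaging_function n q \<omega> \<nu> \<phi> u r z = M / (S * y)"
      by (simp add: averaging_function_def M_def S_def y_def weighted_pushforward_measure pseudohyperbolic_disc_subset)
    have Ph: "\<Phi> r z = M / (x * y)" by (simp add: \<Phi>_def M_def x_def y_def)
    have "M / (S * y) \<le> M / (c * x * y)" using S S0 pos M0 c(1) by (intro divide_left_mono mult_right_mono) auto
    moreover have "M / (x * y) \<le> 2 * (M / (S * y))"
    proof -
      have "M / (2 * x * y) \<le> M / (S * y)" using S S0 pos M0 by (intro divide_left_mono mult_right_mono) auto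
      then show ?thesis by simp
    qed
    ultimately show ?thesis unfolding avg Ph using c(1) by simp
  qed
  have \<Phi>0: "0 \<le> averaging_function n q \<omega> \<nu> \<phi> u r z" for z r
    by (simp add: averaging_function_def)
  show ?thesis
  proof (rule that[of "max (1 / c) 2"])
    fix z r assume z: "z \<in> unit_disc"
    have "1 / c * \<Phi> r z \<le> max (1 / c) 2 * \<Phi> r z" using \<Phi>_nonneg[OF z] by (intro mult_right_mono) auto
    then show "averaging_function n q \<omega> \<nu> \<phi> u r z \<le> max (1 / c) 2 * \<Phi> r z" using main[OF z] by (meson order_trans)
    have "2 * averaging_function n q \<omega> \<nu> \<phi> u r z \<le> max (1 / c) 2 * averaging_function n q \<omega> \<nu> \<phi> u r z"
      using \<Phi>0 by (intro mult_right_mono) auto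
    then show "\<Phi> r z \<le> max (1 / c) 2 * averaging_function n q \<omega> \<nu> \<phi> u r z" using main[OF z] by (meson order_trans)
  qed simp
qed

text \<open>Membership in \<open>Lp\<close> includes measurability, which two-sided bounds by
  \<open>\<Phi>\<close> cannot give; the formula for the mass of Carleson squares exhibits a Borel
  function that coincides with it on the disc.\<close>

lemma averaging_function_measurable:
  "averaging_function n q \<omega> \<nu> \<phi> u r \<in> borel_measurable (weighted_area (weight_tilde \<omega>))"
proof -
  have [measurable]: "(\<lambda>z. indicator unit_disc z * measure m (pseudohyperbolic_disc z r)) \<in> borel_measurable borel"
    by (rule measurable_measure_pseudohyperbolic_disc[OF finite_measure_m sets_m])
  define Z where "Z = (\<lambda>x. \<integral>\<^sup>+s\<in>{x..<1}. ennreal s * ennreal (g s) \<partial>lborel)"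
  have [measurable]: "Z \<in> borel_measurable borel"
  proof -
    \<comment> \<open>The lower limit x is coded as an indicator of s - x, so that the integrand is
      visibly measurable in both variables.\<close>
    have "(\<lambda>x. \<integral>\<^sup>+s. ennreal s * ennreal (g s) * (indicator {s'::real. 0 \<le> s'} (s - x) * indicator {s. s < 1} s) \<partial>lborel) \<in> borel_measurable borel"
      by measurable
    moreover have "Z x = (\<integral>\<^sup>+s. ennreal s * ennreal (g s) * (indicator {s'::real. 0 \<le> s'} (s - x) * indicator {s. s < 1} s) \<partial>lborel)" for x
      unfolding Z_def by (intro nn_integral_cong) (auto simp: indicator_def)
    ultimately show ?thesis by (subst measurable_cong) auto
  qed
  have "(\<lambda>z. (indicator unit_disc z * measure m (pseudohyperbolic_disc z r)) /
      (enn2real (ennreal (if z = 0 then 2 else (1 - norm z) / pi) * Z (norm z)) * (1 - norm z) powr (real n * q))) \<in> borel_measurable borel"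
    by measurable
  then have "(\<lambda>z. (indicator unit_disc z * measure m (pseudohyperbolic_disc z r)) /
      (enn2real (ennreal (if z = 0 then 2 else (1 - norm z) / pi) * Z (norm z)) * (1 - norm z) powr (real n * q))) \<in> borel_measurable (lebesgue_on unit_disc)"
    by (intro measurable_restrict_space1 measurable_completion) simp
  moreover have "averaging_function n q \<omega> \<nu> \<phi> u r z = (indicator unit_disc z * measure m (pseudohyperbolic_disc z r)) /
      (enn2real (ennreal (if z = 0 then 2 else (1 - norm z) / pi) * Z (norm z)) * (1 - norm z) powr (real n * q))" if "z \<in> unit_disc" for z
  proof -
    have "measure (weighted_area (\<lambda>x. ennreal (\<omega> x))) (carleson_square z) =
        enn2real (ennreal (if z = 0 then 2 else (1 - norm z) / pi) * Z (norm z))"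
      unfolding measure_def Z_def by (rule arg_cong[OF carleson_square_emeasure[OF \<omega>_eq \<omega>_measurable that]])
    moreover have "measure (weighted_pushforward \<phi> (\<lambda>x. norm (u x) powr q) \<nu>) (pseudohyperbolic_disc z r)
        = indicator unit_disc z * measure m (pseudohyperbolic_disc z r)"
      using that by (simp add: weighted_pushforward_measure pseudohyperbolic_disc_subset)
    ultimately show ?thesis unfolding averaging_function_def by (simp only:)
  qed
  ultimately have "averaging_function n q \<omega> \<nu> \<phi> u r \<in> borel_measurable (lebesgue_on unit_disc)"
    by (subst measurable_cong) auto
  then show ?thesis by (simp add: weighted_area_def cong: measurable_cong_sets)
qed

lemma averaging_function_mem_Lp_iff:
  assumes s: "0 < s"
  shows "averaging_function n q \<omega> \<nu> \<phi> u r \<in> Lp s (weighted_area (weight_tilde \<omega>)) \<longleftrightarrow>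
    (\<integral>\<^sup>+z\<in>unit_disc. ennreal (\<Phi> r z powr s * W (norm z)) \<partial>lborel) < \<infinity>"
proof -
  let ?A = "averaging_function n q \<omega> \<nu> \<phi> u r"
  obtain c where c: "0 < c" "\<And>z r. z \<in> unit_disc \<Longrightarrow> averaging_function n q \<omega> \<nu> \<phi> u r z \<le> c * \<Phi> r z"
    "\<And>z r. z \<in> unit_disc \<Longrightarrow> \<Phi> r z \<le> c * averaging_function n q \<omega> \<nu> \<phi> u r z"
    by (rule averaging_function_bounds) (rule that)
  have Wm: "(\<lambda>z. ennreal (W (norm z))) \<in> borel_measurable area" by (rule borel_measurable_area) measurable
  then have wt: "weight_tilde \<omega> \<in> borel_measurable area"
    by (subst measurable_cong[where g="\<lambda>z. ennreal (W (norm z))"]) (auto simp: weight_tilde_eq)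
  have Am: "?A \<in> borel_measurable area" using averaging_function_measurable[of r] by (simp add: weighted_area_def)
  have A0: "0 \<le> ?A z" for z by (simp add: averaging_function_def)
  note [measurable] = Wm Am
  define I where "I = (\<integral>\<^sup>+z. ennreal (norm (?A z) powr s) \<partial>weighted_area (weight_tilde \<omega>))"
  have I: "I = (\<integral>\<^sup>+z. ennreal (W (norm z)) * ennreal (?A z powr s) \<partial>area)"
  proof -
    have "I = (\<integral>\<^sup>+z. weight_tilde \<omega> z * ennreal (norm (?A z) powr s) \<partial>area)"
      unfolding I_def weighted_area_def using Am by (intro nn_integral_density wt) measurable
    also have "\<dots> = (\<integral>\<^sup>+z. ennreal (W (norm z)) * ennreal (?A z powr s) \<partial>area)"
      using A0 by (intro nn_integral_cong) (simp add: weight_tilde_eq)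
    finally show ?thesis .
  qed
  define F where "F = (\<lambda>z. ennreal ((indicator unit_disc z * \<Phi> r z) powr s * W (norm z)))"
  have [measurable]: "F \<in> borel_measurable borel" unfolding F_def using \<Phi>_measurable[of r] by measurable
  have Fa: "(\<integral>\<^sup>+z. F z \<partial>area) = ennreal (1 / pi) * (\<integral>\<^sup>+z\<in>unit_disc. ennreal (\<Phi> r z powr s * W (norm z)) \<partial>lborel)"
  proof -
    have "(\<integral>\<^sup>+z. F z \<partial>area) = ennreal (1 / pi) * (\<integral>\<^sup>+z\<in>unit_disc. F z \<partial>lborel)"
      by (rule nn_integral_area) measurable
    also have "(\<integral>\<^sup>+z\<in>unit_disc. F z \<partial>lborel) = (\<integral>\<^sup>+z\<in>unit_disc. ennreal (\<Phi> r z powr s * W (norm z)) \<partial>lborel)"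
      by (intro nn_integral_cong) (auto simp: F_def indicator_def)
    finally show ?thesis .
  qed
  have le1: "I \<le> ennreal (c powr s) * (\<integral>\<^sup>+z. F z \<partial>area)"
  proof -
    have "I \<le> (\<integral>\<^sup>+z. ennreal (c powr s) * F z \<partial>area)" unfolding I
    proof (rule nn_integral_mono)
      fix z assume "z \<in> space area"
      then have z: "z \<in> unit_disc" by simp
      have "?A z powr s \<le> (c * \<Phi> r z) powr s" using c(2)[OF z] A0 s by (intro powr_mono2) auto
      then have "W (norm z) * ?A z powr s \<le> W (norm z) * (c * \<Phi> r z) powr s" using W_nonneg by (rule mult_left_mono)
      also have "\<dots> = c powr s * (\<Phi> r z powr s * W (norm z))" by (simp add: powr_mult)
      finally show "ennreal (W (norm z)) * ennreal (?A z powr s) \<le> ennreal (c powr s) * F z"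
        using z W_nonneg by (simp add: F_def ennreal_leI flip: ennreal_mult)
    qed
    also have "\<dots> = ennreal (c powr s) * (\<integral>\<^sup>+z. F z \<partial>area)" by (intro nn_integral_cmult borel_measurable_area) measurable
    finally show ?thesis .
  qed
  have le2: "(\<integral>\<^sup>+z. F z \<partial>area) \<le> ennreal (c powr s) * I"
  proof -
    have "(\<integral>\<^sup>+z. F z \<partial>area) \<le> (\<integral>\<^sup>+z. ennreal (c powr s) * (ennreal (W (norm z)) * ennreal (?A z powr s)) \<partial>area)"
    proof (rule nn_integral_mono)
      fix z assume "z \<in> space area"
      then have z: "z \<in> unit_disc" by simp
      have "\<Phi> r z powr s \<le> (c * ?A z) powr s" using c(3)[OF z] \<Phi>_nonneg[OF z] s by (intro powr_mono2) auto
      then have "\<Phi> r z powr s * W (norm z) \<le> (c * ?A z) powr s * W (norm z)" using W_nonneg by (rule mult_right_mono)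
      also have "\<dots> = c powr s * (W (norm z) * ?A z powr s)" by (simp add: powr_mult)
      finally show "F z \<le> ennreal (c powr s) * (ennreal (W (norm z)) * ennreal (?A z powr s))"
        using z W_nonneg by (simp add: F_def ennreal_leI flip: ennreal_mult)
    qed
    also have "\<dots> = ennreal (c powr s) * I" unfolding I by (intro nn_integral_cmult) measurable
    finally show ?thesis .
  qed
  have "I < \<infinity> \<longleftrightarrow> (\<integral>\<^sup>+z\<in>unit_disc. ennreal (\<Phi> r z powr s * W (norm z)) \<partial>lborel) < \<infinity>"
  proof
    assume "I < \<infinity>"
    then have "ennreal (c powr s) * I < \<infinity>" by (simp add: ennreal_mult_less_top)
    with le2 have "(\<integral>\<^sup>+z. F z \<partial>area) < \<infinity>" by (rule le_less_trans)
    then show "(\<integral>\<^sup>+z\<in>unit_disc. ennreal (\<Phi> r z powr s * W (norm z)) \<partial>lborel) < \<infinity>"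
      unfolding Fa by (auto simp: ennreal_mult_less_top)
  next
    assume "(\<integral>\<^sup>+z\<in>unit_disc. ennreal (\<Phi> r z powr s * W (norm z)) \<partial>lborel) < \<infinity>"
    then have "ennreal (c powr s) * (\<integral>\<^sup>+z. F z \<partial>area) < \<infinity>" unfolding Fa by (simp add: ennreal_mult_less_top)
    with le1 show "I < \<infinity>" by (rule le_less_trans)
  qed
  then show ?thesis using averaging_function_measurable[of r] by (simp add: mem_Lp_iff I_def)
qed

section \<open>Boundedness, compactness and the averaging condition\<close>

lemma bounded_imp_averaging:
  assumes bd: "bounded_operator_Lp p \<omega> q \<nu> T" and r: "0 < r" "r < 1"
  shows "averaging_function n q \<omega> \<nu> \<phi> u r \<in> Lp (p / (p - q)) (weighted_area (weight_tilde \<omega>))"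
proof -
  obtain B where sub: "T ` bergman_space p \<omega> \<subseteq> Lp q \<nu>"
    and B: "\<And>f. f \<in> bergman_space p \<omega> \<Longrightarrow> Lp_norm q \<nu> (T f) \<le> B * bergman_norm p \<omega> f"
    using bd by (auto simp: bounded_operator_Lp_def)
  obtain c where c: "0 < c" "\<And>f. f holomorphic_on unit_disc \<Longrightarrow> J f \<le> ennreal c * JW f"
    "\<And>f. f holomorphic_on unit_disc \<Longrightarrow> JW f \<le> ennreal c * J f"
    by (rule J_JW_comparable) (rule that)
  define C0 where "C0 = \<bar>B\<bar> powr q * (c / pi) powr (q / p)"
  have "(\<integral>\<^sup>+z. ennreal (norm ((deriv ^^ n) f z) powr q) \<partial>m) \<le> ennreal (C0 * t powr (q / p))"
    if f: "f holomorphic_on unit_disc" and t: "0 \<le> t"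
      and le: "(\<integral>\<^sup>+z\<in>unit_disc. ennreal (norm (f z) powr p) * ennreal (W (norm z)) \<partial>lborel) \<le> ennreal t" for f t
  proof -
    have "J f \<le> ennreal c * JW f" by (rule c(2)[OF f])
    also have "\<dots> \<le> ennreal c * ennreal t" using le unfolding JW_def by (rule mult_left_mono) simp
    finally have Jct: "J f \<le> ennreal (c * t)" using c(1) t by (simp add: ennreal_mult)
    then have "J f < \<infinity>" by (rule le_less_trans) simp
    then have fA: "f \<in> bergman_space p \<omega>" using f by (simp add: mem_bergman_space_iff)
    have "pi * bergman_norm p \<omega> f powr p \<le> c * t"
      using Jct c(1) t unfolding J_eq_bergman_norm[OF fA] by (subst (asm) ennreal_le_iff) auto
    then have "bergman_norm p \<omega> f powr p \<le> c / pi * t" by (simp add: field_simps)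
    then have "(bergman_norm p \<omega> f powr p) powr (q / p) \<le> (c / pi * t) powr (q / p)"
      using p_pos q_pos by (intro powr_mono2) auto
    moreover have "(bergman_norm p \<omega> f powr p) powr (q / p) = bergman_norm p \<omega> f powr q"
      using p_pos by (simp add: powr_powr)
    ultimately have nq: "bergman_norm p \<omega> f powr q \<le> (c / pi) powr (q / p) * t powr (q / p)"
      by (simp only: powr_mult)
    have "Lp_norm q \<nu> (T f) \<le> \<bar>B\<bar> * bergman_norm p \<omega> f"
      using B[OF fA] mult_right_mono[OF abs_ge_self[of B] bergman_norm_nonneg[of f]] by linarith
    then have "Lp_norm q \<nu> (T f) powr q \<le> (\<bar>B\<bar> * bergman_norm p \<omega> f) powr q"
      using q_pos Lp_norm_nonneg by (intro powr_mono2) auto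
    also have "\<dots> = \<bar>B\<bar> powr q * bergman_norm p \<omega> f powr q" by (rule powr_mult)
    also have "\<dots> \<le> \<bar>B\<bar> powr q * ((c / pi) powr (q / p) * t powr (q / p))" using nq by (intro mult_left_mono) auto
    finally have "enn2real (\<integral>\<^sup>+z. ennreal (norm ((deriv ^^ n) f z) powr q) \<partial>m) \<le> C0 * t powr (q / p)"
      by (simp add: T_Lp_norm_powr[OF f] C0_def mult.assoc)
    \<comment> \<open>\<open>Lp_norm\<close> is 0 when the q-th power is not integrable, so the norm
      inequality alone does not give finiteness; the inclusion of the range in
      \<open>Lp q \<nu>\<close> does.\<close>
    moreover have "(\<integral>\<^sup>+z. ennreal (norm ((deriv ^^ n) f z) powr q) \<partial>m) < \<infinity>"
      using sub fA T_mem_Lp_iff[OF f] by blast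
    ultimately show ?thesis
      by (metis ennreal_enn2real ennreal_leI infinity_ennreal_def)
  qed
  from averages_integrable[OF finite_measure_m sets_m AE_m_disc q_pos q_less_p _ this r]
  show ?thesis using q_pos q_less_p
    by (subst averaging_function_mem_Lp_iff) (auto simp: \<Phi>_def C0_def)
qed

lemma T_diff:
  assumes "f holomorphic_on unit_disc" "k holomorphic_on unit_disc" "x \<in> unit_disc"
  shows "T f x - T k x = T (\<lambda>z. f z - k z) x"
  using higher_deriv_diff[OF assms(1,2) open_ball \<phi>_in_disc[OF assms(3)]]
  by (simp add: weighted_diff_comp_def right_diff_distrib)

lemma T_cmult:
  assumes "f holomorphic_on unit_disc" "x \<in> unit_disc"
  shows "T (\<lambda>z. c * f z) x = c * T f x"
  using higher_deriv_cmult[OF assms(1) \<phi>_in_disc[OF assms(2)] open_ball, of n c]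
  by (simp add: weighted_diff_comp_def)

text \<open>Along a subsequence the functions converge pointwise to a holomorphic f, and Fatou's
  lemma gives f the same bound. The differences are then bounded in L^p with respect to
  \<open>W\<close> and tend to 0 pointwise, so their images tend to 0; the limit of the images is
  \<open>T f\<close>.\<close>

lemma averaging_imp_compact:
  assumes r: "0 < r" "r < 1"
    and avg: "averaging_function n q \<omega> \<nu> \<phi> u r \<in> Lp (p / (p - q)) (weighted_area (weight_tilde \<omega>))"
  shows "compact_operator_Lp p \<omega> q \<nu> T"
proof -
  let ?s = "p / (p - q)"
  have s: "0 < ?s" using q_pos q_less_p by simp
  have \<Phi>fin: "(\<integral>\<^sup>+z\<in>unit_disc. ennreal (\<Phi> r z powr ?s * W (norm z)) \<partial>lborel) < \<infinity>"
    using avg averaging_function_mem_Lp_iff[OF s] by simp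
  obtain c where c: "0 < c" "\<And>f. f holomorphic_on unit_disc \<Longrightarrow> J f \<le> ennreal c * JW f"
    "\<And>f. f holomorphic_on unit_disc \<Longrightarrow> JW f \<le> ennreal c * J f"
    by (rule J_JW_comparable) (rule that)
  obtain K where K: "0 < K" "\<And>f. f holomorphic_on unit_disc \<Longrightarrow>
    (\<integral>\<^sup>+z. ennreal (norm ((deriv ^^ n) f z) powr q) \<partial>m)
      \<le> ennreal K * (\<integral>\<^sup>+w\<in>unit_disc. ennreal (norm (f w) powr q) *
          ennreal (measure m (pseudohyperbolic_disc w r) * (1 - norm w) powr (- (real n * q) - 2)) \<partial>lborel)"
    by (rule higher_deriv_integral_le[OF finite_measure_m sets_m AE_m_disc q_pos r]) (rule that)
  define P where "P = density lborel (\<lambda>z. ennreal (W (norm z)) * indicator unit_disc z)"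
  define \<Psi> where "\<Psi> = (\<lambda>z. indicator unit_disc z * \<Phi> r z)"
  have \<Psi>[measurable]: "\<Psi> \<in> borel_measurable borel" unfolding \<Psi>_def by (rule \<Phi>_measurable)
  have \<Psi>0: "0 \<le> \<Psi> z" for z using \<Phi>_nonneg[of z r] by (cases "z \<in> unit_disc") (auto simp: \<Psi>_def)
  have nnP: "(\<integral>\<^sup>+z. F z \<partial>P) = (\<integral>\<^sup>+z\<in>unit_disc. F z * ennreal (W (norm z)) \<partial>lborel)" if [measurable]: "F \<in> borel_measurable borel" for F
    unfolding P_def by (subst nn_integral_density) (auto intro!: nn_integral_cong simp: mult_ac)
  have \<Psi>fin: "(\<integral>\<^sup>+z. ennreal (\<Psi> z powr ?s) \<partial>P) < \<infinity>"
  proof -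
    have "(\<integral>\<^sup>+z. ennreal (\<Psi> z powr ?s) \<partial>P) = (\<integral>\<^sup>+z\<in>unit_disc. ennreal (\<Psi> z powr ?s) * ennreal (W (norm z)) \<partial>lborel)"
      by (rule nnP) measurable
    also have "\<dots> = (\<integral>\<^sup>+z\<in>unit_disc. ennreal (\<Phi> r z powr ?s * W (norm z)) \<partial>lborel)"
      using W_nonneg by (intro nn_integral_cong) (auto simp: \<Psi>_def indicator_def ennreal_mult)
    finally show ?thesis using \<Phi>fin by simp
  qed
  \<comment> \<open>Functions holomorphic on the disc are arbitrary outside it; the cut-off makes
    them Borel on the plane, where \<open>P\<close> is defined.\<close>
  define N where "N = (\<lambda>f z. indicator unit_disc z *\<^sub>R f z :: complex)"
  have Nm: "N f \<in> borel_measurable borel" if "f holomorphic_on unit_disc" for f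
    unfolding N_def by (intro borel_measurable_continuous_on_indicator holomorphic_on_imp_continuous_on that) auto
  have NJ: "(\<integral>\<^sup>+z. ennreal (norm (N f z) powr p) \<partial>P) = JW f" if "f holomorphic_on unit_disc" for f
  proof -
    note [measurable] = Nm[OF that]
    have "(\<integral>\<^sup>+z. ennreal (norm (N f z) powr p) \<partial>P) = (\<integral>\<^sup>+z\<in>unit_disc. ennreal (norm (N f z) powr p) * ennreal (W (norm z)) \<partial>lborel)"
      by (rule nnP) measurable
    also have "\<dots> = JW f" unfolding JW_def by (intro nn_integral_cong) (auto simp: N_def indicator_def)
    finally show ?thesis .
  qed
  \<comment> \<open>The factor \<open>W\<close> of the measure \<open>P\<close> cancels the one in
    the denominator of \<open>\<Phi>\<close>, which leaves exactly the power -n q - 2 of 1 -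
    |w|.\<close>
  have K': "(\<integral>\<^sup>+z. ennreal (norm ((deriv ^^ n) f z) powr q) \<partial>m) \<le> ennreal K * (\<integral>\<^sup>+z. ennreal (norm (N f z) powr q * \<Psi> z) \<partial>P)"
    if f: "f holomorphic_on unit_disc" for f
  proof -
    note [measurable] = Nm[OF that]
    have "(\<integral>\<^sup>+z. ennreal (norm (N f z) powr q * \<Psi> z) \<partial>P) = (\<integral>\<^sup>+z\<in>unit_disc. ennreal (norm (N f z) powr q * \<Psi> z) * ennreal (W (norm z)) \<partial>lborel)"
      by (rule nnP) measurable
    also have "\<dots> = (\<integral>\<^sup>+w\<in>unit_disc. ennreal (norm (f w) powr q) *
          ennreal (measure m (pseudohyperbolic_disc w r) * (1 - norm w) powr (- (real n * q) - 2)) \<partial>lborel)"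
    proof (rule nn_integral_cong)
      fix w
      show "ennreal (norm (N f w) powr q * \<Psi> w) * ennreal (W (norm w)) * indicator unit_disc w
        = ennreal (norm (f w) powr q) * ennreal (measure m (pseudohyperbolic_disc w r) * (1 - norm w) powr (- (real n * q) - 2)) * indicator unit_disc w"
      proof (cases "w \<in> unit_disc")
        case True
        define y where "y = 1 - norm w"
        have y: "0 < y" "0 < W (norm w)" using True W_pos[of "norm w"] by (auto simp: y_def)
        have "y powr (- (real n * q) - 2) = 1 / (y\<^sup>2 * y powr (real n * q))"
          using y by (simp add: powr_diff powr_minus_divide)
        then have "\<Phi> r w * W (norm w) = measure m (pseudohyperbolic_disc w r) * y powr (- (real n * q) - 2)"
          using y by (simp add: \<Phi>_def flip: y_def)
        then have "norm (f w) powr q * \<Phi> r w * W (norm w) = norm (f w) powr q * (measure m (pseudohyperbolic_disc w r) * y powr (- (real n * q) - 2))"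
          by (simp add: mult.assoc)
        then show ?thesis using True W_nonneg \<Phi>_nonneg[OF True, of r]
          by (simp add: N_def \<Psi>_def y_def flip: ennreal_mult)
      qed simp
    qed
    finally show ?thesis using K(2)[OF f] by simp
  qed
  have JWfin: "JW f < \<infinity>" if "f \<in> bergman_space p \<omega>" for f
    using c(3)[of f] that by (auto simp: mem_bergman_space_iff ennreal_mult_less_top intro: le_less_trans)
  have TLp: "T f \<in> Lp q \<nu>" if f: "f holomorphic_on unit_disc" and J: "JW f < \<infinity>" for f
  proof -
    note [measurable] = Nm[OF f]
    have Psets: "sets P = sets borel" by (simp add: P_def)
    note [measurable_cong] = Psets
    have "(\<integral>\<^sup>+z. ennreal (norm (N f z) powr q * \<Psi> z) \<partial>P) \<le> (\<integral>\<^sup>+z. ennreal (norm (N f z) powr p) + ennreal (\<Psi> z powr ?s) \<partial>P)"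
    proof (rule nn_integral_mono)
      fix z
      have "norm (N f z) powr q * \<Psi> z \<le> norm (N f z) powr p + \<Psi> z powr ?s"
        using powr_mult_le_eps[of "norm (N f z)" "\<Psi> z" 1 q p] \<Psi>0 q_pos q_less_p by simp
      then show "ennreal (norm (N f z) powr q * \<Psi> z) \<le> ennreal (norm (N f z) powr p) + ennreal (\<Psi> z powr ?s)"
        by (simp add: ennreal_leI flip: ennreal_plus)
    qed
    also have "\<dots> = JW f + (\<integral>\<^sup>+z. ennreal (\<Psi> z powr ?s) \<partial>P)"
      unfolding NJ[OF f, symmetric] by (rule nn_integral_add) measurable
    also have "\<dots> < \<infinity>" using J \<Psi>fin by simp
    finally have "ennreal K * (\<integral>\<^sup>+z. ennreal (norm (N f z) powr q * \<Psi> z) \<partial>P) < \<infinity>" by (simp add: ennreal_mult_less_top)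
    then show ?thesis using K'[OF f] T_mem_Lp_iff[OF f] by (auto intro: le_less_trans)
  qed
  show ?thesis unfolding compact_operator_Lp_def
  proof (intro conjI allI impI)
    show "T ` bergman_space p \<omega> \<subseteq> Lp q \<nu>"
      using TLp JWfin by (auto simp: mem_bergman_space_iff)
    fix F :: "nat \<Rightarrow> complex \<Rightarrow> complex" and B
    assume F: "\<forall>k. F k \<in> bergman_space p \<omega> \<and> bergman_norm p \<omega> (F k) \<le> B"
    have Fhol: "F k holomorphic_on unit_disc" for k using F by (auto simp: mem_bergman_space_iff)
    define D where "D = c * (pi * \<bar>B\<bar> powr p)"
    have D0: "0 \<le> D" using c(1) by (simp add: D_def)
    have JD: "JW (F k) \<le> ennreal D" for k
    proof -
      have "JW (F k) \<le> ennreal c * J (F k)" by (rule c(3)[OF Fhol])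
      also have "J (F k) = ennreal (pi * bergman_norm p \<omega> (F k) powr p)" using F by (intro J_eq_bergman_norm) auto
      also have "ennreal c * \<dots> \<le> ennreal c * ennreal (pi * \<bar>B\<bar> powr p)"
      proof (intro mult_left_mono ennreal_leI powr_mono2)
        have "bergman_norm p \<omega> (F k) \<le> B" using F by blast
        then show "bergman_norm p \<omega> (F k) \<le> \<bar>B\<bar>" by linarith
      qed (use p_pos bergman_norm_nonneg in auto)
      also have "\<dots> = ennreal D" using c(1) by (simp add: D_def flip: ennreal_mult)
      finally show ?thesis .
    qed
    \<comment> \<open>The family for Montel's theorem is described by \<open>JW\<close> rather than
      by the norm because \<open>pointwise_bound\<close> is stated for that integral.\<close>
    define \<H> where "\<H> = {f. f holomorphic_on unit_disc \<and> JW f \<le> ennreal D}"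
    have bnd: "\<exists>b. \<forall>f\<in>\<H>. \<forall>z\<in>S. norm (f z) \<le> b" if S: "compact S" "S \<subseteq> unit_disc" for S
    proof -
      obtain R where R: "0 \<le> R" "R < 1" "S \<subseteq> cball 0 R"
      proof (cases "S = {}")
        case False
        obtain z where z: "z \<in> S" "\<And>w. w \<in> S \<Longrightarrow> norm w \<le> norm z"
          using continuous_attains_sup[OF S(1) False, of norm] by (auto intro: continuous_intros)
        have "norm z < 1" "S \<subseteq> cball 0 (norm z)" using z S(2) by auto
        then show ?thesis by (intro that[of "norm z"]) auto
      qed (use that[of 0] in auto)
      obtain K1 where K1: "0 < K1" "\<And>f z t. f holomorphic_on unit_disc \<Longrightarrow> 0 \<le> t \<Longrightarrow>
        (\<integral>\<^sup>+z\<in>unit_disc. ennreal (norm (f z) powr p) * ennreal (W (norm z)) \<partial>lborel) \<le> ennreal t \<Longrightarrow>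
        norm z \<le> R \<Longrightarrow> norm (f z) powr p \<le> K1 * t"
        by (rule pointwise_bound[OF R(1,2) p_pos]) (rule that)
      have "norm (f z) \<le> (K1 * D) powr (1 / p)" if "f \<in> \<H>" "z \<in> S" for f z
      proof -
        have "norm (f z) powr p \<le> K1 * D"
          using that R(3) D0 by (intro K1(2)) (auto simp: \<H>_def JW_def)
        then have "(norm (f z) powr p) powr (1 / p) \<le> (K1 * D) powr (1 / p)"
          using p_pos by (intro powr_mono2) auto
        then show ?thesis using p_pos by (simp add: powr_powr)
      qed
      then show ?thesis by blast
    qed
    have hH: "f holomorphic_on unit_disc" if "f \<in> \<H>" for f using that by (simp add: \<H>_def)
    have rng: "range F \<subseteq> \<H>" using Fhol JD by (auto simp: \<H>_def)
    obtain f \<sigma> where f: "f holomorphic_on unit_disc" and \<sigma>: "strict_mono \<sigma>"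
      and lim: "\<And>z. z \<in> unit_disc \<Longrightarrow> (\<lambda>k. F (\<sigma> k) z) \<longlonglongrightarrow> f z"
      using Montel[OF open_ball hH bnd rng] by metis
    \<comment> \<open>Fatou's lemma: the limit inherits the bound, so \<open>T f\<close> lies in
      \<open>Lp q \<nu>\<close> and the differences stay bounded.\<close>
    have Jf: "JW f \<le> ennreal D"
    proof -
      note [measurable] = Nm[OF Fhol] Nm[OF f]
      have Psets: "sets P = sets borel" by (simp add: P_def)
      note [measurable_cong] = Psets
      have "JW f = (\<integral>\<^sup>+z. ennreal (norm (N f z) powr p) \<partial>P)" by (simp add: NJ[OF f])
      also have "\<dots> = (\<integral>\<^sup>+z. liminf (\<lambda>k. ennreal (norm (N (F (\<sigma> k)) z) powr p)) \<partial>P)"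
      proof (rule nn_integral_cong)
        fix z
        have "(\<lambda>k. N (F (\<sigma> k)) z) \<longlonglongrightarrow> N f z"
          using lim[of z] by (cases "z \<in> unit_disc") (auto simp: N_def)
        then have "(\<lambda>k. norm (N (F (\<sigma> k)) z) powr p) \<longlonglongrightarrow> norm (N f z) powr p"
          using p_pos by (intro tendsto_powr' tendsto_norm tendsto_const) auto
        then have "(\<lambda>k. ennreal (norm (N (F (\<sigma> k)) z) powr p)) \<longlonglongrightarrow> ennreal (norm (N f z) powr p)"
          by (rule tendsto_ennrealI)
        then show "ennreal (norm (N f z) powr p) = liminf (\<lambda>k. ennreal (norm (N (F (\<sigma> k)) z) powr p))"
          by (intro lim_imp_Liminf[symmetric]) auto
      qed
      also have "\<dots> \<le> liminf (\<lambda>k. \<integral>\<^sup>+z. ennreal (norm (N (F (\<sigma> k)) z) powr p) \<partial>P)"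
        by (rule nn_integral_liminf) measurable
      also have "\<dots> \<le> ennreal D"
        by (rule order_trans[OF Liminf_le_Limsup Limsup_bounded]) (auto simp: NJ[OF Fhol] JD)
      finally show ?thesis .
    qed
    define H where "H = (\<lambda>k z. F (\<sigma> k) z - f z)"
    have Hhol: "H k holomorphic_on unit_disc" for k unfolding H_def by (intro holomorphic_intros Fhol f)
    define D' where "D' = 2 powr p * (D + D)"
    have HD: "(\<integral>\<^sup>+z. ennreal (norm (N (H k) z) powr p) \<partial>P) \<le> ennreal D'" for k
    proof -
      note [measurable] = Nm[OF Fhol] Nm[OF f]
      have Psets: "sets P = sets borel" by (simp add: P_def)
      note [measurable_cong] = Psets
      have "(\<integral>\<^sup>+z. ennreal (norm (N (H k) z) powr p) \<partial>P)
        \<le> (\<integral>\<^sup>+z. ennreal (2 powr p) * (ennreal (norm (N (F (\<sigma> k)) z) powr p) + ennreal (norm (N f z) powr p)) \<partial>P)"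
      proof (rule nn_integral_mono)
        fix z
        have "N (H k) z = N (F (\<sigma> k)) z - N f z" by (simp add: N_def H_def scaleR_diff_right)
        then have "norm (N (H k) z) powr p \<le> 2 powr p * (norm (N (F (\<sigma> k)) z) powr p + norm (N f z) powr p)"
          using powr_norm_diff_le[OF p_pos] by simp
        then show "ennreal (norm (N (H k) z) powr p) \<le> ennreal (2 powr p) * (ennreal (norm (N (F (\<sigma> k)) z) powr p) + ennreal (norm (N f z) powr p))"
          by (simp add: ennreal_leI flip: ennreal_plus ennreal_mult)
      qed
      also have "\<dots> = ennreal (2 powr p) * (JW (F (\<sigma> k)) + JW f)"
        by (subst nn_integral_cmult, measurable, subst nn_integral_add) (simp_all add: NJ[OF Fhol] NJ[OF f])
      also have "\<dots> \<le> ennreal (2 powr p) * (ennreal D + ennreal D)"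
        by (intro mult_left_mono add_mono JD Jf) simp
      also have "\<dots> = ennreal D'" using D0 by (simp add: D'_def flip: ennreal_plus ennreal_mult)
      finally show ?thesis .
    qed
    have Hlim: "(\<lambda>k. N (H k) z) \<longlonglongrightarrow> 0" for z
    proof (cases "z \<in> unit_disc")
      case True
      from tendsto_diff[OF lim[OF True] tendsto_const[of "f z"]] show ?thesis using True by (simp add: N_def H_def)
    qed (simp add: N_def)
    have "(\<lambda>k. \<integral>\<^sup>+z. ennreal (norm (N (H k) z) powr q * \<Psi> z) \<partial>P) \<longlonglongrightarrow> 0"
    proof (rule nn_integral_powr_tendsto_zero[OF _ _ \<Psi>0 q_pos q_less_p _ HD \<Psi>fin])
      show "N (H k) \<in> borel_measurable P" for k using Nm[OF Hhol] by (simp add: P_def)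
      show "\<Psi> \<in> borel_measurable P" using \<Psi> by (simp add: P_def)
      show "AE z in P. (\<lambda>k. N (H k) z) \<longlonglongrightarrow> 0" using Hlim by simp
    qed
    then have "(\<lambda>k. ennreal K * (\<integral>\<^sup>+z. ennreal (norm (N (H k) z) powr q * \<Psi> z) \<partial>P)) \<longlonglongrightarrow> ennreal K * 0"
      by (intro ennreal_tendsto_cmult) auto
    then have up: "(\<lambda>k. ennreal K * (\<integral>\<^sup>+z. ennreal (norm (N (H k) z) powr q * \<Psi> z) \<partial>P)) \<longlonglongrightarrow> 0"
      by simp
    have lim0: "(\<lambda>k. \<integral>\<^sup>+z. ennreal (norm ((deriv ^^ n) (H k) z) powr q) \<partial>m) \<longlonglongrightarrow> 0"
    proof (rule tendsto_sandwich[OF _ _ tendsto_const up])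
      show "\<forall>\<^sub>F k in sequentially. (\<integral>\<^sup>+z. ennreal (norm ((deriv ^^ n) (H k) z) powr q) \<partial>m)
        \<le> ennreal K * (\<integral>\<^sup>+z. ennreal (norm (N (H k) z) powr q * \<Psi> z) \<partial>P)"
        by (rule always_eventually, rule allI, rule K'[OF Hhol])
    qed simp
    have lim1: "(\<lambda>k. Lp_norm q \<nu> (T (H k))) \<longlonglongrightarrow> 0"
    proof -
      have "(\<lambda>k. enn2real (\<integral>\<^sup>+z. ennreal (norm ((deriv ^^ n) (H k) z) powr q) \<partial>m)) \<longlonglongrightarrow> enn2real 0"
        using tendsto_enn2real[of "\<lambda>k. \<integral>\<^sup>+z. ennreal (norm ((deriv ^^ n) (H k) z) powr q) \<partial>m" 0] lim0 by simp
      then have "(\<lambda>k. enn2real (\<integral>\<^sup>+z. ennreal (norm ((deriv ^^ n) (H k) z) powr q) \<partial>m) powr (1 / q)) \<longlonglongrightarrow> 0 powr (1 / q)"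
        using q_pos by (intro tendsto_powr' tendsto_const) auto
      then show ?thesis using T_measurable[OF Hhol] q_pos
        by (simp add: Lp_norm_eq T_integral[OF Hhol])
    qed
    have "Lp_norm q \<nu> (\<lambda>x. T (F (\<sigma> k)) x - T f x) = Lp_norm q \<nu> (T (H k))" for k
    proof -
      have "(\<integral>x. norm (T (F (\<sigma> k)) x - T f x) powr q \<partial>\<nu>) = (\<integral>x. norm (T (H k) x) powr q \<partial>\<nu>)"
        unfolding H_def by (intro Bochner_Integration.integral_cong refl) (simp add: T_diff[OF Fhol f])
      then show ?thesis by (simp add: Lp_norm_def)
    qed
    with lim1 have "(\<lambda>k. Lp_norm q \<nu> (\<lambda>x. T (F (\<sigma> k)) x - T f x)) \<longlonglongrightarrow> 0" by simp
    moreover have "T f \<in> Lp q \<nu>" using Jf by (intro TLp f) (auto intro: le_less_trans)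
    ultimately show "\<exists>g\<in>Lp q \<nu>. \<exists>s. strict_mono s \<and> (\<lambda>k. Lp_norm q \<nu> (\<lambda>x. T (F (s k)) x - g x)) \<longlonglongrightarrow> 0"
      using \<sigma> by blast
  qed
qed

text \<open>Allows division by norms when a sequence is normalized; the reason is the pointwise
  bound with t = 0.\<close>

lemma bergman_norm_eq_0_imp:
  assumes "f \<in> bergman_space p \<omega>" "bergman_norm p \<omega> f = 0" "z \<in> unit_disc"
  shows "f z = 0"
proof -
  have f: "f holomorphic_on unit_disc" using assms by (simp add: mem_bergman_space_iff)
  obtain c where c: "0 < c" "\<And>f. f holomorphic_on unit_disc \<Longrightarrow> J f \<le> ennreal c * JW f"
    "\<And>f. f holomorphic_on unit_disc \<Longrightarrow> JW f \<le> ennreal c * J f"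
    by (rule J_JW_comparable) (rule that)
  have "JW f \<le> ennreal 0" using c(3)[OF f] J_eq_bergman_norm[OF assms(1)] assms(2) p_pos by simp
  then have J0: "(\<integral>\<^sup>+z\<in>unit_disc. ennreal (norm (f z) powr p) * ennreal (W (norm z)) \<partial>lborel) \<le> ennreal 0"
    by (simp only: JW_def)
  have z: "0 \<le> norm z" "norm z < 1" using assms(3) by auto
  obtain K where K: "0 < K" "\<And>f w t. f holomorphic_on unit_disc \<Longrightarrow> 0 \<le> t \<Longrightarrow>
      (\<integral>\<^sup>+z\<in>unit_disc. ennreal (norm (f z) powr p) * ennreal (W (norm z)) \<partial>lborel) \<le> ennreal t \<Longrightarrow>
      norm w \<le> norm z \<Longrightarrow> norm (f w) powr p \<le> K * t"
    by (rule pointwise_bound[OF z p_pos]) (rule that)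
  have "norm (f z) powr p \<le> K * 0" by (rule K(2)[OF f _ J0]) auto
  then show ?thesis by simp
qed

text \<open>If T were unbounded, normalization would give functions of norm 1 whose images have norm
  above k, while a convergent subsequence of images has bounded norms. As q may be below 1, the
  comparison is made between q-th powers of the norms.\<close>

lemma compact_imp_bounded:
  assumes comp: "compact_operator_Lp p \<omega> q \<nu> T"
  shows "bounded_operator_Lp p \<omega> q \<nu> T"
proof (rule ccontr)
  assume nb: "\<not> bounded_operator_Lp p \<omega> q \<nu> T"
  have sub: "T ` bergman_space p \<omega> \<subseteq> Lp q \<nu>" using comp by (simp add: compact_operator_Lp_def)
  have "\<exists>f\<in>bergman_space p \<omega>. real k * bergman_norm p \<omega> f < Lp_norm q \<nu> (T f)" for k
    using nb sub by (auto simp: bounded_operator_Lp_def not_le)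
  then obtain f where f: "\<And>k. f k \<in> bergman_space p \<omega>" "\<And>k. real k * bergman_norm p \<omega> (f k) < Lp_norm q \<nu> (T (f k))"
    by metis
  have fhol: "f k holomorphic_on unit_disc" for k using f(1) by (simp add: mem_bergman_space_iff)
  define N where "N = (\<lambda>k. bergman_norm p \<omega> (f k))"
  \<comment> \<open>A function of norm zero vanishes on the disc, and so does its image, which
    contradicts the strict inequality in the choice of f.\<close>
  have N: "0 < N k" for k
  proof (rule ccontr)
    assume "\<not> 0 < N k"
    then have N0: "bergman_norm p \<omega> (f k) = 0" using bergman_norm_nonneg[of "f k"] by (simp add: N_def)
    have "T (f k) x = 0" if "x \<in> unit_disc" for x
    proof -
      have "T (f k) x = T (\<lambda>z. 0 * f k z) x"
      proof -
        have "(deriv ^^ n) (f k) (\<phi> x) = (deriv ^^ n) (\<lambda>z. 0 * f k z) (\<phi> x)"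
          using bergman_norm_eq_0_imp[OF f(1) N0] \<phi>_in_disc[OF that]
          by (intro higher_deriv_transform_within_open[OF fhol _ open_ball]) auto
        then show ?thesis by (simp add: weighted_diff_comp_def)
      qed
      then show ?thesis using T_cmult[OF fhol[of k] that, where c=0] by simp
    qed
    then have "(\<integral>x. norm (T (f k) x) powr q \<partial>\<nu>) = (\<integral>x. 0 \<partial>\<nu>)"
      using q_pos by (intro Bochner_Integration.integral_cong) auto
    then have "Lp_norm q \<nu> (T (f k)) = 0" using q_pos by (simp add: Lp_norm_def)
    then show False using f(2)[of k] N0 by simp
  qed
  define F where "F = (\<lambda>k z. of_real (1 / N k) * f k z)"
  have Fhol: "F k holomorphic_on unit_disc" for k unfolding F_def by (intro holomorphic_intros fhol)
  have "bergman_norm p \<omega> (F k) = 1" for k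
  proof -
    have "bergman_norm p \<omega> (F k) = norm (complex_of_real (1 / N k)) * bergman_norm p \<omega> (f k)"
      unfolding F_def bergman_norm_def by (rule Lp_norm_cmult[OF p_pos])
    moreover have "bergman_norm p \<omega> (f k) = N k" by (simp add: N_def)
    ultimately show ?thesis using N[of k] by (simp add: norm_divide)
  qed
  moreover have "F k \<in> bergman_space p \<omega>" for k
  proof -
    have "J (F k) = ennreal ((1 / N k) powr p) * J (f k)"
    proof -
      have "(\<lambda>z. ennreal (norm (f k z) powr p) * indicator unit_disc z) \<in> borel_measurable borel"
        by (intro measurable_norm_powr_indicator holomorphic_on_imp_continuous_on fhol p_pos) auto
      then have m: "(\<lambda>z. ennreal (norm (f k z) powr p) * indicator unit_disc z * ennreal (g (norm z))) \<in> borel_measurable lborel"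
        by measurable
      have "J (F k) = (\<integral>\<^sup>+z. ennreal ((1 / N k) powr p) * (ennreal (norm (f k z) powr p) * indicator unit_disc z * ennreal (g (norm z))) \<partial>lborel)"
      proof -
        have "norm (complex_of_real (1 / N k) * f k z) powr p = (1 / N k) powr p * norm (f k z) powr p" for z
          unfolding norm_mult norm_of_real powr_mult using N[of k] by simp
        then show ?thesis unfolding J_def F_def
          by (intro nn_integral_cong) (simp only: ennreal_mult powr_ge_zero mult_ac)
      qed
      also have "\<dots> = ennreal ((1 / N k) powr p) * (\<integral>\<^sup>+z. ennreal (norm (f k z) powr p) * indicator unit_disc z * ennreal (g (norm z)) \<partial>lborel)"
        using m by (rule nn_integral_cmult)
      also have "(\<integral>\<^sup>+z. ennreal (norm (f k z) powr p) * indicator unit_disc z * ennreal (g (norm z)) \<partial>lborel) = J (f k)"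
        unfolding J_def by (intro nn_integral_cong) (simp add: mult_ac)
      finally show ?thesis .
    qed
    then show ?thesis using f(1)[of k] Fhol by (simp add: mem_bergman_space_iff ennreal_mult_less_top)
  qed
  ultimately have "\<forall>k. F k \<in> bergman_space p \<omega> \<and> bergman_norm p \<omega> (F k) \<le> 1" by simp
  then obtain G s where G: "G \<in> Lp q \<nu>" and s: "strict_mono s"
    and lim: "(\<lambda>k. Lp_norm q \<nu> (\<lambda>x. T (F (s k)) x - G x)) \<longlonglongrightarrow> 0"
    using comp unfolding compact_operator_Lp_def by blast
  have Gm[measurable]: "G \<in> borel_measurable \<nu>" and Gfin: "(\<integral>\<^sup>+x. ennreal (norm (G x) powr q) \<partial>\<nu>) < \<infinity>"
    using G by (auto simp: mem_Lp_iff)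
  note [measurable] = T_measurable[OF Fhol]
  have big: "real k < Lp_norm q \<nu> (T (F k))" for k
  proof -
    have "(\<integral>x. norm (T (F k) x) powr q \<partial>\<nu>) = (\<integral>x. norm (of_real (1 / N k) * T (f k) x) powr q \<partial>\<nu>)"
      by (rule Bochner_Integration.integral_cong[OF refl]) (simp only: F_def space_\<nu> T_cmult[OF fhol])
    then have "Lp_norm q \<nu> (T (F k)) = Lp_norm q \<nu> (\<lambda>x. of_real (1 / N k) * T (f k) x)" by (simp add: Lp_norm_def)
    also have "\<dots> = 1 / N k * Lp_norm q \<nu> (T (f k))"
      using Lp_norm_cmult[OF q_pos, of \<nu> "of_real (1 / N k)"] N[of k] by (simp add: norm_divide)
    finally have e: "Lp_norm q \<nu> (T (F k)) = 1 / N k * Lp_norm q \<nu> (T (f k))" .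
    show ?thesis unfolding e using f(2)[of k] N[of k] by (simp add: N_def pos_less_divide_eq)
  qed
  define E where "E = (\<lambda>k. enn2real (\<integral>\<^sup>+x. ennreal (norm (T (F (s k)) x - G x) powr q) \<partial>\<nu>))"
  \<comment> \<open>Convergence of \<open>Lp_norm\<close> to 0 is informative only where the
    integral is finite, since otherwise its value is 0 by default.\<close>
  have Efin: "(\<integral>\<^sup>+x. ennreal (norm (T (F (s k)) x - G x) powr q) \<partial>\<nu>) < \<infinity>" for k
  proof -
    have "(\<integral>\<^sup>+x. ennreal (norm (T (F (s k)) x - G x) powr q) \<partial>\<nu>)
      \<le> (\<integral>\<^sup>+x. ennreal (2 powr q) * (ennreal (norm (T (F (s k)) x) powr q) + ennreal (norm (G x) powr q)) \<partial>\<nu>)"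
      by (intro nn_integral_mono)
        (simp add: ennreal_leI powr_norm_diff_le q_pos flip: ennreal_plus ennreal_mult)
    also have "\<dots> = ennreal (2 powr q) * ((\<integral>\<^sup>+x. ennreal (norm (T (F (s k)) x) powr q) \<partial>\<nu>) + (\<integral>\<^sup>+x. ennreal (norm (G x) powr q) \<partial>\<nu>))"
      by (subst nn_integral_cmult, measurable, subst nn_integral_add) auto
    also have "\<dots> < \<infinity>"
    proof -
      have "T (F (s k)) \<in> Lp q \<nu>" using sub \<open>\<forall>k. F k \<in> bergman_space p \<omega> \<and> bergman_norm p \<omega> (F k) \<le> 1\<close> by blast
      then show ?thesis using Gfin by (simp add: mem_Lp_iff ennreal_mult_less_top)
    qed
    finally show ?thesis .
  qed
  have ineq: "real (s k) powr q \<le> 2 powr q * (E k + enn2real (\<integral>\<^sup>+x. ennreal (norm (G x) powr q) \<partial>\<nu>))" for k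
  proof -
    have "real (s k) powr q \<le> Lp_norm q \<nu> (T (F (s k))) powr q"
      using big[of "s k"] q_pos by (intro powr_mono2) auto
    also have "\<dots> = enn2real (\<integral>\<^sup>+x. ennreal (norm (T (F (s k)) x) powr q) \<partial>\<nu>)"
      using q_pos by (intro Lp_norm_powr) auto
    also have "\<dots> \<le> enn2real (ennreal (2 powr q) * ((\<integral>\<^sup>+x. ennreal (norm (T (F (s k)) x - G x) powr q) \<partial>\<nu>) + (\<integral>\<^sup>+x. ennreal (norm (G x) powr q) \<partial>\<nu>)))"
    proof (rule enn2real_mono)
      have "(\<integral>\<^sup>+x. ennreal (norm (T (F (s k)) x) powr q) \<partial>\<nu>)
        \<le> (\<integral>\<^sup>+x. ennreal (2 powr q) * (ennreal (norm (T (F (s k)) x - G x) powr q) + ennreal (norm (G x) powr q)) \<partial>\<nu>)"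
      proof (intro nn_integral_mono)
        fix x
        have "norm ((T (F (s k)) x - G x) - (- G x)) powr q \<le> 2 powr q * (norm (T (F (s k)) x - G x) powr q + norm (- G x) powr q)"
          by (rule powr_norm_diff_le[OF q_pos])
        then show "ennreal (norm (T (F (s k)) x) powr q) \<le> ennreal (2 powr q) * (ennreal (norm (T (F (s k)) x - G x) powr q) + ennreal (norm (G x) powr q))"
          by (simp add: ennreal_leI flip: ennreal_plus ennreal_mult)
      qed
      also have "\<dots> = ennreal (2 powr q) * ((\<integral>\<^sup>+x. ennreal (norm (T (F (s k)) x - G x) powr q) \<partial>\<nu>) + (\<integral>\<^sup>+x. ennreal (norm (G x) powr q) \<partial>\<nu>))"
        by (subst nn_integral_cmult, measurable, subst nn_integral_add) auto
      finally show "(\<integral>\<^sup>+x. ennreal (norm (T (F (s k)) x) powr q) \<partial>\<nu>) \<le> \<dots>" .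
      show "ennreal (2 powr q) * ((\<integral>\<^sup>+x. ennreal (norm (T (F (s k)) x - G x) powr q) \<partial>\<nu>) + (\<integral>\<^sup>+x. ennreal (norm (G x) powr q) \<partial>\<nu>)) < top"
        using Efin[of k] Gfin by (simp add: ennreal_mult_less_top)
    qed
    also have "\<dots> = 2 powr q * (E k + enn2real (\<integral>\<^sup>+x. ennreal (norm (G x) powr q) \<partial>\<nu>))"
      using Efin[of k] Gfin by (simp add: enn2real_mult enn2real_plus E_def)
    finally show ?thesis .
  qed
  have "(\<lambda>k. Lp_norm q \<nu> (\<lambda>x. T (F (s k)) x - G x) powr q) \<longlonglongrightarrow> 0 powr q"
    using q_pos by (intro tendsto_powr' lim tendsto_const) (auto intro!: always_eventually Lp_norm_nonneg)
  then have "E \<longlonglongrightarrow> 0" using q_pos by (simp add: Lp_norm_powr E_def)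
  then have "Bseq E" by (intro convergent_imp_Bseq convergentI)
  then obtain B where B: "\<And>k. \<bar>E k\<bar> \<le> B" by (auto simp: Bseq_def)
  define M where "M = 2 powr q * (B + enn2real (\<integral>\<^sup>+x. ennreal (norm (G x) powr q) \<partial>\<nu>))"
  have bd: "real k powr q \<le> M" for k
  proof -
    have "real k powr q \<le> real (s k) powr q"
      using strict_mono_imp_increasing[OF s, of k] q_pos by (intro powr_mono2) auto
    also have "\<dots> \<le> 2 powr q * (E k + enn2real (\<integral>\<^sup>+x. ennreal (norm (G x) powr q) \<partial>\<nu>))" by (rule ineq)
    also have "\<dots> \<le> M" unfolding M_def using B[of k] by (intro mult_left_mono) auto
    finally show ?thesis .
  qed
  obtain k :: nat where k: "M powr (1 / q) < real k" using reals_Archimedean2 by blast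
  have "0 \<le> M" using bd[of 0] q_pos by simp
  have "(M powr (1 / q)) powr q < real k powr q" using k q_pos by (intro powr_less_mono2) auto
  then have "M < real k powr q" using q_pos \<open>0 \<le> M\<close> by (simp add: powr_powr)
  then show False using bd[of k] by simp
qed

end

theorem theorem1:
  fixes p q :: real and n :: nat and \<omega> :: "complex \<Rightarrow> real"
    and \<nu> :: "complex measure" and \<phi> u :: "complex \<Rightarrow> complex"
  assumes "0 < q" and "q < p"
    and "doubling_weight \<omega>"
    and "sets \<nu> = sets (restrict_space borel unit_disc)"
    and "\<phi> holomorphic_on unit_disc" and "\<phi> ` unit_disc \<subseteq> unit_disc"
    and "u \<in> Lp q \<nu>"
  shows "(bounded_operator_Lp p \<omega> q \<nu> (weighted_diff_comp n \<phi> u) \<longleftrightarrow>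
          compact_operator_Lp p \<omega> q \<nu> (weighted_diff_comp n \<phi> u)) \<and>
         (bounded_operator_Lp p \<omega> q \<nu> (weighted_diff_comp n \<phi> u) \<longleftrightarrow>
          (\<exists>r\<in>{0<..<1}. averaging_function n q \<omega> \<nu> \<phi> u r
             \<in> Lp (p / (p - q)) (weighted_area (weight_tilde \<omega>)))) \<and>
         (bounded_operator_Lp p \<omega> q \<nu> (weighted_diff_comp n \<phi> u) \<longleftrightarrow>
          (\<forall>r\<in>{0<..<1}. averaging_function n q \<omega> \<nu> \<phi> u r
             \<in> Lp (p / (p - q)) (weighted_area (weight_tilde \<omega>))))"
proof -
  obtain g h C b \<alpha> where profile: "doubling_profile g h C b \<alpha>" and eq: "AE z in area. \<omega> z = g (norm z)"
    and hat: "\<And>z. z \<in> unit_disc \<Longrightarrow> weight_hat \<omega> z = ennreal (h (norm z))"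
    using doubling_weight_profile[OF assms(3)] by blast
  have meas: "\<omega> \<in> borel_measurable area"
    using assms(3) unfolding doubling_weight_def radial_weight_def by (blast intro: borel_measurable_integrable)
  interpret doubling_profile g h C b \<alpha> by (rule profile)
  interpret weighted_bergman_setup g h C b \<alpha> \<omega> p q n \<nu> \<phi> u
    by unfold_locales (fact assms meas eq hat)+
  let ?A = "\<lambda>r. averaging_function n q \<omega> \<nu> \<phi> u r \<in> Lp (p / (p - q)) (weighted_area (weight_tilde \<omega>))"
  \<comment> \<open>The implications form a cycle: bounded, the averaging condition for every r, for
    some r, compact, bounded.\<close>
  have "\<forall>r\<in>{0<..<1}. ?A r" if "bounded_operator_Lp p \<omega> q \<nu> T"
    using bounded_imp_averaging[OF that] by simp
  moreover have "compact_operator_Lp p \<omega> q \<nu> T" if "\<exists>r\<in>{0<..<1}. ?A r"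
    using that averaging_imp_compact by auto
  moreover have "\<exists>r\<in>{0<..<1}. ?A r" if "\<forall>r\<in>{0<..<1}. ?A r"
    using that by (intro bexI[of _ "1 / 2"]) auto
  ultimately show ?thesis using compact_imp_bounded by blast
qed

end
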